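(* Let $1\leqslant k<n$ be coprime integers, let $\frac{n}{k}=n_1-\frac{1}{n_2-\dots-\frac{1}{n_p}}$ with $n_1,\dots,n_p\geqslant 2$, and let $\Gamma=\mathbb{Z}+\mathbb{Z}\eta$, $\mathrm{Im}\,\eta>0$, $\mathcal{E}=\mathbb{C}/\Gamma$. Let $q_{n,k}(\mathcal{E})=\bigoplus_{\alpha\geqslant 0}S^\alpha(\Theta_{(n_1,\dots,n_p)}(\Gamma))$ be the graded commutative algebra realized in holomorphic functions as described in the context. For $f\in S^\alpha(\Theta_{(n_1,\dots,n_p)}(\Gamma))$ and $g\in S^\beta(\Theta_{(n_1,\dots,n_p)}(\Gamma))$ put $$\{f,g\}(x_{1,1},\dots,x_{p,1};\dots;x_{1,\alpha+\beta},\dots,x_{p,\alpha+\beta})=\frac{1}{\alpha!\beta!}\sum_{\sigma\in S_{\alpha+\beta}}\Big(T_1+T_2+T_3+T_4\Big),$$ where, writing $c_\psi=\frac{d(n_1,\dots,n_{\psi-1})+d(n_{\psi+1},\dots,n_p)}{d(n_1,\dots,n_p)}$, $f_\sigma=f(x_{1,\sigma_1},\dots,x_{p,\sigma_1};\dots;x_{1,\sigma_\alpha},\dots,x_{p,\sigma_\alpha})$ and $g_\sigma=g(x_{1,\sigma_{\alpha+1}},\dots,x_{p,\sigma_{\alpha+1}};\dots;x_{1,\sigma_{\alpha+\beta}},\dots,x_{p,\sigma_{\alpha+\beta}})$, $$T_1=\beta\, g_\sigma\sum_{1\leqslant\psi\leqslant p,\ 1\leqslant\mu\leqslant\alpha}c_\psi\,\frac{\partial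 f_\sigma}{\partial x_{\psi,\sigma_\mu}},\qquad T_2=-\alpha\, f_\sigma\sum_{1\leqslant\psi\leqslant p,\ \alpha+1\leqslant\mu\leqslant\alpha+\beta}c_\psi\,\frac{\partial g_\sigma}{\partial x_{\psi,\sigma_\mu}},$$ $$T_3=\Big(\sum_{1\leqslant\mu\leqslant\alpha,\ \alpha+1\leqslant\mu'\leqslant\alpha+\beta}\Big[\frac{\theta'(x_{1,\sigma_{\mu'}}-x_{1,\sigma_\mu})}{\theta(x_{1,\sigma_{\mu'}}-x_{1,\sigma_\mu})}+\frac{\theta'(x_{p,\sigma_{\mu'}}-x_{p,\sigma_\mu})}{\theta(x_{p,\sigma_{\mu'}}-x_{p,\sigma_\mu})}\Big]-2\pi i\,\alpha\beta\Big)f_\sigma g_\sigma,$$ $$T_4=\theta'(0)\sum_{\substack{1\leqslant\mu\leqslant\alpha\\ \alpha+1\leqslant\mu'\leqslant\alpha+\beta\\ 1\leqslant\psi\leqslant p-1}}\frac{\theta(x_{\psi,\sigma_\mu}+x_{\psi+1,\sigma_{\mu'}}-x_{\psi,\sigma_{\mu'}}-x_{\psi+1,\sigma_\mu})}{\theta(x_{\psi,\sigma_\mu}-x_{\psi,\sigma_{\mu'}})\,\theta(x_{\psi+1,\sigma_{\mu'}}-x_{\psi+1,\sigma_\mu})}\,f_\sigma^{(\mu,\mu',\psi)}\,g_\sigma^{(\mu,\mu',\psi)}.$$ Here $f_\sigma^{(\mu,\mu',\psi)}$ is obtained from $f_\sigma$ by replacing its block of arguments $(x_{1,\sigma_\mu},\dots,x_{p,\sigma_\mu})$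 by $(x_{1,\sigma_{\mu'}},\dots,x_{\psi,\sigma_{\mu'}},x_{\psi+1,\sigma_\mu},\dots,x_{p,\sigma_\mu})$, and $g_\sigma^{(\mu,\mu',\psi)}$ is obtained from $g_\sigma$ by replacing its block of arguments $(x_{1,\sigma_{\mu'}},\dots,x_{p,\sigma_{\mu'}})$ by $(x_{1,\sigma_\mu},\dots,x_{\psi,\sigma_\mu},x_{\psi+1,\sigma_{\mu'}},\dots,x_{p,\sigma_{\mu'}})$. Then the operation $\{\,,\}$ (extended bilinearly) defines a Poisson bracket on the space $q_{n,k}(\mathcal{E})$, with $\{f,g\}\in S^{\alpha+\beta}(\Theta_{(n_1,\dots,n_p)}(\Gamma))$.
   Context: Notation. $\theta(z)=\sum_{\alpha\in\mathbb{Z}}(-1)^\alpha e^{2\pi i(\alpha z+\frac{\alpha(\alpha-1)}{2}\eta)}$; it satisfies $\theta(z+1)=\theta(z)$, $\theta(z+\eta)=-e^{-2\pi i z}\theta(z)$, $\theta(-z)=-e^{-2\pi i z}\theta(z)$, and $\theta'$ is its derivative. For a sequence $(a_1,\dots,a_r)$, $d(a_1,\dots,a_r)$ is the determinant of the $r\times r$ matrix $(m_{i,j})$ with $m_{i,i}=a_i$, $m_{i,i+1}=m_{i+1,i}=-1$ and $m_{i,j}=0$ for $|i-j|>1$; $d(\emptyset)=1$. One has $n=d(n_1,\dots,n_p)$, $k=d(n_2,\dots,n_p)$. $\Theta_{(n_1,\dots,n_p)}(\Gamma)$ is the ($n$-dimensional) space of holomorphic functions $f(z_1,\dots,z_p)$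 on $\mathbb{C}^p$ with $f(z_1,\dots,z_\alpha+1,\dots,z_p)=f(z_1,\dots,z_p)$ and $f(z_1,\dots,z_\alpha+\eta,\dots,z_p)=e^{-2\pi i(n_\alpha z_\alpha-z_{\alpha-1}-z_{\alpha+1})}f(z_1,\dots,z_p)$ for each $\alpha$, where $z_0=z_{p+1}=0$. $S^\alpha(\Theta_{(n_1,\dots,n_p)}(\Gamma))$ is realized as the space of holomorphic functions $f(x_{1,1},\dots,x_{p,1};\dots;x_{1,\alpha},\dots,x_{p,\alpha})$ that are (1) invariant under all permutations $x_{i,j}\mapsto x_{i,\sigma_j}$, $\sigma\in S_\alpha$, of the $\alpha$ blocks, and (2) $1$-periodic in each variable $x_{\mu,\nu}$ and multiplied by $e^{-2\pi i(n_\mu x_{\mu,\nu}-x_{\mu-1,\nu}-x_{\mu+1,\nu})}$ under $x_{\mu,\nu}\mapsto x_{\mu,\nu}+\eta$ (with $x_{0,\nu}=x_{p+1,\nu}=0$). $S^0=\mathbb{C}$. The commutative product of $f$ of degree $\alpha$ and $g$ of degree $\beta$ is $$fg=\frac{1}{\alpha!\beta!}\sum_{\sigma\in S_{\alpha+\beta}}f(x_{1,\sigma_1},\dots,x_{p,\sigma_1};\dots;x_{1,\sigma_\alpha},\dots,x_{p,\sigma_\alpha})\,g(x_{1,\sigma_{\alpha+1}},\dots,x_{p,\sigma_{\alpha+1}};\dots;x_{1,\sigma_{\alpha+\beta}},\dots,x_{p,\sigma_{\alpha+\beta}}),$$ so that $q_{n,k}(\mathcal{E})=S^*(\Theta_{(n_1,\dots,n_p)}(\Gamma))$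 is a polynomial ring in $n$ variables. A Poisson bracket (Poisson structure) on a commutative associative algebra $A$ is a Lie algebra structure $\{\,,\}$ on $A$ with $\{f,gh\}=\{f,g\}h+g\{f,h\}$. *)

theory Defs
  imports
    "HOL-Analysis.Analysis"
    "HOL-Algebra.Module"
    "Jordan_Normal_Form.Determinant"
begin

hide_const (open) Determinants.det

section \<open>Theta function, continued fractions and continuants\<close>

definition theta :: "complex \<Rightarrow> complex \<Rightarrow> complex" where
  "theta \<eta> z = (\<Sum>\<^sub>\<infinity>a\<in>(UNIV :: int set).
     (- 1) powi a *
     exp (2 * of_real pi * \<i> * (of_int a * z + of_int (a * (a - 1)) / 2 * \<eta>)))"

abbreviation theta' :: "complex \<Rightarrow> complex \<Rightarrow> complex" where
  "theta' \<eta> \<equiv> deriv (theta \<eta>)"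

fun neg_cont_frac :: "nat list \<Rightarrow> real" where
  "neg_cont_frac [] = 0"
| "neg_cont_frac [a] = real a"
| "neg_cont_frac (a # b # bs) = real a - 1 / neg_cont_frac (b # bs)"

text \<open>For the empty list this is the determinant of the 0 by 0 matrix, which is 1.\<close>

definition continuant :: "nat list \<Rightarrow> int" where
  "continuant a = Determinant.det (Matrix.mat (length a) (length a)
     (\<lambda>(i, j). if i = j then int (a ! i)
               else if j = i + 1 \<or> i = j + 1 then - 1
               else 0))"

definition c_coeff :: "nat list \<Rightarrow> nat \<Rightarrow> complex" where
  "c_coeff ns \<psi> =
     of_int (continuant (take (\<psi> - 1) ns) + continuant (drop \<psi> ns)) / of_int (continuant ns)"


section \<open>Holomorphic functions of \<open>p\<close> times \<open>\<alpha>\<close> variables\<close>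

text \<open>
  A point is a family \<open>x\<close> of blocks, and \<open>x \<nu> \<mu>\<close> is the variable written
  $x_{\mu,\nu}$, with \<open>\<mu> \<in> {1..p}\<close> the position inside the block and
  \<open>\<nu> \<in> {1..\<alpha>}\<close> the number of the block.  As the number of variables is not fixed,
  functions on $\mathbb{C}^{p\alpha}$ are represented by functions on all of
  \<^typ>\<open>nat \<Rightarrow> nat \<Rightarrow> complex\<close> that depend on these variables only.
\<close>

type_synonym point = "nat \<Rightarrow> nat \<Rightarrow> complex"
type_synonym pfun = "point \<Rightarrow> complex"

definition set_var :: "point \<Rightarrow> nat \<Rightarrow> nat \<Rightarrow> complex \<Rightarrow> point" where
  "set_var x \<nu> \<mu> z = x(\<nu> := (x \<nu>)(\<mu> := z))"

text \<open>
  The three conjuncts: dependence on the $p\alpha$ variables only, continuity (for the product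
  topology, which on such functions amounts to continuity on $\mathbb{C}^{p\alpha}$), and
  holomorphy in each variable separately.
\<close>

definition holomorphic_vars :: "nat \<Rightarrow> nat \<Rightarrow> pfun \<Rightarrow> bool" where
  "holomorphic_vars p \<alpha> f \<longleftrightarrow>
     (\<forall>x y. (\<forall>\<nu>\<in>{1..\<alpha>}. \<forall>\<mu>\<in>{1..p}. x \<nu> \<mu> = y \<nu> \<mu>) \<longrightarrow> f x = f y) \<and>
     continuous_on UNIV f \<and>
     (\<forall>x. \<forall>\<nu>\<in>{1..\<alpha>}. \<forall>\<mu>\<in>{1..p}. (\<lambda>z. f (set_var x \<nu> \<mu> z)) holomorphic_on UNIV)"

definition partial_deriv :: "nat \<Rightarrow> nat \<Rightarrow> pfun \<Rightarrow> pfun" where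
  "partial_deriv \<nu> \<mu> f x = deriv (\<lambda>z. f (set_var x \<nu> \<mu> z)) (x \<nu> \<mu>)"


section \<open>The graded commutative algebra\<close>

definition multiplier :: "complex \<Rightarrow> nat list \<Rightarrow> nat \<Rightarrow> (nat \<Rightarrow> complex) \<Rightarrow> complex" where
  "multiplier \<eta> ns \<mu> u =
     exp (- 2 * of_real pi * \<i> *
       (of_nat (ns ! (\<mu> - 1)) * u \<mu>
        - (if \<mu> = 1 then 0 else u (\<mu> - 1))
        - (if \<mu> = length ns then 0 else u (\<mu> + 1))))"

definition sym_theta :: "complex \<Rightarrow> nat list \<Rightarrow> nat \<Rightarrow> pfun set" where
  "sym_theta \<eta> ns \<alpha> = {f.
     holomorphic_vars (length ns) \<alpha> f \<and>
     (\<forall>\<sigma> x. \<sigma> permutes {1..\<alpha>} \<longrightarrow> f (\<lambda>\<nu>. x (\<sigma> \<nu>)) = f x) \<and>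
     (\<forall>x. \<forall>\<nu>\<in>{1..\<alpha>}. \<forall>\<mu>\<in>{1..length ns}.
        f (set_var x \<nu> \<mu> (x \<nu> \<mu> + 1)) = f x \<and>
        f (set_var x \<nu> \<mu> (x \<nu> \<mu> + \<eta>)) = multiplier \<eta> ns \<mu> (x \<nu>) * f x)}"

text \<open>The functions written $f_\sigma$ and $g_\sigma$ in the formulas for product and bracket.\<close>

definition first_blocks :: "(nat \<Rightarrow> nat) \<Rightarrow> pfun \<Rightarrow> pfun" where
  "first_blocks \<sigma> f = (\<lambda>x. f (\<lambda>j. x (\<sigma> j)))"

definition last_blocks :: "nat \<Rightarrow> (nat \<Rightarrow> nat) \<Rightarrow> pfun \<Rightarrow> pfun" where
  "last_blocks \<alpha> \<sigma> g = (\<lambda>x. g (\<lambda>j. x (\<sigma> (\<alpha> + j))))"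

definition sym_prod :: "nat \<Rightarrow> nat \<Rightarrow> pfun \<Rightarrow> pfun \<Rightarrow> pfun" where
  "sym_prod \<alpha> \<beta> f g = (\<lambda>x.
     1 / (fact \<alpha> * fact \<beta>) *
     (\<Sum>\<sigma> | \<sigma> permutes {1..\<alpha> + \<beta>}. first_blocks \<sigma> f x * last_blocks \<alpha> \<sigma> g x))"

definition complex_field :: "complex ring" where
  "complex_field =
     \<lparr>carrier = UNIV, mult = (*), one = 1, zero = 0, add = (+)\<rparr>"

text \<open>An element of the direct sum is the family of its homogeneous components.\<close>

definition q_algebra :: "complex \<Rightarrow> nat list \<Rightarrow> (complex, nat \<Rightarrow> pfun) module" where
  "q_algebra \<eta> ns =
     \<lparr>carrier = {F. (\<forall>\<alpha>. F \<alpha> \<in> sym_theta \<eta> ns \<alpha>) \<and> finite {\<alpha>. F \<alpha> \<noteq> (\<lambda>x. 0)}},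
      mult = (\<lambda>F G m x. \<Sum>\<alpha>\<le>m. sym_prod \<alpha> (m - \<alpha>) (F \<alpha>) (G (m - \<alpha>)) x),
      one = (\<lambda>\<alpha> x. if \<alpha> = 0 then 1 else 0),
      zero = (\<lambda>\<alpha> x. 0),
      add = (\<lambda>F G \<alpha> x. F \<alpha> x + G \<alpha> x),
      smult = (\<lambda>c F \<alpha> x. c * F \<alpha> x)\<rparr>"


section \<open>The bracket\<close>

definition T1 :: "nat list \<Rightarrow> nat \<Rightarrow> nat \<Rightarrow> pfun \<Rightarrow> pfun \<Rightarrow> (nat \<Rightarrow> nat) \<Rightarrow> pfun" where
  "T1 ns \<alpha> \<beta> f g \<sigma> x =
     of_nat \<beta> * last_blocks \<alpha> \<sigma> g x *
     (\<Sum>\<psi>\<in>{1..length ns}. \<Sum>\<mu>\<in>{1..\<alpha>}.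
        c_coeff ns \<psi> * partial_deriv (\<sigma> \<mu>) \<psi> (first_blocks \<sigma> f) x)"

definition T2 :: "nat list \<Rightarrow> nat \<Rightarrow> nat \<Rightarrow> pfun \<Rightarrow> pfun \<Rightarrow> (nat \<Rightarrow> nat) \<Rightarrow> pfun" where
  "T2 ns \<alpha> \<beta> f g \<sigma> x =
     - of_nat \<alpha> * first_blocks \<sigma> f x *
     (\<Sum>\<psi>\<in>{1..length ns}. \<Sum>\<mu>\<in>{\<alpha> + 1..\<alpha> + \<beta>}.
        c_coeff ns \<psi> * partial_deriv (\<sigma> \<mu>) \<psi> (last_blocks \<alpha> \<sigma> g) x)"

definition T3 ::
  "complex \<Rightarrow> nat list \<Rightarrow> nat \<Rightarrow> nat \<Rightarrow> pfun \<Rightarrow> pfun \<Rightarrow> (nat \<Rightarrow> nat) \<Rightarrow> pfun" where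
  "T3 \<eta> ns \<alpha> \<beta> f g \<sigma> x =
     (let p = length ns in
      ((\<Sum>\<mu>\<in>{1..\<alpha>}. \<Sum>\<mu>'\<in>{\<alpha> + 1..\<alpha> + \<beta>}.
          theta' \<eta> (x (\<sigma> \<mu>') 1 - x (\<sigma> \<mu>) 1) / theta \<eta> (x (\<sigma> \<mu>') 1 - x (\<sigma> \<mu>) 1) +
          theta' \<eta> (x (\<sigma> \<mu>') p - x (\<sigma> \<mu>) p) / theta \<eta> (x (\<sigma> \<mu>') p - x (\<sigma> \<mu>) p))
        - 2 * of_real pi * \<i> * of_nat \<alpha> * of_nat \<beta>) *
      first_blocks \<sigma> f x * last_blocks \<alpha> \<sigma> g x)"

text \<open>
  As $f_\sigma$ reads the block with number \<open>\<sigma> \<mu>\<close> (and $g_\sigma$ the one with number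
  \<open>\<sigma> \<mu>'\<close>) and the other function does not, replacing a block of arguments of
  $f_\sigma$ or $g_\sigma$ is an update of the point at that block.
\<close>

definition splice :: "nat \<Rightarrow> (nat \<Rightarrow> complex) \<Rightarrow> (nat \<Rightarrow> complex) \<Rightarrow> nat \<Rightarrow> complex" where
  "splice \<psi> u v = (\<lambda>i. if i \<le> \<psi> then u i else v i)"

definition T4 ::
  "complex \<Rightarrow> nat list \<Rightarrow> nat \<Rightarrow> nat \<Rightarrow> pfun \<Rightarrow> pfun \<Rightarrow> (nat \<Rightarrow> nat) \<Rightarrow> pfun" where
  "T4 \<eta> ns \<alpha> \<beta> f g \<sigma> x =
     theta' \<eta> 0 *
     (\<Sum>\<mu>\<in>{1..\<alpha>}. \<Sum>\<mu>'\<in>{\<alpha> + 1..\<alpha> + \<beta>}. \<Sum>\<psi>\<in>{1..length ns - 1}.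
        let a = x (\<sigma> \<mu>); b = x (\<sigma> \<mu>') in
        theta \<eta> (a \<psi> + b (\<psi> + 1) - b \<psi> - a (\<psi> + 1)) /
        (theta \<eta> (a \<psi> - b \<psi>) * theta \<eta> (b (\<psi> + 1) - a (\<psi> + 1))) *
        first_blocks \<sigma> f (x(\<sigma> \<mu> := splice \<psi> b a)) *
        last_blocks \<alpha> \<sigma> g (x(\<sigma> \<mu>' := splice \<psi> a b)))"

definition bracket_expr ::
  "complex \<Rightarrow> nat list \<Rightarrow> nat \<Rightarrow> nat \<Rightarrow> pfun \<Rightarrow> pfun \<Rightarrow> pfun" where
  "bracket_expr \<eta> ns \<alpha> \<beta> f g x =
     1 / (fact \<alpha> * fact \<beta>) *
     (\<Sum>\<sigma> | \<sigma> permutes {1..\<alpha> + \<beta>}.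
        T1 ns \<alpha> \<beta> f g \<sigma> x + T2 ns \<alpha> \<beta> f g \<sigma> x +
        T3 \<eta> ns \<alpha> \<beta> f g \<sigma> x + T4 \<eta> ns \<alpha> \<beta> f g \<sigma> x)"

text \<open>
  The summands of \<^const>\<open>bracket_expr\<close> are meromorphic, and division by zero yields zero in HOL,
  so \<^const>\<open>bracket_expr\<close> has its intended value only where none of the theta functions in
  the denominators vanishes.  The bracket is the holomorphic function that agrees with it there.
  As these points are dense, there is at most one such function.
\<close>

definition off_poles :: "complex \<Rightarrow> nat \<Rightarrow> nat \<Rightarrow> point set" where
  "off_poles \<eta> p m = {x. \<forall>\<nu>\<in>{1..m}. \<forall>\<nu>'\<in>{1..m}. \<nu> \<noteq> \<nu>' \<longrightarrow>
     (\<forall>\<mu>\<in>{1..p}. theta \<eta> (x \<nu> \<mu> - x \<nu>' \<mu>) \<noteq> 0)}"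

definition bracket ::
  "complex \<Rightarrow> nat list \<Rightarrow> nat \<Rightarrow> nat \<Rightarrow> pfun \<Rightarrow> pfun \<Rightarrow> pfun" where
  "bracket \<eta> ns \<alpha> \<beta> f g =
     (THE h. holomorphic_vars (length ns) (\<alpha> + \<beta>) h \<and>
        (\<forall>x\<in>off_poles \<eta> (length ns) (\<alpha> + \<beta>). h x = bracket_expr \<eta> ns \<alpha> \<beta> f g x))"

definition q_bracket ::
  "complex \<Rightarrow> nat list \<Rightarrow> (nat \<Rightarrow> pfun) \<Rightarrow> (nat \<Rightarrow> pfun) \<Rightarrow> nat \<Rightarrow> pfun" where
  "q_bracket \<eta> ns F G =
     (\<lambda>m x. \<Sum>\<alpha>\<le>m. bracket \<eta> ns \<alpha> (m - \<alpha>) (F \<alpha>) (G (m - \<alpha>)) x)"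


section \<open>Poisson brackets\<close>

text \<open>
  The locale \<^locale>\<open>Module.algebra\<close> is that of commutative associative algebras with unit.
\<close>

locale poisson_algebra = Module.algebra R A for R (structure) and A (structure) +
  fixes br :: "'b \<Rightarrow> 'b \<Rightarrow> 'b"
  assumes br_closed: "\<lbrakk>f \<in> carrier A; g \<in> carrier A\<rbrakk> \<Longrightarrow> br f g \<in> carrier A"
    and br_add_left: "\<lbrakk>f \<in> carrier A; g \<in> carrier A; h \<in> carrier A\<rbrakk> \<Longrightarrow>
      br (f \<oplus>\<^bsub>A\<^esub> g) h = br f h \<oplus>\<^bsub>A\<^esub> br g h"
    and br_add_right: "\<lbrakk>f \<in> carrier A; g \<in> carrier A; h \<in> carrier A\<rbrakk> \<Longrightarrow>
      br f (g \<oplus>\<^bsub>A\<^esub> h) = br f g \<oplus>\<^bsub>A\<^esub> br f h"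
    and br_smult_left: "\<lbrakk>c \<in> carrier R; f \<in> carrier A; g \<in> carrier A\<rbrakk> \<Longrightarrow>
      br (c \<odot>\<^bsub>A\<^esub> f) g = c \<odot>\<^bsub>A\<^esub> br f g"
    and br_smult_right: "\<lbrakk>c \<in> carrier R; f \<in> carrier A; g \<in> carrier A\<rbrakk> \<Longrightarrow>
      br f (c \<odot>\<^bsub>A\<^esub> g) = c \<odot>\<^bsub>A\<^esub> br f g"
    and br_alternating: "f \<in> carrier A \<Longrightarrow> br f f = \<zero>\<^bsub>A\<^esub>"
    and br_jacobi: "\<lbrakk>f \<in> carrier A; g \<in> carrier A; h \<in> carrier A\<rbrakk> \<Longrightarrow>
      br f (br g h) \<oplus>\<^bsub>A\<^esub> br g (br h f) \<oplus>\<^bsub>A\<^esub> br h (br f g) = \<zero>\<^bsub>A\<^esub>"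
    and br_leibniz: "\<lbrakk>f \<in> carrier A; g \<in> carrier A; h \<in> carrier A\<rbrakk> \<Longrightarrow>
      br f (g \<otimes>\<^bsub>A\<^esub> h) = br f g \<otimes>\<^bsub>A\<^esub> h \<oplus>\<^bsub>A\<^esub> g \<otimes>\<^bsub>A\<^esub> br f h"

end

theory Submission
  imports Defs "HOL-Complex_Analysis.Complex_Analysis" "HOL-Combinatorics.Permutations"
begin

text \<open>
  Let \<open>RR i j\<close> be the sum of the operators in the bracket that involve the blocks \<open>i\<close> and \<open>j\<close>.
  Then the bracket of \<open>f\<close> and \<open>g\<close> is, up to a factor, the symmetrization of the sum of \<open>RR i j\<close>
  over the blocks \<open>i\<close> of \<open>f\<close> and \<open>j\<close> of \<open>g\<close>, applied to their tensor product. These operators form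
  a classical r-matrix: they are antisymmetric, \<open>RR i j\<close> and \<open>RR k l\<close> commute for disjoint pairs,
  and the classical Yang-Baxter equation holds, which comes down to Fay's identity for the Kronecker
  function \<open>\<theta>'(0) \<theta>(x + y) / (\<theta>(x) \<theta>(y))\<close>. Jacobi identity and Leibniz rule follow formally. The
  coefficients \<open>c\<^sub>\<psi>\<close> make the result quasi-periodic, since they solve the linear
  system given by the tridiagonal matrix of the continuant. The poles of \<open>RR i j f\<close> on the hyperplanes \<open>x\<^sub>i\<^sub>\<phi> = x\<^sub>j\<^sub>\<phi>\<close>
  cancel for \<open>f\<close> antisymmetric in \<open>i\<close> and \<open>j\<close>, which may be assumed under the symmetrization.
\<close>

section \<open>Quotients of entire functions\<close>

text \<open>The main obstacle is that single summands of the bracket have poles and that division by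
  zero returns 0 in HOL, so that operator identities can fail at the poles. They are therefore
  proved on the set \<open>U N\<close>, where no denominator vanishes, and carried over by
  continuity along lines that leave the poles at once. As \<open>RR i j f\<close> is in general not
  holomorphic, operators are composed on the weaker class \<open>dif\<close>; second derivatives are
  only commuted for holomorphic functions. A bracket is known only after symmetrization, and a
  nested bracket is an operator applied to such a symmetrization. It becomes computable because the
  outer symmetrization absorbs the inner one: inner permutations preserve the two index sets of the
  outer operator. The analytic input is that theta has simple zeros, exactly at the lattice points.
  They are read off from an infinite product with the same quasi-periodicity, since Liouville's
  theorem makes the quotient constant. The constant 2 pi i for each pair of blocks in
  \<open>T3\<close> splits evenly over the two logarithmic derivatives and makes each of them odd,
  as antisymmetry requires.\<close>

lemma entire_eventually_nonzero:
  assumes "g holomorphic_on UNIV" "g b \<noteq> 0"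
  shows "\<forall>\<^sub>F z in at z0. g z \<noteq> 0"
  using non_zero_neighbour_alt[OF assms(1), of z0 b] assms(2) by (auto elim: eventually_mono)

text \<open>At a zero of \<open>g\<close> the value is that of L'Hopital's rule for a simple zero of
  \<open>g\<close> that is also a zero of \<open>f\<close>.\<close>

definition holo_quot :: "(complex \<Rightarrow> complex) \<Rightarrow> (complex \<Rightarrow> complex) \<Rightarrow> complex \<Rightarrow> complex" where
  "holo_quot f g z = (if g z = 0 then deriv f z / deriv g z else f z / g z)"

lemma holo_quot_mult:
  assumes "g z = 0 \<Longrightarrow> f z = 0"
  shows "g z * holo_quot f g z = f z"
  using assms by (auto simp: holo_quot_def)

text \<open>At a simple zero of \<open>g\<close>, L'Hopital's rule makes the quotient continuous, so
  that the isolated singularity is removable.\<close>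

lemma holomorphic_on_holo_quot:
  assumes f: "f holomorphic_on UNIV" and g: "g holomorphic_on UNIV"
    and simple: "\<And>z. g z = 0 \<Longrightarrow> deriv g z \<noteq> 0" and zero: "\<And>z. g z = 0 \<Longrightarrow> f z = 0"
  shows "holo_quot f g holomorphic_on UNIV"
proof -
  have "holo_quot f g field_differentiable at z0" for z0
  proof -
    have df: "(f has_field_derivative deriv f z0) (at z0)" and dg: "(g has_field_derivative deriv g z0) (at z0)"
      using f g holomorphic_derivI by blast+
    show ?thesis
    proof (cases "g z0 = 0")
      case False
      have op: "open {z. g z \<noteq> 0}"
        using g by (intro open_Collect_neq holomorphic_on_imp_continuous_on continuous_on_const) auto
      have "(\<lambda>z. f z / g z) holomorphic_on {z. g z \<noteq> 0}"
        using f g by (intro holomorphic_intros) (auto intro: holomorphic_on_subset)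
      then have "holo_quot f g holomorphic_on {z. g z \<noteq> 0}"
        by (rule holomorphic_transform) (auto simp: holo_quot_def)
      with op False show ?thesis
        using holomorphic_on_imp_differentiable_at by blast
    next
      case True
      have "\<forall>\<^sub>F z in at z0. g z \<noteq> 0"
      proof -
        have "\<exists>b. g b \<noteq> 0"
        proof (rule ccontr)
          assume "\<not> ?thesis"
          then have "g = (\<lambda>_. 0)" by auto
          with simple[OF True] show False by simp
        qed
        with entire_eventually_nonzero[OF g] show ?thesis by blast
      qed
      then obtain r where r: "r > 0" "\<And>z. z \<noteq> z0 \<Longrightarrow> dist z z0 < r \<Longrightarrow> g z \<noteq> 0"
        by (auto simp: eventually_at)
      have lim: "((\<lambda>w. f w / g w) \<longlongrightarrow> holo_quot f g z0) (at z0)"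
        using lhopital_complex_simple[OF df dg zero[OF True] True simple[OF True] refl] True
        by (simp add: holo_quot_def)
      have ev: "\<forall>\<^sub>F w in at z0. f w / g w = holo_quot f g w"
        unfolding eventually_at using r by (auto simp: holo_quot_def intro!: exI[of _ r])
      have "(holo_quot f g \<longlongrightarrow> holo_quot f g z0) (at z0)"
        using lim tendsto_cong[OF ev] by simp
      moreover have "holo_quot f g holomorphic_on ball z0 r - {z0}"
      proof (rule holomorphic_transform)
        show "(\<lambda>z. f z / g z) holomorphic_on ball z0 r - {z0}"
          using f g r by (intro holomorphic_intros)
            (auto intro: holomorphic_on_subset simp: dist_commute)
      qed (use r in \<open>auto simp: holo_quot_def dist_commute\<close>)
      ultimately have "holo_quot f g holomorphic_on ball z0 r"
        using no_isolated_singularity'[of "{z0}" "holo_quot f g" "ball z0 r"] tendsto_within_subset by blast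
      then have "holo_quot f g field_differentiable at z0"
        by (rule holomorphic_on_imp_differentiable_at) (use r in auto)
      then show ?thesis
        .
    qed
  qed
  then show ?thesis by (simp add: holomorphic_on_def field_differentiable_at_within)
qed

section \<open>The theta function\<close>

locale upper_half =
  fixes \<eta> :: complex
  assumes Im_pos: "Im \<eta> > 0"
begin

definition ee :: "complex \<Rightarrow> complex" where "ee z = exp (2 * of_real pi * \<i> * z)"

lemma ee_add: "ee (z + w) = ee z * ee w"
  by (simp add: ee_def distrib_left exp_add)

lemma ee_minus: "ee (- z) = inverse (ee z)"
  by (simp add: ee_def exp_minus)

lemma ee_diff: "ee (z - w) = ee z / ee w"
  by (simp add: ee_def right_diff_distrib exp_diff)

lemma ee_nonzero [simp]: "ee z \<noteq> 0"
  by (simp add: ee_def)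

lemma ee_0 [simp]: "ee 0 = 1" and ee_1 [simp]: "ee 1 = 1"
  by (simp_all add: ee_def)

lemma ee_of_int [simp]: "ee (of_int m) = 1"
  unfolding ee_def using exp_integer_2pi[of "of_int m"] by (simp add: algebra_simps)

lemma ee_eq_1_iff: "ee z = 1 \<longleftrightarrow> z \<in> \<int>"
proof
  assume "ee z = 1"
  then obtain n :: int where "Re (2 * of_real pi * \<i> * z) = 0" "Im (2 * of_real pi * \<i> * z) = of_int (2 * n) * pi"
    unfolding ee_def exp_eq_1 by blast
  then have "z = of_int n" by (auto simp: complex_eq_iff)
  then show "z \<in> \<int>" by simp
next
  assume "z \<in> \<int>" then show "ee z = 1" by (auto elim: Ints_cases)
qed

lemma has_field_derivative_ee [derivative_intros]:
  "(ee has_field_derivative 2 * of_real pi * \<i> * ee z) (at z within S)"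
  unfolding ee_def by (auto intro!: derivative_eq_intros)

lemma holomorphic_on_ee [holomorphic_intros]:
  "f holomorphic_on S \<Longrightarrow> (\<lambda>z. ee (f z)) holomorphic_on S"
  unfolding ee_def by (intro holomorphic_intros)

lemma continuous_on_ee [continuous_intros]:
  "continuous_on S f \<Longrightarrow> continuous_on S (\<lambda>z. ee (f z))"
  unfolding ee_def by (intro continuous_intros)

section \<open>Functional equations of the theta series\<close>

abbreviation "th \<equiv> theta \<eta>"

definition theta_term :: "int \<Rightarrow> complex \<Rightarrow> complex" where
  "theta_term a z = (- 1) powi a *
     exp (2 * of_real pi * \<i> * (of_int a * z + of_int (a * (a - 1)) / 2 * \<eta>))"

lemma theta_eq: "th z = (\<Sum>\<^sub>\<infinity>a. theta_term a z)"
  by (simp add: theta_def theta_term_def)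

lemma theta_add_1: "th (z + 1) = th z"
proof -
  have "theta_term a (z + 1) = theta_term a z" for a
  proof -
    have "theta_term a (z + 1) = theta_term a z * ee (of_int a)"
      unfolding theta_term_def ee_def mult.assoc exp_add[symmetric] by (simp add: algebra_simps)
    then show ?thesis by simp
  qed
  then show ?thesis by (simp add: theta_eq)
qed

text \<open>Shifting by \<eta> raises the summation index by one, because a + a(a-1)/2 = (a+1)a/2;
  the sign and the factor \<open>ee (- z)\<close> come from this change of index.\<close>

lemma theta_add_eta: "th (z + \<eta>) = - ee (- z) * th z"
proof -
  have "theta_term a (z + \<eta>) = - ee (- z) * theta_term (a + 1) z" for a
  proof -
    have "(- 1 :: complex) powi (a + 1) = - ((- 1) powi a)"
      by (simp add: power_int_add)
    moreover have e: "of_int a * (z + \<eta>) + of_int (a * (a - 1)) / 2 * \<eta> =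
        - z + (of_int (a + 1) * z + of_int ((a + 1) * (a + 1 - 1)) / 2 * \<eta>)"
      by (simp add: field_simps)
    ultimately show ?thesis
      unfolding theta_term_def ee_def e distrib_left[of _ "- z"] exp_add by (simp add: mult_ac)
  qed
  then have "th (z + \<eta>) = (\<Sum>\<^sub>\<infinity>a. - ee (- z) * theta_term (a + 1) z)"
    by (simp add: theta_eq)
  also have "\<dots> = - ee (- z) * (\<Sum>\<^sub>\<infinity>a. theta_term (a + 1) z)"
    by (rule infsum_cmult_right')
  also have "(\<Sum>\<^sub>\<infinity>a. theta_term (a + 1) z) = th z"
    unfolding theta_eq by (rule infsum_reindex_bij_witness[of _ "\<lambda>a. a - 1" "\<lambda>a. a + 1"]) auto
  finally show ?thesis .
qed

text \<open>The substitution of 1 - a for a leaves a(a-1)/2 unchanged.\<close>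

lemma theta_minus: "th (- z) = - ee (- z) * th z"
proof -
  have "theta_term a (- z) = - ee (- z) * theta_term (1 - a) z" for a
  proof -
    have "(- 1 :: complex) powi (1 - a) = - ((- 1) powi a)"
      by (simp add: power_int_diff power_int_minus_one_minus divide_inverse flip: power_int_minus)
    moreover have e: "of_int a * (- z) + of_int (a * (a - 1)) / 2 * \<eta> =
        - z + (of_int (1 - a) * z + of_int ((1 - a) * (1 - a - 1)) / 2 * \<eta>)"
      by (simp add: field_simps)
    ultimately show ?thesis
      unfolding theta_term_def ee_def e distrib_left[of _ "- z"] exp_add by (simp add: mult_ac)
  qed
  then have "th (- z) = (\<Sum>\<^sub>\<infinity>a. - ee (- z) * theta_term (1 - a) z)"
    by (simp add: theta_eq)
  also have "\<dots> = - ee (- z) * (\<Sum>\<^sub>\<infinity>a. theta_term (1 - a) z)"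
    by (rule infsum_cmult_right')
  also have "(\<Sum>\<^sub>\<infinity>a. theta_term (1 - a) z) = th z"
    unfolding theta_eq by (rule infsum_reindex_bij_witness[of _ "\<lambda>a. 1 - a" "\<lambda>a. 1 - a"]) auto
  finally show ?thesis .
qed

lemma theta_0 [simp]: "th 0 = 0"
  using theta_minus[of 0] by simp

section \<open>Convergence and holomorphy of the theta series\<close>

lemma summable_on_exp_abs_int: "(\<lambda>a::int. exp (- real_of_int \<bar>a\<bar>)) summable_on UNIV"
proof -
  have s: "summable (\<lambda>n. exp (- real n))" and s': "summable (\<lambda>n. exp (- real (Suc n)))"
    using summable_geometric[of "exp (-1::real)"]
    by (auto simp: exp_of_nat_mult[symmetric] simp del: of_nat_Suc summable_Suc_iff intro: summable_Suc_iff[THEN iffD2])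
  have 1: "(\<lambda>a::int. exp (- real_of_int \<bar>a\<bar>)) summable_on range int"
    using s by (subst summable_on_reindex) (auto simp: o_def summable_on_UNIV_nonneg_real_iff)
  have 2: "(\<lambda>a::int. exp (- real_of_int \<bar>a\<bar>)) summable_on range (\<lambda>n. - int (Suc n))"
    using s' by (subst summable_on_reindex)
      (auto simp: o_def summable_on_UNIV_nonneg_real_iff inj_def simp del: of_nat_Suc summable_Suc_iff)
  have "a \<in> range int \<union> range (\<lambda>n. - int (Suc n))" for a :: int
    by (cases a rule: int_cases) auto
  then have "UNIV = range int \<union> range (\<lambda>n. - int (Suc n))" by blast
  moreover have "range int \<inter> range (\<lambda>n. - int (Suc n)) = {}" by auto
  ultimately show ?thesis using summable_on_Un_disjoint[OF 1 2] by simp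
qed

text \<open>On a horizontal strip the quadratic term of the exponent, with Im \<eta> > 0, dominates
  the linear ones. The resulting majorant is uniform in \<open>z\<close> and summable over the
  integers.\<close>

lemma norm_theta_term_le:
  obtains C where "\<And>a z. \<bar>Im z\<bar> \<le> R \<Longrightarrow> norm (theta_term a z) \<le> C * exp (- real_of_int \<bar>a\<bar>)"
proof -
  define t where "t = Im \<eta>"
  \<comment> \<open>\<open>b\<close> collects the coefficients of |a|: 2 pi R bounds the
    contribution of Im z, pi t that of the linear part of a(a-1), and the extra 1 is spent on the
    decay exp(-|a|).\<close>
  define b where "b = 2 * pi * R + pi * t + 1"
  define c where "c = pi * t"
  have c: "c > 0" using Im_pos by (simp add: c_def t_def)
  have "norm (theta_term a z) \<le> exp (b\<^sup>2 / (4 * c)) * exp (- real_of_int \<bar>a\<bar>)" if z: "\<bar>Im z\<bar> \<le> R" for a z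
  proof -
    define A where "A = real_of_int a"
    have n: "norm (theta_term a z) = exp (- 2 * pi * (A * Im z + A * (A - 1) / 2 * t))"
      unfolding theta_term_def by (simp add: norm_mult norm_power_int A_def t_def)
    have "- 2 * pi * (A * Im z + A * (A - 1) / 2 * t) \<le> b\<^sup>2 / (4 * c) - \<bar>A\<bar>"
    proof -
      have "- (A * Im z) \<le> \<bar>A * Im z\<bar>" by linarith
      also have "\<dots> = \<bar>A\<bar> * \<bar>Im z\<bar>" by (rule abs_mult)
      also have "\<dots> \<le> \<bar>A\<bar> * R" using z by (intro mult_left_mono) auto
      finally have "2 * pi * (- (A * Im z)) \<le> 2 * pi * (\<bar>A\<bar> * R)"
        by (intro mult_left_mono) auto
      then have 1: "- 2 * pi * (A * Im z) \<le> 2 * pi * (\<bar>A\<bar> * R)"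
        by simp
      have 2: "c * A \<le> c * \<bar>A\<bar>" using c by (intro mult_left_mono) auto
      \<comment> \<open>Completing the square in |A|.\<close>
      have 3: "b * \<bar>A\<bar> - c * \<bar>A\<bar>\<^sup>2 \<le> b\<^sup>2 / (4 * c)"
      proof -
        have "0 \<le> (b - 2 * c * \<bar>A\<bar>)\<^sup>2" by simp
        then have "4 * c * (b * \<bar>A\<bar> - c * \<bar>A\<bar>\<^sup>2) \<le> b\<^sup>2"
          by (simp add: power2_eq_square algebra_simps del: abs_mult_self_eq) 
        then show ?thesis using c by (simp add: field_simps)
      qed
      have "- 2 * pi * (A * Im z + A * (A - 1) / 2 * t) = - 2 * pi * (A * Im z) - c * \<bar>A\<bar>\<^sup>2 + c * A"
        by (simp add: c_def power2_eq_square) (simp add: field_simps)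
      also have "\<dots> \<le> (b * \<bar>A\<bar> - c * \<bar>A\<bar>\<^sup>2) - \<bar>A\<bar>"
      proof -
        have "b * \<bar>A\<bar> = 2 * pi * (\<bar>A\<bar> * R) + c * \<bar>A\<bar> + \<bar>A\<bar>"
          by (simp add: b_def c_def algebra_simps)
        with 1 2 show ?thesis by linarith
      qed
      finally show ?thesis using 3 by linarith
    qed
    then show ?thesis by (simp add: n A_def[symmetric] flip: exp_add)
  qed
  then show ?thesis by (rule that)
qed

lemma uniform_limit_theta:
  assumes "\<And>z. z \<in> S \<Longrightarrow> \<bar>Im z\<bar> \<le> R"
  shows "uniform_limit S (\<lambda>A z. \<Sum>a\<in>A. theta_term a z) th (finite_subsets_at_top UNIV)"
proof -
  obtain C where C: "\<And>a z. \<bar>Im z\<bar> \<le> R \<Longrightarrow> norm (theta_term a z) \<le> C * exp (- real_of_int \<bar>a\<bar>)"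
    using norm_theta_term_le[of R] by metis
  have "uniform_limit S (\<lambda>A z. \<Sum>a\<in>A. theta_term a z) (\<lambda>z. \<Sum>\<^sub>\<infinity>a. theta_term a z) (finite_subsets_at_top UNIV)"
    by (rule Weierstrass_m_test_general[where M = "\<lambda>a. C * exp (- real_of_int \<bar>a\<bar>)"])
      (use C assms summable_on_exp_abs_int in \<open>auto intro: summable_on_cmult_right\<close>)
  then show ?thesis by (simp add: theta_eq[abs_def])
qed

lemma holomorphic_theta_UNIV: "th holomorphic_on UNIV"
proof -
  have "th field_differentiable at z" for z
  proof -
    have "\<bar>Im w\<bar> \<le> norm z + 1" if "w \<in> cball z 1" for w
    proof -
      have "\<bar>Im w\<bar> \<le> norm w" by (rule abs_Im_le_cmod)
      also have "norm w \<le> norm z + norm (w - z)" by norm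
      finally show ?thesis using that by (simp add: dist_norm norm_minus_commute)
    qed
    from uniform_limit_theta[OF this]
    have u: "uniform_limit (cball z 1) (\<lambda>A z. \<Sum>a\<in>A. theta_term a z) th (finite_subsets_at_top UNIV)"
      by blast
    have "th holomorphic_on ball z 1"
      by (rule holomorphic_uniform_limit[OF _ u])
        (auto simp: theta_term_def intro!: always_eventually continuous_intros holomorphic_intros)
    then show ?thesis by (auto intro: holomorphic_on_imp_differentiable_at)
  qed
  then show ?thesis by (simp add: holomorphic_on_def field_differentiable_at_within)
qed

lemma holomorphic_on_theta [holomorphic_intros]:
  "f holomorphic_on S \<Longrightarrow> (\<lambda>z. th (f z)) holomorphic_on S"
  by (rule holomorphic_on_compose_gen[OF _ holomorphic_theta_UNIV, unfolded o_def]) auto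

lemma has_field_derivative_theta: "(th has_field_derivative deriv th z) (at z)"
  using holomorphic_theta_UNIV holomorphic_derivI by blast

text \<open>If theta vanished identically, so would its constant Fourier coefficient, which is the term with index 0.\<close>

lemma theta_not_0: "\<exists>z. th z \<noteq> 0"
proof (rule ccontr)
  assume "\<not> ?thesis"
  then have th0: "\<And>z. th z = 0" by auto
  have u: "uniform_limit (cbox 0 (1::real)) (\<lambda>A x. \<Sum>a\<in>A. theta_term a (of_real x)) (\<lambda>x. th (of_real x)) (finite_subsets_at_top UNIV)"
  proof -
    have "uniform_limit (of_real ` cbox 0 (1::real)) (\<lambda>A z. \<Sum>a\<in>A. theta_term a z) th (finite_subsets_at_top UNIV)"
      by (rule uniform_limit_theta[of _ 0]) auto
    then show ?thesis by (simp add: uniform_limit_iff)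
  qed
  obtain I J where I: "\<And>A. ((\<lambda>x. \<Sum>a\<in>A. theta_term a (of_real x)) has_integral I A) (cbox 0 (1::real))"
    and J: "((\<lambda>x. th (of_real x)) has_integral J) (cbox 0 (1::real))"
    and IJ: "(I \<longlongrightarrow> J) (finite_subsets_at_top UNIV)"
    by (rule uniform_limit_integral_cbox[OF u]) (auto simp: theta_term_def intro!: continuous_intros)
  have "J = 0" using J th0 has_integral_unique[of "\<lambda>x. 0::complex" J "cbox 0 (1::real)" 0] by simp
  \<comment> \<open>Orthogonality: every term but the one of index 0 has the 1-periodic primitive
    \<open>F\<close> and thus integral 0.\<close>
  have trm: "((\<lambda>x. theta_term a (of_real x)) has_integral (if a = 0 then 1 else 0)) (cbox 0 (1::real))" for a
  proof (cases "a = 0")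
    case True
    have "((\<lambda>x. 1::complex) has_integral 1) (cbox 0 (1::real))"
      using has_integral_const_real[of "1::complex" 0 1] by simp
    then show ?thesis using True by (simp add: theta_term_def)
  next
    case False
    define F where "F x = theta_term a (of_real x) / (2 * of_real pi * \<i> * of_int a)" for x :: real
    have "(F has_vector_derivative theta_term a (of_real x)) (at x within {0..1})" for x
    proof -
      have "((\<lambda>z. theta_term a z / (2 * of_real pi * \<i> * of_int a)) has_field_derivative theta_term a (of_real x)) (at (of_real x))"
        unfolding theta_term_def using False by (auto intro!: derivative_eq_intros)
      from has_vector_derivative_real_field[OF this] show ?thesis by (simp add: F_def[abs_def])
    qed
    from fundamental_theorem_of_calculus[of 0 1 F, OF _ this]
    have "((\<lambda>x. theta_term a (of_real x)) has_integral (F 1 - F 0)) {0..1}" by simp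
    moreover have "theta_term a (0 + 1) = theta_term a 0"
    proof -
      have "theta_term a (0 + 1) = theta_term a 0 * ee (of_int a)"
        unfolding theta_term_def ee_def mult.assoc exp_add[symmetric] by (simp add: algebra_simps)
      then show ?thesis by simp
    qed
    ultimately show ?thesis using False by (simp add: F_def)
  qed
  have "I A = 1" if "finite A" "0 \<in> A" for A
  proof -
    have "((\<lambda>x. \<Sum>a\<in>A. theta_term a (of_real x)) has_integral (\<Sum>a\<in>A. if a = 0 then 1 else 0)) (cbox 0 (1::real))"
      by (intro has_integral_sum trm that)
    then show ?thesis using I[of A] that by (simp add: has_integral_unique)
  qed
  then have "\<forall>\<^sub>F A in finite_subsets_at_top UNIV. I A = 1"
    by (auto simp: eventually_finite_subsets_at_top intro!: exI[of _ "{0}"])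
  then have "(I \<longlongrightarrow> 1) (finite_subsets_at_top UNIV)"
    by (rule tendsto_eventually)
  with IJ \<open>J = 0\<close> show False
    using tendsto_unique[of "finite_subsets_at_top UNIV" I 0 1] by simp
qed


subsection \<open>The product formula and the zeros\<close>

text \<open>The zeros of \<open>g\<close> are isolated, so \<open>f1\<close> and \<open>f2\<close>
  agree on a punctured neighbourhood of every point, and by continuity at the point itself.\<close>

lemma entire_cancel:
  assumes "f1 holomorphic_on UNIV" "f2 holomorphic_on UNIV" "g holomorphic_on UNIV" "g b \<noteq> 0"
    and eq: "\<And>z. g z * f1 z = g z * f2 z"
  shows "f1 z = (f2 z :: complex)"
proof -
  have "\<forall>\<^sub>F w in at z. f1 w = f2 w"
    using entire_eventually_nonzero[OF assms(3,4), of z] by eventually_elim (use eq mult_left_cancel in blast)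
  moreover have "(f1 \<longlongrightarrow> f1 z) (at z)" "(f2 \<longlongrightarrow> f2 z) (at z)"
    using assms(1,2) by (auto dest!: holomorphic_on_imp_continuous_on simp: continuous_on_def)
  ultimately show ?thesis
    using tendsto_cong tendsto_unique[of "at z"] by (metis trivial_limit_at)
qed

definition nome :: complex where "nome = ee \<eta>"

lemma norm_nome: "norm nome < 1" and nome_nonzero [simp]: "nome \<noteq> 0"
  using Im_pos by (simp_all add: nome_def ee_def)

lemma nome_power: "nome ^ n = ee (of_nat n * \<eta>)"
  by (simp add: nome_def ee_def exp_of_nat_mult[symmetric] mult_ac)

lemma nome_power_neq_1: "nome ^ Suc n \<noteq> 1"
proof
  assume "nome ^ Suc n = 1"
  then have "norm nome ^ Suc n = 1" by (metis norm_one norm_power)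
  moreover have "norm nome ^ Suc n < 1" using norm_nome by (intro power_Suc_less_one) auto
  ultimately show False by simp
qed

text \<open>Euler's coefficients: up to the sign (-1)^n, the value is nome^(n(n-1)/2) divided by (1
  - nome) ... (1 - nome^n).\<close>

primrec qcoeff :: "nat \<Rightarrow> complex" where
  "qcoeff 0 = 1"
| "qcoeff (Suc n) = - (nome ^ n) / (1 - nome ^ Suc n) * qcoeff n"

text \<open>By Euler's expansion, this is the product of the factors \<open>1 - nome ^ n * w\<close> over all \<open>n\<close>.\<close>

definition qprod :: "complex \<Rightarrow> complex" where
  "qprod w = (\<Sum>n. qcoeff n * w ^ n)"

text \<open>The quotient of consecutive terms tends to 0, as the powers of \<open>nome\<close> do so
  and the denominators stay at least 1 - |nome| in absolute value.\<close>

lemma summable_qcoeff: "summable (\<lambda>n. qcoeff n * w ^ n)"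
proof -
  define r where "r = norm nome"
  have r: "0 \<le> r" "r < 1" using norm_nome by (auto simp: r_def)
  have "(\<lambda>n. r ^ n * (norm w / (1 - r))) \<longlonglongrightarrow> 0 * (norm w / (1 - r))"
    by (intro tendsto_intros LIMSEQ_power_zero) (use r in auto)
  then have "\<forall>\<^sub>F n in sequentially. r ^ n * (norm w / (1 - r)) < 1/2"
    by (intro order_tendstoD(2)[where y = 0]) auto
  then obtain N where N: "\<And>n. n \<ge> N \<Longrightarrow> r ^ n * (norm w / (1 - r)) < 1/2"
    by (auto simp: eventually_sequentially)
  show ?thesis
  proof (rule summable_ratio_test[of "1/2" N])
    fix n assume n: "n \<ge> N"
    have "1 - r \<le> 1 - r ^ Suc n" using r power_le_one[of r n] mult_left_le[of "r ^ n" r] by simp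
    also have "\<dots> = norm (1::complex) - norm (nome ^ Suc n)" by (simp add: r_def norm_mult norm_power)
    also have "\<dots> \<le> norm (1 - nome ^ Suc n)" by (rule norm_triangle_ineq2)
    finally have *: "1 - r \<le> norm (1 - nome ^ Suc n)" .
    have "norm (qcoeff (Suc n) * w ^ Suc n) = r ^ n * (norm w / norm (1 - nome ^ Suc n)) * norm (qcoeff n * w ^ n)"
      by (simp add: norm_mult norm_divide norm_power r_def)
    also have "\<dots> \<le> r ^ n * (norm w / (1 - r)) * norm (qcoeff n * w ^ n)"
      using r * by (intro mult_right_mono mult_left_mono divide_left_mono mult_pos_pos) auto
    also have "\<dots> \<le> 1 / 2 * norm (qcoeff n * w ^ n)"
      using N[OF n] by (intro mult_right_mono) auto
    finally show "norm (qcoeff (Suc n) * w ^ Suc n) \<le> 1 / 2 * norm (qcoeff n * w ^ n)" .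
  qed auto
qed

lemma holomorphic_qprod: "qprod holomorphic_on UNIV"
  unfolding holomorphic_on_def field_differentiable_def qprod_def
  using termdiffs_strong_converges_everywhere[OF summable_qcoeff] has_field_derivative_at_within by blast

lemma holomorphic_on_qprod [holomorphic_intros]:
  "f holomorphic_on S \<Longrightarrow> (\<lambda>z. qprod (f z)) holomorphic_on S"
  by (rule holomorphic_on_compose_gen[OF _ holomorphic_qprod, unfolded o_def]) auto

lemma qprod_0 [simp]: "qprod 0 = 1"
  unfolding qprod_def by (subst powser_zero) simp

text \<open>The recursion of \<open>qcoeff\<close> is the comparison of coefficients in this
  equation.\<close>

lemma qprod_rec: "qprod w = (1 - w) * qprod (nome * w)"
proof -
  have s: "summable (\<lambda>n. qcoeff n * nome ^ n * w ^ n)"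
    using summable_qcoeff[of "nome * w"] by (simp add: power_mult_distrib mult_ac)
  have eq: "qcoeff (Suc n) = qcoeff (Suc n) * nome ^ Suc n - qcoeff n * nome ^ n" for n
  proof -
    have "qcoeff (Suc n) * (1 - nome ^ Suc n) = - (nome ^ n) * qcoeff n"
      using nome_power_neq_1[of n] by (simp del: power_Suc)
    then show ?thesis by (simp add: algebra_simps del: qcoeff.simps)
  qed
  have "qprod w = 1 + (\<Sum>n. qcoeff (Suc n) * w ^ Suc n)"
    unfolding qprod_def using suminf_split_head[OF summable_qcoeff, of w] by simp
  also have "(\<Sum>n. qcoeff (Suc n) * w ^ Suc n) =
      (\<Sum>n. qcoeff (Suc n) * nome ^ Suc n * w ^ Suc n - w * (qcoeff n * nome ^ n * w ^ n))"
    by (subst eq) (simp add: algebra_simps del: qcoeff.simps)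
  also have "\<dots> = (\<Sum>n. qcoeff (Suc n) * nome ^ Suc n * w ^ Suc n) - (\<Sum>n. w * (qcoeff n * nome ^ n * w ^ n))"
    by (intro suminf_diff[symmetric] summable_mult s) (use s in \<open>subst summable_Suc_iff, simp\<close>)
  also have "1 + \<dots> = (\<Sum>n. qcoeff n * nome ^ n * w ^ n) - w * (\<Sum>n. qcoeff n * nome ^ n * w ^ n)"
    using suminf_split_head[OF s] s by (simp add: suminf_mult del: qcoeff.simps(2))
  also have "\<dots> = (1 - w) * qprod (nome * w)"
    by (simp add: qprod_def power_mult_distrib algebra_simps)
  finally show ?thesis .
qed

text \<open>Were no factor zero, \<open>qprod_rec\<close> would carry the zero from w to nome w,
  nome^2 w and so on; these points tend to 0, where \<open>qprod\<close> is 1.\<close>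

lemma qprod_eq_0_D:
  assumes "qprod w = 0"
  obtains n where "nome ^ n * w = 1"
proof (rule ccontr)
  assume "\<not> thesis"
  then have ne: "nome ^ n * w \<noteq> 1" for n using that by blast
  have "qprod (nome ^ n * w) = 0" for n
  proof (induction n)
    case (Suc n)
    then show ?case using qprod_rec[of "nome ^ n * w"] ne[of n] by (simp add: mult.assoc)
  qed (use assms in simp)
  moreover have "(\<lambda>n. qprod (nome ^ n * w)) \<longlonglongrightarrow> qprod 0"
  proof (rule isCont_tendsto_compose[where g = qprod])
    show "isCont qprod 0"
      using holomorphic_on_imp_continuous_on[OF holomorphic_qprod] by (simp add: continuous_on_eq_continuous_at)
    have "(\<lambda>n. nome ^ n * w) \<longlonglongrightarrow> 0 * w"
      by (intro tendsto_intros LIMSEQ_power_zero norm_nome)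
    then show "(\<lambda>n. nome ^ n * w) \<longlonglongrightarrow> 0" by simp
  qed
  ultimately show False by (simp add: LIMSEQ_const_iff)
qed

text \<open>Jacobi's triple product without its constant factor. The first factor has its zeros at m
  - n \<eta>, the second at m + (n + 1) \<eta>, for integers m and natural numbers n; together they
  make up the lattice.\<close>

definition theta_prod :: "complex \<Rightarrow> complex" where
  "theta_prod z = qprod (ee z) * qprod (nome / ee z)"

lemma holomorphic_theta_prod: "theta_prod holomorphic_on UNIV"
  unfolding theta_prod_def[abs_def] by (intro holomorphic_intros) auto

lemma theta_prod_add_1: "theta_prod (z + 1) = theta_prod z"
  by (simp add: theta_prod_def ee_add)

lemma theta_prod_add_eta: "theta_prod (z + \<eta>) = - ee (- z) * theta_prod z"
proof -
  have 1: "qprod (inverse (ee z)) = (1 - inverse (ee z)) * qprod (nome / ee z)"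
    using qprod_rec[of "inverse (ee z)"] by (simp add: divide_inverse)
  have "theta_prod (z + \<eta>) = qprod (nome * ee z) * qprod (inverse (ee z))"
    by (simp add: theta_prod_def ee_add nome_def[symmetric] mult.commute field_simps)
  also have "\<dots> = - inverse (ee z) * ((1 - ee z) * qprod (nome * ee z)) * qprod (nome / ee z)"
  proof -
    have "A * ((1 - i) * B) = - i * ((1 - e) * A) * B" if "i * e = 1" for A B i e :: complex
    proof -
      have "- i * (1 - e) = 1 - i" using that by (simp add: right_diff_distrib)
      then show ?thesis by (metis mult.assoc mult.commute)
    qed
    then show ?thesis unfolding 1 using left_inverse[OF ee_nonzero] by blast
  qed
  also have "\<dots> = - ee (- z) * theta_prod z"
    by (simp add: theta_prod_def ee_minus mult.assoc flip: qprod_rec)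
  finally show ?thesis .
qed

section \<open>The period lattice, and theta compared with the product\<close>

definition lat :: "complex set" where
  "lat = {of_int m + of_int l * \<eta> | m l. True}"

lemma lat_add: "x \<in> lat \<Longrightarrow> y \<in> lat \<Longrightarrow> x + y \<in> lat"
  unfolding lat_def
  by clarify (metis (mono_tags, opaque_lifting) add.assoc add.left_commute distrib_right of_int_add)

lemma lat_minus: "x \<in> lat \<Longrightarrow> - x \<in> lat"
  unfolding lat_def
  by clarify (metis (mono_tags, opaque_lifting) minus_add_distrib mult_minus_left of_int_minus)

text \<open>With this rule a property of lattice points only has to be checked against the
  functional equations of the two generators, in both directions.\<close>

lemma lat_induct [consumes 1, case_names zero one one' eta eta']:
  assumes "l \<in> lat" "P 0"
    and "\<And>x. P x \<Longrightarrow> P (x + 1)" "\<And>x. P x \<Longrightarrow> P (x - 1)"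
    and "\<And>x. P x \<Longrightarrow> P (x + \<eta>)" "\<And>x. P x \<Longrightarrow> P (x - \<eta>)"
  shows "P l"
proof -
  obtain m n where l: "l = of_int m + of_int n * \<eta>" using assms(1) by (auto simp: lat_def)
  have "P (of_int m)"
    by (induction m rule: int_induct[of _ 0]) (use assms in auto)
  then have "P (of_int m + of_int n * \<eta>)"
  proof (induction n rule: int_induct[of _ 0])
    case (step1 i) then show ?case using assms(5)[of "of_int m + of_int i * \<eta>"] by (simp add: algebra_simps)
  next
    case (step2 i) then show ?case using assms(6)[of "of_int m + of_int i * \<eta>"] by (simp add: algebra_simps)
  qed simp
  then show ?thesis by (simp add: l)
qed

lemma theta_prod_eq_0_D: "theta_prod z = 0 \<Longrightarrow> z \<in> lat"
proof -
  assume "theta_prod z = 0"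
  then consider "qprod (ee z) = 0" | "qprod (nome / ee z) = 0" by (auto simp: theta_prod_def)
  then show ?thesis
  proof cases
    case 1
    then obtain n where "nome ^ n * ee z = 1" by (rule qprod_eq_0_D)
    then have "ee (of_nat n * \<eta> + z) = 1" by (simp add: nome_power ee_add)
    then obtain m where "of_nat n * \<eta> + z = of_int m" by (auto simp: ee_eq_1_iff elim: Ints_cases)
    then have "z = of_int m + of_int (- int n) * \<eta>" by (simp add: algebra_simps)
    then show ?thesis unfolding lat_def by blast
  next
    case 2
    then obtain n where "nome ^ n * (nome / ee z) = 1" by (rule qprod_eq_0_D)
    then have "nome ^ Suc n / ee z = 1" by (simp add: mult.commute)
    then have "ee (of_nat (Suc n) * \<eta> - z) = 1" by (simp only: nome_power ee_diff)
    then obtain m where m: "of_nat (Suc n) * \<eta> - z = of_int m" by (auto simp: ee_eq_1_iff elim: Ints_cases)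
    then have "z = of_int (- m) + of_int (int (Suc n)) * \<eta>" by (simp add: algebra_simps)
    then show ?thesis unfolding lat_def by blast
  qed
qed

text \<open>Quasi-periodicity transports the value and the derivative at 0 to any lattice point.\<close>

lemma quasi_periodic_lat:
  assumes f: "f holomorphic_on UNIV" "f 0 = 0" and p1: "\<And>z. f (z + 1) = f z"
    and pe: "\<And>z. f (z + \<eta>) = - ee (- z) * f z" and l: "l \<in> lat"
  shows "f l = 0" and "deriv f 0 \<noteq> 0 \<Longrightarrow> deriv f l \<noteq> 0"
proof -
  have d: "(f has_field_derivative deriv f z) (at z)" for z using f(1) holomorphic_derivI by blast
  have d1: "deriv f (z + 1) = deriv f z" for z
  proof -
    have "((\<lambda>z. f (z + 1)) has_field_derivative deriv f (z + 1)) (at z)"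
      by (rule DERIV_shift[THEN iffD1]) (rule d)
    then show ?thesis using d[of z] DERIV_unique by (simp add: p1)
  qed
  have de: "deriv f (z + \<eta>) = - ee (- z) * deriv f z + 2 * of_real pi * \<i> * ee (- z) * f z" for z
  proof -
    have "((\<lambda>z. f (z + \<eta>)) has_field_derivative deriv f (z + \<eta>)) (at z)"
      by (rule DERIV_shift[THEN iffD1]) (rule d)
    moreover have "((\<lambda>z. - ee (- z) * f z) has_field_derivative
        - ee (- z) * deriv f z + 2 * of_real pi * \<i> * ee (- z) * f z) (at z)"
      unfolding ee_def by (auto intro!: derivative_eq_intros d simp: algebra_simps)
    ultimately show ?thesis using DERIV_unique by (simp add: pe)
  qed
  \<comment> \<open>Value and derivative are treated together: under a shift by \<eta> the new
    derivative contains the old value, which is 0 by induction.\<close>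
  from l have "f l = 0 \<and> (deriv f 0 \<noteq> 0 \<longrightarrow> deriv f l \<noteq> 0)"
  proof (induction rule: lat_induct)
    case (one x) then show ?case by (simp add: p1 d1)
  next
    case (one' x) then show ?case using p1[of "x - 1"] d1[of "x - 1"] by simp
  next
    case (eta x) then show ?case by (simp add: pe de)
  next
    case (eta' x) then show ?case using pe[of "x - \<eta>"] de[of "x - \<eta>"] by simp
  qed (use f in simp)
  then show "f l = 0" and "deriv f 0 \<noteq> 0 \<Longrightarrow> deriv f l \<noteq> 0" by auto
qed

lemma theta_prod_0: "theta_prod 0 = 0"
  using qprod_rec[of 1] by (simp add: theta_prod_def)

text \<open>\<open>qprod_rec\<close> splits off the factor 1 - ee z, which has a simple zero at 0;
  the remaining factor is there the square of \<open>qprod nome\<close>, which is not 0.\<close>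

lemma deriv_theta_prod_0: "deriv theta_prod 0 \<noteq> 0"
proof -
  have nz: "qprod nome \<noteq> 0"
  proof
    assume "qprod nome = 0"
    then obtain n where "nome ^ n * nome = 1" by (rule qprod_eq_0_D)
    then show False using nome_power_neq_1[of n] by (simp add: mult.commute)
  qed
  define g where "g z = qprod (nome * ee z) * qprod (nome / ee z)" for z
  have g: "g holomorphic_on UNIV" unfolding g_def by (intro holomorphic_intros) auto
  have "theta_prod = (\<lambda>z. (1 - ee z) * g z)"
    by (rule ext) (simp add: theta_prod_def g_def qprod_rec[of "ee _"] mult.assoc)
  moreover have "((\<lambda>z. (1 - ee z) * g z) has_field_derivative - (2 * of_real pi * \<i>) * g 0) (at 0)"
    using holomorphic_derivI[OF g open_UNIV, of 0] by (auto intro!: derivative_eq_intros)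
  ultimately have "deriv theta_prod 0 = - (2 * of_real pi * \<i>) * g 0"
    by (simp add: DERIV_imp_deriv)
  moreover have "g 0 \<noteq> 0" using nz by (simp add: g_def)
  ultimately show ?thesis by simp
qed

text \<open>All values are taken on the closed period parallelogram, which is compact, so
  Liouville's theorem applies.\<close>

lemma entire_doubly_periodic_constant:
  assumes h: "h holomorphic_on UNIV" and "\<And>z. h (z + 1) = h z" "\<And>z. h (z + \<eta>) = h z"
  shows "h z = (h 0 :: complex)"
proof -
  have per: "h (z + l) = h z" if "l \<in> lat" for z l
    using that
  proof (induction rule: lat_induct)
    case (one x) then show ?case using assms(2)[of "z + x"] by (simp add: add.assoc)
  next
    case (one' x) then show ?case using assms(2)[of "z + (x - 1)"] by (simp add: algebra_simps)
  next
    case (eta x) then show ?case using assms(3)[of "z + x"] by (simp add: add.assoc)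
  next
    case (eta' x) then show ?case using assms(3)[of "z + (x - \<eta>)"] by (simp add: algebra_simps)
  qed simp
  define K where "K = (\<lambda>(s, t). complex_of_real s + complex_of_real t * \<eta>) ` ({0..1} \<times> {0..1})"
  have "compact K" unfolding K_def
    by (intro compact_continuous_image compact_Times compact_Icc) (auto simp: case_prod_unfold intro!: continuous_intros)
  then have "bounded (h ` K)"
    using h by (intro compact_imp_bounded compact_continuous_image)
      (auto intro: holomorphic_on_imp_continuous_on continuous_on_subset)
  moreover have "range h \<subseteq> h ` K"
  proof
    fix w assume "w \<in> range h"
    then obtain z where w: "w = h z" by auto
    \<comment> \<open>\<open>s\<close> and \<open>t\<close> are the real coordinates of
      \<open>z\<close> with respect to 1 and \<eta>; their integer parts form the lattice point to
      be subtracted.\<close>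
    define t where "t = Im z / Im \<eta>"
    define s where "s = Re (z - of_real t * \<eta>)"
    have z: "z = of_real s + of_real t * \<eta>"
      using Im_pos by (auto simp: complex_eq_iff s_def t_def)
    have "z = (of_real (frac s) + of_real (frac t) * \<eta>) + (of_int \<lfloor>s\<rfloor> + of_int \<lfloor>t\<rfloor> * \<eta>)"
      by (subst z) (simp add: frac_def algebra_simps)
    moreover have "of_int \<lfloor>s\<rfloor> + of_int \<lfloor>t\<rfloor> * \<eta> \<in> lat" unfolding lat_def by blast
    ultimately have "w = h (of_real (frac s) + of_real (frac t) * \<eta>)"
      using per w by simp
    moreover have "frac s \<in> {0..1}" "frac t \<in> {0..1}"
      using frac_ge_0 frac_lt_1 less_imp_le by (metis atLeastAtMost_iff)+
    then have "of_real (frac s) + of_real (frac t) * \<eta> \<in> K" unfolding K_def by force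
    ultimately show "w \<in> h ` K" by blast
  qed
  ultimately have "bounded (range h)" by (rule bounded_subset)
  with h have "h constant_on UNIV" by (rule Liouville_theorem)
  then show ?thesis by (auto simp: constant_on_def)
qed

text \<open>The quotient is taken in this direction because all zeros of the product are known to be
  simple and to lie in the lattice, while of theta only the vanishing on the lattice is known so
  far. The quotient is entire and doubly periodic, hence constant; the constant is not 0 because
  theta does not vanish identically.\<close>

lemma theta_eq_theta_prod: "\<exists>c. c \<noteq> 0 \<and> (\<forall>z. th z = c * theta_prod z)"
proof -
  define h where "h = holo_quot th theta_prod"
  have zero: "th z = 0" and simple: "deriv theta_prod z \<noteq> 0" if "theta_prod z = 0" for z
    using quasi_periodic_lat[OF holomorphic_theta_UNIV theta_0 theta_add_1 theta_add_eta]
      quasi_periodic_lat[OF holomorphic_theta_prod theta_prod_0 theta_prod_add_1 theta_prod_add_eta]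
      deriv_theta_prod_0 theta_prod_eq_0_D[OF that] by blast+
  have h: "h holomorphic_on UNIV" unfolding h_def
    by (rule holomorphic_on_holo_quot[OF holomorphic_theta_UNIV holomorphic_theta_prod simple zero])
  have th: "th z = theta_prod z * h z" for z
    unfolding h_def by (rule holo_quot_mult[symmetric]) (rule zero)
  obtain b where "theta_prod b \<noteq> 0" using th theta_not_0 by (metis mult_zero_left)
  note cancel = entire_cancel[OF _ h holomorphic_theta_prod this]
  have h_shift: "(\<lambda>z. h (z + c)) holomorphic_on UNIV" for c
    using holomorphic_on_compose_gen[OF _ h, of "\<lambda>z. z + c" UNIV] by (simp add: o_def holomorphic_intros)
  have "h (z + 1) = h z" for z
    by (rule cancel[OF h_shift]) (use th theta_add_1 theta_prod_add_1 in metis)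
  moreover have "h (z + \<eta>) = h z" for z
  proof (rule cancel[OF h_shift])
    fix z
    have "theta_prod (z + \<eta>) * h (z + \<eta>) = theta_prod (z + \<eta>) * h z"
      using th[of "z + \<eta>"] by (auto simp: theta_add_eta theta_prod_add_eta th[of z])
    then show "theta_prod z * h (z + \<eta>) = theta_prod z * h z"
      by (simp add: theta_prod_add_eta)
  qed
  ultimately have "h z = h 0" for z by (rule entire_doubly_periodic_constant[OF h])
  then have *: "th z = h 0 * theta_prod z" for z using th[of z] by (metis mult.commute)
  then have "h 0 \<noteq> 0" using theta_not_0 by auto
  with * show ?thesis by blast
qed

lemma theta_eq_0_iff: "th z = 0 \<longleftrightarrow> z \<in> lat"
  using theta_eq_theta_prod theta_prod_eq_0_D
    quasi_periodic_lat(1)[OF holomorphic_theta_UNIV theta_0 theta_add_1 theta_add_eta]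
  by (metis mult_eq_0_iff)

lemma deriv_theta_0: "deriv th 0 \<noteq> 0"
proof -
  obtain c where c: "c \<noteq> 0" "\<And>z. th z = c * theta_prod z" using theta_eq_theta_prod by blast
  then have "th = (\<lambda>z. c * theta_prod z)" by auto
  moreover have "deriv (\<lambda>z. c * theta_prod z) 0 = c * deriv theta_prod 0"
    using holomorphic_theta_prod by (intro deriv_cmult) (auto simp: holomorphic_on_def)
  ultimately have "deriv th 0 = c * deriv theta_prod 0" by metis
  then show ?thesis using c(1) deriv_theta_prod_0 by simp
qed

lemma deriv_theta_nonzero: "th z = 0 \<Longrightarrow> deriv th z \<noteq> 0"
  using quasi_periodic_lat(2)[OF holomorphic_theta_UNIV theta_0 theta_add_1 theta_add_eta _ deriv_theta_0]
  by (simp add: theta_eq_0_iff)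


subsection \<open>Weierstrass' three-term identity and the Kronecker function\<close>

lemma theta_diff_eta: "th (z - \<eta>) = - ee (z - \<eta>) * th z"
  using theta_add_eta[of "z - \<eta>"] by (simp add: ee_minus field_simps del: minus_diff_eq)

text \<open>
  As functions of \<open>a\<close>, both sides are theta functions of order 2 with the same multipliers, and
  their difference vanishes at \<open>- b\<close>, at \<open>- x1\<close> and at 0, hence identically.
\<close>

lemma weierstrass_identity:
  "th (x1 + a) * th (x2 + b) * th (a + b) * th (x2 - x1) =
   th (x1 + a + b) * th (x2 - x1 + b) * th x2 * th a -
   ee (x2 - x1) * th (x2 + a + b) * th (x1 - x2 + a) * th x1 * th b"
proof -
  \<comment> \<open>\<open>x1\<close> is generalized to a variable \<open>x\<close>, in which
    \<open>E\<close> is entire, so that exceptional values of \<open>x\<close> can be removed at the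
    end.\<close>
  define E where "E x b a =
    th (x + a) * th (x2 + b) * th (a + b) * th (x2 - x) -
    (th (x + a + b) * th (x2 - x + b) * th x2 * th a -
     ee (x2 - x) * th (x2 + a + b) * th (x - x2 + a) * th x * th b)" for x b a
  note hol = holomorphic_intros holomorphic_on_theta[of _ UNIV] holomorphic_on_ee[of _ UNIV]
  have hE: "(\<lambda>x. E x b a) holomorphic_on UNIV" "(\<lambda>b. E x b a) holomorphic_on UNIV" "(\<lambda>a. E x b a) holomorphic_on UNIV" for x b a
    unfolding E_def by (intro hol)+
  have E_1: "E x b (a + 1) = E x b a" for x b a
    using theta_add_1[of "x + a"] theta_add_1[of "a + b"] theta_add_1[of "x + a + b"] theta_add_1[of a]
      theta_add_1[of "x2 + a + b"] theta_add_1[of "x - x2 + a"]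
    unfolding E_def by (simp add: ac_simps)
  have E_eta: "E x b (a + \<eta>) = ee (- (x + a)) * ee (- (a + b)) * E x b a" for x b a
  proof -
    have 1: "y + (a + \<eta>) = y + a + \<eta>" "y + a + \<eta> + b = y + a + b + \<eta>" "a + \<eta> + b = a + b + \<eta>" for y
      by simp_all
    have e: "ee (- (x + a + b)) * ee (- a) = ee (- (x + a)) * ee (- (a + b))"
      "ee (- (x2 + a + b)) * ee (- (x - x2 + a)) = ee (- (x + a)) * ee (- (a + b))"
      unfolding ee_add[symmetric] by (rule arg_cong[where f = ee], simp)+
    have t1: "th (x + a + b + \<eta>) * th (x2 - x + b) * th x2 * th (a + \<eta>) =
      (ee (- (x + a + b)) * ee (- a)) * (th (x + a + b) * th (x2 - x + b) * th x2 * th a)"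
      unfolding theta_add_eta by (simp add: mult_ac)
    have t2: "ee (x2 - x) * th (x2 + a + b + \<eta>) * th (x - x2 + a + \<eta>) * th x * th b =
      (ee (- (x2 + a + b)) * ee (- (x - x2 + a))) * (ee (x2 - x) * th (x2 + a + b) * th (x - x2 + a) * th x * th b)"
      unfolding theta_add_eta by (simp add: mult_ac)
    have t3: "th (x + a + \<eta>) * th (x2 + b) * th (a + b + \<eta>) * th (x2 - x) =
      ee (- (x + a)) * ee (- (a + b)) * (th (x + a) * th (x2 + b) * th (a + b) * th (x2 - x))"
      unfolding theta_add_eta by (simp add: mult_ac)
    show ?thesis unfolding E_def 1 t1 t2 t3 e by (simp only: right_diff_distrib)
  qed
  have E_lat: "E x b (a + l) = 0" if "l \<in> lat" "E x b a = 0" for x b a l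
    using that
  proof (induction rule: lat_induct)
    case (one y) then show ?case using E_1[of x b "a + y"] by (simp add: add.assoc)
  next
    case (one' y) then show ?case using E_1[of x b "a + (y - 1)"] by (simp add: algebra_simps)
  next
    case (eta y) then show ?case using E_eta[of x b "a + y"] by (simp add: add.assoc)
  next
    case (eta' y) then show ?case using E_eta[of x b "a + (y - \<eta>)"] by (simp add: algebra_simps)
  qed simp
  have E_b: "E x b (- b) = 0" for x b
  proof -
    have "th (- b) = - ee (- b) * th b" by (rule theta_minus)
    moreover have "th (x - x2 + - b) = - ee (x - x2 - b) * th (x2 - x + b)"
      using theta_minus[of "x2 - x + b"] by (simp add: algebra_simps)
    moreover have "ee (x2 - x) * ee (x - x2 - b) = ee (- b)"
      unfolding ee_add[symmetric] by simp
    ultimately show ?thesis unfolding E_def by simp algebra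
  qed
  have E_x: "E x b (- x) = 0" for x b
  proof -
    have "th (- x) = - ee (- x) * th x" "th (- x2) = - ee (- x2) * th x2" by (rule theta_minus)+
    moreover have "ee (x2 - x) * ee (- x2) = ee (- x)"
      unfolding ee_add[symmetric] by simp
    ultimately show ?thesis unfolding E_def by simp algebra
  qed
  have E_0: "E x b 0 = 0" for x b
  proof -
    have "th (x - x2) = - ee (x - x2) * th (x2 - x)"
      using theta_minus[of "x2 - x"] by simp
    moreover have "ee (x2 - x) * ee (x - x2) = 1"
      unfolding ee_add[symmetric] by simp
    ultimately show ?thesis unfolding E_def by simp algebra
  qed
  \<comment> \<open>For generic parameters \<open>d\<close> has the multipliers of \<open>E\<close>
    and only simple zeros, at all of which \<open>E\<close> vanishes, so E/d is entire and doubly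
    periodic. The constant is 0 because \<open>E\<close> vanishes at 0 and \<open>d\<close> does
    not.\<close>
  have generic: "E x b a = 0" if nz: "th x \<noteq> 0" "th b \<noteq> 0" "th (b - x) \<noteq> 0" for x b a
  proof -
    define d where "d a = th (a + b) * th (a + x)" for a
    define h where "h = holo_quot (E x b) d"
    have hd: "d holomorphic_on UNIV" unfolding d_def by (intro hol)
    have both: False if "th (a + b) = 0" "th (a + x) = 0" for a
    proof -
      have "(a + b) + - (a + x) \<in> lat" using that by (intro lat_add[OF _ lat_minus]) (simp_all only: theta_eq_0_iff)
      then show False using nz(3) by (simp add: theta_eq_0_iff)
    qed
    have zero: "E x b a = 0" if "d a = 0" for a
    proof -
      from that consider "a + b \<in> lat" | "a + x \<in> lat" by (auto simp: d_def theta_eq_0_iff)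
      then show ?thesis
        using E_lat[OF _ E_b, of "a + b" x b] E_lat[OF _ E_x, of "a + x" x b] by cases auto
    qed
    have simple: "deriv d a \<noteq> 0" if "d a = 0" for a
    proof -
      have D: "((\<lambda>a. th (a + c)) has_field_derivative deriv th (a + c)) (at a)" for c
        by (rule DERIV_shift[THEN iffD1]) (rule has_field_derivative_theta)
      have "deriv d a = th (a + b) * deriv th (a + x) + deriv th (a + b) * th (a + x)"
        unfolding d_def[abs_def] by (rule DERIV_imp_deriv) (auto intro!: derivative_eq_intros D)
      with that both[of a] show ?thesis by (auto simp: d_def deriv_theta_nonzero)
    qed
    have h: "h holomorphic_on UNIV" unfolding h_def
      by (rule holomorphic_on_holo_quot[OF hE(3) hd simple zero])
    have dh: "d a * h a = E x b a" for a
      unfolding h_def by (rule holo_quot_mult) (rule zero)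
    have d0: "d 0 \<noteq> 0" using nz by (simp add: d_def)
    note cancel = entire_cancel[OF _ h hd d0]
    have h_shift: "(\<lambda>z. h (z + c)) holomorphic_on UNIV" for c
      using holomorphic_on_compose_gen[OF _ h, of "\<lambda>z. z + c" UNIV] by (simp add: o_def holomorphic_intros)
    have "h (z + 1) = h z" for z
    proof (rule cancel[OF h_shift])
      fix z
      have "d (z + 1) = d z"
        using theta_add_1[of "z + b"] theta_add_1[of "z + x"] by (simp add: d_def ac_simps)
      then show "d z * h (z + 1) = d z * h z" using dh[of "z + 1"] dh[of z] E_1 by simp
    qed
    moreover have "h (z + \<eta>) = h z" for z
    proof (rule cancel[OF h_shift])
      fix z
      have "d (z + \<eta>) = ee (- (x + z)) * ee (- (z + b)) * d z"
        using theta_add_eta[of "z + b"] theta_add_eta[of "z + x"] by (simp add: d_def ac_simps)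
      then have "ee (- (x + z)) * ee (- (z + b)) * (d z * h (z + \<eta>)) = ee (- (x + z)) * ee (- (z + b)) * (d z * h z)"
        using dh[of "z + \<eta>"] dh[of z] E_eta[of x b z] by simp
      then show "d z * h (z + \<eta>) = d z * h z" by simp
    qed
    ultimately have "h z = h 0" for z by (rule entire_doubly_periodic_constant[OF h])
    moreover have "h 0 = 0" using dh[of 0] E_0 d0 by simp
    ultimately show ?thesis using dh[of a] by simp
  qed
  obtain z0 where z0: "th z0 \<noteq> 0" using theta_not_0 by blast
  \<comment> \<open>The excluded values of \<open>b\<close> are isolated, and so are those of
    \<open>x\<close> in the step after this one; analyticity in these variables removes
    them.\<close>
  have "E x b a = 0" if x: "th x \<noteq> 0" for x b a
  proof -
    have hx: "(\<lambda>c. th (c - x)) holomorphic_on UNIV" by (intro hol)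
    obtain c where c: "th c \<noteq> 0" "th (c - x) \<noteq> 0"
    proof -
      have "\<forall>\<^sub>F c in at 0. th c \<noteq> 0" "\<forall>\<^sub>F c in at 0. th (c - x) \<noteq> 0"
        using entire_eventually_nonzero[OF holomorphic_theta_UNIV z0]
          entire_eventually_nonzero[OF hx, of "z0 + x"] z0 by simp_all
      then have "\<forall>\<^sub>F c in at (0::complex). th c \<noteq> 0 \<and> th (c - x) \<noteq> 0" by eventually_elim auto
      then show thesis using that eventually_happens[of _ "at (0::complex)"] by auto
    qed
    show ?thesis
      by (rule entire_cancel[of "\<lambda>b. E x b a" "\<lambda>_. 0" "\<lambda>b. th b * th (b - x)" c])
        (use c generic x hE in \<open>auto intro: holomorphic_on_mult[OF holomorphic_theta_UNIV hx]\<close>)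
  qed
  then have "E x1 b a = 0"
    by (intro entire_cancel[of "\<lambda>x. E x b a" "\<lambda>_. 0" th z0]) (use hE z0 holomorphic_theta_UNIV in auto)
  then show ?thesis by (simp add: E_def)
qed

definition kron :: "complex \<Rightarrow> complex \<Rightarrow> complex" where
  "kron u v = deriv th 0 * th (u + v) / (th u * th v)"

text \<open>Subtracting pi i makes the logarithmic derivative odd, since theta(-z) = -e^(-2 pi i z)
  theta(z). The function differs from Weierstrass' zeta function of the lattice by a multiple of
  z.\<close>

definition zeta :: "complex \<Rightarrow> complex" where
  "zeta z = deriv th z / th z - of_real pi * \<i>"

lemma kron_minus: "kron (- u) (- v) = - kron u v"
  using theta_minus[of "u + v"] ee_add[of "- u" "- v"]
  by (simp add: kron_def theta_minus[of u] theta_minus[of v])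

lemma kron_add_1: "kron (u + 1) v = kron u v" "kron u (v + 1) = kron u v"
  using theta_add_1[of "u + v"] theta_add_1[of u] theta_add_1[of v] by (simp_all add: kron_def ac_simps)

lemma kron_add_eta: "kron (u + \<eta>) v = ee (- v) * kron u v" "kron u (v + \<eta>) = ee (- u) * kron u v"
proof -
  have 1: "th (u + \<eta> + v) = - (ee (- u) * ee (- v)) * th (u + v)" "th (u + (v + \<eta>)) = - (ee (- u) * ee (- v)) * th (u + v)"
    using theta_add_eta[of "u + v"] ee_add[of "- u" "- v"] by (simp_all add: ac_simps)
  show "kron (u + \<eta>) v = ee (- v) * kron u v" "kron u (v + \<eta>) = ee (- u) * kron u v"
    by (simp_all add: kron_def 1 theta_add_eta)
qed

lemma kron_diff_eta: "kron (u - \<eta>) v = ee v * kron u v" "kron u (v - \<eta>) = ee u * kron u v"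
proof -
  show "kron (u - \<eta>) v = ee v * kron u v"
    using kron_add_eta(1)[of "u - \<eta>" v] by (simp add: ee_minus)
  show "kron u (v - \<eta>) = ee u * kron u v"
    using kron_add_eta(2)[of u "v - \<eta>"] by (simp add: ee_minus)
qed

lemma kron_diff_1: "kron (u - 1) v = kron u v" "kron u (v - 1) = kron u v"
  using kron_add_1(1)[of "u - 1" v] kron_add_1(2)[of u "v - 1"] by simp_all

lemma deriv_theta_add_1: "deriv th (z + 1) = deriv th z"
proof -
  have "((\<lambda>z. th (z + 1)) has_field_derivative deriv th (z + 1)) (at z)"
    by (rule DERIV_shift[THEN iffD1]) (rule has_field_derivative_theta)
  then show ?thesis using has_field_derivative_theta[of z] DERIV_unique by (simp add: theta_add_1)
qed

lemma deriv_theta_add_eta: "deriv th (z + \<eta>) = - ee (- z) * deriv th z + 2 * of_real pi * \<i> * ee (- z) * th z"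
proof -
  have "((\<lambda>z. th (z + \<eta>)) has_field_derivative deriv th (z + \<eta>)) (at z)"
    by (rule DERIV_shift[THEN iffD1]) (rule has_field_derivative_theta)
  moreover have "((\<lambda>z. - ee (- z) * th z) has_field_derivative
      - ee (- z) * deriv th z + 2 * of_real pi * \<i> * ee (- z) * th z) (at z)"
    unfolding ee_def by (auto intro!: derivative_eq_intros has_field_derivative_theta simp: algebra_simps)
  ultimately show ?thesis using DERIV_unique by (simp add: theta_add_eta)
qed

lemma deriv_theta_minus: "deriv th (- z) = ee (- z) * deriv th z - 2 * of_real pi * \<i> * ee (- z) * th z"
proof -
  have "((\<lambda>z. th (- z)) has_field_derivative deriv th (- z) * (- 1)) (at z)"
    by (rule DERIV_chain2[OF has_field_derivative_theta]) (auto intro!: derivative_eq_intros)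
  then have "((\<lambda>z. th (- z)) has_field_derivative - deriv th (- z)) (at z)" by simp
  moreover have "((\<lambda>z. - ee (- z) * th z) has_field_derivative
      - ee (- z) * deriv th z + 2 * of_real pi * \<i> * ee (- z) * th z) (at z)"
    unfolding ee_def by (auto intro!: derivative_eq_intros has_field_derivative_theta simp: algebra_simps)
  ultimately have "- deriv th (- z) = - ee (- z) * deriv th z + 2 * of_real pi * \<i> * ee (- z) * th z"
    unfolding theta_minus by (rule DERIV_unique)
  then have "- (- deriv th (- z)) = - (- ee (- z) * deriv th z + 2 * of_real pi * \<i> * ee (- z) * th z)"
    by (rule arg_cong)
  then show ?thesis by simp
qed

lemma zeta_minus: "th z \<noteq> 0 \<Longrightarrow> zeta (- z) = - zeta z"
  by (simp add: zeta_def theta_minus deriv_theta_minus field_simps)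

lemma zeta_add_1: "zeta (z + 1) = zeta z"
  by (simp add: zeta_def theta_add_1 deriv_theta_add_1)

lemma zeta_add_eta: "th z \<noteq> 0 \<Longrightarrow> zeta (z + \<eta>) = zeta z - 2 * of_real pi * \<i>"
  unfolding zeta_def theta_add_eta deriv_theta_add_eta by (simp add: field_simps)

lemma zeta_diff_1: "zeta (z - 1) = zeta z"
  using zeta_add_1[of "z - 1"] by simp

lemma zeta_diff_eta: "th z \<noteq> 0 \<Longrightarrow> zeta (z - \<eta>) = zeta z + 2 * of_real pi * \<i>"
  using zeta_add_eta[of "z - \<eta>"] by (simp add: theta_diff_eta)

text \<open>\<open>weierstrass_identity\<close> divided by the product \<open>D\<close> of all
  denominators. The factor \<open>ee (x2 - x1)\<close> there turns, up to sign,
  \<open>th (x1 - x2)\<close> into \<open>th (x2 - x1)\<close>, as the last Kronecker function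
  requires.\<close>

lemma kron_fay:
  assumes "th x1 \<noteq> 0" "th x2 \<noteq> 0" "th (x2 - x1) \<noteq> 0" "th a \<noteq> 0" "th b \<noteq> 0" "th (a + b) \<noteq> 0"
  shows "kron x1 a * kron x2 b = kron x1 (a + b) * kron (x2 - x1) b + kron x2 (a + b) * kron (x1 - x2) a"
proof -
  define t where "t = deriv th 0"
  have m: "th (x2 - x1) = - ee (x2 - x1) * th (x1 - x2)" "th (x1 - x2) \<noteq> 0"
    using theta_minus[of "x1 - x2"] assms(3) by auto
  define e where "e = ee (x2 - x1)"
  have e: "e \<noteq> 0" by (simp add: e_def)
  have w: "th (x1 + a) * th (x2 + b) * th (a + b) * th (x2 - x1) =
   th (x1 + (a + b)) * th (x2 - x1 + b) * th x2 * th a - e * th (x2 + (a + b)) * th (x1 - x2 + a) * th x1 * th b"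
    using weierstrass_identity[of x1 a x2 b] by (simp add: e_def add.assoc)
  define D where "D = th x1 * th x2 * th a * th b * th (a + b) * th (x2 - x1)"
  have D: "D \<noteq> 0" using assms by (simp add: D_def)
  have 1: "kron x1 a * kron x2 b * D = t\<^sup>2 * (th (x1 + a) * th (x2 + b) * th (a + b) * th (x2 - x1))"
    using assms by (simp add: kron_def D_def t_def power2_eq_square)
  have 2: "kron x1 (a + b) * kron (x2 - x1) b * D = t\<^sup>2 * (th (x1 + (a + b)) * th (x2 - x1 + b) * th x2 * th a)"
    using assms by (simp add: kron_def D_def t_def power2_eq_square)
  have 3: "kron x2 (a + b) * kron (x1 - x2) a * D = - (t\<^sup>2 * (e * th (x2 + (a + b)) * th (x1 - x2 + a) * th x1 * th b))"
    using assms e by (simp add: kron_def D_def t_def power2_eq_square m(1) m(2) flip: e_def)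
  have "kron x1 a * kron x2 b * D = (kron x1 (a + b) * kron (x2 - x1) b + kron x2 (a + b) * kron (x1 - x2) a) * D"
    unfolding distrib_right 1 2 3 w by (simp add: right_diff_distrib)
  with D show ?thesis by simp
qed

end

section \<open>Holomorphic functions of several variables\<close>

lemma set_var_apply: "set_var x \<nu> \<mu> z \<nu>' \<mu>' = (if \<nu>' = \<nu> \<and> \<mu>' = \<mu> then z else x \<nu>' \<mu>')"
  by (simp add: set_var_def)

lemma set_var_same [simp]: "set_var x \<nu> \<mu> (x \<nu> \<mu>) = x"
  by (simp add: set_var_def)

lemma set_var_set_var [simp]: "set_var (set_var x \<nu> \<mu> z) \<nu> \<mu> w = set_var x \<nu> \<mu> w"
  by (simp add: set_var_def)

lemma set_var_commute:
  "(\<nu>, \<mu>) \<noteq> (\<nu>', \<mu>') \<Longrightarrow> set_var (set_var x \<nu> \<mu> z) \<nu>' \<mu>' w = set_var (set_var x \<nu>' \<mu>' w) \<nu> \<mu> z"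
  by (auto simp: set_var_def fun_eq_iff)

lemma continuous_on_point_coordinate:
  fixes s :: "'a :: topological_space \<Rightarrow> point"
  assumes "continuous_on A s"
  shows "continuous_on A (\<lambda>y. s y \<nu> \<mu>)"
proof -
  have "continuous_on A (\<lambda>y. s y \<nu>)"
    using assms by (rule continuous_on_product_then_coordinatewise)
  then show ?thesis by (rule continuous_on_product_then_coordinatewise)
qed

lemma continuous_on_point_apply [continuous_intros]:
  "continuous_on A (\<lambda>x :: point. x \<nu> \<mu>)"
  "continuous_on B (\<lambda>y :: point \<times> 'b :: topological_space. fst y \<nu> \<mu>)"
  by (intro continuous_on_point_coordinate continuous_on_fst continuous_on_id)+

lemma continuous_on_pointI:
  fixes s :: "'a :: topological_space \<Rightarrow> point"
  assumes "\<And>\<nu> \<mu>. continuous_on A (\<lambda>y. s y \<nu> \<mu>)"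
  shows "continuous_on A s"
  by (intro continuous_on_coordinatewise_then_product assms)

lemma continuous_on_set_var_apply [continuous_intros]:
  assumes "continuous_on A (\<lambda>y. s y \<nu>' \<mu>')" "continuous_on A f"
  shows "continuous_on A (\<lambda>y. set_var (s y) \<nu> \<mu> (f y) \<nu>' \<mu>')"
  by (cases "\<nu>' = \<nu> \<and> \<mu>' = \<mu>") (use assms in \<open>auto simp: set_var_apply\<close>)

lemma tendsto_along_line:
  fixes f :: pfun
  assumes "continuous_on UNIV f"
  shows "((\<lambda>t. f (\<lambda>\<nu> \<mu>. x \<nu> \<mu> + t * v \<nu> \<mu>)) \<longlongrightarrow> f x) (at 0)"
proof -
  have "continuous_on UNIV (\<lambda>t. f (\<lambda>\<nu> \<mu>. x \<nu> \<mu> + t * v \<nu> \<mu>))"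
    by (rule continuous_on_compose2[OF assms]) (auto intro!: continuous_on_pointI continuous_intros)
  then show ?thesis by (auto simp: continuous_on_def dest: spec[of _ 0])
qed

text \<open>The density argument in the form in which it is used: it is enough that one line through
  \<open>x\<close> meets the exceptional set, near \<open>x\<close>, at most in \<open>x\<close>
  itself.\<close>

lemma eq_by_line_limit:
  fixes f g :: pfun
  assumes "continuous_on UNIV f" "continuous_on UNIV g"
    and "\<forall>\<^sub>F t in at 0. f (\<lambda>\<nu> \<mu>. x \<nu> \<mu> + t * v \<nu> \<mu>) = g (\<lambda>\<nu> \<mu>. x \<nu> \<mu> + t * v \<nu> \<mu>)"
  shows "f x = g x"
proof (rule tendsto_unique)
  show "((\<lambda>t. g (\<lambda>\<nu> \<mu>. x \<nu> \<mu> + t * v \<nu> \<mu>)) \<longlongrightarrow> f x) (at 0)"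
    using tendsto_along_line[OF assms(1), of x v] by (rule Lim_transform_eventually) (rule assms(3))
qed (auto intro: tendsto_along_line assms)

lemma holomorphic_varsD:
  assumes "holomorphic_vars p N f"
  shows "(\<And>\<nu> \<mu>. \<nu> \<in> {1..N} \<Longrightarrow> \<mu> \<in> {1..p} \<Longrightarrow> x \<nu> \<mu> = y \<nu> \<mu>) \<Longrightarrow> f x = f y"
    and "continuous_on UNIV f"
    and "\<nu> \<in> {1..N} \<Longrightarrow> \<mu> \<in> {1..p} \<Longrightarrow> (\<lambda>z. f (set_var x \<nu> \<mu> z)) holomorphic_on UNIV"
  using assms unfolding holomorphic_vars_def by blast+

lemma holomorphic_varsI:
  assumes "\<And>x y. (\<And>\<nu> \<mu>. \<nu> \<in> {1..N} \<Longrightarrow> \<mu> \<in> {1..p} \<Longrightarrow> x \<nu> \<mu> = y \<nu> \<mu>) \<Longrightarrow> f x = f y"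
    and "continuous_on UNIV f"
    and "\<And>x \<nu> \<mu>. \<nu> \<in> {1..N} \<Longrightarrow> \<mu> \<in> {1..p} \<Longrightarrow> (\<lambda>z. f (set_var x \<nu> \<mu> z)) holomorphic_on UNIV"
  shows "holomorphic_vars p N f"
  using assms unfolding holomorphic_vars_def by blast

named_theorems holomorphic_vars_intros

lemma holomorphic_vars_const [holomorphic_vars_intros]: "holomorphic_vars p N (\<lambda>_. c)"
  by (auto simp: holomorphic_vars_def)

lemma holomorphic_vars_coord [holomorphic_vars_intros]:
  "\<nu> \<in> {1..N} \<Longrightarrow> \<mu> \<in> {1..p} \<Longrightarrow> holomorphic_vars p N (\<lambda>x. x \<nu> \<mu>)"
proof (rule holomorphic_varsI)
  fix x :: point and \<nu>' \<mu>'
  show "(\<lambda>z. set_var x \<nu>' \<mu>' z \<nu> \<mu>) holomorphic_on UNIV"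
    by (cases "\<nu> = \<nu>' \<and> \<mu> = \<mu>'") (auto simp: set_var_apply)
qed (auto intro: continuous_intros)

lemma holomorphic_vars_add [holomorphic_vars_intros]:
  assumes "holomorphic_vars p N f" "holomorphic_vars p N g"
  shows "holomorphic_vars p N (\<lambda>x. f x + g x)"
  using assms by (auto simp: holomorphic_vars_def intro!: continuous_intros holomorphic_intros arg_cong2[where f = "(+)"])

lemma holomorphic_vars_mult [holomorphic_vars_intros]:
  assumes "holomorphic_vars p N f" "holomorphic_vars p N g"
  shows "holomorphic_vars p N (\<lambda>x. f x * g x)"
  using assms by (auto simp: holomorphic_vars_def intro!: continuous_intros holomorphic_intros arg_cong2[where f = "(*)"])

lemma holomorphic_vars_diff [holomorphic_vars_intros]:
  assumes "holomorphic_vars p N f" "holomorphic_vars p N g"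
  shows "holomorphic_vars p N (\<lambda>x. f x - g x)"
  using assms by (auto simp: holomorphic_vars_def intro!: continuous_intros holomorphic_intros arg_cong2[where f = "(-)"])

lemma holomorphic_vars_minus [holomorphic_vars_intros]:
  assumes "holomorphic_vars p N f"
  shows "holomorphic_vars p N (\<lambda>x. - f x)"
  using holomorphic_vars_diff[OF holomorphic_vars_const[of p N 0] assms] by simp

lemma holomorphic_vars_sum [holomorphic_vars_intros]:
  assumes "\<And>i. i \<in> I \<Longrightarrow> holomorphic_vars p N (f i)"
  shows "holomorphic_vars p N (\<lambda>x. \<Sum>i\<in>I. f i x)"
  using assms by (induction I rule: infinite_finite_induct) (auto intro: holomorphic_vars_intros)

lemma holomorphic_vars_prod [holomorphic_vars_intros]:
  assumes "\<And>i. i \<in> I \<Longrightarrow> holomorphic_vars p N (f i)"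
  shows "holomorphic_vars p N (\<lambda>x. \<Prod>i\<in>I. f i x)"
  using assms by (induction I rule: infinite_finite_induct) (auto intro: holomorphic_vars_intros)

lemma holomorphic_vars_compose_entire:
  assumes "g holomorphic_on UNIV" "holomorphic_vars p N f"
  shows "holomorphic_vars p N (\<lambda>x. g (f x))"
proof (rule holomorphic_varsI)
  show "continuous_on UNIV (\<lambda>x. g (f x))"
    by (rule continuous_on_compose2[OF holomorphic_on_imp_continuous_on[OF assms(1)] holomorphic_varsD(2)[OF assms(2)]]) auto
next
  fix x :: point and \<nu> \<mu> assume "\<nu> \<in> {1..N}" "\<mu> \<in> {1..p}"
  then show "(\<lambda>z. g (f (set_var x \<nu> \<mu> z))) holomorphic_on UNIV"
    using holomorphic_on_compose_gen[OF holomorphic_varsD(3)[OF assms(2)] assms(1)] by (simp add: o_def)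
next
  fix x y :: point
  assume "\<And>\<nu> \<mu>. \<nu> \<in> {1..N} \<Longrightarrow> \<mu> \<in> {1..p} \<Longrightarrow> x \<nu> \<mu> = y \<nu> \<mu>"
  then have "f x = f y" by (rule holomorphic_varsD(1)[OF assms(2)])
  then show "g (f x) = g (f y)" by simp
qed

text \<open>The rearrangement may depend on the position \<mu> within a block but keeps every
  variable in its position. This covers permutations of whole blocks, selections of blocks and the
  partial swaps of \<open>T4\<close> alike.\<close>

definition reblock :: "(nat \<Rightarrow> nat \<Rightarrow> nat) \<Rightarrow> point \<Rightarrow> point" where
  "reblock r x = (\<lambda>\<nu> \<mu>. x (r \<nu> \<mu>) \<mu>)"

text \<open>Injectivity ensures that each variable enters \<open>f\<close> through at most one
  argument, so that holomorphy of \<open>f\<close> in single variables is enough.\<close>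

lemma holomorphic_vars_reblock:
  assumes f: "holomorphic_vars p M f"
    and r: "\<And>\<nu> \<mu>. \<nu> \<in> {1..M} \<Longrightarrow> \<mu> \<in> {1..p} \<Longrightarrow> r \<nu> \<mu> \<in> {1..N}"
    and inj: "\<And>\<mu>. \<mu> \<in> {1..p} \<Longrightarrow> inj_on (\<lambda>\<nu>. r \<nu> \<mu>) {1..M}"
  shows "holomorphic_vars p N (\<lambda>x. f (reblock r x))"
proof (rule holomorphic_varsI)
  show "continuous_on UNIV (\<lambda>x. f (reblock r x))"
    by (rule continuous_on_compose2[OF holomorphic_varsD(2)[OF f]])
      (auto simp: reblock_def intro!: continuous_on_pointI continuous_intros)
next
  fix x y :: point
  assume "\<And>\<nu> \<mu>. \<nu> \<in> {1..N} \<Longrightarrow> \<mu> \<in> {1..p} \<Longrightarrow> x \<nu> \<mu> = y \<nu> \<mu>"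
  then show "f (reblock r x) = f (reblock r y)"
    using r by (intro holomorphic_varsD(1)[OF f]) (auto simp: reblock_def)
next
  fix x :: point and \<nu> \<mu> assume *: "\<nu> \<in> {1..N}" "\<mu> \<in> {1..p}"
  show "(\<lambda>z. f (reblock r (set_var x \<nu> \<mu> z))) holomorphic_on UNIV"
  proof (cases "\<exists>\<nu>'\<in>{1..M}. r \<nu>' \<mu> = \<nu>")
    case True
    then obtain \<nu>' where \<nu>': "\<nu>' \<in> {1..M}" "r \<nu>' \<mu> = \<nu>" by blast
    have "f (reblock r (set_var x \<nu> \<mu> z)) = f (set_var (reblock r x) \<nu>' \<mu> z)" for z
    proof (rule holomorphic_varsD(1)[OF f])
      fix a b assume a: "a \<in> {1..M}" "b \<in> {1..p}"
      have "r a \<mu> = \<nu> \<longleftrightarrow> a = \<nu>'" using inj_onD[OF inj[OF *(2)], of a \<nu>'] a \<nu>' by auto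
      then show "reblock r (set_var x \<nu> \<mu> z) a b = set_var (reblock r x) \<nu>' \<mu> z a b"
        by (cases "b = \<mu>") (auto simp: reblock_def set_var_apply)
    qed
    then show ?thesis using holomorphic_varsD(3)[OF f \<nu>'(1) *(2)] by simp
  next
    case False
    have "f (reblock r (set_var x \<nu> \<mu> z)) = f (reblock r x)" for z
      by (rule holomorphic_varsD(1)[OF f]) (use False in \<open>auto simp: reblock_def set_var_apply\<close>)
    then show ?thesis by simp
  qed
qed

subsection \<open>Partial derivatives\<close>

text \<open>Cauchy's formula over the unit circle around the current value. It expresses the
  derivative by values of \<open>f\<close>, so that regularity in the other variables follows from
  theorems on integrals with a parameter.\<close>

lemma partial_deriv_integral:
  assumes f: "holomorphic_vars p N f" and i: "\<nu> \<in> {1..N}" "\<mu> \<in> {1..p}"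
  shows "partial_deriv \<nu> \<mu> f x = integral (cbox 0 1)
    (\<lambda>t. f (set_var x \<nu> \<mu> (x \<nu> \<mu> + exp (2 * of_real pi * \<i> * of_real t))) * exp (- (2 * of_real pi * \<i> * of_real t)))"
proof -
  define g where "g = (\<lambda>z. f (set_var x \<nu> \<mu> z))"
  define c where "c = x \<nu> \<mu>"
  have g: "g holomorphic_on UNIV" unfolding g_def by (rule holomorphic_varsD(3)[OF f i])
  have "(g has_field_derivative (1 / (2 * of_real pi * \<i>) * contour_integral (circlepath c 1) (\<lambda>u. g u / (u - c)\<^sup>2))) (at c)"
    by (rule Cauchy_derivative_integral_circlepath(2))
      (auto intro!: holomorphic_on_imp_continuous_on holomorphic_on_subset[OF g])
  then have "deriv g c = 1 / (2 * of_real pi * \<i>) * contour_integral (circlepath c 1) (\<lambda>u. g u / (u - c)\<^sup>2)"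
    by (rule DERIV_imp_deriv)
  also have "contour_integral (circlepath c 1) (\<lambda>u. g u / (u - c)\<^sup>2) = integral {0..1} (\<lambda>t.
      2 * of_real pi * \<i> * (g (c + exp (2 * of_real pi * \<i> * of_real t)) * exp (- (2 * of_real pi * \<i> * of_real t))))"
    unfolding contour_integral_integral
  proof (rule integral_cong)
    fix t :: real assume "t \<in> {0..1}"
    then have "vector_derivative (circlepath c 1) (at t) = 2 * of_real pi * \<i> * exp (2 * of_real pi * \<i> * of_real t)"
      by (subst vector_derivative_circlepath) auto
    then show "g (circlepath c 1 t) / (circlepath c 1 t - c)\<^sup>2 * vector_derivative (circlepath c 1) (at t) =
      2 * of_real pi * \<i> * (g (c + exp (2 * of_real pi * \<i> * of_real t)) * exp (- (2 * of_real pi * \<i> * of_real t)))"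
      by (simp add: circlepath power2_eq_square exp_minus field_simps)
  qed
  also have "1 / (2 * of_real pi * \<i>) * \<dots> = integral {0..1} (\<lambda>t. g (c + exp (2 * of_real pi * \<i> * of_real t)) * exp (- (2 * of_real pi * \<i> * of_real t)))"
    by (subst integral_mult_right) simp
  finally show ?thesis by (simp add: partial_deriv_def g_def c_def)
qed

lemma has_field_derivative_partial_deriv:
  assumes "holomorphic_vars p N f" "\<nu> \<in> {1..N}" "\<mu> \<in> {1..p}"
  shows "((\<lambda>z. f (set_var x \<nu> \<mu> z)) has_field_derivative partial_deriv \<nu> \<mu> f (set_var x \<nu> \<mu> z)) (at z within S)"
  using holomorphic_derivI[OF holomorphic_varsD(3)[OF assms], of z x S] by (simp add: partial_deriv_def set_var_apply)

lemma continuous_on_partial_deriv: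
  assumes f: "holomorphic_vars p N f" and i: "\<nu> \<in> {1..N}" "\<mu> \<in> {1..p}"
  shows "continuous_on UNIV (partial_deriv \<nu> \<mu> f)"
proof -
  have "continuous_on UNIV (\<lambda>x. integral (cbox 0 (1::real))
    (\<lambda>t. f (set_var x \<nu> \<mu> (x \<nu> \<mu> + exp (2 * of_real pi * \<i> * of_real t))) * exp (- (2 * of_real pi * \<i> * of_real t))))"
    by (rule integral_continuous_on_param)
      (auto simp: case_prod_unfold intro!: continuous_intros continuous_on_compose2[OF holomorphic_varsD(2)[OF f]])
  then show ?thesis using partial_deriv_integral[OF f i] by (simp cong: continuous_on_cong)
qed

lemma partial_deriv_has_field_derivative_other:
  assumes f: "holomorphic_vars p N f" and i: "\<nu> \<in> {1..N}" "\<mu> \<in> {1..p}" and j: "\<nu>' \<in> {1..N}" "\<mu>' \<in> {1..p}"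
    and ne: "(\<nu>, \<mu>) \<noteq> (\<nu>', \<mu>')"
  shows "((\<lambda>z. partial_deriv \<nu> \<mu> f (set_var x \<nu>' \<mu>' z)) has_field_derivative
    integral (cbox 0 1) (\<lambda>t. partial_deriv \<nu>' \<mu>' f (set_var (set_var x \<nu>' \<mu>' z) \<nu> \<mu> (x \<nu> \<mu> + exp (2 * of_real pi * \<i> * of_real t)))
      * exp (- (2 * of_real pi * \<i> * of_real t)))) (at z)"
proof -
  define F where "F = (\<lambda>z t. f (set_var (set_var x \<nu> \<mu> (x \<nu> \<mu> + exp (2 * of_real pi * \<i> * of_real t))) \<nu>' \<mu>' z) *
    exp (- (2 * of_real pi * \<i> * of_real t)))"
  define F' where "F' = (\<lambda>z t. partial_deriv \<nu>' \<mu>' f (set_var (set_var x \<nu> \<mu> (x \<nu> \<mu> + exp (2 * of_real pi * \<i> * of_real t))) \<nu>' \<mu>' z) *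
    exp (- (2 * of_real pi * \<i> * of_real t)))"
  have x: "set_var x \<nu>' \<mu>' z \<nu> \<mu> = x \<nu> \<mu>" for z using ne by (auto simp: set_var_apply)
  have "((\<lambda>z. integral (cbox 0 1) (F z)) has_field_derivative integral (cbox 0 1) (F' z)) (at z within UNIV)"
  proof (rule leibniz_rule_field_derivative)
    show "((\<lambda>z. F z t) has_field_derivative F' z t) (at z within UNIV)" for z t
      unfolding F_def F'_def by (intro DERIV_cmult_right has_field_derivative_partial_deriv[OF f j])
    show "F z integrable_on cbox 0 1" for z unfolding F_def
      by (rule integrable_continuous)
        (auto intro!: continuous_intros continuous_on_compose2[OF holomorphic_varsD(2)[OF f]])
    show "continuous_on (UNIV \<times> cbox 0 1) (\<lambda>(z, t). F' z t)" unfolding F'_def case_prod_unfold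
      by (auto intro!: continuous_intros continuous_on_compose2[OF continuous_on_partial_deriv[OF f j]])
  qed auto
  then show ?thesis
    unfolding partial_deriv_integral[OF f i] x F_def F'_def set_var_commute[OF ne[symmetric]] by simp
qed

lemma holomorphic_vars_partial_deriv [holomorphic_vars_intros]:
  assumes f: "holomorphic_vars p N f" and i: "\<nu> \<in> {1..N}" "\<mu> \<in> {1..p}"
  shows "holomorphic_vars p N (partial_deriv \<nu> \<mu> f)"
proof (rule holomorphic_varsI)
  fix x y :: point
  assume eq: "\<And>\<nu> \<mu>. \<nu> \<in> {1..N} \<Longrightarrow> \<mu> \<in> {1..p} \<Longrightarrow> x \<nu> \<mu> = y \<nu> \<mu>"
  have "f (set_var x \<nu> \<mu> z) = f (set_var y \<nu> \<mu> z)" for z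
    by (rule holomorphic_varsD(1)[OF f]) (auto simp: set_var_apply eq)
  then show "partial_deriv \<nu> \<mu> f x = partial_deriv \<nu> \<mu> f y"
    using eq i by (simp add: partial_deriv_def)
next
  fix x :: point and \<nu>' \<mu>' assume j: "\<nu>' \<in> {1..N}" "\<mu>' \<in> {1..p}"
  show "(\<lambda>z. partial_deriv \<nu> \<mu> f (set_var x \<nu>' \<mu>' z)) holomorphic_on UNIV"
  proof (cases "(\<nu>, \<mu>) = (\<nu>', \<mu>')")
    case True
    then show ?thesis using holomorphic_deriv[OF holomorphic_varsD(3)[OF f i] open_UNIV, of x]
      by (simp add: partial_deriv_def set_var_apply)
  next
    case False
    show ?thesis unfolding holomorphic_on_def field_differentiable_def
      using partial_deriv_has_field_derivative_other[OF f i j False] by auto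
  qed
qed (rule continuous_on_partial_deriv[OF f i])

text \<open>Differentiating Cauchy's integral for one derivative under the integral sign yields
  Cauchy's integral for the derivatives in the other order.\<close>

lemma partial_deriv_commute:
  assumes f: "holomorphic_vars p N f" and i: "\<nu> \<in> {1..N}" "\<mu> \<in> {1..p}" and j: "\<nu>' \<in> {1..N}" "\<mu>' \<in> {1..p}"
  shows "partial_deriv \<nu>' \<mu>' (partial_deriv \<nu> \<mu> f) x = partial_deriv \<nu> \<mu> (partial_deriv \<nu>' \<mu>' f) x"
proof (cases "(\<nu>, \<mu>) = (\<nu>', \<mu>')")
  case False
  from partial_deriv_has_field_derivative_other[OF f i j False, of x "x \<nu>' \<mu>'"]
  have "partial_deriv \<nu>' \<mu>' (partial_deriv \<nu> \<mu> f) x = integral (cbox 0 1)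
    (\<lambda>t. partial_deriv \<nu>' \<mu>' f (set_var x \<nu> \<mu> (x \<nu> \<mu> + exp (2 * of_real pi * \<i> * of_real t)))
      * exp (- (2 * of_real pi * \<i> * of_real t)))"
    unfolding partial_deriv_def[of \<nu>' \<mu>' "partial_deriv \<nu> \<mu> f"] by (intro DERIV_imp_deriv) simp
  also have "\<dots> = partial_deriv \<nu> \<mu> (partial_deriv \<nu>' \<mu>' f) x"
    by (rule partial_deriv_integral[OF holomorphic_vars_partial_deriv[OF f j] i, symmetric])
  finally show ?thesis .
qed auto

subsection \<open>Division by a function of the difference of two variables\<close>

text \<open>The quotient is formed in the variable \<open>x i \<phi>\<close> alone, where holomorphy
  is clear. Cauchy's integral over circles that avoid the zeros of \<open>g\<close> then gives
  continuity, and holomorphy in the variables outside the difference; for \<open>x j \<phi>\<close>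
  continuity makes the isolated singularities removable.\<close>

lemma holomorphic_vars_divide_diff:
  assumes f: "holomorphic_vars p N f" and ij: "i \<in> {1..N}" "j \<in> {1..N}" "i \<noteq> j" and \<phi>: "\<phi> \<in> {1..p}"
    and g: "g holomorphic_on UNIV" and simple: "\<And>z. g z = 0 \<Longrightarrow> deriv g z \<noteq> 0"
    and zero: "\<And>x. g (x i \<phi> - x j \<phi>) = 0 \<Longrightarrow> f x = 0"
  obtains h where "holomorphic_vars p N h" "\<And>x. f x = g (x i \<phi> - x j \<phi>) * h x"
proof -
  define F where "F x = holo_quot (\<lambda>z. f (set_var x i \<phi> z)) (\<lambda>z. g (z - x j \<phi>))" for x
  define h where "h x = F x (x i \<phi>)" for x
  have D: "((\<lambda>z. g (z - c)) has_field_derivative deriv g (z - c)) (at z)" for c z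
  proof -
    have "((\<lambda>z. g (z - c)) has_field_derivative deriv g (z - c) * 1) (at z)"
      by (rule DERIV_chain2[OF holomorphic_derivI[OF g open_UNIV UNIV_I]]) (auto intro!: derivative_eq_intros)
    then show ?thesis by simp
  qed
  have g': "(\<lambda>z. g (z - c)) holomorphic_on UNIV" and g'': "(\<lambda>z. g (c - z)) holomorphic_on UNIV" for c
    using holomorphic_on_compose_gen[OF _ g, of "\<lambda>z. z - c" UNIV] holomorphic_on_compose_gen[OF _ g, of "\<lambda>z. c - z" UNIV]
    by (simp_all add: o_def holomorphic_intros)
  have zero': "f (set_var x i \<phi> z) = 0" if "g (z - x j \<phi>) = 0" for x z
    using zero[of "set_var x i \<phi> z"] that ij by (simp add: set_var_apply)
  have F: "F x holomorphic_on UNIV" for x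
    unfolding F_def
    by (rule holomorphic_on_holo_quot[OF holomorphic_varsD(3)[OF f ij(1) \<phi>] g'])
      (use zero' simple DERIV_imp_deriv[OF D] in auto)
  have gF: "g (z - x j \<phi>) * F x z = f (set_var x i \<phi> z)" for x z
    unfolding F_def by (rule holo_quot_mult) (rule zero')
  have Fset: "F (set_var x i \<phi> z) = F x" for x z
    using ij by (simp add: F_def set_var_apply)
  have hF: "h (set_var x i \<phi> z) = F x z" for x z
    by (simp add: h_def Fset set_var_apply)
  have fh: "f x = g (x i \<phi> - x j \<phi>) * h x" for x
    using gF[of "x i \<phi>" x] by (simp add: h_def)
  have dep: "h x = h y" if "\<And>\<nu> \<mu>. \<nu> \<in> {1..N} \<Longrightarrow> \<mu> \<in> {1..p} \<Longrightarrow> x \<nu> \<mu> = y \<nu> \<mu>" for x y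
  proof -
    have "f (set_var x i \<phi> z) = f (set_var y i \<phi> z)" for z
      by (rule holomorphic_varsD(1)[OF f]) (auto simp: set_var_apply that)
    then show ?thesis using that ij \<phi> by (simp add: h_def F_def)
  qed
  have gnz: "\<forall>\<^sub>F z in at c. g z \<noteq> 0" for c
  proof -
    have "\<exists>b. g b \<noteq> 0"
    proof (rule ccontr)
      assume "\<not> ?thesis"
      then have "g = (\<lambda>_. 0)" by auto
      with simple[of 0] show False by simp
    qed
    with entire_eventually_nonzero[OF g] show ?thesis by blast
  qed
  txt \<open>The Cauchy integral over a circle around \<open>x j \<phi> + c\<close> on which the denominator does not vanish.\<close>
  have repr: "\<exists>r>0. (\<forall>t::real. g (c + of_real r * exp (2 * of_real pi * \<i> * of_real t)) \<noteq> 0) \<and>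
     (\<forall>x. norm (x i \<phi> - x j \<phi> - c) < r \<longrightarrow> h x = integral (cbox 0 1) (\<lambda>t.
        f (set_var x i \<phi> (x j \<phi> + c + of_real r * exp (2 * of_real pi * \<i> * of_real t))) *
        (of_real r * exp (2 * of_real pi * \<i> * of_real t) / g (c + of_real r * exp (2 * of_real pi * \<i> * of_real t)) /
         (of_real r * exp (2 * of_real pi * \<i> * of_real t) - (x i \<phi> - x j \<phi> - c)))))" for c
  proof -
    obtain R where R: "R > 0" "\<And>z. z \<noteq> c \<Longrightarrow> dist z c < R \<Longrightarrow> g z \<noteq> 0"
      using gnz[of c] by (auto simp: eventually_at)
    \<comment> \<open>Half the radius keeps the circle itself, not just the disc inside, away from
      the zeros of \<open>g\<close>.\<close>
    define r where "r = R / 2"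
    have r: "r > 0" using R by (simp add: r_def)
    define E where "E = (\<lambda>t::real. of_real r * exp (2 * of_real pi * \<i> * of_real t))"
    have nE: "norm (E t) = r" for t using r by (simp add: E_def norm_mult)
    have gE: "g (c + E t) \<noteq> 0" for t
      using R(2)[of "c + E t"] nE[of t] r R(1) by (auto simp: dist_norm r_def)
    have "h x = integral (cbox 0 1) (\<lambda>t. f (set_var x i \<phi> (x j \<phi> + c + E t)) * (E t / g (c + E t) / (E t - (x i \<phi> - x j \<phi> - c))))"
      if x: "norm (x i \<phi> - x j \<phi> - c) < r" for x
    proof -
      define w where "w = x i \<phi>"
      define z0 where "z0 = x j \<phi> + c"
      have w: "norm (w - z0) < r" using x by (simp add: w_def z0_def algebra_simps)
      have "((\<lambda>u. F x u / (u - w)) has_contour_integral (2 * of_real pi * \<i> * F x w)) (circlepath z0 r)"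
        using Cauchy_integral_circlepath_simple[OF holomorphic_on_subset[OF F] w] by auto
      then have "2 * of_real pi * \<i> * F x w = contour_integral (circlepath z0 r) (\<lambda>u. F x u / (u - w))"
        by (simp add: contour_integral_unique)
      also have "\<dots> = integral {0..1} (\<lambda>t. 2 * of_real pi * \<i> *
          (f (set_var x i \<phi> (z0 + E t)) * (E t / g (c + E t) / (E t - (x i \<phi> - x j \<phi> - c)))))"
        unfolding contour_integral_integral
      proof (rule integral_cong)
        fix t :: real assume "t \<in> {0..1}"
        then have vd: "vector_derivative (circlepath z0 r) (at t) = 2 * of_real pi * \<i> * E t"
          unfolding E_def by (subst vector_derivative_circlepath) auto
        have cp: "circlepath z0 r t = z0 + E t" by (simp add: circlepath E_def)
        have "g (c + E t) * F x (z0 + E t) = f (set_var x i \<phi> (z0 + E t))"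
          using gF[of "z0 + E t" x] by (simp add: z0_def add.assoc)
        then have a: "F x (z0 + E t) = f (set_var x i \<phi> (z0 + E t)) / g (c + E t)"
          using gE[of t] by (simp add: field_simps)
        have b: "z0 + E t - w = E t - (x i \<phi> - x j \<phi> - c)" by (simp add: z0_def w_def)
        show "F x (circlepath z0 r t) / (circlepath z0 r t - w) * vector_derivative (circlepath z0 r) (at t) =
          2 * of_real pi * \<i> * (f (set_var x i \<phi> (z0 + E t)) * (E t / g (c + E t) / (E t - (x i \<phi> - x j \<phi> - c))))"
          unfolding vd cp a b by (simp add: mult_ac)
      qed
      also have "\<dots> = 2 * of_real pi * \<i> * integral {0..1} (\<lambda>t.
          f (set_var x i \<phi> (z0 + E t)) * (E t / g (c + E t) / (E t - (x i \<phi> - x j \<phi> - c))))"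
        by (rule integral_mult_right)
      finally show ?thesis by (simp add: h_def w_def z0_def)
    qed
    then show ?thesis using r gE unfolding E_def by blast
  qed
  have cont: "continuous_on UNIV h"
  proof -
    have "isCont h x0" for x0
    proof -
      define c where "c = x0 i \<phi> - x0 j \<phi>"
      from repr[of c] obtain r where r: "r > 0"
        and gE: "\<And>t::real. g (c + of_real r * exp (2 * of_real pi * \<i> * of_real t)) \<noteq> 0"
        and hx: "\<And>x. norm (x i \<phi> - x j \<phi> - c) < r \<Longrightarrow> h x = integral (cbox 0 1) (\<lambda>t.
        f (set_var x i \<phi> (x j \<phi> + c + of_real r * exp (2 * of_real pi * \<i> * of_real t))) *
        (of_real r * exp (2 * of_real pi * \<i> * of_real t) / g (c + of_real r * exp (2 * of_real pi * \<i> * of_real t)) /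
         (of_real r * exp (2 * of_real pi * \<i> * of_real t) - (x i \<phi> - x j \<phi> - c))))"
        by blast
      define W where "W = {x :: point. norm (x i \<phi> - x j \<phi> - c) < r}"
      have W: "open W" "x0 \<in> W" unfolding W_def
        using r by (auto simp: c_def intro!: open_Collect_less continuous_intros)
      have nz: "of_real r * exp (2 * of_real pi * \<i> * of_real t) - (x i \<phi> - x j \<phi> - c) \<noteq> 0" if "x \<in> W" for x and t :: real
      proof
        assume "of_real r * exp (2 * of_real pi * \<i> * of_real t) - (x i \<phi> - x j \<phi> - c) = 0"
        then have "norm (x i \<phi> - x j \<phi> - c) = norm (of_real r * exp (2 * of_real pi * \<i> * of_real t))" by simp
        with that r show False by (simp add: W_def norm_mult)
      qed
      have "continuous_on W (\<lambda>x. integral (cbox 0 1) (\<lambda>t.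
        f (set_var x i \<phi> (x j \<phi> + c + of_real r * exp (2 * of_real pi * \<i> * of_real t))) *
        (of_real r * exp (2 * of_real pi * \<i> * of_real t) / g (c + of_real r * exp (2 * of_real pi * \<i> * of_real t)) /
         (of_real r * exp (2 * of_real pi * \<i> * of_real t) - (x i \<phi> - x j \<phi> - c)))))"
        by (rule integral_continuous_on_param, unfold case_prod_unfold)
          (auto intro!: continuous_intros continuous_on_compose2[OF holomorphic_varsD(2)[OF f]]
            continuous_on_compose2[OF holomorphic_on_imp_continuous_on[OF g]] simp: gE nz simp del: right_minus_eq)
      then have "continuous_on W h"
        by (rule continuous_on_eq) (auto simp: W_def hx)
      then show ?thesis using W by (simp add: continuous_on_eq_continuous_at)
    qed
    then show ?thesis by (simp add: continuous_on_eq_continuous_at)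
  qed
  have "holomorphic_vars p N h"
  proof (rule holomorphic_varsI[OF dep cont])
    fix x :: point and \<nu> \<mu> assume v: "\<nu> \<in> {1..N}" "\<mu> \<in> {1..p}"
    consider "(\<nu>, \<mu>) = (i, \<phi>)" | "(\<nu>, \<mu>) = (j, \<phi>)" | "(\<nu>, \<mu>) \<noteq> (i, \<phi>)" "(\<nu>, \<mu>) \<noteq> (j, \<phi>)" by blast
    then show "(\<lambda>z. h (set_var x \<nu> \<mu> z)) holomorphic_on UNIV"
    proof cases
      case 1 then show ?thesis using F by (simp add: hF)
    next
      case 2
      define k where "k = (\<lambda>z. h (set_var x j \<phi> z))"
      have ck: "continuous_on UNIV k" unfolding k_def
        by (rule continuous_on_compose2[OF cont]) (auto intro!: continuous_intros)
      have kz: "f (set_var x j \<phi> z) = g (x i \<phi> - z) * k z" for z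
        using fh[of "set_var x j \<phi> z"] ij by (simp add: set_var_apply k_def)
      have "k field_differentiable at z0" for z0
      proof -
        have "\<exists>R>0. \<forall>z. z \<noteq> z0 \<and> dist z z0 < R \<longrightarrow> g (x i \<phi> - z) \<noteq> 0"
        proof -
          obtain R where R: "R > 0" "\<And>z. z \<noteq> x i \<phi> - z0 \<Longrightarrow> dist z (x i \<phi> - z0) < R \<Longrightarrow> g z \<noteq> 0"
            using gnz[of "x i \<phi> - z0"] by (auto simp: eventually_at)
          have "g (x i \<phi> - z) \<noteq> 0" if "z \<noteq> z0" "dist z z0 < R" for z
            using R(2)[of "x i \<phi> - z"] that by (auto simp: dist_norm norm_minus_commute)
          with R show ?thesis by blast
        qed
        then obtain R where R: "R > 0" "\<And>z. z \<noteq> z0 \<Longrightarrow> dist z z0 < R \<Longrightarrow> g (x i \<phi> - z) \<noteq> 0" by blast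
        have "k holomorphic_on ball z0 R - {z0}"
        proof (rule holomorphic_transform)
          show "(\<lambda>z. f (set_var x j \<phi> z) / g (x i \<phi> - z)) holomorphic_on ball z0 R - {z0}"
            using R(2) by (intro holomorphic_on_divide holomorphic_on_subset[OF holomorphic_varsD(3)[OF f ij(2) \<phi>]]
                holomorphic_on_subset[OF g'']) (auto simp: dist_commute)
          fix z assume "z \<in> ball z0 R - {z0}"
          then have "g (x i \<phi> - z) \<noteq> 0" using R(2) by (auto simp: dist_commute)
          then show "f (set_var x j \<phi> z) / g (x i \<phi> - z) = k z" by (simp add: kz)
        qed
        then have "k holomorphic_on ball z0 R"
          using no_isolated_singularity[of "ball z0 R" k "{z0}"] ck continuous_on_subset by blast
        then show ?thesis
          by (rule holomorphic_on_imp_differentiable_at) (use R in auto)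
      qed
      then have "k holomorphic_on UNIV" by (simp add: holomorphic_on_def field_differentiable_at_within)
      then show ?thesis using 2 by (simp add: k_def)
    next
      case 3
      \<comment> \<open>These variables leave \<open>x i \<phi> - x j \<phi>\<close> fixed, so one
        circle serves for all \<open>z\<close>, and under the integral only \<open>f\<close> depends
        on \<open>z\<close>.\<close>
      have inv: "set_var x \<nu> \<mu> z i \<phi> = x i \<phi>" "set_var x \<nu> \<mu> z j \<phi> = x j \<phi>" for z using 3 by (auto simp: set_var_apply)
      define c where "c = x i \<phi> - x j \<phi>"
      from repr[of c] obtain r where r: "r > 0"
        and gE: "\<And>t::real. g (c + of_real r * exp (2 * of_real pi * \<i> * of_real t)) \<noteq> 0"
        and hx: "\<And>x. norm (x i \<phi> - x j \<phi> - c) < r \<Longrightarrow> h x = integral (cbox 0 1) (\<lambda>t.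
        f (set_var x i \<phi> (x j \<phi> + c + of_real r * exp (2 * of_real pi * \<i> * of_real t))) *
        (of_real r * exp (2 * of_real pi * \<i> * of_real t) / g (c + of_real r * exp (2 * of_real pi * \<i> * of_real t)) /
         (of_real r * exp (2 * of_real pi * \<i> * of_real t) - (x i \<phi> - x j \<phi> - c))))"
        by blast
      define Q where "Q = (\<lambda>t::real. of_real r * exp (2 * of_real pi * \<i> * of_real t) /
        g (c + of_real r * exp (2 * of_real pi * \<i> * of_real t)) / (of_real r * exp (2 * of_real pi * \<i> * of_real t)))"
      define y where "y = (\<lambda>t::real. set_var x i \<phi> (x j \<phi> + c + of_real r * exp (2 * of_real pi * \<i> * of_real t)))"
      have Q: "continuous_on A Q" for A unfolding Q_def using r
        by (auto intro!: continuous_intros continuous_on_compose2[OF holomorphic_on_imp_continuous_on[OF g]] simp: gE)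
      have y: "continuous_on A (\<lambda>t. y (s t) a b)" if "continuous_on A s" for A :: "'x :: topological_space set" and s a b
        unfolding y_def by (intro continuous_intros that)
      have "h (set_var x \<nu> \<mu> z) = integral (cbox 0 1) (\<lambda>t. f (set_var (y t) \<nu> \<mu> z) * Q t)" for z
        using hx[of "set_var x \<nu> \<mu> z"] r 3(1)
        by (simp add: inv c_def[symmetric] Q_def y_def set_var_commute[of \<nu> \<mu> i \<phi>])
      moreover have "(\<lambda>z. integral (cbox 0 1) (\<lambda>t. f (set_var (y t) \<nu> \<mu> z) * Q t)) holomorphic_on UNIV"
      proof (rule leibniz_rule_holomorphic)
        show "((\<lambda>z. f (set_var (y t) \<nu> \<mu> z) * Q t) has_field_derivative partial_deriv \<nu> \<mu> f (set_var (y t) \<nu> \<mu> z) * Q t) (at z within UNIV)" for z t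
          by (intro DERIV_cmult_right has_field_derivative_partial_deriv[OF f v])
        show "(\<lambda>t. f (set_var (y t) \<nu> \<mu> z) * Q t) integrable_on cbox 0 1" for z
          by (rule integrable_continuous)
            (auto intro!: continuous_intros y Q continuous_on_compose2[OF holomorphic_varsD(2)[OF f]])
        show "continuous_on (UNIV \<times> cbox 0 1) (\<lambda>(z, t). partial_deriv \<nu> \<mu> f (set_var (y t) \<nu> \<mu> z) * Q t)"
          unfolding case_prod_unfold
          by (auto intro!: continuous_intros continuous_on_compose2[OF continuous_on_partial_deriv[OF f v]]
            y continuous_on_compose2[OF Q])
      qed auto
      ultimately show ?thesis by simp
    qed
  qed
  with fh show ?thesis using that by blast
qed

section \<open>Continuants\<close>

definition continuant_mat :: "nat list \<Rightarrow> int mat" where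
  "continuant_mat a = Matrix.mat (length a) (length a)
     (\<lambda>(i, j). if i = j then int (a ! i) else if j = i + 1 \<or> i = j + 1 then - 1 else 0)"

lemma continuant_mat_carrier [simp]: "continuant_mat a \<in> carrier_mat (length a) (length a)"
  by (simp add: continuant_mat_def)

lemma continuant_eq_det: "continuant a = Determinant.det (continuant_mat a)"
  by (simp add: continuant_def continuant_mat_def)

lemma continuant_Nil [simp]: "continuant [] = 1"
  by (simp add: continuant_eq_det det_dim_zero[of "continuant_mat []"] continuant_mat_def)

lemma continuant_single [simp]: "continuant [a] = int a"
  by (simp add: continuant_eq_det det_single continuant_mat_def)

text \<open>Laplace expansion along the first row leaves two minors; the second one is expanded
  along its first column, which has a single nonzero entry.\<close>

lemma continuant_Cons_Cons: "continuant (a # b # r) = int a * continuant (b # r) - continuant r"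
proof -
  define A where "A = continuant_mat (a # b # r)"
  define B where "B = mat_delete A 0 1"
  define m where "m = length r"
  have A: "A \<in> carrier_mat (Suc (Suc m)) (Suc (Suc m))" using continuant_mat_carrier[of "a # b # r"] by (simp add: A_def m_def)
  have B: "B \<in> carrier_mat (Suc m) (Suc m)" using A unfolding B_def by (simp add: mat_delete_def)
  have A00: "mat_delete A 0 0 = continuant_mat (b # r)"
    by (rule eq_matI) (auto simp: A_def mat_delete_def continuant_mat_def)
  have B00: "mat_delete B 0 0 = continuant_mat r"
    by (rule eq_matI) (auto simp: A_def B_def mat_delete_def continuant_mat_def)
  have "Determinant.det A = (\<Sum>j<Suc (Suc m). A $$ (0, j) * cofactor A 0 j)"
    by (rule laplace_expansion_row[OF A]) simp
  also have "\<dots> = (\<Sum>j\<in>{0, 1}. A $$ (0, j) * cofactor A 0 j)"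
    by (rule sum.mono_neutral_right) (auto simp: A_def continuant_mat_def m_def)
  also have "\<dots> = int a * Determinant.det (mat_delete A 0 0) + Determinant.det B"
    by (simp add: cofactor_def B_def) (simp add: A_def continuant_mat_def)
  also have "Determinant.det B = (\<Sum>i<Suc m. B $$ (i, 0) * cofactor B i 0)"
    by (rule laplace_expansion_column[OF B]) simp
  also have "\<dots> = (\<Sum>i\<in>{0}. B $$ (i, 0) * cofactor B i 0)"
    by (rule sum.mono_neutral_right) (auto simp: A_def B_def mat_delete_def continuant_mat_def m_def)
  also have "\<dots> = - Determinant.det (mat_delete B 0 0)"
    by (simp add: cofactor_def) (simp add: A_def B_def mat_delete_def continuant_mat_def)
  finally show ?thesis by (simp add: continuant_eq_det A00 B00 flip: A_def)
qed

text \<open>The two recursions are linear and work at different ends of the list, so the one at the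
  front carries this one through the induction.\<close>

lemma continuant_snoc_snoc: "continuant (xs @ [y, z]) = int z * continuant (xs @ [y]) - continuant xs"
proof (induction xs rule: induct_list012)
  case (3 x x' xs)
  have "continuant ((x # x' # xs) @ [y, z]) = int x * continuant ((x' # xs) @ [y, z]) - continuant (xs @ [y, z])"
    by (simp add: continuant_Cons_Cons)
  also have "\<dots> = int z * continuant ((x # x' # xs) @ [y]) - continuant (x # x' # xs)"
    unfolding 3 by (simp add: continuant_Cons_Cons algebra_simps)
  finally show ?case .
qed (simp_all add: continuant_Cons_Cons algebra_simps)

text \<open>As the entries are at least 2, d(a, b, r) >= 2 d(b, r) - d(r), and d(b, r) > d(r) by
  induction.\<close>

lemma continuant_mono:
  assumes "\<forall>m\<in>set (a # r). 2 \<le> m"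
  shows "0 < continuant r \<and> continuant r < continuant (a # r)"
  using assms
proof (induction r arbitrary: a)
  case (Cons b r)
  then have IH: "0 < continuant r" "continuant r < continuant (b # r)" and a: "2 \<le> a" by auto
  have "2 * continuant (b # r) \<le> int a * continuant (b # r)"
    using a IH by (intro mult_right_mono) auto
  with IH show ?case unfolding continuant_Cons_Cons by linarith
qed simp

lemma continuant_pos: "\<forall>m\<in>set ns. 2 \<le> m \<Longrightarrow> 0 < continuant ns"
  using continuant_mono[of 2 ns] by simp

text \<open>The recursion at the front, for the tails of \<open>ns\<close>. The case distinction
  stands for the convention that a list of length -1 has continuant 0.\<close>

lemma continuant_drop:
  assumes "1 \<le> \<psi>" "\<psi> \<le> length ns"
  shows "int (ns ! (\<psi> - 1)) * continuant (drop \<psi> ns) - (if \<psi> = length ns then 0 else continuant (drop (\<psi> + 1) ns))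
    = continuant (drop (\<psi> - 1) ns)"
proof -
  have 1: "drop (\<psi> - 1) ns = ns ! (\<psi> - 1) # drop \<psi> ns"
    using assms Cons_nth_drop_Suc[of "\<psi> - 1" ns] by simp
  show ?thesis
  proof (cases "\<psi> = length ns")
    case False
    then have "drop \<psi> ns = ns ! \<psi> # drop (\<psi> + 1) ns"
      using assms Cons_nth_drop_Suc[of \<psi> ns] by simp
    with False show ?thesis unfolding 1 by (simp add: continuant_Cons_Cons)
  qed (use 1 in simp)
qed

lemma continuant_take:
  assumes "1 \<le> \<psi>" "\<psi> \<le> length ns"
  shows "int (ns ! (\<psi> - 1)) * continuant (take (\<psi> - 1) ns) - (if \<psi> = 1 then 0 else continuant (take (\<psi> - 2) ns))
    = continuant (take \<psi> ns)"
proof -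
  have 1: "take \<psi> ns = take (\<psi> - 1) ns @ [ns ! (\<psi> - 1)]"
    using assms take_Suc_conv_app_nth[of "\<psi> - 1" ns] by simp
  show ?thesis
  proof (cases "\<psi> = 1")
    case False
    have "Suc (\<psi> - 2) = \<psi> - 1" using assms False by simp
    then have 2: "take (\<psi> - 1) ns = take (\<psi> - 2) ns @ [ns ! (\<psi> - 2)]"
      using assms False take_Suc_conv_app_nth[of "\<psi> - 2" ns] by simp
    have "continuant (take \<psi> ns) = continuant (take (\<psi> - 2) ns @ [ns ! (\<psi> - 2), ns ! (\<psi> - 1)])"
      unfolding 1 2 by simp
    with False show ?thesis unfolding continuant_snoc_snoc using 2 by simp
  qed (use 1 in simp)
qed

text \<open>
  The vector of the \<open>c_coeff\<close> is the image of the sum of the first and the last unit vector under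
  the inverse of the tridiagonal matrix.
\<close>

lemma c_coeff_tridiagonal:
  assumes "\<forall>m\<in>set ns. 2 \<le> m" "1 \<le> \<psi>" "\<psi> \<le> length ns"
  shows "of_nat (ns ! (\<psi> - 1)) * c_coeff ns \<psi> - (if \<psi> = 1 then 0 else c_coeff ns (\<psi> - 1))
      - (if \<psi> = length ns then 0 else c_coeff ns (\<psi> + 1))
    = (if \<psi> = 1 then 1 else 0) + (if \<psi> = length ns then 1 else 0)"
proof -
  define n where "n = int (ns ! (\<psi> - 1))"
  define d where "d = continuant ns"
  define L where "L \<psi> = continuant (take (\<psi> - 1) ns)" for \<psi>
  define R where "R \<psi> = continuant (drop \<psi> ns)" for \<psi>
  have d: "d \<noteq> 0" using continuant_pos[OF assms(1)] by (simp add: d_def)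
  have c: "of_int (L \<psi> + R \<psi>) = c_coeff ns \<psi> * of_int d" for \<psi>
    using d by (simp add: c_coeff_def L_def R_def d_def)
  have 1: "n * R \<psi> - (if \<psi> = length ns then 0 else R (\<psi> + 1)) = R (\<psi> - 1)"
    using continuant_drop[OF assms(2,3)] by (auto simp: n_def R_def split: if_splits)
  have 2: "n * L \<psi> - (if \<psi> = 1 then 0 else L (\<psi> - 1)) = L (\<psi> + 1)"
    using continuant_take[OF assms(2,3)] by (auto simp: n_def L_def numeral_2_eq_2 split: if_splits)
  \<comment> \<open>Where one of the recursions arrives at an end of the list, it produces the full
    continuant \<open>d\<close>; this is the source of the right-hand side.\<close>
  have R0: "\<psi> = 1 \<Longrightarrow> R (\<psi> - 1) = d" and Lp: "\<psi> = length ns \<Longrightarrow> L (\<psi> + 1) = d"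
    by (simp_all add: R_def L_def d_def)
  have "n * (L \<psi> + R \<psi>) - (if \<psi> = 1 then 0 else L (\<psi> - 1) + R (\<psi> - 1)) - (if \<psi> = length ns then 0 else L (\<psi> + 1) + R (\<psi> + 1))
    = (if \<psi> = 1 then d else 0) + (if \<psi> = length ns then d else 0)"
    using 1 2 R0 Lp by (auto simp: distrib_left split: if_splits)
  from arg_cong[OF this, of "of_int :: int \<Rightarrow> complex"]
  have "of_int n * of_int (L \<psi> + R \<psi>) - (if \<psi> = 1 then 0 else of_int (L (\<psi> - 1) + R (\<psi> - 1)))
      - (if \<psi> = length ns then 0 else of_int (L (\<psi> + 1) + R (\<psi> + 1)))
    = (if \<psi> = 1 then of_int d else 0) + (if \<psi> = length ns then of_int d else (0 :: complex))"
    by (simp split: if_splits)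
  then have "(of_int n * c_coeff ns \<psi> - (if \<psi> = 1 then 0 else c_coeff ns (\<psi> - 1))
      - (if \<psi> = length ns then 0 else c_coeff ns (\<psi> + 1))) * of_int d
    = ((if \<psi> = 1 then 1 else 0) + (if \<psi> = length ns then 1 else 0)) * of_int d"
    unfolding c by (simp only: left_diff_distrib distrib_right if_distrib[of "\<lambda>x. x * of_int d"]
        mult_zero_left mult_1_left mult.assoc cong: if_cong)
  then show ?thesis using d by (simp add: n_def)
qed

section \<open>The classical r-matrix\<close>

locale theta_data = upper_half \<eta> for \<eta> +
  fixes ns :: "nat list"
  assumes ns_nonempty: "ns \<noteq> []" and ns_ge_2: "\<forall>m\<in>set ns. 2 \<le> m"
begin

abbreviation "p \<equiv> length ns"
abbreviation "U N \<equiv> off_poles \<eta> p N"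

lemma p_pos: "p \<ge> 1"
  using ns_nonempty by (cases ns) auto

lemma in_p [simp]: "1 \<in> {1..p}" "p \<in> {1..p}" "Suc 0 \<le> p"
  using p_pos by auto

lemma U_D: "x \<in> U N \<Longrightarrow> \<nu> \<in> {1..N} \<Longrightarrow> \<nu>' \<in> {1..N} \<Longrightarrow> \<nu> \<noteq> \<nu>' \<Longrightarrow> \<mu> \<in> {1..p} \<Longrightarrow> th (x \<nu> \<mu> - x \<nu>' \<mu>) \<noteq> 0"
  unfolding off_poles_def by blast

lemma field_differentiable_set_var [intro]:
  "(\<lambda>z. set_var x \<nu> \<mu> z a b) field_differentiable at w"
  by (cases "a = \<nu> \<and> b = \<mu>") (auto simp: set_var_apply)

lemma field_differentiable_theta_compose [intro]:
  assumes "f field_differentiable at w"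
  shows "(\<lambda>z. th (f z)) field_differentiable at w" "(\<lambda>z. deriv th (f z)) field_differentiable at w"
proof -
  have "th field_differentiable at (f w)" "deriv th field_differentiable at (f w)"
    using holomorphic_on_imp_differentiable_at[OF holomorphic_theta_UNIV open_UNIV]
      holomorphic_on_imp_differentiable_at[OF holomorphic_deriv[OF holomorphic_theta_UNIV open_UNIV] open_UNIV] by auto
  then show "(\<lambda>z. th (f z)) field_differentiable at w" "(\<lambda>z. deriv th (f z)) field_differentiable at w"
    using field_differentiable_compose[OF assms] by (auto simp: o_def)
qed

text \<open>\<open>U N\<close> is given by finitely many conditions that a continuous function be
  nonzero, so it is open in every coordinate direction and derivatives at its points are
  local.\<close>

lemma eventually_set_var_U:
  assumes "x \<in> U N"
  shows "\<forall>\<^sub>F z in nhds (x \<nu> \<mu>). set_var x \<nu> \<mu> z \<in> U N"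
proof -
  have "\<forall>\<^sub>F z in nhds (x \<nu> \<mu>). \<nu>1 \<noteq> \<nu>2 \<longrightarrow> th (set_var x \<nu> \<mu> z \<nu>1 \<mu>' - set_var x \<nu> \<mu> z \<nu>2 \<mu>') \<noteq> 0"
    if "\<nu>1 \<in> {1..N}" "\<nu>2 \<in> {1..N}" "\<mu>' \<in> {1..p}" for \<nu>1 \<nu>2 \<mu>'
  proof (cases "\<nu>1 = \<nu>2")
    case False
    define k where "k = (\<lambda>z. th (set_var x \<nu> \<mu> z \<nu>1 \<mu>' - set_var x \<nu> \<mu> z \<nu>2 \<mu>'))"
    have "k field_differentiable at (x \<nu> \<mu>)" unfolding k_def
      by (intro field_differentiable_theta_compose field_differentiable_diff field_differentiable_set_var)
    then have "isCont k (x \<nu> \<mu>)" by (rule field_differentiable_imp_continuous_at)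
    then have "(k \<longlongrightarrow> k (x \<nu> \<mu>)) (nhds (x \<nu> \<mu>))"
      by (simp add: isCont_def tendsto_at_iff_tendsto_nhds)
    moreover have "k (x \<nu> \<mu>) \<noteq> 0" using U_D[OF assms that(1,2) False that(3)] by (simp add: k_def)
    ultimately have "\<forall>\<^sub>F z in nhds (x \<nu> \<mu>). k z \<noteq> 0" by (rule tendsto_imp_eventually_ne)
    then show ?thesis by (rule eventually_mono) (simp add: k_def)
  qed simp
  then have "\<forall>\<^sub>F z in nhds (x \<nu> \<mu>). \<forall>\<nu>1\<in>{1..N}. \<forall>\<nu>2\<in>{1..N}. \<forall>\<mu>'\<in>{1..p}.
      \<nu>1 \<noteq> \<nu>2 \<longrightarrow> th (set_var x \<nu> \<mu> z \<nu>1 \<mu>' - set_var x \<nu> \<mu> z \<nu>2 \<mu>') \<noteq> 0"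
    by (intro eventually_ball_finite ballI) auto
  then show ?thesis by (rule eventually_mono) (auto simp: off_poles_def)
qed

subsection \<open>Functions that are separately differentiable off the poles\<close>

text \<open>The class in which operators are composed. \<open>RR i j f\<close> may have poles
  outside \<open>U N\<close>, and a second operator only needs its first partial derivatives on
  \<open>U N\<close>.\<close>

definition dif :: "nat \<Rightarrow> pfun set" where
  "dif N = {f. \<forall>x\<in>U N. \<forall>\<nu>\<in>{1..N}. \<forall>\<mu>\<in>{1..p}. (\<lambda>z. f (set_var x \<nu> \<mu> z)) field_differentiable at (x \<nu> \<mu>)}"

lemma difD: "f \<in> dif N \<Longrightarrow> x \<in> U N \<Longrightarrow> \<nu> \<in> {1..N} \<Longrightarrow> \<mu> \<in> {1..p} \<Longrightarrow>
    (\<lambda>z. f (set_var x \<nu> \<mu> z)) field_differentiable at (x \<nu> \<mu>)"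
  by (simp add: dif_def)

lemma has_field_derivative_dif: "f \<in> dif N \<Longrightarrow> x \<in> U N \<Longrightarrow> \<nu> \<in> {1..N} \<Longrightarrow> \<mu> \<in> {1..p} \<Longrightarrow>
    ((\<lambda>z. f (set_var x \<nu> \<mu> z)) has_field_derivative partial_deriv \<nu> \<mu> f x) (at (x \<nu> \<mu>))"
  unfolding partial_deriv_def using difD field_differentiable_derivI by blast

lemma holomorphic_vars_dif: "holomorphic_vars p N f \<Longrightarrow> f \<in> dif N"
  unfolding dif_def using holomorphic_on_imp_differentiable_at[OF holomorphic_varsD(3) open_UNIV UNIV_I] by blast

lemma dif_const: "(\<lambda>_. c) \<in> dif N"
  by (simp add: dif_def)

lemma dif_add: "f \<in> dif N \<Longrightarrow> g \<in> dif N \<Longrightarrow> (\<lambda>x. f x + g x) \<in> dif N"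
  unfolding dif_def by (auto intro!: field_differentiable_add)

lemma dif_diff: "f \<in> dif N \<Longrightarrow> g \<in> dif N \<Longrightarrow> (\<lambda>x. f x - g x) \<in> dif N"
  unfolding dif_def by (auto intro!: field_differentiable_diff)

lemma dif_mult: "f \<in> dif N \<Longrightarrow> g \<in> dif N \<Longrightarrow> (\<lambda>x. f x * g x) \<in> dif N"
  unfolding dif_def by (auto intro!: field_differentiable_mult)

lemma dif_sum: "(\<And>i. i \<in> I \<Longrightarrow> f i \<in> dif N) \<Longrightarrow> (\<lambda>x. \<Sum>i\<in>I. f i x) \<in> dif N"
  by (induction I rule: infinite_finite_induct) (auto intro: dif_const dif_add)

lemmas dif_intros = dif_const dif_add dif_diff dif_mult dif_sum

lemma partial_deriv_add:
  assumes "f \<in> dif N" "g \<in> dif N" "x \<in> U N" "\<nu> \<in> {1..N}" "\<mu> \<in> {1..p}"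
  shows "partial_deriv \<nu> \<mu> (\<lambda>x. f x + g x) x = partial_deriv \<nu> \<mu> f x + partial_deriv \<nu> \<mu> g x"
  unfolding partial_deriv_def by (rule deriv_add) (use assms difD in blast)+

lemma partial_deriv_mult:
  assumes "f \<in> dif N" "g \<in> dif N" "x \<in> U N" "\<nu> \<in> {1..N}" "\<mu> \<in> {1..p}"
  shows "partial_deriv \<nu> \<mu> (\<lambda>x. f x * g x) x = f x * partial_deriv \<nu> \<mu> g x + partial_deriv \<nu> \<mu> f x * g x"
  unfolding partial_deriv_def by (subst deriv_mult) (use assms difD in \<open>auto\<close>)

lemma partial_deriv_const [simp]: "partial_deriv \<nu> \<mu> (\<lambda>_. c) x = 0"
  by (simp add: partial_deriv_def)

lemma partial_deriv_sum:
  assumes "\<And>i. i \<in> I \<Longrightarrow> f i \<in> dif N" "x \<in> U N" "\<nu> \<in> {1..N}" "\<mu> \<in> {1..p}"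
  shows "partial_deriv \<nu> \<mu> (\<lambda>x. \<Sum>i\<in>I. f i x) x = (\<Sum>i\<in>I. partial_deriv \<nu> \<mu> (f i) x)"
  using assms
proof (induction I rule: infinite_finite_induct)
  case (insert i I)
  have "partial_deriv \<nu> \<mu> (\<lambda>x. f i x + (\<Sum>i\<in>I. f i x)) x =
      partial_deriv \<nu> \<mu> (f i) x + partial_deriv \<nu> \<mu> (\<lambda>x. \<Sum>i\<in>I. f i x) x"
    by (rule partial_deriv_add[of _ N]) (use insert in \<open>auto intro: dif_sum\<close>)
  then show ?case using insert by simp
qed auto

lemma partial_deriv_cong:
  assumes "\<And>y. y \<in> U N \<Longrightarrow> f y = g y" "x \<in> U N"
  shows "partial_deriv \<nu> \<mu> f x = partial_deriv \<nu> \<mu> g x"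
  unfolding partial_deriv_def
  by (rule deriv_cong_ev[OF eventually_mono[OF eventually_set_var_U[OF assms(2)]]]) (auto intro: assms(1))

lemma dif_cong: "(\<And>y. y \<in> U N \<Longrightarrow> f y = g y) \<Longrightarrow> f \<in> dif N \<Longrightarrow> g \<in> dif N"
proof -
  assume eq: "\<And>y. y \<in> U N \<Longrightarrow> f y = g y" and f: "f \<in> dif N"
  have "(\<lambda>z. g (set_var x \<nu> \<mu> z)) field_differentiable at (x \<nu> \<mu>)"
    if x: "x \<in> U N" "\<nu> \<in> {1..N}" "\<mu> \<in> {1..p}" for x \<nu> \<mu>
  proof -
    have "\<forall>\<^sub>F z in nhds (x \<nu> \<mu>). f (set_var x \<nu> \<mu> z) = g (set_var x \<nu> \<mu> z)"
      using eventually_set_var_U[OF x(1)] by (rule eventually_mono) (rule eq)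
    then have "((\<lambda>z. g (set_var x \<nu> \<mu> z)) has_field_derivative partial_deriv \<nu> \<mu> f x) (at (x \<nu> \<mu>))"
      using has_field_derivative_dif[OF f x] by (subst DERIV_cong_ev[OF refl _ refl]) (auto elim: eventually_mono)
    then show ?thesis by (auto simp: field_differentiable_def)
  qed
  then show ?thesis by (simp add: dif_def)
qed

text \<open>A permutation of the blocks for every position \<mu> separately: the partial swaps
  depend on \<mu>, permutations of whole blocks do not.\<close>

definition block_perm :: "nat \<Rightarrow> (nat \<Rightarrow> nat \<Rightarrow> nat) \<Rightarrow> bool" where
  "block_perm N r \<longleftrightarrow> (\<forall>\<mu>. (\<lambda>\<nu>. r \<nu> \<mu>) permutes {1..N})"

lemma block_permD:
  assumes "block_perm N r"
  shows "\<nu> \<in> {1..N} \<Longrightarrow> r \<nu> \<mu> \<in> {1..N}" "r \<nu> \<mu> = r \<nu>' \<mu> \<longleftrightarrow> \<nu> = \<nu>'" "inj_on (\<lambda>\<nu>. r \<nu> \<mu>) A"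
    "\<nu> \<in> {1..N} \<Longrightarrow> \<exists>\<nu>'\<in>{1..N}. r \<nu>' \<mu> = \<nu>"
proof -
  have *: "(\<lambda>\<nu>. r \<nu> \<mu>) permutes {1..N}" using assms by (simp add: block_perm_def)
  show "\<nu> \<in> {1..N} \<Longrightarrow> r \<nu> \<mu> \<in> {1..N}" using permutes_in_image[OF *, of \<nu>] by simp
  show "r \<nu> \<mu> = r \<nu>' \<mu> \<longleftrightarrow> \<nu> = \<nu>'" using permutes_inj[OF *] by (auto simp: inj_def)
  show "inj_on (\<lambda>\<nu>. r \<nu> \<mu>) A" using permutes_inj[OF *] by (auto simp: inj_on_def inj_def)
  show "\<exists>\<nu>'\<in>{1..N}. r \<nu>' \<mu> = \<nu>" if "\<nu> \<in> {1..N}"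
    using permutes_image[OF *] that by (metis imageE)
qed

lemma reblock_set_var:
  assumes "block_perm N r"
  shows "reblock r (set_var x (r \<nu> \<mu>) \<mu> z) = set_var (reblock r x) \<nu> \<mu> z"
  by (intro ext) (auto simp: reblock_def set_var_apply block_permD(2)[OF assms])

lemma partial_deriv_reblock:
  assumes "block_perm N r"
  shows "partial_deriv (r \<nu> \<mu>) \<mu> (\<lambda>x. f (reblock r x)) x = partial_deriv \<nu> \<mu> f (reblock r x)"
  by (simp add: partial_deriv_def reblock_set_var[OF assms]) (simp add: reblock_def)

lemma reblock_U: "block_perm N r \<Longrightarrow> x \<in> U N \<Longrightarrow> reblock r x \<in> U N"
  using block_permD(1,2) unfolding off_poles_def reblock_def by auto

lemma dif_reblock:
  assumes "f \<in> dif N" and r: "block_perm N r"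
  shows "(\<lambda>x. f (reblock r x)) \<in> dif N"
  unfolding dif_def
proof (intro CollectI ballI)
  fix x \<nu> \<mu> assume x: "x \<in> U N" "\<nu> \<in> {1..N}" "\<mu> \<in> {1..p}"
  obtain \<nu>' where \<nu>': "\<nu>' \<in> {1..N}" "r \<nu>' \<mu> = \<nu>" using block_permD(4)[OF r x(2)] by blast
  have "(\<lambda>z. f (set_var (reblock r x) \<nu>' \<mu> z)) field_differentiable at (reblock r x \<nu>' \<mu>)"
    by (rule difD[OF assms(1) reblock_U[OF r x(1)] \<nu>'(1) x(3)])
  then show "(\<lambda>z. f (reblock r (set_var x \<nu> \<mu> z))) field_differentiable at (x \<nu> \<mu>)"
    using reblock_set_var[OF r, of x \<nu>' \<mu>] \<nu>'(2) by (simp add: reblock_def)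
qed

lemma holomorphic_vars_block_perm:
  "holomorphic_vars p N f \<Longrightarrow> block_perm N r \<Longrightarrow> holomorphic_vars p N (\<lambda>x. f (reblock r x))"
  by (rule holomorphic_vars_reblock[of p N f]) (auto dest: block_permD(1) block_permD(3))

subsection \<open>Partial swaps of two blocks\<close>

text \<open>Blocks \<open>i\<close> and \<open>j\<close> are exchanged in the positions 1 to \<psi>.
  Position 0 carries no variable; leaving it alone makes the swap with \<psi> = 0 the identity on
  points.\<close>

definition swb :: "nat \<Rightarrow> nat \<Rightarrow> nat \<Rightarrow> nat \<Rightarrow> nat \<Rightarrow> nat" where
  "swb \<psi> i j \<nu> \<mu> = (if 1 \<le> \<mu> \<and> \<mu> \<le> \<psi> then Transposition.transpose i j \<nu> else \<nu>)"

abbreviation sw :: "nat \<Rightarrow> nat \<Rightarrow> nat \<Rightarrow> point \<Rightarrow> point" where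
  "sw \<psi> i j \<equiv> reblock (swb \<psi> i j)"

lemma block_perm_swb: "i \<in> {1..N} \<Longrightarrow> j \<in> {1..N} \<Longrightarrow> block_perm N (swb \<psi> i j)"
proof -
  assume "i \<in> {1..N}" "j \<in> {1..N}"
  then have "Transposition.transpose i j permutes {1..N}" by (rule permutes_swap_id)
  moreover have "(\<lambda>\<nu>. \<nu>) permutes {1..N}" using permutes_id by (simp add: id_def)
  moreover have "(\<lambda>\<nu>. swb \<psi> i j \<nu> \<mu>) = (if 1 \<le> \<mu> \<and> \<mu> \<le> \<psi> then Transposition.transpose i j else (\<lambda>\<nu>. \<nu>))" for \<mu>
    by (auto simp: swb_def)
  ultimately show ?thesis by (simp add: block_perm_def)
qed

lemma sw_commute: "sw \<psi> j i = sw \<psi> i j"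
  by (intro ext) (simp add: reblock_def swb_def Transposition.transpose_commute)

lemma sw_0 [simp]: "sw 0 i j x = x"
  by (intro ext) (auto simp: reblock_def swb_def)

lemma sw_apply: "sw \<psi> i j x \<nu> \<mu> = x (if 1 \<le> \<mu> \<and> \<mu> \<le> \<psi> then Transposition.transpose i j \<nu> else \<nu>) \<mu>"
  by (simp add: reblock_def swb_def)

text \<open>
  The sum over \<open>\<psi>\<close> in \<open>T4\<close> is extended by the index 0, with the trivial swap, to
  absorb the first half of \<open>T3\<close>.
\<close>

definition kk :: "nat \<Rightarrow> nat \<Rightarrow> nat \<Rightarrow> pfun" where
  "kk \<psi> i j x = (if \<psi> = 0 then zeta (x j 1 - x i 1)
     else kron (x i \<psi> - x j \<psi>) (x j (\<psi> + 1) - x i (\<psi> + 1)))"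

definition zp :: "nat \<Rightarrow> nat \<Rightarrow> pfun" where
  "zp i j x = zeta (x j p - x i p)"

definition VV :: "nat \<Rightarrow> nat \<Rightarrow> pfun \<Rightarrow> pfun" where
  "VV i j f x = (\<Sum>\<psi><p. kk \<psi> i j x * f (sw \<psi> i j x)) + zp i j x * f x"

definition DD :: "nat \<Rightarrow> pfun \<Rightarrow> pfun" where
  "DD i f x = (\<Sum>\<psi>\<in>{1..p}. c_coeff ns \<psi> * partial_deriv i \<psi> f x)"

definition RR :: "nat \<Rightarrow> nat \<Rightarrow> pfun \<Rightarrow> pfun" where
  "RR i j f x = DD i f x - DD j f x + VV i j f x"

lemma kk_antisym:
  assumes "x \<in> U N" "i \<in> {1..N}" "j \<in> {1..N}" "i \<noteq> j"
  shows "kk \<psi> j i x = - kk \<psi> i j x"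
  using zeta_minus[of "x j 1 - x i 1"] U_D[OF assms(1,3,2), of 1] assms(4)
    kron_minus[of "x i \<psi> - x j \<psi>" "x j (\<psi> + 1) - x i (\<psi> + 1)"]
  by (simp add: kk_def)

lemma zp_antisym:
  assumes "x \<in> U N" "i \<in> {1..N}" "j \<in> {1..N}" "i \<noteq> j"
  shows "zp j i x = - zp i j x"
  using zeta_minus[of "x j p - x i p"] U_D[OF assms(1,3,2), of p] assms(4) by (simp add: zp_def)

lemma RR_antisym:
  assumes "x \<in> U N" "i \<in> {1..N}" "j \<in> {1..N}" "i \<noteq> j"
  shows "RR j i f x = - RR i j f x"
  unfolding RR_def VV_def sw_commute[of _ j i]
  by (simp add: kk_antisym[OF assms] zp_antisym[OF assms] sum_negf)

lemma field_differentiable_zeta_compose: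
  assumes "f field_differentiable at w" "th (f w) \<noteq> 0"
  shows "(\<lambda>z. zeta (f z)) field_differentiable at w"
  unfolding zeta_def using assms
  by (intro field_differentiable_diff field_differentiable_divide field_differentiable_theta_compose) auto

lemma field_differentiable_kron_compose:
  assumes "f field_differentiable at w" "g field_differentiable at w" "th (f w) \<noteq> 0" "th (g w) \<noteq> 0"
  shows "(\<lambda>z. kron (f z) (g z)) field_differentiable at w"
  unfolding kron_def using assms
  by (intro field_differentiable_divide field_differentiable_mult field_differentiable_theta_compose
      field_differentiable_add) auto

lemma kk_dif: "i \<in> {1..N} \<Longrightarrow> j \<in> {1..N} \<Longrightarrow> i \<noteq> j \<Longrightarrow> \<psi> < p \<Longrightarrow> kk \<psi> i j \<in> dif N"
  unfolding dif_def
proof (intro CollectI ballI)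
  fix x \<nu> \<mu> assume ij: "i \<in> {1..N}" "j \<in> {1..N}" "i \<noteq> j" and \<psi>: "\<psi> < p" and x: "x \<in> U N"
  have nz: "th (x i \<mu> - x j \<mu>) \<noteq> 0" "th (x j \<mu> - x i \<mu>) \<noteq> 0" if "\<mu> \<in> {1..p}" for \<mu>
    using U_D[OF x ij that] U_D[OF x ij(2,1) ij(3)[symmetric] that] by auto
  show "(\<lambda>z. kk \<psi> i j (set_var x \<nu> \<mu> z)) field_differentiable at (x \<nu> \<mu>)"
  proof (cases "\<psi> = 0")
    case True
    have "th (set_var x \<nu> \<mu> (x \<nu> \<mu>) j 1 - set_var x \<nu> \<mu> (x \<nu> \<mu>) i 1) \<noteq> 0"
      using nz(2)[of 1] by simp
    with True show ?thesis unfolding kk_def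
      by (simp only: if_True refl) (intro field_differentiable_zeta_compose field_differentiable_diff field_differentiable_set_var)
  next
    case False
    have "th (set_var x \<nu> \<mu> (x \<nu> \<mu>) i \<psi> - set_var x \<nu> \<mu> (x \<nu> \<mu>) j \<psi>) \<noteq> 0"
      "th (set_var x \<nu> \<mu> (x \<nu> \<mu>) j (\<psi> + 1) - set_var x \<nu> \<mu> (x \<nu> \<mu>) i (\<psi> + 1)) \<noteq> 0"
      using nz(1)[of \<psi>] nz(2)[of "\<psi> + 1"] \<psi> False by simp_all
    with False show ?thesis unfolding kk_def
      by (simp only: if_False) (intro field_differentiable_kron_compose field_differentiable_diff field_differentiable_set_var)
  qed
qed

lemma zp_dif: "i \<in> {1..N} \<Longrightarrow> j \<in> {1..N} \<Longrightarrow> i \<noteq> j \<Longrightarrow> zp i j \<in> dif N"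
  unfolding dif_def
proof (intro CollectI ballI)
  fix x \<nu> \<mu> assume ij: "i \<in> {1..N}" "j \<in> {1..N}" "i \<noteq> j" and x: "x \<in> U N"
  have "th (set_var x \<nu> \<mu> (x \<nu> \<mu>) j p - set_var x \<nu> \<mu> (x \<nu> \<mu>) i p) \<noteq> 0"
    using U_D[OF x ij(2,1) ij(3)[symmetric] in_p(2)] by simp
  then show "(\<lambda>z. zp i j (set_var x \<nu> \<mu> z)) field_differentiable at (x \<nu> \<mu>)"
    unfolding zp_def by (intro field_differentiable_zeta_compose field_differentiable_diff field_differentiable_set_var)
qed

lemma VV_dif:
  assumes "f \<in> dif N" "i \<in> {1..N}" "j \<in> {1..N}" "i \<noteq> j"
  shows "VV i j f \<in> dif N"
proof -
  have "(\<lambda>x. (\<Sum>\<psi>\<in>{..<p}. kk \<psi> i j x * f (sw \<psi> i j x)) + zp i j x * f x) \<in> dif N"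
    using assms by (intro dif_intros dif_reblock kk_dif zp_dif block_perm_swb) auto
  then show ?thesis by (simp add: VV_def[abs_def])
qed

lemma holomorphic_vars_DD [holomorphic_vars_intros]:
  "holomorphic_vars p N f \<Longrightarrow> i \<in> {1..N} \<Longrightarrow> holomorphic_vars p N (DD i f)"
  unfolding DD_def[abs_def] by (intro holomorphic_vars_intros)

lemma RR_dif:
  assumes "holomorphic_vars p N f" "i \<in> {1..N}" "j \<in> {1..N}" "i \<noteq> j"
  shows "RR i j f \<in> dif N"
  unfolding RR_def[abs_def]
  by (intro dif_intros VV_dif holomorphic_vars_dif[OF holomorphic_vars_DD] holomorphic_vars_dif assms)

subsection \<open>Linearity and locality\<close>

lemma DD_add:
  "f \<in> dif N \<Longrightarrow> g \<in> dif N \<Longrightarrow> x \<in> U N \<Longrightarrow> i \<in> {1..N} \<Longrightarrow> DD i (\<lambda>x. f x + g x) x = DD i f x + DD i g x"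
  by (simp add: DD_def partial_deriv_add[of _ N] sum.distrib distrib_left)

lemma DD_mult_const:
  "f \<in> dif N \<Longrightarrow> x \<in> U N \<Longrightarrow> i \<in> {1..N} \<Longrightarrow> DD i (\<lambda>x. c * f x) x = c * DD i f x"
  by (simp add: DD_def partial_deriv_mult[of "\<lambda>_. c" N] dif_const sum_distrib_left mult.left_commute)

lemma DD_diff:
  assumes "f \<in> dif N" "g \<in> dif N" "x \<in> U N" "i \<in> {1..N}"
  shows "DD i (\<lambda>x. f x - g x) x = DD i f x - DD i g x"
  using DD_add[OF assms(1) dif_mult[OF dif_const assms(2)] assms(3,4), of "- 1"]
    DD_mult_const[OF assms(2-), of "- 1"] by simp

lemma DD_sum:
  "(\<And>k. k \<in> I \<Longrightarrow> f k \<in> dif N) \<Longrightarrow> x \<in> U N \<Longrightarrow> i \<in> {1..N} \<Longrightarrow> DD i (\<lambda>x. \<Sum>k\<in>I. f k x) x = (\<Sum>k\<in>I. DD i (f k) x)"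
  unfolding DD_def by (subst sum.swap) (simp add: partial_deriv_sum[of _ _ N] sum_distrib_left)

lemma VV_sum: "VV i j (\<lambda>x. \<Sum>k\<in>I. f k x) x = (\<Sum>k\<in>I. VV i j (f k) x)"
  unfolding VV_def by (simp add: sum_distrib_left sum.distrib sum.swap[of _ I])

lemma VV_add: "VV i j (\<lambda>x. f x + g x) x = VV i j f x + VV i j g x"
  by (simp add: VV_def distrib_left sum.distrib)

lemma VV_diff: "VV i j (\<lambda>x. f x - g x) x = VV i j f x - VV i j g x"
  by (simp add: VV_def right_diff_distrib sum_subtractf)

lemma VV_mult_const: "VV i j (\<lambda>x. c * f x) x = c * VV i j f x"
  by (simp add: VV_def distrib_left sum_distrib_left mult.left_commute)

lemma RR_sum:
  assumes "\<And>k. k \<in> I \<Longrightarrow> f k \<in> dif N" "x \<in> U N" "i \<in> {1..N}" "j \<in> {1..N}"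
  shows "RR i j (\<lambda>x. \<Sum>k\<in>I. f k x) x = (\<Sum>k\<in>I. RR i j (f k) x)"
  using assms by (simp add: RR_def DD_sum[of _ _ N] VV_sum sum.distrib sum_subtractf)

lemma RR_mult_const:
  assumes "f \<in> dif N" "x \<in> U N" "i \<in> {1..N}" "j \<in> {1..N}"
  shows "RR i j (\<lambda>x. c * f x) x = c * RR i j f x"
  using assms by (simp add: RR_def DD_mult_const[of _ N] VV_mult_const algebra_simps)

lemma RR_add:
  assumes "f \<in> dif N" "g \<in> dif N" "x \<in> U N" "i \<in> {1..N}" "j \<in> {1..N}"
  shows "RR i j (\<lambda>x. f x + g x) x = RR i j f x + RR i j g x"
  using assms by (simp add: RR_def DD_add[of _ N] VV_add)

lemma RR_cong:
  assumes "\<And>y. y \<in> U N \<Longrightarrow> f y = g y" "x \<in> U N" "i \<in> {1..N}" "j \<in> {1..N}"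
  shows "RR i j f x = RR i j g x"
proof -
  have "DD i f x = DD i g x" "DD j f x = DD j g x" unfolding DD_def
    by (simp_all add: partial_deriv_cong[OF assms(1,2)])
  moreover have "f (sw \<psi> i j x) = g (sw \<psi> i j x)" for \<psi>
    by (intro assms(1) reblock_U[OF block_perm_swb] assms)
  ultimately show ?thesis using assms by (simp add: RR_def VV_def)
qed

subsection \<open>Commutation relations\<close>

text \<open>By \<open>inv\<close>, moving the variable in block \<open>l\<close> has the same effect
  as moving the one in block \<open>k\<close> backwards, so the two derivatives are
  opposite.\<close>

lemma partial_deriv_coefficient:
  assumes C: "C \<in> dif N" and x: "x \<in> U N" and kl: "k \<in> {1..N}" "l \<in> {1..N}" "k \<noteq> l" and \<mu>: "\<mu> \<in> {1..p}"
    and inv: "\<And>t. C (set_var x l \<mu> (x l \<mu> + t)) = C (set_var x k \<mu> (x k \<mu> - t))"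
  shows "partial_deriv k \<mu> C x + partial_deriv l \<mu> C x = 0"
proof -
  have "((\<lambda>z. C (set_var x k \<mu> (x k \<mu> + x l \<mu> - z))) has_field_derivative partial_deriv k \<mu> C x * (- 1)) (at (x l \<mu>))"
    by (rule DERIV_chain2[where f = "\<lambda>z. C (set_var x k \<mu> z)"])
      (use has_field_derivative_dif[OF C x kl(1) \<mu>] in \<open>auto intro!: derivative_eq_intros\<close>)
  moreover have "C (set_var x k \<mu> (x k \<mu> + x l \<mu> - z)) = C (set_var x l \<mu> z)" for z
    using inv[of "z - x l \<mu>"] by (simp add: algebra_simps)
  ultimately have "partial_deriv l \<mu> C x = - partial_deriv k \<mu> C x"
    using has_field_derivative_dif[OF C x kl(2) \<mu>] DERIV_unique by fastforce
  then show ?thesis by simp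
qed

lemma kk_set_var_other: "\<nu> \<noteq> k \<Longrightarrow> \<nu> \<noteq> l \<Longrightarrow> kk \<psi> k l (set_var x \<nu> \<mu> z) = kk \<psi> k l x"
  by (simp add: kk_def set_var_apply)

lemma zp_set_var_other: "\<nu> \<noteq> k \<Longrightarrow> \<nu> \<noteq> l \<Longrightarrow> zp k l (set_var x \<nu> \<mu> z) = zp k l x"
  by (simp add: zp_def set_var_apply)

lemma kk_set_var_diff: "k \<noteq> l \<Longrightarrow> kk \<psi> k l (set_var x l \<mu> (x l \<mu> + t)) = kk \<psi> k l (set_var x k \<mu> (x k \<mu> - t))"
  by (auto simp: kk_def set_var_apply algebra_simps)

lemma zp_set_var_diff: "k \<noteq> l \<Longrightarrow> zp k l (set_var x l \<mu> (x l \<mu> + t)) = zp k l (set_var x k \<mu> (x k \<mu> - t))"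
  by (auto simp: zp_def set_var_apply algebra_simps)

lemma partial_deriv_sw:
  assumes "i \<in> {1..N}" "j \<in> {1..N}"
  shows "partial_deriv \<nu> \<mu> (\<lambda>x. f (sw \<psi> i j x)) x = partial_deriv (swb \<psi> i j \<nu> \<mu>) \<mu> f (sw \<psi> i j x)"
proof -
  have "swb \<psi> i j (swb \<psi> i j \<nu> \<mu>) \<mu> = \<nu>" by (simp add: swb_def)
  then show ?thesis
    using partial_deriv_reblock[OF block_perm_swb[OF assms, of \<psi>], of "swb \<psi> i j \<nu> \<mu>" \<mu> f x] by simp
qed

lemma DD_coefficient_other:
  assumes C: "C \<in> dif N" and f: "f \<in> dif N" and x: "x \<in> U N" and kl: "k \<in> {1..N}" "l \<in> {1..N}" "i \<in> {1..N}" "i \<noteq> k" "i \<noteq> l"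
    and inv: "\<And>\<mu> z. C (set_var x i \<mu> z) = C x"
  shows "DD i (\<lambda>x. C x * f (sw \<psi> k l x)) x = C x * DD i f (sw \<psi> k l x)"
proof -
  have "partial_deriv i \<mu> (\<lambda>x. C x * f (sw \<psi> k l x)) x = C x * partial_deriv i \<mu> f (sw \<psi> k l x)" if "\<mu> \<in> {1..p}" for \<mu>
  proof -
    have "partial_deriv i \<mu> C x = 0" by (simp add: partial_deriv_def inv)
    moreover have "swb \<psi> k l i \<mu> = i" using kl by (simp add: swb_def Transposition.transpose_def)
    ultimately show ?thesis
      using partial_deriv_mult[OF C dif_reblock[OF f block_perm_swb[OF kl(1,2)]] x kl(3) that]
      by (simp add: partial_deriv_sw[OF kl(1,2)])
  qed
  then show ?thesis by (simp add: DD_def sum_distrib_left mult.left_commute)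
qed

text \<open>In each position the swap either fixes or exchanges the derivatives in the blocks
  \<open>k\<close> and \<open>l\<close>, so only their sum passes through it; the coefficient,
  depending on differences, is annihilated by this sum.\<close>

lemma DD_coefficient_sum:
  assumes C: "C \<in> dif N" and f: "f \<in> dif N" and x: "x \<in> U N" and kl: "k \<in> {1..N}" "l \<in> {1..N}" "k \<noteq> l"
    and inv: "\<And>\<mu> t. C (set_var x l \<mu> (x l \<mu> + t)) = C (set_var x k \<mu> (x k \<mu> - t))"
  shows "DD k (\<lambda>x. C x * f (sw \<psi> k l x)) x + DD l (\<lambda>x. C x * f (sw \<psi> k l x)) x =
    C x * (DD k f (sw \<psi> k l x) + DD l f (sw \<psi> k l x))"
proof -
  have "partial_deriv k \<mu> (\<lambda>x. C x * f (sw \<psi> k l x)) x + partial_deriv l \<mu> (\<lambda>x. C x * f (sw \<psi> k l x)) x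
    = C x * (partial_deriv k \<mu> f (sw \<psi> k l x) + partial_deriv l \<mu> f (sw \<psi> k l x))" if \<mu>: "\<mu> \<in> {1..p}" for \<mu>
  proof -
    note m = partial_deriv_mult[OF C dif_reblock[OF f block_perm_swb[OF kl(1,2)]] x _ \<mu>]
    have "partial_deriv k \<mu> (\<lambda>x. C x * f (sw \<psi> k l x)) x + partial_deriv l \<mu> (\<lambda>x. C x * f (sw \<psi> k l x)) x
      = C x * (partial_deriv (swb \<psi> k l k \<mu>) \<mu> f (sw \<psi> k l x) + partial_deriv (swb \<psi> k l l \<mu>) \<mu> f (sw \<psi> k l x)) +
        (partial_deriv k \<mu> C x + partial_deriv l \<mu> C x) * f (sw \<psi> k l x)"
      unfolding m[OF kl(1)] m[OF kl(2)] partial_deriv_sw[OF kl(1,2)] by (simp add: algebra_simps)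
    then show ?thesis
      unfolding partial_deriv_coefficient[OF C x kl \<mu> inv] by (simp add: swb_def add.commute)
  qed
  then show ?thesis
    unfolding DD_def sum.distrib[symmetric] distrib_left[symmetric]
    by (simp add: sum_distrib_left mult.left_commute)
qed

lemma DD_VV_other:
  assumes f: "f \<in> dif N" and x: "x \<in> U N" and kl: "k \<in> {1..N}" "l \<in> {1..N}" "k \<noteq> l" "i \<in> {1..N}" "i \<noteq> k" "i \<noteq> l"
  shows "DD i (VV k l f) x = VV k l (DD i f) x"
proof -
  have s: "(\<lambda>x. kk \<psi> k l x * f (sw \<psi> k l x)) \<in> dif N" if "\<psi> \<in> {..<p}" for \<psi>
    using f kl that by (intro dif_mult kk_dif dif_reblock block_perm_swb) auto
  \<comment> \<open>Written with the trivial swap \<open>sw 0\<close>, the last term of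
    \<open>VV\<close> falls under the same lemma as the others.\<close>
  have z: "(\<lambda>x. zp k l x * f (sw 0 k l x)) \<in> dif N" using f kl by (simp add: dif_mult zp_dif)
  have "DD i (VV k l f) x = (\<Sum>\<psi><p. DD i (\<lambda>x. kk \<psi> k l x * f (sw \<psi> k l x)) x) + DD i (\<lambda>x. zp k l x * f (sw 0 k l x)) x"
  proof -
    have "(\<lambda>x. \<Sum>\<psi><p. kk \<psi> k l x * f (sw \<psi> k l x)) \<in> dif N" by (rule dif_sum) (rule s)
    from DD_add[OF this z x kl(4)] show ?thesis
      unfolding VV_def by (subst DD_sum[OF _ x kl(4), symmetric]) (use s in auto)
  qed
  also have "\<dots> = VV k l (DD i f) x"
    unfolding VV_def using assms
    by (simp add: DD_coefficient_other[of _ N] kk_dif zp_dif kk_set_var_other zp_set_var_other del: sw_0) simp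
  finally show ?thesis .
qed

lemma DD_VV_sum:
  assumes f: "f \<in> dif N" and x: "x \<in> U N" and kl: "k \<in> {1..N}" "l \<in> {1..N}" "k \<noteq> l"
  shows "DD k (VV k l f) x + DD l (VV k l f) x = VV k l (DD k f) x + VV k l (DD l f) x"
proof -
  have s: "(\<lambda>x. kk \<psi> k l x * f (sw \<psi> k l x)) \<in> dif N" if "\<psi> \<in> {..<p}" for \<psi>
    using f kl that by (intro dif_mult kk_dif dif_reblock block_perm_swb) auto
  have z: "(\<lambda>x. zp k l x * f (sw 0 k l x)) \<in> dif N" using f kl by (simp add: dif_mult zp_dif)
  have D: "DD i (VV k l f) x = (\<Sum>\<psi><p. DD i (\<lambda>x. kk \<psi> k l x * f (sw \<psi> k l x)) x) + DD i (\<lambda>x. zp k l x * f (sw 0 k l x)) x"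
    if "i \<in> {1..N}" for i
  proof -
    have "(\<lambda>x. \<Sum>\<psi><p. kk \<psi> k l x * f (sw \<psi> k l x)) \<in> dif N" by (rule dif_sum) (rule s)
    from DD_add[OF this z x that] show ?thesis
      unfolding VV_def by (subst DD_sum[OF _ x that, symmetric]) (use s in auto)
  qed
  have "DD k (VV k l f) x + DD l (VV k l f) x =
      (\<Sum>\<psi><p. DD k (\<lambda>x. kk \<psi> k l x * f (sw \<psi> k l x)) x + DD l (\<lambda>x. kk \<psi> k l x * f (sw \<psi> k l x)) x) +
      (DD k (\<lambda>x. zp k l x * f (sw 0 k l x)) x + DD l (\<lambda>x. zp k l x * f (sw 0 k l x)) x)"
    using D kl by (simp add: sum.distrib)
  also have "\<dots> = (\<Sum>\<psi><p. kk \<psi> k l x * (DD k f (sw \<psi> k l x) + DD l f (sw \<psi> k l x))) +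
      zp k l x * (DD k f (sw 0 k l x) + DD l f (sw 0 k l x))"
    using assms by (intro arg_cong2[where f = "(+)"] sum.cong DD_coefficient_sum[of _ N] kk_dif zp_dif
        kk_set_var_diff zp_set_var_diff) auto
  also have "\<dots> = VV k l (DD k f) x + VV k l (DD l f) x"
    by (simp add: VV_def sum.distrib distrib_left)
  finally show ?thesis .
qed

lemma DD_commute:
  assumes f: "holomorphic_vars p N f" and i: "i \<in> {1..N}" "j \<in> {1..N}" and x: "x \<in> U N"
  shows "DD i (DD j f) x = DD j (DD i f) x"
proof -
  have D: "DD i (DD j f) x = (\<Sum>\<phi>\<in>{1..p}. \<Sum>\<psi>\<in>{1..p}. c_coeff ns \<psi> * c_coeff ns \<phi> * partial_deriv i \<psi> (partial_deriv j \<phi> f) x)"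
    if i: "i \<in> {1..N}" "j \<in> {1..N}" for i j
  proof -
    have d: "partial_deriv j \<phi> f \<in> dif N" if "\<phi> \<in> {1..p}" for \<phi>
      using that i f by (intro holomorphic_vars_dif holomorphic_vars_intros)
    have "DD i (DD j f) x = (\<Sum>\<phi>\<in>{1..p}. DD i (\<lambda>x. c_coeff ns \<phi> * partial_deriv j \<phi> f x) x)"
      unfolding DD_def[of j] by (rule DD_sum[OF _ x i(1)]) (intro dif_mult dif_const d)
    also have "\<dots> = (\<Sum>\<phi>\<in>{1..p}. c_coeff ns \<phi> * DD i (partial_deriv j \<phi> f) x)"
      by (intro sum.cong refl DD_mult_const[OF d x i(1)])
    finally show ?thesis by (simp add: DD_def sum_distrib_left mult_ac)
  qed
  show ?thesis unfolding D[OF i] D[OF i(2,1)]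
    by (subst sum.swap) (intro sum.cong refl, subst partial_deriv_commute[OF f], use i in simp_all)
qed


subsection \<open>The classical Yang-Baxter equation\<close>

definition AA :: "nat \<Rightarrow> nat \<Rightarrow> nat \<Rightarrow> pfun \<Rightarrow> pfun" where
  "AA \<psi> i j f x = kk \<psi> i j x * f (sw \<psi> i j x)"

lemma AA_antisym:
  assumes "x \<in> U N" "i \<in> {1..N}" "j \<in> {1..N}" "i \<noteq> j"
  shows "AA \<psi> j i f x = - AA \<psi> i j f x"
  by (simp add: AA_def kk_antisym[OF assms] sw_commute[of _ j i])

text \<open>The coefficient of the shorter swap involves only positions up to \<phi>, all moved by
  the longer one, so it is relabelled as a whole. The coefficient of the longer swap involves
  positions above \<psi> and is not affected by the shorter one.\<close>

lemma AA_exchange: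
  assumes "\<psi> < \<phi>" "i \<noteq> j" "k \<noteq> l"
  shows "AA \<phi> k l (AA \<psi> i j f) x =
    AA \<psi> (Transposition.transpose k l i) (Transposition.transpose k l j) (AA \<phi> k l f) x"
proof -
  define t where "t = Transposition.transpose k l"
  have tt: "t (t v) = v" for v by (simp add: t_def)
  have conj: "t (Transposition.transpose i j v) = Transposition.transpose (t i) (t j) (t v)" for v
    by (auto simp: Transposition.transpose_def t_def)
  have 1: "kk \<psi> i j (sw \<phi> k l x) = kk \<psi> (t i) (t j) x"
    using assms(1) by (auto simp: kk_def sw_apply t_def)
  have 2: "kk \<phi> k l (sw \<psi> (t i) (t j) x) = kk \<phi> k l x"
    using assms(1) by (auto simp: kk_def sw_apply)
  have "sw \<psi> i j (sw \<phi> k l x) \<nu> \<mu> = sw \<phi> k l (sw \<psi> (t i) (t j) x) \<nu> \<mu>" for \<nu> \<mu>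
    using assms(1) by (auto simp: sw_apply conj tt simp flip: t_def)
  then have 3: "sw \<psi> i j (sw \<phi> k l x) = sw \<phi> k l (sw \<psi> (t i) (t j) x)" by blast
  show ?thesis unfolding AA_def t_def[symmetric] 1 2 3 by (simp add: mult_ac)
qed

text \<open>
  For \<open>\<psi> \<noteq> \<phi>\<close> the products of two partial swaps are matched by commuting the longer swap past the
  shorter one; for \<open>\<psi> = \<phi>\<close> the two 3-cycles give two instances of Fay's identity.
\<close>

lemma AA_yang_baxter_diagonal:
  assumes x: "x \<in> U N" and abc: "a \<in> {1..N}" "b \<in> {1..N}" "c \<in> {1..N}" "a \<noteq> b" "a \<noteq> c" "b \<noteq> c" and \<psi>: "\<psi> < p"
  shows "AA \<psi> a b (AA \<psi> a c f) x - AA \<psi> a c (AA \<psi> a b f) x + AA \<psi> a b (AA \<psi> b c f) x - AA \<psi> b c (AA \<psi> a b f) x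
    + AA \<psi> a c (AA \<psi> b c f) x - AA \<psi> b c (AA \<psi> a c f) x = 0"
proof (cases "\<psi> = 0")
  \<comment> \<open>All swaps are trivial for \<psi> = 0, and multiplications by functions
    commute.\<close>
  case True
  then show ?thesis by (simp add: AA_def)
next
  case False
  define ua ub uc where u: "ua = x a \<psi>" "ub = x b \<psi>" "uc = x c \<psi>"
  define va vb vc where v: "va = x a (\<psi> + 1)" "vb = x b (\<psi> + 1)" "vc = x c (\<psi> + 1)"
  have nu: "th (x i \<psi> - x j \<psi>) \<noteq> 0" "th (x i (\<psi> + 1) - x j (\<psi> + 1)) \<noteq> 0" if "i \<in> {1..N}" "j \<in> {1..N}" "i \<noteq> j" for i j
    using U_D[OF x that, of \<psi>] U_D[OF x that, of "\<psi> + 1"] \<psi> False by simp_all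
  have k0: "kk \<psi> i j x = kron (x i \<psi> - x j \<psi>) (x j (\<psi> + 1) - x i (\<psi> + 1))" for i j
    using False by (simp add: kk_def)
  have k1: "kk \<psi> i j (sw \<psi> k l x) = kron (x (Transposition.transpose k l i) \<psi> - x (Transposition.transpose k l j) \<psi>) (x j (\<psi> + 1) - x i (\<psi> + 1))" for i j k l
    using False by (simp add: kk_def sw_apply)
  have "sw \<psi> a c (sw \<psi> a b x) \<nu> \<mu> = sw \<psi> b c (sw \<psi> a c x) \<nu> \<mu>" "sw \<psi> a b (sw \<psi> b c x) \<nu> \<mu> = sw \<psi> b c (sw \<psi> a c x) \<nu> \<mu>"
    "sw \<psi> a b (sw \<psi> a c x) \<nu> \<mu> = sw \<psi> b c (sw \<psi> a b x) \<nu> \<mu>" "sw \<psi> a c (sw \<psi> b c x) \<nu> \<mu> = sw \<psi> b c (sw \<psi> a b x) \<nu> \<mu>" for \<nu> \<mu>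
    using abc by (auto simp: sw_apply Transposition.transpose_def)
  then have s: "sw \<psi> a c (sw \<psi> a b x) = sw \<psi> b c (sw \<psi> a c x)" "sw \<psi> a b (sw \<psi> b c x) = sw \<psi> b c (sw \<psi> a c x)"
    "sw \<psi> a b (sw \<psi> a c x) = sw \<psi> b c (sw \<psi> a b x)" "sw \<psi> a c (sw \<psi> b c x) = sw \<psi> b c (sw \<psi> a b x)" by blast+
  have fay1: "kron (ua - uc) (vb - va) * kron (ub - uc) (vc - vb) =
      kron (ua - uc) (vc - va) * kron (ub - ua) (vc - vb) + kron (ub - uc) (vc - va) * kron (ua - ub) (vb - va)"
    using kron_fay[of "ua - uc" "ub - uc" "vb - va" "vc - vb"] nu abc by (simp add: u v)
  have fay2: "kron (ua - ub) (vb - va) * kron (ua - uc) (vc - vb) =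
      kron (ua - ub) (vc - va) * kron (ub - uc) (vc - vb) + kron (ua - uc) (vc - va) * kron (uc - ub) (vb - va)"
    using kron_fay[of "ua - ub" "ua - uc" "vb - va" "vc - vb"] nu abc by (simp add: u v)
  have t: "Transposition.transpose a b c = c" "Transposition.transpose a c b = b" "Transposition.transpose b c a = a"
    using abc by (simp_all add: Transposition.transpose_def)
  have 1: "AA \<psi> a b (AA \<psi> a c f) x + AA \<psi> a c (AA \<psi> b c f) x - AA \<psi> b c (AA \<psi> a b f) x = 0"
    unfolding AA_def s k0 k1 t
    using arg_cong[OF fay1[unfolded u v], of "\<lambda>z. z * f (sw \<psi> b c (sw \<psi> a c x))"] by (simp add: algebra_simps)
  have 2: "AA \<psi> a b (AA \<psi> b c f) x - AA \<psi> a c (AA \<psi> a b f) x - AA \<psi> b c (AA \<psi> a c f) x = 0"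
    unfolding AA_def s k0 k1 t
    using arg_cong[OF fay2[unfolded u v], of "\<lambda>z. z * f (sw \<psi> b c (sw \<psi> a b x))"] by (simp add: algebra_simps)
  from 1 2 show ?thesis by (simp add: algebra_simps)
qed

lemma AA_yang_baxter:
  fixes f :: pfun
  assumes x: "x \<in> U N" and abc: "a \<in> {1..N}" "b \<in> {1..N}" "c \<in> {1..N}" "a \<noteq> b" "a \<noteq> c" "b \<noteq> c" and \<psi>: "\<psi> < p" "\<phi> < p"
  defines "J \<equiv> \<lambda>\<psi> \<phi>. AA \<psi> a b (AA \<phi> a c f) x - AA \<psi> a c (AA \<phi> a b f) x + AA \<psi> a b (AA \<phi> b c f) x - AA \<psi> b c (AA \<phi> a b f) x
    + AA \<psi> a c (AA \<phi> b c f) x - AA \<psi> b c (AA \<phi> a c f) x"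
  shows "J \<psi> \<phi> + J \<phi> \<psi> = 0"
proof -
  have off: "J \<psi> \<phi> + J \<phi> \<psi> = 0" if lt: "\<psi> < \<phi>" for \<psi> \<phi>
  proof -
    have t: "Transposition.transpose a b a = b" "Transposition.transpose a b b = a" "Transposition.transpose a b c = c"
      "Transposition.transpose a c a = c" "Transposition.transpose a c c = a" "Transposition.transpose a c b = b"
      "Transposition.transpose b c b = c" "Transposition.transpose b c c = b" "Transposition.transpose b c a = a"
      using abc by (simp_all add: Transposition.transpose_def)
    note e = AA_exchange[OF lt, of _ _ _ _ f x]
    note ne = abc(4-6) abc(4-6)[symmetric]
    have anti: "AA \<psi> c b g x = - AA \<psi> b c g x" "AA \<psi> b a g x = - AA \<psi> a b g x" "AA \<psi> c a g x = - AA \<psi> a c g x" for g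
      by (rule AA_antisym[OF x]; use abc in auto)+
    \<comment> \<open>The six exchange relations; a relabelled pair may come out in reverse order,
      hence the signs.\<close>
    have "AA \<phi> a b (AA \<psi> a c f) x = AA \<psi> b c (AA \<phi> a b f) x" "AA \<phi> a c (AA \<psi> a b f) x = - AA \<psi> b c (AA \<phi> a c f) x"
      "AA \<phi> a b (AA \<psi> b c f) x = AA \<psi> a c (AA \<phi> a b f) x" "AA \<phi> b c (AA \<psi> a b f) x = AA \<psi> a c (AA \<phi> b c f) x"
      "AA \<phi> a c (AA \<psi> b c f) x = - AA \<psi> a b (AA \<phi> a c f) x" "AA \<phi> b c (AA \<psi> a c f) x = AA \<psi> a b (AA \<phi> b c f) x"
      using e[of a c a b] e[of a b a c] e[of b c a b] e[of a b b c] e[of b c a c] e[of a c b c] ne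
      by (simp_all add: t anti)
    then show ?thesis by (simp add: J_def)
  qed
  show ?thesis
  proof (rule linorder_cases[of \<psi> \<phi>])
    assume "\<psi> = \<phi>"
    then show ?thesis using AA_yang_baxter_diagonal[OF x abc \<psi>(1), of f] by (simp add: J_def)
  qed (use off[of \<psi> \<phi>] off[of \<phi> \<psi>] in \<open>simp_all add: add.commute\<close>)
qed

lemma VV_eq: "VV i j f x = (\<Sum>\<psi><p. AA \<psi> i j f x) + zp i j x * f x"
  by (simp add: VV_def AA_def)

text \<open>The coefficients \<open>zp\<close> live in position \<open>p\<close>, which no swap with
  \<psi> < p moves; they commute with all other terms and drop out of the commutator.\<close>

lemma VV_VV_diff:
  "VV i j (VV k l f) x - VV k l (VV i j f) x =
    (\<Sum>\<psi><p. \<Sum>\<phi><p. AA \<psi> i j (AA \<phi> k l f) x - AA \<psi> k l (AA \<phi> i j f) x)"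
proof -
  have z: "zp k l (sw \<psi> i j x) = zp k l x" if "\<psi> < p" for \<psi> i j k l
    using that by (auto simp: zp_def sw_apply)
  have *: "VV i j (VV k l f) x = (\<Sum>\<psi><p. \<Sum>\<phi><p. AA \<psi> i j (AA \<phi> k l f) x) +
      zp k l x * (\<Sum>\<psi><p. AA \<psi> i j f x) + zp i j x * (\<Sum>\<psi><p. AA \<psi> k l f x) + zp i j x * zp k l x * f x" for i j k l
  proof -
    have "(\<Sum>\<psi><p. AA \<psi> i j (VV k l f) x) = (\<Sum>\<psi><p. (\<Sum>\<phi><p. AA \<psi> i j (AA \<phi> k l f) x) + zp k l x * AA \<psi> i j f x)"
    proof (rule sum.cong[OF refl])
      fix \<psi> assume "\<psi> \<in> {..<p}"
      then show "AA \<psi> i j (VV k l f) x = (\<Sum>\<phi><p. AA \<psi> i j (AA \<phi> k l f) x) + zp k l x * AA \<psi> i j f x"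
        using z by (simp add: AA_def VV_def sum_distrib_left distrib_left mult_ac)
    qed
    then show ?thesis
      unfolding VV_eq[of i j] by (simp add: VV_eq[of k l] sum.distrib sum_distrib_left distrib_left mult_ac)
  qed
  show ?thesis unfolding *[of i j k l] *[of k l i j] by (simp add: sum_subtractf mult_ac)
qed

text \<open>Only the sum of \<open>J \<psi> \<phi>\<close> and \<open>J \<phi> \<psi>\<close> is
  known to vanish, so the double sum is added to its own transpose.\<close>

lemma VV_yang_baxter:
  assumes x: "x \<in> U N" and abc: "a \<in> {1..N}" "b \<in> {1..N}" "c \<in> {1..N}" "a \<noteq> b" "a \<noteq> c" "b \<noteq> c"
  shows "(VV a b (VV a c f) x - VV a c (VV a b f) x) + (VV a b (VV b c f) x - VV b c (VV a b f) x)
    + (VV a c (VV b c f) x - VV b c (VV a c f) x) = 0"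
proof -
  define J where "J = (\<lambda>\<psi> \<phi>. AA \<psi> a b (AA \<phi> a c f) x - AA \<psi> a c (AA \<phi> a b f) x + AA \<psi> a b (AA \<phi> b c f) x - AA \<psi> b c (AA \<phi> a b f) x
    + AA \<psi> a c (AA \<phi> b c f) x - AA \<psi> b c (AA \<phi> a c f) x)"
  have eq: "(VV a b (VV a c f) x - VV a c (VV a b f) x) + (VV a b (VV b c f) x - VV b c (VV a b f) x)
    + (VV a c (VV b c f) x - VV b c (VV a c f) x) = (\<Sum>\<psi><p. \<Sum>\<phi><p. J \<psi> \<phi>)"
    unfolding VV_VV_diff sum.distrib[symmetric] J_def by (intro sum.cong refl) simp
  have "(\<Sum>\<psi><p. \<Sum>\<phi><p. J \<psi> \<phi>) + (\<Sum>\<psi><p. \<Sum>\<phi><p. J \<psi> \<phi>) = (\<Sum>\<psi><p. \<Sum>\<phi><p. J \<psi> \<phi> + J \<phi> \<psi>)"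
    unfolding sum.distrib by (subst (3) sum.swap) simp
  also have "\<dots> = 0"
    using AA_yang_baxter[OF x abc] unfolding J_def by (intro sum.neutral ballI) auto
  finally have "2 * (\<Sum>\<psi><p. \<Sum>\<phi><p. J \<psi> \<phi>) = 0" by simp
  then show ?thesis unfolding eq by simp
qed

lemma VV_commute:
  assumes "i \<noteq> k" "i \<noteq> l" "j \<noteq> k" "j \<noteq> l"
  shows "VV i j (VV k l f) x = VV k l (VV i j f) x"
proof -
  have "AA \<psi> i j (AA \<phi> k l f) x = AA \<phi> k l (AA \<psi> i j f) x" for \<psi> \<phi>
  proof -
    have k: "kk \<phi> k l (sw \<psi> i j x) = kk \<phi> k l x" "kk \<psi> i j (sw \<phi> k l x) = kk \<psi> i j x"
      using assms by (auto simp: kk_def sw_apply Transposition.transpose_def)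
    have "sw \<phi> k l (sw \<psi> i j x) \<nu> \<mu> = sw \<psi> i j (sw \<phi> k l x) \<nu> \<mu>" for \<nu> \<mu>
      using assms by (auto simp: sw_apply Transposition.transpose_def)
    then have "sw \<phi> k l (sw \<psi> i j x) = sw \<psi> i j (sw \<phi> k l x)" by blast
    then show ?thesis by (simp add: AA_def k mult_ac)
  qed
  then have "(\<Sum>\<psi><p. \<Sum>\<phi><p. AA \<psi> i j (AA \<phi> k l f) x) = (\<Sum>\<psi><p. \<Sum>\<phi><p. AA \<psi> k l (AA \<phi> i j f) x)"
    by (subst sum.swap) simp
  then have "VV i j (VV k l f) x - VV k l (VV i j f) x = 0"
    unfolding VV_VV_diff sum_subtractf by simp
  then show ?thesis by simp
qed

lemma RR_RR:
  assumes f: "holomorphic_vars p N f" and x: "x \<in> U N" and ij: "i \<in> {1..N}" "j \<in> {1..N}" and kl: "k \<in> {1..N}" "l \<in> {1..N}" "k \<noteq> l"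
  shows "RR i j (RR k l f) x = DD i (DD k f) x - DD i (DD l f) x + DD i (VV k l f) x
    - (DD j (DD k f) x - DD j (DD l f) x + DD j (VV k l f) x)
    + VV i j (DD k f) x - VV i j (DD l f) x + VV i j (VV k l f) x"
proof -
  have dk: "DD k f \<in> dif N" and dl: "DD l f \<in> dif N"
    using f kl by (intro holomorphic_vars_dif holomorphic_vars_DD; simp)+
  have dv: "VV k l f \<in> dif N" by (intro VV_dif holomorphic_vars_dif f kl)
  note d = dk dl dv dif_diff[OF dk dl]
  have D: "DD i (RR k l f) x = DD i (DD k f) x - DD i (DD l f) x + DD i (VV k l f) x" if "i \<in> {1..N}" for i
    unfolding RR_def[abs_def] using d x that by (simp add: DD_add[of _ N] DD_diff[of _ N])
  have "VV i j (RR k l f) x = VV i j (DD k f) x - VV i j (DD l f) x + VV i j (VV k l f) x"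
    unfolding RR_def[abs_def] by (simp add: VV_add VV_diff)
  then show ?thesis unfolding RR_def[of i j] D[OF ij(1)] D[OF ij(2)] by simp
qed

text \<open>
  In each commutator with a potential, the derivatives combine to weights that are equal on the two
  blocks of the potential.
\<close>

theorem RR_yang_baxter:
  assumes f: "holomorphic_vars p N f" and x: "x \<in> U N"
    and abc: "a \<in> {1..N}" "b \<in> {1..N}" "c \<in> {1..N}" "a \<noteq> b" "a \<noteq> c" "b \<noteq> c"
  shows "(RR a b (RR a c f) x - RR a c (RR a b f) x) + (RR a b (RR b c f) x - RR b c (RR a b f) x)
    + (RR a c (RR b c f) x - RR b c (RR a c f) x) = 0"
proof -
  note d = holomorphic_vars_dif[OF f]
  note ne = abc(4-6) abc(4-6)[symmetric]
  note R = RR_RR[OF f x]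
  have c: "DD b (DD a f) x = DD a (DD b f) x" "DD c (DD a f) x = DD a (DD c f) x" "DD c (DD b f) x = DD b (DD c f) x"
    using DD_commute[OF f _ _ x] abc by blast+
  have o: "DD c (VV a b f) x = VV a b (DD c f) x" "DD b (VV a c f) x = VV a c (DD b f) x" "DD a (VV b c f) x = VV b c (DD a f) x"
    by (rule DD_VV_other[OF d x]; use abc in auto)+
  have s: "DD a (VV a b f) x + DD b (VV a b f) x = VV a b (DD a f) x + VV a b (DD b f) x"
    "DD a (VV a c f) x + DD c (VV a c f) x = VV a c (DD a f) x + VV a c (DD c f) x"
    "DD b (VV b c f) x + DD c (VV b c f) x = VV b c (DD b f) x + VV b c (DD c f) x"
    by (rule DD_VV_sum[OF d x]; use abc in auto)+
  have 1: "RR a b (RR a c f) x - RR a c (RR a b f) x + (RR a b (RR b c f) x - RR b c (RR a b f) x) + (RR a c (RR b c f) x - RR b c (RR a c f) x)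
    = (DD a (VV a c f) x + DD c (VV a c f) x - VV a c (DD a f) x - VV a c (DD c f) x)
    + (VV a b (DD a f) x + VV a b (DD b f) x - DD a (VV a b f) x - DD b (VV a b f) x)
    + (VV b c (DD b f) x + VV b c (DD c f) x - DD b (VV b c f) x - DD c (VV b c f) x)
    + ((VV a b (VV a c f) x - VV a c (VV a b f) x) + (VV a b (VV b c f) x - VV b c (VV a b f) x)
    + (VV a c (VV b c f) x - VV b c (VV a c f) x))"
    unfolding R[OF abc(1,2) abc(1,3) abc(5)] R[OF abc(1,3) abc(1,2) abc(4)] R[OF abc(1,2) abc(2,3) abc(6)]
      R[OF abc(2,3) abc(1,2) abc(4)] R[OF abc(1,3) abc(2,3) abc(6)] R[OF abc(2,3) abc(1,3) abc(5)] c o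
    by (simp add: algebra_simps)
  show ?thesis unfolding 1 VV_yang_baxter[OF x abc] by (simp add: diff_diff_eq s)
qed

lemma RR_commute:
  assumes f: "holomorphic_vars p N f" and x: "x \<in> U N"
    and abcd: "a \<in> {1..N}" "b \<in> {1..N}" "c \<in> {1..N}" "d \<in> {1..N}" "a \<noteq> b" "c \<noteq> d" "a \<noteq> c" "a \<noteq> d" "b \<noteq> c" "b \<noteq> d"
  shows "RR a b (RR c d f) x = RR c d (RR a b f) x"
proof -
  note dd = holomorphic_vars_dif[OF f]
  have o: "DD a (VV c d f) x = VV c d (DD a f) x" "DD b (VV c d f) x = VV c d (DD b f) x"
     "DD c (VV a b f) x = VV a b (DD c f) x" "DD d (VV a b f) x = VV a b (DD d f) x"
    by (rule DD_VV_other[OF dd x]; use abcd in auto)+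
  have c: "DD a (DD c f) x = DD c (DD a f) x" "DD a (DD d f) x = DD d (DD a f) x"
     "DD b (DD c f) x = DD c (DD b f) x" "DD b (DD d f) x = DD d (DD b f) x"
    using DD_commute[OF f _ _ x] abcd by blast+
  have v: "VV a b (VV c d f) x = VV c d (VV a b f) x"
    using abcd by (intro VV_commute) auto
  show ?thesis unfolding RR_RR[OF f x abcd(1,2,3,4,6)] RR_RR[OF f x abcd(3,4,1,2,5)] o c v by simp
qed

section \<open>Quasi-periodicity of the bracket\<close>

text \<open>
  The two periods, each with the factor by which it scales the exponent of the multiplier, so that
  both can be treated at once.
\<close>

definition periods :: "(complex \<times> complex) set" where
  "periods = {(1, 0), (\<eta>, 1)}"

definition lin :: "nat \<Rightarrow> (nat \<Rightarrow> complex) \<Rightarrow> complex" where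
  "lin \<mu> u = of_nat (ns ! (\<mu> - 1)) * u \<mu> - (if \<mu> = 1 then 0 else u (\<mu> - 1)) - (if \<mu> = p then 0 else u (\<mu> + 1))"

definition mul :: "complex \<Rightarrow> nat \<Rightarrow> (nat \<Rightarrow> complex) \<Rightarrow> complex" where
  "mul e \<mu> u = ee (- (e * lin \<mu> u))"

definition shift :: "complex \<Rightarrow> nat \<Rightarrow> nat \<Rightarrow> point \<Rightarrow> point" where
  "shift \<omega> \<nu> \<mu> x = set_var x \<nu> \<mu> (x \<nu> \<mu> + \<omega>)"

text \<open>The set \<open>X\<close> is \<open>U N\<close> for functions with poles and
  \<open>UNIV\<close> for their holomorphic extensions.\<close>

definition quasi :: "point set \<Rightarrow> nat \<Rightarrow> pfun \<Rightarrow> bool" where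
  "quasi X N f \<longleftrightarrow> (\<forall>(\<omega>, e)\<in>periods. \<forall>x\<in>X. \<forall>\<nu>\<in>{1..N}. \<forall>\<mu>\<in>{1..p}. f (shift \<omega> \<nu> \<mu> x) = mul e \<mu> (x \<nu>) * f x)"

text \<open>\<open>sym_theta\<close> without the symmetry, since tensor products and the single
  summands of a symmetrization lack it.\<close>

definition TH :: "nat \<Rightarrow> pfun set" where
  "TH N = {f. holomorphic_vars p N f \<and> quasi UNIV N f}"

lemma quasiD: "quasi X N f \<Longrightarrow> (\<omega>, e) \<in> periods \<Longrightarrow> x \<in> X \<Longrightarrow> \<nu> \<in> {1..N} \<Longrightarrow> \<mu> \<in> {1..p} \<Longrightarrow>
    f (shift \<omega> \<nu> \<mu> x) = mul e \<mu> (x \<nu>) * f x"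
  unfolding quasi_def by blast

lemma quasiI: "(\<And>\<omega> e x \<nu> \<mu>. (\<omega>, e) \<in> periods \<Longrightarrow> x \<in> X \<Longrightarrow> \<nu> \<in> {1..N} \<Longrightarrow> \<mu> \<in> {1..p} \<Longrightarrow>
    f (shift \<omega> \<nu> \<mu> x) = mul e \<mu> (x \<nu>) * f x) \<Longrightarrow> quasi X N f"
  unfolding quasi_def by blast

lemma TH_D: "f \<in> TH N \<Longrightarrow> holomorphic_vars p N f" "f \<in> TH N \<Longrightarrow> quasi UNIV N f"
  by (simp_all add: TH_def)

lemma shift_apply: "shift \<omega> \<nu> \<mu> x a b = (if a = \<nu> \<and> b = \<mu> then x \<nu> \<mu> + \<omega> else x a b)"
  by (simp add: shift_def set_var_apply)

lemma multiplier_eq: "multiplier \<eta> ns \<mu> u = mul 1 \<mu> u"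
proof -
  have "- 2 * of_real pi * \<i> * z = 2 * of_real pi * \<i> * (- (1 * z))" for z :: complex by simp
  then show ?thesis unfolding multiplier_def mul_def lin_def ee_def by (rule arg_cong[where f = exp])
qed

lemma mul_0 [simp]: "mul 0 \<mu> u = 1"
  by (simp add: mul_def)

lemma mul_nonzero [simp]: "mul e \<mu> u \<noteq> 0"
  by (simp add: mul_def)

lemma sym_theta_iff:
  "f \<in> sym_theta \<eta> ns N \<longleftrightarrow> f \<in> TH N \<and> (\<forall>\<sigma> x. \<sigma> permutes {1..N} \<longrightarrow> f (\<lambda>\<nu>. x (\<sigma> \<nu>)) = f x)"
proof -
  have "quasi UNIV N f \<longleftrightarrow> (\<forall>x. \<forall>\<nu>\<in>{1..N}. \<forall>\<mu>\<in>{1..p}.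
      f (set_var x \<nu> \<mu> (x \<nu> \<mu> + 1)) = f x \<and> f (set_var x \<nu> \<mu> (x \<nu> \<mu> + \<eta>)) = mul 1 \<mu> (x \<nu>) * f x)"
    unfolding quasi_def periods_def shift_def
    by (simp only: ball_simps case_prod_conv mul_0 mult_1_left simp_thms) blast
  then show ?thesis unfolding sym_theta_def TH_def multiplier_eq mem_Collect_eq by argo
qed

text \<open>The factor \<open>1 - 2 * e\<close> encodes the sign: 1 for the period 1 and -1 for the
  period \<eta>.\<close>

lemma theta_period: "(\<omega>, e) \<in> periods \<Longrightarrow> th (z + \<omega>) = (1 - 2 * e) * ee (- (e * z)) * th z"
  by (auto simp: periods_def theta_add_1 theta_add_eta)

lemma period_sign_nonzero: "(\<omega>, e) \<in> periods \<Longrightarrow> 1 - 2 * e \<noteq> 0"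
  by (auto simp: periods_def)

lemma theta_period_eq_0: "(\<omega>, e) \<in> periods \<Longrightarrow> th (z + \<omega>) = 0 \<longleftrightarrow> th z = 0"
  by (auto simp: periods_def theta_add_1 theta_add_eta)

lemma theta_period_diff_eq_0: "(\<omega>, e) \<in> periods \<Longrightarrow> th (z - \<omega>) = 0 \<longleftrightarrow> th z = 0"
  using theta_period_eq_0[of \<omega> e "z - \<omega>"] by simp

lemma kron_period:
  assumes "(\<omega>, e) \<in> periods"
  shows "kron (u + \<omega>) v = ee (- (e * v)) * kron u v" "kron u (v - \<omega>) = ee (e * u) * kron u v"
proof -
  from assms consider "\<omega> = 1" "e = 0" | "\<omega> = \<eta>" "e = 1" by (auto simp: periods_def)
  then show "kron (u + \<omega>) v = ee (- (e * v)) * kron u v" "kron u (v - \<omega>) = ee (e * u) * kron u v"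
    by (cases; simp only: kron_add_1 kron_add_eta kron_diff_1 kron_diff_eta mult_zero_left mult_1_left minus_zero ee_0)+
qed

lemma zeta_period:
  assumes "(\<omega>, e) \<in> periods" "th z \<noteq> 0"
  shows "zeta (z - \<omega>) = zeta z + 2 * of_real pi * \<i> * e"
proof -
  from assms(1) consider "\<omega> = 1" "e = 0" | "\<omega> = \<eta>" "e = 1" by (auto simp: periods_def)
  then show ?thesis
    by cases (simp_all only: zeta_diff_1 zeta_diff_eta[OF assms(2)] mult_zero_right mult_1_right add_0_right)
qed

lemma shift_U: "(\<omega>, e) \<in> periods \<Longrightarrow> x \<in> U N \<Longrightarrow> shift \<omega> \<nu> \<mu> x \<in> U N"
  unfolding off_poles_def
proof (intro CollectI ballI impI)
  fix a b c assume per: "(\<omega>, e) \<in> periods" and x: "x \<in> {x. \<forall>\<nu>\<in>{1..N}. \<forall>\<nu>'\<in>{1..N}. \<nu> \<noteq> \<nu>' \<longrightarrow> (\<forall>\<mu>\<in>{1..p}. th (x \<nu> \<mu> - x \<nu>' \<mu>) \<noteq> 0)}"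
    and abc: "a \<in> {1..N}" "b \<in> {1..N}" "a \<noteq> b" "c \<in> {1..p}"
  have "th (x a c - x b c) \<noteq> 0" using x abc by blast
  moreover have "shift \<omega> \<nu> \<mu> x a c - shift \<omega> \<nu> \<mu> x b c \<in> {x a c - x b c, x a c - x b c + \<omega>, x a c - x b c - \<omega>}"
    using abc(3) by (auto simp: shift_apply algebra_simps)
  ultimately show "th (shift \<omega> \<nu> \<mu> x a c - shift \<omega> \<nu> \<mu> x b c) \<noteq> 0"
    using theta_period_eq_0[OF per] theta_period_diff_eq_0[OF per] by fastforce
qed

text \<open>The entry of the tridiagonal matrix in row \<mu> and column \<phi>, which is the
  coefficient of \<open>u \<phi>\<close> in \<open>lin \<mu> u\<close>.\<close>

definition kap :: "nat \<Rightarrow> nat \<Rightarrow> complex" where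
  "kap \<mu> \<phi> = (if \<phi> = \<mu> then of_nat (ns ! (\<mu> - 1)) else 0) - (if \<mu> \<noteq> 1 \<and> \<phi> = \<mu> - 1 then 1 else 0)
    - (if \<mu> \<noteq> p \<and> \<phi> = \<mu> + 1 then 1 else 0)"

text \<open>The right-hand side of the linear system solved by the \<open>c_coeff\<close>; for
  \<open>p = 1\<close> both ends of the chain coincide and the value is 2.\<close>

definition bnd :: "nat \<Rightarrow> complex" where
  "bnd \<mu> = (if \<mu> = 1 then 1 else 0) + (if \<mu> = p then 1 else 0)"

lemma lin_set_var:
  assumes "\<mu> \<in> {1..p}"
  shows "lin \<mu> (set_var x \<nu> \<phi> z \<nu>) = lin \<mu> (x \<nu>) + kap \<mu> \<phi> * (z - x \<nu> \<phi>)"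
proof -
  define \<delta> where "\<delta> m = (if \<phi> = m then 1 else 0 :: complex)" for m
  have 1: "set_var x \<nu> \<phi> z \<nu> m = x \<nu> m + \<delta> m * (z - x \<nu> \<phi>)" for m
    by (auto simp: set_var_apply \<delta>_def)
  have 2: "kap \<mu> \<phi> = of_nat (ns ! (\<mu> - 1)) * \<delta> \<mu> - (if \<mu> = 1 then 0 else \<delta> (\<mu> - 1)) - (if \<mu> = p then 0 else \<delta> (\<mu> + 1))"
    by (simp add: kap_def \<delta>_def)
  show ?thesis unfolding lin_def 1 2
    by (cases "\<mu> = 1"; cases "\<mu> = p"; simp only: if_True if_False refl) (simp_all add: algebra_simps)
qed

lemma sum_c_coeff_kap:
  assumes \<mu>: "\<mu> \<in> {1..p}"
  shows "(\<Sum>\<phi>\<in>{1..p}. c_coeff ns \<phi> * kap \<mu> \<phi>) = bnd \<mu>"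
proof -
  have "(\<Sum>\<phi>\<in>{1..p}. c_coeff ns \<phi> * kap \<mu> \<phi>) =
     (\<Sum>\<phi>\<in>{1..p}. if \<phi> = \<mu> then c_coeff ns \<phi> * of_nat (ns ! (\<mu> - 1)) else 0)
     - (\<Sum>\<phi>\<in>{1..p}. if \<phi> = \<mu> - 1 then (if \<mu> = 1 then 0 else c_coeff ns \<phi>) else 0)
     - (\<Sum>\<phi>\<in>{1..p}. if \<phi> = \<mu> + 1 then (if \<mu> = p then 0 else c_coeff ns \<phi>) else 0)"
    unfolding sum_subtractf[symmetric] by (intro sum.cong refl) (auto simp: kap_def algebra_simps)
  also have "(\<Sum>\<phi>\<in>{1..p}. if \<phi> = \<mu> - 1 then (if \<mu> = 1 then 0 else c_coeff ns \<phi>) else 0) = (if \<mu> = 1 then 0 else c_coeff ns (\<mu> - 1))"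
  proof (cases "\<mu> = 1")
    case False
    then have "\<mu> - 1 \<in> {1..p}" using \<mu> by auto
    then show ?thesis by (subst sum.delta) simp_all
  qed simp
  also have "(\<Sum>\<phi>\<in>{1..p}. if \<phi> = \<mu> + 1 then (if \<mu> = p then 0 else c_coeff ns \<phi>) else 0) = (if \<mu> = p then 0 else c_coeff ns (\<mu> + 1))"
  proof (cases "\<mu> = p")
    case False
    then have "\<mu> + 1 \<in> {1..p}" using \<mu> by auto
    then show ?thesis by (subst sum.delta) simp_all
  qed simp
  also have "(\<Sum>\<phi>\<in>{1..p}. if \<phi> = \<mu> then c_coeff ns \<phi> * of_nat (ns ! (\<mu> - 1)) else 0) - (if \<mu> = 1 then 0 else c_coeff ns (\<mu> - 1))
      - (if \<mu> = p then 0 else c_coeff ns (\<mu> + 1)) = c_coeff ns \<mu> * of_nat (ns ! (\<mu> - 1)) - (if \<mu> = 1 then 0 else c_coeff ns (\<mu> - 1))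
      - (if \<mu> = p then 0 else c_coeff ns (\<mu> + 1))"
    using \<mu> by (subst sum.delta) simp_all
  also have "\<dots> = bnd \<mu>"
    using c_coeff_tridiagonal[OF ns_ge_2, of \<mu>] \<mu> by (simp add: bnd_def mult.commute)
  finally show ?thesis .
qed

lemma mul_has_field_derivative:
  assumes \<mu>: "\<mu> \<in> {1..p}"
  shows "((\<lambda>z. mul e \<mu> (set_var x \<nu> \<phi> z \<nu>)) has_field_derivative
    - (2 * of_real pi * \<i> * e * kap \<mu> \<phi>) * mul e \<mu> (x \<nu>)) (at (x \<nu> \<phi>))"
proof -
  have "((\<lambda>z. - (e * (lin \<mu> (x \<nu>) + kap \<mu> \<phi> * (z - x \<nu> \<phi>)))) has_field_derivative - (e * kap \<mu> \<phi>)) (at (x \<nu> \<phi>))"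
    by (auto intro!: derivative_eq_intros)
  from DERIV_chain2[OF has_field_derivative_ee this]
  show ?thesis unfolding mul_def lin_set_var[OF \<mu>] by (simp add: mult_ac)
qed

text \<open>Derivative of the functional equation. The multiplier depends on the block
  \<open>x \<nu>\<close> only, through \<open>lin\<close>, whose partial derivatives are the numbers
  \<open>kap\<close>; so an extra term can appear only for i = \<nu>.\<close>

lemma partial_deriv_shift:
  assumes f: "f \<in> TH N" and per: "(\<omega>, e) \<in> periods" and \<nu>: "\<nu> \<in> {1..N}" "\<mu> \<in> {1..p}" and i: "i \<in> {1..N}" "\<phi> \<in> {1..p}"
  shows "partial_deriv i \<phi> f (shift \<omega> \<nu> \<mu> x) = mul e \<mu> (x \<nu>) *
    (partial_deriv i \<phi> f x - (if i = \<nu> then 2 * of_real pi * \<i> * e * kap \<mu> \<phi> else 0) * f x)"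
proof -
  define d where "d = (if i = \<nu> then - (2 * of_real pi * \<i> * e * kap \<mu> \<phi>) * mul e \<mu> (x \<nu>) else 0)"
  have m: "((\<lambda>z. mul e \<mu> (set_var x i \<phi> z \<nu>)) has_field_derivative d) (at (x i \<phi>))"
  proof (cases "i = \<nu>")
    case True then show ?thesis using mul_has_field_derivative[OF \<nu>(2)] by (simp add: d_def)
  next
    case False
    then have "set_var x i \<phi> z \<nu> = x \<nu>" for z by (intro ext) (simp add: set_var_apply)
    then show ?thesis using False by (simp add: d_def)
  qed
  have "((\<lambda>z. mul e \<mu> (set_var x i \<phi> z \<nu>) * f (set_var x i \<phi> z)) has_field_derivative
      d * f x + mul e \<mu> (x \<nu>) * partial_deriv i \<phi> f x) (at (x i \<phi>))"
    using DERIV_mult[OF m has_field_derivative_partial_deriv[OF TH_D(1)[OF f] i, of x "x i \<phi>"]] by (simp add: mult.commute add.commute)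
  moreover have "mul e \<mu> (set_var x i \<phi> z \<nu>) * f (set_var x i \<phi> z) = f (shift \<omega> \<nu> \<mu> (set_var x i \<phi> z))" for z
    using quasiD[OF TH_D(2)[OF f] per UNIV_I \<nu>] by simp
  ultimately have D: "((\<lambda>z. f (shift \<omega> \<nu> \<mu> (set_var x i \<phi> z))) has_field_derivative
      d * f x + mul e \<mu> (x \<nu>) * partial_deriv i \<phi> f x) (at (x i \<phi>))" by simp
  have "partial_deriv i \<phi> f (shift \<omega> \<nu> \<mu> x) = d * f x + mul e \<mu> (x \<nu>) * partial_deriv i \<phi> f x"
  proof (cases "(i, \<phi>) = (\<nu>, \<mu>)")
    case True
    have "((\<lambda>z. f (set_var x i \<phi> (z + \<omega>))) has_field_derivative
      d * f x + mul e \<mu> (x \<nu>) * partial_deriv i \<phi> f x) (at (x i \<phi>))"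
      using D True by (simp add: shift_def set_var_apply)
    then have "((\<lambda>z. f (set_var x i \<phi> z)) has_field_derivative
      d * f x + mul e \<mu> (x \<nu>) * partial_deriv i \<phi> f x) (at (x i \<phi> + \<omega>))"
      by (rule DERIV_shift[THEN iffD2])
    then show ?thesis using True unfolding partial_deriv_def[of i \<phi> f "shift \<omega> \<nu> \<mu> x"]
      by (simp add: shift_def set_var_apply DERIV_imp_deriv)
  next
    case False
    then have "shift \<omega> \<nu> \<mu> (set_var x i \<phi> z) = set_var (shift \<omega> \<nu> \<mu> x) i \<phi> z" for z
      by (auto simp: fun_eq_iff shift_apply set_var_apply)
    moreover have "shift \<omega> \<nu> \<mu> x i \<phi> = x i \<phi>" using False by (auto simp: shift_apply)
    ultimately show ?thesis using D unfolding partial_deriv_def[of i \<phi> f "shift \<omega> \<nu> \<mu> x"]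
      by (simp add: DERIV_imp_deriv)
  qed
  then show ?thesis by (simp add: d_def algebra_simps)
qed

text \<open>The weights \<open>c_coeff\<close> collapse the extra terms to \<open>bnd \<mu>\<close>,
  which lives at the ends of the chain. Exactly there the two functions \<open>zeta\<close> in
  \<open>VV\<close> produce the opposite term, see \<open>VV_shift\<close>.\<close>

lemma DD_shift:
  assumes f: "f \<in> TH N" and per: "(\<omega>, e) \<in> periods" and \<nu>: "\<nu> \<in> {1..N}" "\<mu> \<in> {1..p}" and i: "i \<in> {1..N}"
  shows "DD i f (shift \<omega> \<nu> \<mu> x) = mul e \<mu> (x \<nu>) * (DD i f x - (if i = \<nu> then 2 * of_real pi * \<i> * e * bnd \<mu> else 0) * f x)"
proof -
  have "DD i f (shift \<omega> \<nu> \<mu> x) = mul e \<mu> (x \<nu>) * (DD i f x -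
      (if i = \<nu> then 2 * of_real pi * \<i> * e else 0) * f x * (\<Sum>\<phi>\<in>{1..p}. c_coeff ns \<phi> * kap \<mu> \<phi>))"
    unfolding DD_def sum_distrib_left right_diff_distrib sum_subtractf[symmetric]
    by (intro sum.cong refl) (simp add: partial_deriv_shift[OF f per \<nu> i] algebra_simps)
  then show ?thesis unfolding sum_c_coeff_kap[OF \<nu>(2)] by simp
qed

text \<open>The multiplier belonging to the swapped point differs from that of \<open>x i\<close>
  only if \<mu> is adjacent to the cut between the positions \<psi> and \<psi> + 1, and then by the
  inverse of the factor which \<open>kron\<close> acquires. For \<psi> = 0 the quasi-period of
  \<open>zeta\<close> leaves an additive term instead.\<close>

lemma kk_sw_shift:
  assumes f: "f \<in> TH N" and per: "(\<omega>, e) \<in> periods" and ij: "i \<in> {1..N}" "j \<in> {1..N}" "i \<noteq> j" and \<mu>: "\<mu> \<in> {1..p}"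
    and x: "x \<in> U N" and \<psi>: "\<psi> < p"
  shows "kk \<psi> i j (shift \<omega> i \<mu> x) * f (sw \<psi> i j (shift \<omega> i \<mu> x)) = mul e \<mu> (x i) *
    (kk \<psi> i j x * f (sw \<psi> i j x) + (if \<psi> = 0 \<and> \<mu> = 1 then 2 * of_real pi * \<i> * e * f x else 0))"
proof -
  note q = quasiD[OF TH_D(2)[OF f] per UNIV_I _ \<mu>]
  show ?thesis
  proof (cases "\<psi> = 0")
    case True
    have "th (x j 1 - x i 1) \<noteq> 0" using U_D[OF x ij(2,1) ij(3)[symmetric], of 1] by simp
    from zeta_period[OF per this]
    have "kk 0 i j (shift \<omega> i \<mu> x) = kk 0 i j x + (if \<mu> = 1 then 2 * of_real pi * \<i> * e else 0)"
      using ij(3) by (auto simp: kk_def shift_apply algebra_simps)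
    then show ?thesis using True q[OF ij(1)] by (simp add: algebra_simps)
  next
    case False
    \<comment> \<open>\<open>k\<close> is the block in which the shifted variable is found after the
      swap.\<close>
    define k where "k = (if \<mu> \<le> \<psi> then j else i)"
    have k: "k \<in> {1..N}" using ij by (simp add: k_def)
    have "sw \<psi> i j (shift \<omega> i \<mu> x) = shift \<omega> k \<mu> (sw \<psi> i j x)"
      using ij(3) \<mu> by (auto simp: fun_eq_iff sw_apply shift_apply k_def Transposition.transpose_def)
    then have 1: "f (sw \<psi> i j (shift \<omega> i \<mu> x)) = mul e \<mu> (sw \<psi> i j x k) * f (sw \<psi> i j x)"
      using q[OF k] by simp
    \<comment> \<open>\<open>s\<close> is the change in the neighbour across the cut, which after
      the swap comes from the other block.\<close>
    define s where "s = (if \<mu> = \<psi> then x j (\<psi> + 1) - x i (\<psi> + 1) else if \<mu> = \<psi> + 1 then - (x i \<psi> - x j \<psi>) else 0)"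
    have "lin \<mu> (sw \<psi> i j x k) = lin \<mu> (x i) - s"
    proof -
      have swk: "sw \<psi> i j x k m = (if 1 \<le> m \<and> m \<le> \<psi> \<longleftrightarrow> \<mu> \<le> \<psi> then x i m else x j m)" for m
        by (simp add: sw_apply k_def)
      have 1: "(if \<mu> = 1 then 0 else sw \<psi> i j x k (\<mu> - 1)) =
          (if \<mu> = 1 then 0 else x i (\<mu> - 1)) + (if \<mu> = \<psi> + 1 then - (x i \<psi> - x j \<psi>) else 0)"
      proof (cases "\<mu> = 1")
        case False
        then have "1 \<le> \<mu> - 1" "\<mu> - 1 \<le> \<psi> \<longleftrightarrow> \<mu> \<le> \<psi> + 1" "\<mu> = \<psi> + 1 \<longrightarrow> \<mu> - 1 = \<psi>" using \<mu> by auto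
        with False show ?thesis unfolding swk by auto
      qed (use \<open>\<psi> \<noteq> 0\<close> in simp)
      have 2: "(if \<mu> = p then 0 else sw \<psi> i j x k (\<mu> + 1)) =
          (if \<mu> = p then 0 else x i (\<mu> + 1)) + (if \<mu> = \<psi> then x j (\<psi> + 1) - x i (\<psi> + 1) else 0)"
      proof (cases "\<mu> = p")
        case False
        have "1 \<le> \<mu> + 1" "\<mu> + 1 \<le> \<psi> \<longleftrightarrow> \<mu> \<le> \<psi> \<and> \<mu> \<noteq> \<psi>" by auto
        with False show ?thesis unfolding swk by auto
      qed (use \<psi> in simp)
      have 3: "sw \<psi> i j x k \<mu> = x i \<mu>" using \<mu> unfolding swk by simp
      show ?thesis unfolding lin_def 1 2 3 s_def by simp
    qed
    then have 2: "mul e \<mu> (sw \<psi> i j x k) = mul e \<mu> (x i) * ee (e * s)"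
      by (simp add: mul_def right_diff_distrib flip: ee_add)
    have 3: "kk \<psi> i j (shift \<omega> i \<mu> x) = ee (- (e * s)) * kk \<psi> i j x"
    proof -
      consider "\<mu> = \<psi>" | "\<mu> = \<psi> + 1" | "\<mu> \<noteq> \<psi>" "\<mu> \<noteq> \<psi> + 1" by blast
      then show ?thesis
      proof cases
        case 1
        then have "kk \<psi> i j (shift \<omega> i \<mu> x) = kron (x i \<psi> - x j \<psi> + \<omega>) (x j (\<psi> + 1) - x i (\<psi> + 1))"
          using False ij(3) by (simp add: kk_def shift_apply algebra_simps)
        then show ?thesis using False 1 unfolding kron_period(1)[OF per] by (simp add: s_def kk_def)
      next
        case 2
        then have "kk \<psi> i j (shift \<omega> i \<mu> x) = kron (x i \<psi> - x j \<psi>) (x j (\<psi> + 1) - x i (\<psi> + 1) - \<omega>)"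
          using False ij(3) by (simp add: kk_def shift_apply algebra_simps)
        then show ?thesis using False 2 unfolding kron_period(2)[OF per] by (simp add: s_def kk_def del: minus_diff_eq)
      next
        case 3
        then show ?thesis using False ij(3) by (simp add: s_def kk_def shift_apply)
      qed
    qed
    show ?thesis unfolding 1 2 3 using False by (simp add: ee_minus)
  qed
qed

lemma VV_shift:
  assumes f: "f \<in> TH N" and per: "(\<omega>, e) \<in> periods" and ij: "i \<in> {1..N}" "j \<in> {1..N}" "i \<noteq> j" and \<mu>: "\<mu> \<in> {1..p}"
    and x: "x \<in> U N"
  shows "VV i j f (shift \<omega> i \<mu> x) = mul e \<mu> (x i) * (VV i j f x + 2 * of_real pi * \<i> * e * bnd \<mu> * f x)"
proof -
  have "th (x j p - x i p) \<noteq> 0" using U_D[OF x ij(2,1) ij(3)[symmetric] in_p(2)] .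
  from zeta_period[OF per this]
  have z: "zp i j (shift \<omega> i \<mu> x) = zp i j x + (if \<mu> = p then 2 * of_real pi * \<i> * e else 0)"
    using ij(3) by (auto simp: zp_def shift_apply algebra_simps)
  have "(\<Sum>\<psi><p. if \<psi> = 0 \<and> \<mu> = 1 then 2 * of_real pi * \<i> * e * f x else 0) =
      (\<Sum>\<psi><p. if \<psi> = 0 then (if \<mu> = 1 then 2 * of_real pi * \<i> * e * f x else 0) else 0)"
    by (intro sum.cong) auto
  also have "\<dots> = (if \<mu> = 1 then 2 * of_real pi * \<i> * e * f x else 0)"
    using ns_nonempty by (subst sum.delta) auto
  finally have s: "(\<Sum>\<psi><p. if \<psi> = 0 \<and> \<mu> = 1 then 2 * of_real pi * \<i> * e * f x else 0) = (if \<mu> = 1 then 2 * of_real pi * \<i> * e * f x else 0)" .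
  have "(\<Sum>\<psi><p. kk \<psi> i j (shift \<omega> i \<mu> x) * f (sw \<psi> i j (shift \<omega> i \<mu> x))) = mul e \<mu> (x i) *
      ((\<Sum>\<psi><p. kk \<psi> i j x * f (sw \<psi> i j x)) + (if \<mu> = 1 then 2 * of_real pi * \<i> * e * f x else 0))"
    unfolding s[symmetric] sum.distrib[symmetric] sum_distrib_left
    by (intro sum.cong refl kk_sw_shift[OF f per ij \<mu> x]) auto
  then show ?thesis
    unfolding VV_def z using quasiD[OF TH_D(2)[OF f] per UNIV_I ij(1) \<mu>, of x]
    by (simp add: bnd_def algebra_simps)
qed

lemma RR_shift_fst:
  assumes f: "f \<in> TH N" and per: "(\<omega>, e) \<in> periods" and ij: "i \<in> {1..N}" "j \<in> {1..N}" "i \<noteq> j" and \<mu>: "\<mu> \<in> {1..p}"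
    and x: "x \<in> U N"
  shows "RR i j f (shift \<omega> i \<mu> x) = mul e \<mu> (x i) * RR i j f x"
proof -
  have "m * (a - k * f x) - m * (b - 0 * f x) + m * (c + k * f x) = m * (a - b + c)" for m a b c k
    by (simp add: algebra_simps)
  with ij(3) show ?thesis
    unfolding RR_def DD_shift[OF f per ij(1) \<mu> ij(1)] DD_shift[OF f per ij(1) \<mu> ij(2)] VV_shift[OF assms] by simp
qed

lemma RR_quasi:
  assumes f: "f \<in> TH N" and ij: "i \<in> {1..N}" "j \<in> {1..N}" "i \<noteq> j"
  shows "quasi (U N) N (RR i j f)"
proof (rule quasiI)
  fix \<omega> e x \<nu> \<mu> assume per: "(\<omega>, e) \<in> periods" and x: "x \<in> U N" and \<nu>: "\<nu> \<in> {1..N}" "\<mu> \<in> {1..p}"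
  consider "\<nu> = i" | "\<nu> = j" | "\<nu> \<noteq> i" "\<nu> \<noteq> j" by blast
  then show "RR i j f (shift \<omega> \<nu> \<mu> x) = mul e \<mu> (x \<nu>) * RR i j f x"
  proof cases
    case 1 then show ?thesis using RR_shift_fst[OF f per ij \<nu>(2) x] by simp
  next
    case 2
    \<comment> \<open>The second block is reduced to the first by antisymmetry, which also holds at
      the shifted point because \<open>U N\<close> is invariant under the periods.\<close>
    have "RR i j f (shift \<omega> j \<mu> x) = - RR j i f (shift \<omega> j \<mu> x)"
      by (rule RR_antisym[OF shift_U[OF per x] ij(2,1) ij(3)[symmetric]])
    also have "RR j i f (shift \<omega> j \<mu> x) = mul e \<mu> (x j) * RR j i f x"
      by (rule RR_shift_fst[OF f per ij(2,1) ij(3)[symmetric] \<nu>(2) x])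
    also have "RR j i f x = - RR i j f x" by (rule RR_antisym[OF x ij])
    finally show ?thesis using 2 by simp
  next
    case 3
    have s: "sw \<psi> i j (shift \<omega> \<nu> \<mu> x) = shift \<omega> \<nu> \<mu> (sw \<psi> i j x)" for \<psi>
      using 3 by (auto simp: fun_eq_iff sw_apply shift_apply Transposition.transpose_def)
    have s': "sw \<psi> i j x \<nu> = x \<nu>" for \<psi> using 3 by (auto simp: fun_eq_iff sw_apply Transposition.transpose_def)
    have k: "kk \<psi> i j (shift \<omega> \<nu> \<mu> x) = kk \<psi> i j x" "zp i j (shift \<omega> \<nu> \<mu> x) = zp i j x" for \<psi>
      using 3 by (auto simp: kk_def zp_def shift_apply)
    have "VV i j f (shift \<omega> \<nu> \<mu> x) = mul e \<mu> (x \<nu>) * VV i j f x"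
      unfolding VV_def k s using quasiD[OF TH_D(2)[OF f] per UNIV_I \<nu>]
      by (simp add: s' sum_distrib_left algebra_simps)
    then show ?thesis
      unfolding RR_def DD_shift[OF f per \<nu> ij(1)] DD_shift[OF f per \<nu> ij(2)] using 3 by (simp add: algebra_simps)
  qed
qed

section \<open>Removal of the poles\<close>

text \<open>Block \<nu> moves with speed \<nu>, so the difference of any two blocks varies along the
  line and meets the zeros of theta only for isolated parameters.\<close>

lemma U_dense: "\<forall>\<^sub>F t in at 0. (\<lambda>\<nu> \<mu>. x \<nu> \<mu> + t * of_nat \<nu>) \<in> U N"
proof -
  have "\<forall>\<^sub>F t in at 0. a \<noteq> b \<longrightarrow> th (x a \<mu> + t * of_nat a - (x b \<mu> + t * of_nat b)) \<noteq> 0" for a b \<mu>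
  proof (cases "a = b")
    case False
    obtain z0 where z0: "th z0 \<noteq> 0" using theta_not_0 by blast
    define c where "c = (of_nat a - of_nat b :: complex)"
    have c: "c \<noteq> 0" using False by (simp add: c_def)
    have h: "(\<lambda>t. th (x a \<mu> - x b \<mu> + t * c)) holomorphic_on UNIV" by (intro holomorphic_intros)
    have "\<forall>\<^sub>F t in at 0. th (x a \<mu> - x b \<mu> + t * c) \<noteq> 0"
      by (rule entire_eventually_nonzero[OF h, of "(z0 - (x a \<mu> - x b \<mu>)) / c"]) (use c z0 in simp)
    then show ?thesis by (rule eventually_mono) (simp add: c_def algebra_simps)
  qed simp
  then have "\<forall>\<^sub>F t in at 0. \<forall>a\<in>{1..N}. \<forall>b\<in>{1..N}. \<forall>\<mu>\<in>{1..p}. a \<noteq> b \<longrightarrow> th (x a \<mu> + t * of_nat a - (x b \<mu> + t * of_nat b)) \<noteq> 0"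
    by (intro eventually_ball_finite ballI) auto
  then show ?thesis by (rule eventually_mono) (auto simp: off_poles_def)
qed

lemma eq_on_U:
  assumes "continuous_on UNIV f" "continuous_on UNIV g" "\<And>x. x \<in> U N \<Longrightarrow> f x = g x"
  shows "f x = (g x :: complex)"
proof (rule eq_by_line_limit[OF assms(1,2)])
  show "\<forall>\<^sub>F t in at 0. f (\<lambda>\<nu> \<mu>. x \<nu> \<mu> + t * of_nat \<nu>) = g (\<lambda>\<nu> \<mu>. x \<nu> \<mu> + t * of_nat \<nu>)"
    using U_dense[of x N] by eventually_elim (rule assms(3))
qed

lemma continuous_on_shift: "continuous_on UNIV (shift \<omega> \<nu> \<mu>)"
  unfolding shift_def by (intro continuous_on_pointI continuous_intros)

lemma continuous_on_mul: "continuous_on UNIV (\<lambda>x :: point. mul e \<mu> (x \<nu>))"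
proof -
  have "continuous_on UNIV (\<lambda>x :: point. if \<mu> = 1 then 0 else x \<nu> (\<mu> - 1))"
    "continuous_on UNIV (\<lambda>x :: point. if \<mu> = p then 0 else x \<nu> (\<mu> + 1))"
    by (cases "\<mu> = 1"; auto intro: continuous_intros) (cases "\<mu> = p"; auto intro: continuous_intros)
  then show ?thesis unfolding mul_def lin_def
    by (intro continuous_on_ee continuous_on_minus continuous_on_mult continuous_on_diff continuous_on_const continuous_on_point_apply)
qed

lemma quasi_UNIV:
  assumes "continuous_on UNIV f" "quasi (U N) N f"
  shows "quasi UNIV N f"
proof (rule quasiI)
  fix \<omega> e x \<nu> \<mu> assume per: "(\<omega>, e) \<in> periods" and \<nu>: "\<nu> \<in> {1..N}" "\<mu> \<in> {1..p}"
  show "f (shift \<omega> \<nu> \<mu> x) = mul e \<mu> (x \<nu>) * f x"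
  proof (rule eq_on_U[where N = N and f = "\<lambda>x. f (shift \<omega> \<nu> \<mu> x)" and g = "\<lambda>x. mul e \<mu> (x \<nu>) * f x"])
    show "continuous_on UNIV (\<lambda>x. f (shift \<omega> \<nu> \<mu> x))"
      by (rule continuous_on_compose2[OF assms(1) continuous_on_shift]) simp
    show "continuous_on UNIV (\<lambda>x. mul e \<mu> (x \<nu>) * f x)"
      by (rule continuous_on_mult[OF continuous_on_mul assms(1)])
  qed (rule quasiD[OF assms(2) per _ \<nu>])
qed

lemma holomorphic_vars_theta_diff [holomorphic_vars_intros]:
  assumes "holomorphic_vars p N f"
  shows "holomorphic_vars p N (\<lambda>x. th (f x))" "holomorphic_vars p N (\<lambda>x. deriv th (f x))" "holomorphic_vars p N (\<lambda>x. ee (f x))"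
proof -
  note c = holomorphic_vars_compose_entire[OF _ assms]
  show "holomorphic_vars p N (\<lambda>x. th (f x))" by (rule c[OF holomorphic_theta_UNIV])
  show "holomorphic_vars p N (\<lambda>x. deriv th (f x))" by (rule c[OF holomorphic_deriv[OF holomorphic_theta_UNIV open_UNIV]])
  show "holomorphic_vars p N (\<lambda>x. ee (f x))" by (rule c[OF holomorphic_on_ee[OF holomorphic_on_ident]])
qed

text \<open>The factors are split off one at a time. That the quotient still vanishes with the next
  factor is seen away from the zeros of the earlier ones: moving block \<open>i\<close> in all
  positions but \<phi> makes these nonzero and keeps \<open>th (x i \<phi> - x j \<phi>)\<close>
  equal to 0.\<close>

lemma divide_theta_factors:
  assumes f: "holomorphic_vars p N f" and ij: "i \<in> {1..N}" "j \<in> {1..N}" "i \<noteq> j" and S: "finite S" "S \<subseteq> {1..p}"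
    and zero: "\<And>\<phi> x. \<phi> \<in> S \<Longrightarrow> th (x i \<phi> - x j \<phi>) = 0 \<Longrightarrow> f x = 0"
  shows "\<exists>h. holomorphic_vars p N h \<and> (\<forall>x. f x = (\<Prod>\<phi>\<in>S. th (x i \<phi> - x j \<phi>)) * h x)"
  using S zero
proof (induction S rule: finite_induct)
  case empty
  then show ?case using f by auto
next
  case (insert \<phi> S)
  then obtain h where h: "holomorphic_vars p N h" "\<And>x. f x = (\<Prod>\<phi>\<in>S. th (x i \<phi> - x j \<phi>)) * h x" by auto
  have \<phi>: "\<phi> \<in> {1..p}" using insert by auto
  have "h x = 0" if x: "th (x i \<phi> - x j \<phi>) = 0" for x
  proof (rule eq_by_line_limit[OF holomorphic_varsD(2)[OF h(1)], where g = "\<lambda>_. 0" and v = "\<lambda>\<nu> \<mu>. if \<nu> = i \<and> \<mu> \<noteq> \<phi> then 1 else 0"])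
    obtain z0 where z0: "th z0 \<noteq> 0" using theta_not_0 by blast
    have ev: "\<forall>\<^sub>F t in at 0. th (x i \<phi>' - x j \<phi>' + t) \<noteq> 0" for \<phi>'
    proof -
      have "(\<lambda>t. th (x i \<phi>' - x j \<phi>' + t)) holomorphic_on UNIV" by (intro holomorphic_intros)
      then show ?thesis
        by (rule entire_eventually_nonzero[of _ "z0 - (x i \<phi>' - x j \<phi>')"]) (use z0 in simp)
    qed
    then have "\<forall>\<^sub>F t in at 0. \<forall>\<phi>'\<in>S. th (x i \<phi>' - x j \<phi>' + t) \<noteq> 0"
      using insert by (intro eventually_ball_finite ballI) auto
    then show "\<forall>\<^sub>F t in at 0. h (\<lambda>\<nu> \<mu>. x \<nu> \<mu> + t * (if \<nu> = i \<and> \<mu> \<noteq> \<phi> then 1 else 0)) = 0"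
    proof (rule eventually_mono)
      fix t assume t: "\<forall>\<phi>'\<in>S. th (x i \<phi>' - x j \<phi>' + t) \<noteq> 0"
      define y where "y = (\<lambda>\<nu> \<mu>. x \<nu> \<mu> + t * (if \<nu> = i \<and> \<mu> \<noteq> \<phi> then 1 else 0))"
      have "f y = 0" using insert.prems(2)[of \<phi> y] x ij by (simp add: y_def)
      moreover have "th (y i \<phi>' - y j \<phi>') \<noteq> 0" if "\<phi>' \<in> S" for \<phi>'
      proof -
        have "y i \<phi>' - y j \<phi>' = x i \<phi>' - x j \<phi>' + t" using that insert ij by (auto simp: y_def)
        then show ?thesis using t that by simp
      qed
      ultimately show "h y = 0" using h(2)[of y] insert by auto
    qed
  qed auto
  then obtain k where k: "holomorphic_vars p N k" "\<And>x. h x = th (x i \<phi> - x j \<phi>) * k x"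
    using holomorphic_vars_divide_diff[OF h(1) ij \<phi> holomorphic_theta_UNIV deriv_theta_nonzero] by blast
  then show ?case using h(2) insert by (intro exI[of _ k]) (simp add: mult_ac)
qed

text \<open>
  The numerator of \<open>RR i j f\<close> over the common denominator. At \<open>x i \<phi> = x j \<phi>\<close> the terms with
  \<open>\<psi> = \<phi> - 1\<close> and \<open>\<psi> = \<phi>\<close> have opposite residues and equal values of \<open>f\<close>; for \<open>\<phi> = p\<close> this uses
  that \<open>f\<close> is antisymmetric.
\<close>

lemma RR_extend:
  assumes f: "f \<in> TH N" and ij: "i \<in> {1..N}" "j \<in> {1..N}" "i \<noteq> j"
    and anti: "\<And>x. f (x \<circ> Transposition.transpose i j) = - f x"
  shows "\<exists>h\<in>TH N. \<forall>x\<in>U N. h x = RR i j f x"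
proof -
  note hf = TH_D(1)[OF f]
  define u where "u = (\<lambda>\<phi> (x :: point). x i \<phi> - x j \<phi>)"
  define \<Delta> where "\<Delta> = (\<lambda>S x. \<Prod>\<phi>\<in>{1..p} - S. th (u \<phi> x))"
  \<comment> \<open>\<open>nb\<close> and \<open>nk\<close> are the coefficients \<open>zp\<close>
    and \<open>kk\<close> multiplied by the common denominator \<open>\<Delta> {}\<close>, written
    without division; the factor \<open>ee\<close> in \<open>nk\<close> comes from turning
    \<open>th (- u)\<close> into \<open>th u\<close>.\<close>
  define nb where "nb = (\<lambda>\<phi> x. - (deriv th (u \<phi> x) - of_real pi * \<i> * th (u \<phi> x)) * \<Delta> {\<phi>} x)"
  define nk where "nk = (\<lambda>\<psi> x. if \<psi> = 0 then nb 1 x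
    else - deriv th 0 * th (u \<psi> x - u (\<psi> + 1) x) * ee (u (\<psi> + 1) x) * \<Delta> {\<psi>, \<psi> + 1} x)"
  define num where "num x = \<Delta> {} x * (DD i f x - DD j f x) + (\<Sum>\<psi><p. nk \<psi> x * f (sw \<psi> i j x)) + nb p x * f x" for x
  have hu: "holomorphic_vars p N (u \<phi>)" if "\<phi> \<in> {1..p}" for \<phi>
    unfolding u_def using ij that by (intro holomorphic_vars_intros)
  have h\<Delta>: "holomorphic_vars p N (\<Delta> S)" for S
    unfolding \<Delta>_def by (intro holomorphic_vars_intros hu) auto
  have hnb: "holomorphic_vars p N (nb \<phi>)" if "\<phi> \<in> {1..p}" for \<phi>
    unfolding nb_def using that by (intro holomorphic_vars_intros hu h\<Delta>)
  have hnk: "holomorphic_vars p N (nk \<psi>)" if "\<psi> < p" for \<psi>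
  proof (cases "\<psi> = 0")
    case True then show ?thesis using hnb[of 1] by (simp add: nk_def)
  next
    case False then show ?thesis unfolding nk_def using that by (simp, intro holomorphic_vars_intros hu h\<Delta>) auto
  qed
  have hnum: "holomorphic_vars p N num"
    unfolding num_def using ij
    by (intro holomorphic_vars_intros h\<Delta> hf hnk hnb holomorphic_vars_block_perm[OF hf block_perm_swb]) auto
  have \<Delta>1: "\<Delta> {} x = th (u \<phi> x) * \<Delta> {\<phi>} x" if "\<phi> \<in> {1..p}" for \<phi> x
    unfolding \<Delta>_def using that by (simp add: prod.remove)
  have \<Delta>2: "\<Delta> {\<psi>} x = th (u (\<psi> + 1) x) * \<Delta> {\<psi>, \<psi> + 1} x" "\<Delta> {\<psi> + 1} x = th (u \<psi> x) * \<Delta> {\<psi>, \<psi> + 1} x"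
    if "1 \<le> \<psi>" "\<psi> < p" for \<psi> x
  proof -
    have "{1..p} - {\<psi>} - {\<psi> + 1} = {1..p} - {\<psi>, \<psi> + 1}" "{1..p} - {\<psi> + 1} - {\<psi>} = {1..p} - {\<psi>, \<psi> + 1}" by auto
    then show "\<Delta> {\<psi>} x = th (u (\<psi> + 1) x) * \<Delta> {\<psi>, \<psi> + 1} x" "\<Delta> {\<psi> + 1} x = th (u \<psi> x) * \<Delta> {\<psi>, \<psi> + 1} x"
      unfolding \<Delta>_def using that prod.remove[of "{1..p} - {\<psi>}" "\<psi> + 1"] prod.remove[of "{1..p} - {\<psi> + 1}" \<psi>] by auto
  qed
  have u_nz: "th (u \<phi> x) \<noteq> 0" if "x \<in> U N" "\<phi> \<in> {1..p}" for x \<phi>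
    using U_D[OF that(1) ij that(2)] by (simp add: u_def)
  have num_U: "num x = \<Delta> {} x * RR i j f x" if x: "x \<in> U N" for x
  proof -
    have b: "nb \<phi> x = \<Delta> {} x * zeta (x j \<phi> - x i \<phi>)" if "\<phi> \<in> {1..p}" for \<phi>
    proof -
      have z: "zeta (x j \<phi> - x i \<phi>) = - zeta (u \<phi> x)"
        using zeta_minus[OF u_nz[OF x that]] by (simp add: u_def)
      show ?thesis using u_nz[OF x that] unfolding \<Delta>1[OF that] nb_def z zeta_def[of "u \<phi> x"]
        by (simp add: field_simps)
    qed
    have k: "nk \<psi> x = \<Delta> {} x * kk \<psi> i j x" if "\<psi> < p" for \<psi>
    proof (cases "\<psi> = 0")
      case True then show ?thesis using b[of 1] by (simp add: nk_def kk_def)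
    next
      case False
      have nz: "th (u \<psi> x) \<noteq> 0" "th (u (\<psi> + 1) x) \<noteq> 0" using u_nz[OF x] False that by auto
      have "kk \<psi> i j x = kron (u \<psi> x) (- u (\<psi> + 1) x)" using False by (simp add: kk_def u_def)
      also have "\<dots> = - deriv th 0 * th (u \<psi> x - u (\<psi> + 1) x) * ee (u (\<psi> + 1) x) / (th (u \<psi> x) * th (u (\<psi> + 1) x))"
        by (simp add: kron_def theta_minus ee_minus field_simps)
      finally show ?thesis
        using False that nz by (simp add: nk_def \<Delta>1[of \<psi>] \<Delta>2)
    qed
    have s: "(\<Sum>\<psi><p. nk \<psi> x * f (sw \<psi> i j x)) = \<Delta> {} x * (\<Sum>\<psi><p. kk \<psi> i j x * f (sw \<psi> i j x))"
      unfolding sum_distrib_left by (intro sum.cong refl) (simp add: k)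
    show ?thesis
      unfolding num_def s b[OF in_p(2)] RR_def VV_def zp_def by (simp add: algebra_simps)
  qed
  have num_diag: "num x = 0" if \<phi>: "\<phi> \<in> {1..p}" and eq: "x i \<phi> = x j \<phi>" for x \<phi>
  proof -
    have u0: "u \<phi> x = 0" using eq by (simp add: u_def)
    have \<Delta>0: "\<Delta> S x = 0" if "\<phi> \<notin> S" for S
      unfolding \<Delta>_def by (rule prod_zero) (use \<phi> that u0 in \<open>auto intro!: bexI[of _ \<phi>]\<close>)
    define W where "W = \<Delta> {\<phi>} x"
    have k1: "nk \<phi> x = deriv th 0 * W" if "\<phi> < p"
      using that \<phi> \<Delta>2(1)[of \<phi> x] u0 by (simp add: nk_def W_def theta_minus ee_minus)
    have k0: "nk (\<phi> - 1) x = - deriv th 0 * W"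
    proof (cases "\<phi> = 1")
      case True then show ?thesis using u0 by (simp add: nk_def nb_def W_def)
    next
      case False
      then have "\<phi> - 1 \<noteq> 0" "\<phi> - 1 + 1 = \<phi>" "\<phi> - 1 < p" using \<phi> by auto
      then show ?thesis using \<Delta>2(2)[of "\<phi> - 1" x] u0 by (simp add: nk_def W_def)
    qed
    have kz: "nk \<psi> x = 0" if "\<psi> \<noteq> \<phi>" "\<psi> \<noteq> \<phi> - 1" for \<psi>
      using that \<phi> by (auto simp: nk_def nb_def \<Delta>0)
    \<comment> \<open>The two blocks agree in position \<phi>, so it is immaterial whether the swap
      includes it.\<close>
    have sweq: "sw \<phi> i j x = sw (\<phi> - 1) i j x"
    proof (intro ext)
      fix \<nu> \<mu> show "sw \<phi> i j x \<nu> \<mu> = sw (\<phi> - 1) i j x \<nu> \<mu>"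
        using eq \<phi> by (cases "\<mu> = \<phi>") (auto simp: sw_apply Transposition.transpose_def)
    qed
    have ps: "(\<phi> - 1) \<in> {..<p}" using \<phi> by auto
    show ?thesis
    proof (cases "\<phi> = p")
      case False
      have "(\<Sum>\<psi><p. nk \<psi> x * f (sw \<psi> i j x)) = (\<Sum>\<psi>\<in>{\<phi> - 1, \<phi>}. nk \<psi> x * f (sw \<psi> i j x))"
        using \<phi> False by (intro sum.mono_neutral_right) (auto simp: kz)
      also have "\<dots> = nk (\<phi> - 1) x * f (sw (\<phi> - 1) i j x) + nk \<phi> x * f (sw \<phi> i j x)"
        using \<phi> by (subst sum.insert) auto
      also have "\<dots> = 0" using k0 k1 \<phi> False sweq by simp
      finally show ?thesis using False by (simp add: num_def \<Delta>0 nb_def)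
    next
      case True
      have "(\<Sum>\<psi><p. nk \<psi> x * f (sw \<psi> i j x)) = (\<Sum>\<psi>\<in>{\<phi> - 1}. nk \<psi> x * f (sw \<psi> i j x))"
        using ps True by (intro sum.mono_neutral_right) (auto simp: kz)
      also have "\<dots> = - deriv th 0 * W * f (sw p i j x)"
        using k0 sweq True by simp
      \<comment> \<open>Both points agree in the positions 1 to \<open>p\<close>, the only ones on
        which \<open>f\<close> depends.\<close>
      also have "f (sw p i j x) = f (x \<circ> Transposition.transpose i j)"
        by (rule holomorphic_varsD(1)[OF hf]) (simp add: sw_apply)
      also have "\<dots> = - f x" by (rule anti)
      finally show ?thesis using True u0 by (simp add: num_def \<Delta>0 nb_def W_def)
    qed
  qed
  \<comment> \<open>Quasi-periodicity of the numerator carries its vanishing from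
    \<open>x i \<phi> = x j \<phi>\<close> to all lattice translates, that is, to all zeros of the
    denominator.\<close>
  have num_shift: "num (shift \<omega> i \<phi> x) = (1 - 2 * e) * ee (- (e * u \<phi> x)) * mul e \<phi> (x i) * num x"
    if per: "(\<omega>, e) \<in> periods" and \<phi>: "\<phi> \<in> {1..p}" for \<omega> e \<phi> x
  proof (rule eq_on_U[where N = N and f = "\<lambda>x. num (shift \<omega> i \<phi> x)"
        and g = "\<lambda>x. (1 - 2 * e) * ee (- (e * u \<phi> x)) * mul e \<phi> (x i) * num x"])
    show "continuous_on UNIV (\<lambda>x. num (shift \<omega> i \<phi> x))"
      by (rule continuous_on_compose2[OF holomorphic_varsD(2)[OF hnum] continuous_on_shift]) auto
    show "continuous_on UNIV (\<lambda>x. (1 - 2 * e) * ee (- (e * u \<phi> x)) * mul e \<phi> (x i) * num x)"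
      by (intro continuous_intros continuous_on_mul holomorphic_varsD(2)[OF hnum] holomorphic_varsD(2)[OF hu[OF \<phi>]])
    fix x assume x: "x \<in> U N"
    have "\<Delta> {\<phi>} (shift \<omega> i \<phi> x) = \<Delta> {\<phi>} x"
      unfolding \<Delta>_def by (intro prod.cong) (auto simp: u_def shift_apply)
    moreover have "u \<phi> (shift \<omega> i \<phi> x) = u \<phi> x + \<omega>" using ij by (simp add: u_def shift_apply)
    ultimately have "\<Delta> {} (shift \<omega> i \<phi> x) = (1 - 2 * e) * ee (- (e * u \<phi> x)) * \<Delta> {} x"
      using \<phi> by (simp add: \<Delta>1 theta_period[OF per])
    then show "num (shift \<omega> i \<phi> x) = (1 - 2 * e) * ee (- (e * u \<phi> x)) * mul e \<phi> (x i) * num x"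
      unfolding num_U[OF x] num_U[OF shift_U[OF per x]] RR_shift_fst[OF f per ij \<phi> x] by simp
  qed
  have num_zero: "num x = 0" if \<phi>: "\<phi> \<in> {1..p}" and th0: "th (x i \<phi> - x j \<phi>) = 0" for x \<phi>
  proof -
    have step: "num (shift \<omega> i \<phi> y) = 0 \<longleftrightarrow> num y = 0" if "(\<omega>, e) \<in> periods" for \<omega> e y
      using num_shift[OF that \<phi>] period_sign_nonzero[OF that] by simp
    have per: "(1, 0) \<in> periods" "(\<eta>, 1) \<in> periods" by (simp_all add: periods_def)
    have sh: "shift \<omega> i \<phi> (set_var x i \<phi> z) = set_var x i \<phi> (z + \<omega>)" for \<omega> z
      by (simp add: shift_def set_var_apply)
    have "num (set_var x i \<phi> (x j \<phi> + l)) = 0" if "l \<in> lat" for l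
      using that
    proof (induction rule: lat_induct)
      case zero
      show ?case using num_diag[OF \<phi>] ij by (simp add: set_var_apply)
    next
      case (one l) then show ?case using step[OF per(1), of "set_var x i \<phi> (x j \<phi> + l)"] by (simp add: sh add.assoc)
    next
      case (one' l) then show ?case using step[OF per(1), of "set_var x i \<phi> (x j \<phi> + (l - 1))"] by (simp add: sh add.assoc)
    next
      case (eta l) then show ?case using step[OF per(2), of "set_var x i \<phi> (x j \<phi> + l)"] by (simp add: sh add.assoc)
    next
      case (eta' l) then show ?case using step[OF per(2), of "set_var x i \<phi> (x j \<phi> + (l - \<eta>))"] by (simp add: sh add.assoc)
    qed
    from this[of "x i \<phi> - x j \<phi>"] show ?thesis using th0 by (simp add: theta_eq_0_iff)
  qed
  obtain h where h: "holomorphic_vars p N h" "\<And>x. num x = \<Delta> {} x * h x"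
    using divide_theta_factors[OF hnum ij, of "{1..p}"] num_zero by (auto simp: \<Delta>_def u_def)
  have hU: "h x = RR i j f x" if x: "x \<in> U N" for x
  proof -
    have "\<Delta> {} x \<noteq> 0" unfolding \<Delta>_def using u_nz[OF x] by simp
    then show ?thesis using h(2)[of x] num_U[OF x] by simp
  qed
  have "quasi (U N) N h"
    by (rule quasiI) (use hU shift_U quasiD[OF RR_quasi[OF f ij]] in simp)
  then have "quasi UNIV N h" by (rule quasi_UNIV[OF holomorphic_varsD(2)[OF h(1)]])
  then show ?thesis using h(1) hU by (auto simp: TH_def)
qed

end

section \<open>Symmetrization\<close>

definition Sym :: "nat \<Rightarrow> pfun \<Rightarrow> pfun" where
  "Sym N f x = (\<Sum>\<sigma> | \<sigma> permutes {1..N}. f (\<lambda>\<nu>. x (\<sigma> \<nu>)))"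

definition tensor :: "nat \<Rightarrow> pfun \<Rightarrow> pfun \<Rightarrow> pfun" where
  "tensor \<alpha> f g x = f x * g (\<lambda>j. x (\<alpha> + j))"

lemma card_perms: "card {\<sigma>. \<sigma> permutes {1..N :: nat}} = fact N"
  by (intro card_permutations) auto

lemma Sym_add: "Sym N (\<lambda>x. f x + g x) x = Sym N f x + Sym N g x"
  by (simp add: Sym_def sum.distrib)

lemma Sym_mult_const: "Sym N (\<lambda>x. c * f x) x = c * Sym N f x"
  by (simp add: Sym_def sum_distrib_left)

lemma Sym_sum: "Sym N (\<lambda>x. \<Sum>i\<in>I. f i x) x = (\<Sum>i\<in>I. Sym N (f i) x)"
  unfolding Sym_def by (rule sum.swap)

lemma Sym_act:
  assumes "\<rho> permutes {1..N}"
  shows "Sym N (\<lambda>x. f (\<lambda>\<nu>. x (\<rho> \<nu>))) x = Sym N f x"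
  using sum_permutations_compose_right[OF assms, of "\<lambda>\<sigma>. f (\<lambda>\<nu>. x (\<sigma> \<nu>))"] by (simp add: Sym_def o_def)

text \<open>Here the point is permuted and the sum is reindexed by composition on the left; in
  \<open>Sym_act\<close> the function is permuted and the composition is on the right.\<close>

lemma Sym_perm:
  assumes "\<rho> permutes {1..N}"
  shows "Sym N f (\<lambda>\<nu>. x (\<rho> \<nu>)) = Sym N f x"
proof -
  have "inj_on ((\<circ>) \<rho>) {\<sigma>. \<sigma> permutes {1..N}}"
    using fun.inj_map[OF permutes_inj[OF assms]] by (rule inj_on_subset) simp
  moreover have "(\<circ>) \<rho> ` {\<sigma>. \<sigma> permutes {1..N}} = {\<sigma>. \<sigma> permutes {1..N}}"
    using image_compose_permutations_left[OF assms] by blast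
  ultimately have "bij_betw ((\<circ>) \<rho>) {\<sigma>. \<sigma> permutes {1..N}} {\<sigma>. \<sigma> permutes {1..N}}"
    by (simp add: bij_betw_def)
  from sum.reindex_bij_betw[OF this, of "\<lambda>\<sigma>. f (\<lambda>\<nu>. x (\<sigma> \<nu>))"] show ?thesis
    by (simp add: Sym_def o_def)
qed

lemma Sym_symmetric:
  assumes "\<And>\<sigma> x. \<sigma> permutes {1..N} \<Longrightarrow> f (\<lambda>\<nu>. x (\<sigma> \<nu>)) = f x"
  shows "Sym N f x = fact N * f x"
proof -
  have "Sym N f x = (\<Sum>\<sigma> | \<sigma> permutes {1..N}. f x)"
    unfolding Sym_def by (intro sum.cong refl assms) auto
  also have "\<dots> = fact N * f x" unfolding sum_constant card_perms by simp
  finally show ?thesis .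
qed

text \<open>Permutations of the last blocks only, and the exchange of the first \<open>\<alpha>\<close> blocks with the next \<open>\<beta>\<close> ones.\<close>

definition shp :: "nat \<Rightarrow> (nat \<Rightarrow> nat) \<Rightarrow> nat \<Rightarrow> nat" where
  "shp \<alpha> \<tau> \<nu> = (if \<nu> \<le> \<alpha> then \<nu> else \<alpha> + \<tau> (\<nu> - \<alpha>))"

definition rot :: "nat \<Rightarrow> nat \<Rightarrow> nat \<Rightarrow> nat" where
  "rot \<alpha> \<beta> \<nu> = (if \<nu> \<in> {1..\<alpha>} then \<beta> + \<nu> else if \<nu> \<in> {\<alpha> + 1..\<alpha> + \<beta>} then \<nu> - \<alpha> else \<nu>)"

lemma permutes_0: "\<tau> permutes {1..M} \<Longrightarrow> \<tau> (0 :: nat) = 0"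
  by (rule permutes_not_in) auto

lemma permutes_range: "\<tau> permutes {1..M} \<Longrightarrow> \<tau> \<nu> \<in> {1..M} \<longleftrightarrow> \<nu> \<in> {1..M}"
  by (rule permutes_in_image)

lemma shp_permutes:
  assumes \<tau>: "\<tau> permutes {1..M}"
  shows "shp \<alpha> \<tau> permutes {1..\<alpha> + M}"
proof (rule bij_imp_permutes)
  have 1: "\<tau> n \<ge> 1" if "n \<ge> 1" for n
  proof (rule ccontr)
    assume "\<not> 1 \<le> \<tau> n"
    then have "\<tau> n = \<tau> 0" using permutes_0[OF \<tau>] by simp
    then have "n = 0" using permutes_inj[OF \<tau>] by (simp add: inj_eq)
    with that show False by simp
  qed
  have 2: "\<tau> n \<in> {1..M}" if "n \<in> {1..M}" for n using permutes_range[OF \<tau>] that by blast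
  show "bij_betw (shp \<alpha> \<tau>) {1..\<alpha> + M} {1..\<alpha> + M}"
  proof (rule bij_betw_imageI)
    show "inj_on (shp \<alpha> \<tau>) {1..\<alpha> + M}"
    proof (rule inj_onI)
      fix a b assume ab: "shp \<alpha> \<tau> a = shp \<alpha> \<tau> b"
      have "\<alpha> < a \<longrightarrow> 1 \<le> \<tau> (a - \<alpha>)" "\<alpha> < b \<longrightarrow> 1 \<le> \<tau> (b - \<alpha>)" using 1 by simp_all
      moreover have "\<tau> (a - \<alpha>) = \<tau> (b - \<alpha>) \<longleftrightarrow> a - \<alpha> = b - \<alpha>" using permutes_inj[OF \<tau>] by (simp add: inj_eq)
      ultimately show "a = b" using ab by (cases "a \<le> \<alpha>"; cases "b \<le> \<alpha>"; simp add: shp_def)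
    qed
    then have "card (shp \<alpha> \<tau> ` {1..\<alpha> + M}) = card {1..\<alpha> + M}" by (rule card_image)
    moreover have "shp \<alpha> \<tau> ` {1..\<alpha> + M} \<subseteq> {1..\<alpha> + M}"
    proof
      fix b assume "b \<in> shp \<alpha> \<tau> ` {1..\<alpha> + M}"
      then obtain a where a: "a \<in> {1..\<alpha> + M}" "b = shp \<alpha> \<tau> a" by auto
      show "b \<in> {1..\<alpha> + M}"
      proof (cases "a \<le> \<alpha>")
        case False
        then have "\<tau> (a - \<alpha>) \<in> {1..M}" using a by (intro 2) auto
        then show ?thesis using a False by (simp add: shp_def)
      qed (use a in \<open>auto simp: shp_def\<close>)
    qed
    ultimately show "shp \<alpha> \<tau> ` {1..\<alpha> + M} = {1..\<alpha> + M}" by (intro card_subset_eq) auto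
  qed
next
  fix x assume x: "x \<notin> {1..\<alpha> + M}"
  show "shp \<alpha> \<tau> x = x"
  proof (cases "x \<le> \<alpha>")
    case False
    then have "x - \<alpha> \<notin> {1..M}" using x by auto
    then have "\<tau> (x - \<alpha>) = x - \<alpha>" by (rule permutes_not_in[OF \<tau>])
    then show ?thesis using False by (simp add: shp_def)
  qed (simp add: shp_def)
qed

lemma rot_permutes: "rot \<alpha> \<beta> permutes {1..\<alpha> + \<beta>}"
proof (rule bij_imp_permutes)
  show "bij_betw (rot \<alpha> \<beta>) {1..\<alpha> + \<beta>} {1..\<alpha> + \<beta>}"
    by (rule bij_betw_byWitness[where f' = "rot \<beta> \<alpha>"]) (auto simp: rot_def)
qed (auto simp: rot_def)

lemma tensor_assoc: "tensor \<alpha> f (tensor \<beta> g h) = tensor (\<alpha> + \<beta>) (tensor \<alpha> f g) h"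
  by (simp add: tensor_def fun_eq_iff add.assoc mult.assoc)

context theta_data
begin

subsection \<open>Equivariance and locality of the r-matrix\<close>

lemma block_perm_perm: "\<sigma> permutes {1..N} \<Longrightarrow> block_perm N (\<lambda>\<nu> \<mu>. \<sigma> \<nu>)"
  by (simp add: block_perm_def)

lemma reblock_perm: "reblock (\<lambda>\<nu> \<mu>. \<sigma> \<nu>) x = (\<lambda>\<nu>. x (\<sigma> \<nu>))"
  by (simp add: reblock_def)

lemma perm_U: "\<sigma> permutes {1..N} \<Longrightarrow> x \<in> U N \<Longrightarrow> (\<lambda>\<nu>. x (\<sigma> \<nu>)) \<in> U N"
  using reblock_U[OF block_perm_perm] unfolding reblock_perm by blast

lemma perm_dif: "f \<in> dif N \<Longrightarrow> \<sigma> permutes {1..N} \<Longrightarrow> (\<lambda>x. f (\<lambda>\<nu>. x (\<sigma> \<nu>))) \<in> dif N"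
  using dif_reblock[OF _ block_perm_perm] unfolding reblock_perm by blast

lemma perm_holomorphic_vars:
  "holomorphic_vars p N f \<Longrightarrow> \<sigma> permutes {1..N} \<Longrightarrow> holomorphic_vars p N (\<lambda>x. f (\<lambda>\<nu>. x (\<sigma> \<nu>)))"
  using holomorphic_vars_block_perm[OF _ block_perm_perm] unfolding reblock_perm by blast

text \<open>Relabelling the blocks by \<sigma> conjugates the transpositions and carries the
  coefficients along.\<close>

lemma RR_act:
  assumes \<sigma>: "\<sigma> permutes {1..N}"
  shows "RR (\<sigma> i) (\<sigma> j) (\<lambda>x. f (\<lambda>\<nu>. x (\<sigma> \<nu>))) x = RR i j f (\<lambda>\<nu>. x (\<sigma> \<nu>))"
proof -
  have D: "DD (\<sigma> i) (\<lambda>x. f (\<lambda>\<nu>. x (\<sigma> \<nu>))) x = DD i f (\<lambda>\<nu>. x (\<sigma> \<nu>))" for i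
    unfolding DD_def using partial_deriv_reblock[OF block_perm_perm[OF \<sigma>], of i _ f x]
    by (simp add: reblock_perm)
  have t: "Transposition.transpose (\<sigma> i) (\<sigma> j) (\<sigma> \<nu>) = \<sigma> (Transposition.transpose i j \<nu>)" for \<nu>
    using permutes_inj[OF \<sigma>] by (simp add: Transposition.transpose_def inj_eq)
  have s: "(\<lambda>\<nu>. sw \<psi> (\<sigma> i) (\<sigma> j) x (\<sigma> \<nu>)) = sw \<psi> i j (\<lambda>\<nu>. x (\<sigma> \<nu>))" for \<psi>
    by (intro ext) (simp add: sw_apply t)
  show ?thesis unfolding RR_def D VV_def s by (simp add: kk_def zp_def)
qed

definition RRs :: "nat set \<Rightarrow> nat set \<Rightarrow> pfun \<Rightarrow> pfun" where
  "RRs A B f x = (\<Sum>i\<in>A. \<Sum>j\<in>B. RR i j f x)"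

lemma RRs_act:
  assumes \<sigma>: "\<sigma> permutes {1..N}"
  shows "RRs (\<sigma> ` A) (\<sigma> ` B) (\<lambda>x. f (\<lambda>\<nu>. x (\<sigma> \<nu>))) x = RRs A B f (\<lambda>\<nu>. x (\<sigma> \<nu>))"
proof -
  have inj: "inj_on \<sigma> S" for S using permutes_inj[OF \<sigma>] by (rule inj_on_subset) simp
  show ?thesis unfolding RRs_def by (simp add: sum.reindex[OF inj] RR_act[OF \<sigma>])
qed

lemma RRs_cong:
  assumes "\<And>y. y \<in> U N \<Longrightarrow> f y = g y" "x \<in> U N" "A \<subseteq> {1..N}" "B \<subseteq> {1..N}"
  shows "RRs A B f x = RRs A B g x"
  unfolding RRs_def using assms by (intro sum.cong refl RR_cong[OF assms(1)]) auto

lemma RRs_sum: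
  assumes "\<And>k. k \<in> I \<Longrightarrow> f k \<in> dif N" "x \<in> U N" "A \<subseteq> {1..N}" "B \<subseteq> {1..N}"
  shows "RRs A B (\<lambda>x. \<Sum>k\<in>I. f k x) x = (\<Sum>k\<in>I. RRs A B (f k) x)"
proof -
  have "RRs A B (\<lambda>x. \<Sum>k\<in>I. f k x) x = (\<Sum>i\<in>A. \<Sum>j\<in>B. \<Sum>k\<in>I. RR i j (f k) x)"
    unfolding RRs_def using assms by (intro sum.cong refl RR_sum[OF assms(1)]) auto
  also have "\<dots> = (\<Sum>i\<in>A. \<Sum>k\<in>I. \<Sum>j\<in>B. RR i j (f k) x)"
    by (intro sum.cong refl sum.swap)
  also have "\<dots> = (\<Sum>k\<in>I. RRs A B (f k) x)"
    unfolding RRs_def by (rule sum.swap)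
  finally show ?thesis .
qed

lemma RRs_mult_const:
  assumes "f \<in> dif N" "x \<in> U N" "A \<subseteq> {1..N}" "B \<subseteq> {1..N}"
  shows "RRs A B (\<lambda>x. c * f x) x = c * RRs A B f x"
  unfolding RRs_def sum_distrib_left using assms by (intro sum.cong refl RR_mult_const[OF assms(1)]) auto

lemma RRs_add:
  assumes "f \<in> dif N" "g \<in> dif N" "x \<in> U N" "A \<subseteq> {1..N}" "B \<subseteq> {1..N}"
  shows "RRs A B (\<lambda>x. f x + g x) x = RRs A B f x + RRs A B g x"
  unfolding RRs_def sum.distrib[symmetric] using assms by (intro sum.cong refl RR_add[OF assms(1,2)]) auto

lemma RRs_Un:
  assumes "finite B" "finite C" "B \<inter> C = {}"
  shows "RRs A (B \<union> C) f x = RRs A B f x + RRs A C f x"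
  unfolding RRs_def by (simp add: sum.union_disjoint[OF assms] sum.distrib)

lemma RRs_antisym:
  assumes "x \<in> U N" "A \<subseteq> {1..N}" "B \<subseteq> {1..N}" "A \<inter> B = {}"
  shows "RRs B A f x = - RRs A B f x"
proof -
  have "RRs B A f x = (\<Sum>i\<in>A. \<Sum>j\<in>B. RR j i f x)" unfolding RRs_def by (rule sum.swap)
  also have "\<dots> = (\<Sum>i\<in>A. \<Sum>j\<in>B. - RR i j f x)"
    using assms by (intro sum.cong refl RR_antisym[OF assms(1)]) auto
  finally show ?thesis by (simp add: RRs_def sum_negf)
qed

lemma RRs_dif:
  assumes "holomorphic_vars p N f" "A \<subseteq> {1..N}" "B \<subseteq> {1..N}" "A \<inter> B = {}"
  shows "RRs A B f \<in> dif N"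
  unfolding RRs_def[abs_def] using assms by (intro dif_sum RR_dif[OF assms(1)]) auto

lemma Sym_cong:
  assumes "\<And>y. y \<in> U N \<Longrightarrow> f y = g y" "x \<in> U N"
  shows "Sym N f x = Sym N g x"
  unfolding Sym_def using perm_U assms by (intro sum.cong refl) auto

lemma shift_U_right: "x \<in> U (\<alpha> + \<beta>) \<Longrightarrow> (\<lambda>j. x (\<alpha> + j)) \<in> U \<beta>"
  unfolding off_poles_def by auto

lemma U_left: "x \<in> U (\<alpha> + \<beta>) \<Longrightarrow> x \<in> U \<alpha>"
  unfolding off_poles_def by auto

lemma partial_deriv_tensor_left:
  assumes h: "holomorphic_vars p \<beta> h" and i: "i \<in> {1..\<alpha>}"
    and d: "(\<lambda>z. f (set_var x i \<mu> z)) field_differentiable at (x i \<mu>)"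
  shows "partial_deriv i \<mu> (tensor \<alpha> f h) x = partial_deriv i \<mu> f x * h (\<lambda>j. x (\<alpha> + j))"
proof -
  have "h (\<lambda>j. set_var x i \<mu> z (\<alpha> + j)) = h (\<lambda>j. x (\<alpha> + j))" for z
    by (rule holomorphic_varsD(1)[OF h]) (use i in \<open>auto simp: set_var_apply\<close>)
  then have "partial_deriv i \<mu> (tensor \<alpha> f h) x = deriv (\<lambda>z. f (set_var x i \<mu> z) * h (\<lambda>j. x (\<alpha> + j))) (x i \<mu>)"
    by (simp add: partial_deriv_def tensor_def)
  also have "\<dots> = partial_deriv i \<mu> f x * h (\<lambda>j. x (\<alpha> + j))"
    unfolding partial_deriv_def by (rule deriv_cmult_right[OF d])
  finally show ?thesis .
qed

lemma partial_deriv_tensor_right: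
  assumes f: "holomorphic_vars p \<alpha> f" and i: "i \<in> {1..\<beta>}"
    and d: "(\<lambda>z. g (set_var (\<lambda>j. x (\<alpha> + j)) i \<mu> z)) field_differentiable at (x (\<alpha> + i) \<mu>)"
  shows "partial_deriv (\<alpha> + i) \<mu> (tensor \<alpha> f g) x = f x * partial_deriv i \<mu> g (\<lambda>j. x (\<alpha> + j))"
proof -
  have "f (set_var x (\<alpha> + i) \<mu> z) = f x" for z
    by (rule holomorphic_varsD(1)[OF f]) (use i in \<open>auto simp: set_var_apply\<close>)
  moreover have "(\<lambda>j. set_var x (\<alpha> + i) \<mu> z (\<alpha> + j)) = set_var (\<lambda>j. x (\<alpha> + j)) i \<mu> z" for z
    by (intro ext) (simp add: set_var_apply)
  ultimately have "partial_deriv (\<alpha> + i) \<mu> (tensor \<alpha> f g) x =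
      deriv (\<lambda>z. f x * g (set_var (\<lambda>j. x (\<alpha> + j)) i \<mu> z)) (x (\<alpha> + i) \<mu>)"
    by (simp add: partial_deriv_def tensor_def)
  also have "\<dots> = f x * partial_deriv i \<mu> g (\<lambda>j. x (\<alpha> + j))"
    unfolding partial_deriv_def by (rule deriv_cmult[OF d])
  finally show ?thesis .
qed

text \<open>\<open>h\<close> reads only blocks after the first \<alpha>, which neither the
  derivatives nor the swaps in \<open>i\<close> and \<open>j\<close> touch.\<close>

lemma RR_tensor_left:
  assumes h: "holomorphic_vars p \<beta> h" and f: "f \<in> dif \<alpha>" and x: "x \<in> U \<alpha>" and ij: "i \<in> {1..\<alpha>}" "j \<in> {1..\<alpha>}"
  shows "RR i j (tensor \<alpha> f h) x = RR i j f x * h (\<lambda>k. x (\<alpha> + k))"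
proof -
  have D: "DD i (tensor \<alpha> f h) x = DD i f x * h (\<lambda>k. x (\<alpha> + k))" if "i \<in> {1..\<alpha>}" for i
    unfolding DD_def using partial_deriv_tensor_left[OF h that difD[OF f x that]]
    by (simp add: sum_distrib_right mult.assoc)
  have hs: "h (\<lambda>k. sw \<psi> i j x (\<alpha> + k)) = h (\<lambda>k. x (\<alpha> + k))" for \<psi>
    by (rule holomorphic_varsD(1)[OF h]) (use ij in \<open>auto simp: sw_apply Transposition.transpose_def\<close>)
  have V: "VV i j (tensor \<alpha> f h) x = VV i j f x * h (\<lambda>k. x (\<alpha> + k))"
    unfolding VV_def tensor_def hs by (simp add: distrib_right sum_distrib_right mult.assoc)
  show ?thesis
    unfolding RR_def D[OF ij(1)] D[OF ij(2)] V by (simp only: left_diff_distrib distrib_right)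
qed

lemma RR_tensor_right:
  assumes f: "holomorphic_vars p \<alpha> f" and g: "g \<in> dif \<beta>" and x: "(\<lambda>k. x (\<alpha> + k)) \<in> U \<beta>" and ij: "i \<in> {1..\<beta>}" "j \<in> {1..\<beta>}"
  shows "RR (\<alpha> + i) (\<alpha> + j) (tensor \<alpha> f g) x = f x * RR i j g (\<lambda>k. x (\<alpha> + k))"
proof -
  have D: "DD (\<alpha> + i) (tensor \<alpha> f g) x = f x * DD i g (\<lambda>k. x (\<alpha> + k))" if "i \<in> {1..\<beta>}" for i
    unfolding DD_def using partial_deriv_tensor_right[OF f that] difD[OF g x that]
    by (simp add: sum_distrib_left mult_ac)
  have fs: "f (sw \<psi> (\<alpha> + i) (\<alpha> + j) x) = f x" for \<psi>
    by (rule holomorphic_varsD(1)[OF f]) (use ij in \<open>auto simp: sw_apply Transposition.transpose_def\<close>)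
  have gs: "(\<lambda>k. sw \<psi> (\<alpha> + i) (\<alpha> + j) x (\<alpha> + k)) = sw \<psi> i j (\<lambda>k. x (\<alpha> + k))" for \<psi>
    by (intro ext) (simp add: sw_apply Transposition.transpose_def)
  have kz: "kk \<psi> (\<alpha> + i) (\<alpha> + j) x = kk \<psi> i j (\<lambda>k. x (\<alpha> + k))" "zp (\<alpha> + i) (\<alpha> + j) x = zp i j (\<lambda>k. x (\<alpha> + k))" for \<psi>
    by (simp_all add: kk_def zp_def)
  have V: "VV (\<alpha> + i) (\<alpha> + j) (tensor \<alpha> f g) x = f x * VV i j g (\<lambda>k. x (\<alpha> + k))"
    unfolding VV_def tensor_def fs gs kz by (simp add: distrib_left sum_distrib_left mult.left_commute)
  show ?thesis
    unfolding RR_def D[OF ij(1)] D[OF ij(2)] V by (simp only: right_diff_distrib distrib_left)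
qed

lemma RRs_tensor_left:
  assumes h: "holomorphic_vars p \<beta> h" and f: "f \<in> dif \<alpha>" and x: "x \<in> U (\<alpha> + \<beta>)" and AB: "A \<subseteq> {1..\<alpha>}" "B \<subseteq> {1..\<alpha>}"
  shows "tensor \<alpha> (RRs A B f) h x = RRs A B (tensor \<alpha> f h) x"
proof -
  have "RRs A B (tensor \<alpha> f h) x = (\<Sum>i\<in>A. \<Sum>j\<in>B. RR i j f x * h (\<lambda>k. x (\<alpha> + k)))"
    unfolding RRs_def using AB by (intro sum.cong refl RR_tensor_left[OF h f U_left[OF x]]) auto
  then show ?thesis unfolding tensor_def by (simp add: RRs_def sum_distrib_right)
qed

lemma RRs_tensor_right:
  assumes f: "holomorphic_vars p \<alpha> f" and g: "g \<in> dif \<beta>" and x: "x \<in> U (\<alpha> + \<beta>)" and AB: "A \<subseteq> {1..\<beta>}" "B \<subseteq> {1..\<beta>}"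
  shows "tensor \<alpha> f (RRs A B g) x = RRs ((+) \<alpha> ` A) ((+) \<alpha> ` B) (tensor \<alpha> f g) x"
proof -
  have "RRs ((+) \<alpha> ` A) ((+) \<alpha> ` B) (tensor \<alpha> f g) x = (\<Sum>i\<in>A. \<Sum>j\<in>B. f x * RR i j g (\<lambda>k. x (\<alpha> + k)))"
    unfolding RRs_def using AB
    by (simp add: sum.reindex) (intro sum.cong refl RR_tensor_right[OF f g shift_U_right[OF x]]; auto)
  then show ?thesis unfolding tensor_def by (simp add: RRs_def sum_distrib_left)
qed

subsection \<open>The bracket in terms of the r-matrix\<close>

text \<open>The summands agree permutation by permutation, at the permuted point \<open>y\<close>.
  The factors \<beta> in \<open>T1\<close> and \<alpha> in \<open>T2\<close> count the partners of a
  block, so that all four terms become sums over pairs of blocks.\<close>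

lemma bracket_expr_eq:
  assumes f: "holomorphic_vars p \<alpha> f" and g: "holomorphic_vars p \<beta> g"
  shows "bracket_expr \<eta> ns \<alpha> \<beta> f g x =
    1 / (fact \<alpha> * fact \<beta>) * Sym (\<alpha> + \<beta>) (RRs {1..\<alpha>} {\<alpha> + 1..\<alpha> + \<beta>} (tensor \<alpha> f g)) x"
proof -
  have term_eq: "T1 ns \<alpha> \<beta> f g \<sigma> x + T2 ns \<alpha> \<beta> f g \<sigma> x + T3 \<eta> ns \<alpha> \<beta> f g \<sigma> x + T4 \<eta> ns \<alpha> \<beta> f g \<sigma> x =
      RRs {1..\<alpha>} {\<alpha> + 1..\<alpha> + \<beta>} (tensor \<alpha> f g) (\<lambda>\<nu>. x (\<sigma> \<nu>))" if \<sigma>: "\<sigma> permutes {1..\<alpha> + \<beta>}" for \<sigma>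
  proof -
    define y where "y = (\<lambda>\<nu>. x (\<sigma> \<nu>))"
    define y' where "y' = (\<lambda>j. y (\<alpha> + j))"
    define A where "A = {1..\<alpha>}"
    define B where "B = {\<alpha> + 1..\<alpha> + \<beta>}"
    define \<Phi> where "\<Phi> = tensor \<alpha> f g"
    have \<sigma>eq: "\<sigma> a = \<sigma> b \<longleftrightarrow> a = b" for a b using permutes_inj[OF \<sigma>] by (simp add: inj_eq)
    have fd: "(\<lambda>z. f (set_var y i \<mu> z)) field_differentiable at w" if "i \<in> {1..\<alpha>}" "\<mu> \<in> {1..p}" for i \<mu> w
      using holomorphic_on_imp_differentiable_at[OF holomorphic_varsD(3)[OF f that] open_UNIV] by simp
    have gd: "(\<lambda>z. g (set_var y' i \<mu> z)) field_differentiable at w" if "i \<in> {1..\<beta>}" "\<mu> \<in> {1..p}" for i \<mu> w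
      using holomorphic_on_imp_differentiable_at[OF holomorphic_varsD(3)[OF g that] open_UNIV] by simp
    have B: "j \<in> B \<longleftrightarrow> (\<exists>j'\<in>{1..\<beta>}. j = \<alpha> + j')" for j
    proof
      assume "j \<in> B"
      then have "j - \<alpha> \<in> {1..\<beta>}" "j = \<alpha> + (j - \<alpha>)" by (auto simp: B_def)
      then show "\<exists>j'\<in>{1..\<beta>}. j = \<alpha> + j'" by blast
    qed (auto simp: B_def)
    have DA: "DD i \<Phi> y = DD i f y * g y'" if "i \<in> A" for i
      unfolding DD_def \<Phi>_def y'_def using partial_deriv_tensor_left[OF g, of i \<alpha> f y] fd that
      by (simp add: A_def sum_distrib_right mult.assoc)
    have DB: "DD j \<Phi> y = f y * DD (j - \<alpha>) g y'" if "j \<in> B" for j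
      unfolding DD_def \<Phi>_def y'_def using partial_deriv_tensor_right[OF f, of "j - \<alpha>" \<beta> g y] gd[unfolded y'_def] that
      by (auto simp: B sum_distrib_left mult_ac)
    have first: "first_blocks \<sigma> f = (\<lambda>x. f (\<lambda>\<nu>. x (\<sigma> \<nu>)))" by (simp add: first_blocks_def)
    have p1: "partial_deriv (\<sigma> i) \<psi> (first_blocks \<sigma> f) x = partial_deriv i \<psi> f y" for i \<psi>
      using partial_deriv_reblock[OF block_perm_perm[OF \<sigma>], of i \<psi> f x] by (simp add: first reblock_perm y_def)
    have p2: "partial_deriv (\<sigma> j) \<psi> (last_blocks \<alpha> \<sigma> g) x = partial_deriv (j - \<alpha>) \<psi> g y'" if "j \<in> B" for j \<psi>
    proof -
      have j: "j = \<alpha> + (j - \<alpha>)" using that by (auto simp: B)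
      have "(\<lambda>k. set_var x (\<sigma> j) \<psi> z (\<sigma> (\<alpha> + k))) = set_var y' (j - \<alpha>) \<psi> z" for z
        using j by (intro ext) (auto simp: set_var_apply y'_def y_def \<sigma>eq)
      moreover have "x (\<sigma> j) \<psi> = y' (j - \<alpha>) \<psi>" using j by (simp add: y'_def y_def)
      ultimately show ?thesis by (simp add: partial_deriv_def last_blocks_def)
    qed
    have cA: "card A = \<alpha>" "card B = \<beta>" by (simp_all add: A_def B_def)
    have 1: "T1 ns \<alpha> \<beta> f g \<sigma> x = (\<Sum>i\<in>A. \<Sum>j\<in>B. DD i \<Phi> y)"
    proof -
      have "(\<Sum>i\<in>A. \<Sum>j\<in>B. DD i \<Phi> y) = of_nat \<beta> * (\<Sum>i\<in>A. DD i f y * g y')"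
        by (simp add: cA DA sum_distrib_left)
      also have "\<dots> = of_nat \<beta> * g y' * (\<Sum>i\<in>A. \<Sum>\<psi>\<in>{1..p}. c_coeff ns \<psi> * partial_deriv i \<psi> f y)"
        by (simp add: DD_def sum_distrib_left mult_ac flip: sum_distrib_right)
      also have "(\<Sum>i\<in>A. \<Sum>\<psi>\<in>{1..p}. c_coeff ns \<psi> * partial_deriv i \<psi> f y) = (\<Sum>\<psi>\<in>{1..p}. \<Sum>i\<in>A. c_coeff ns \<psi> * partial_deriv i \<psi> f y)"
        by (rule sum.swap)
      finally show ?thesis unfolding T1_def p1 by (simp add: A_def last_blocks_def y'_def y_def)
    qed
    have 2: "T2 ns \<alpha> \<beta> f g \<sigma> x = - (\<Sum>i\<in>A. \<Sum>j\<in>B. DD j \<Phi> y)"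
    proof -
      have "(\<Sum>i\<in>A. \<Sum>j\<in>B. DD j \<Phi> y) = of_nat \<alpha> * (\<Sum>j\<in>B. f y * DD (j - \<alpha>) g y')"
        by (simp add: cA DB)
      also have "\<dots> = of_nat \<alpha> * f y * (\<Sum>j\<in>B. \<Sum>\<psi>\<in>{1..p}. c_coeff ns \<psi> * partial_deriv (j - \<alpha>) \<psi> g y')"
        by (simp add: DD_def mult.assoc flip: sum_distrib_left)
      also have "(\<Sum>j\<in>B. \<Sum>\<psi>\<in>{1..p}. c_coeff ns \<psi> * partial_deriv (j - \<alpha>) \<psi> g y') = (\<Sum>\<psi>\<in>{1..p}. \<Sum>j\<in>B. c_coeff ns \<psi> * partial_deriv (j - \<alpha>) \<psi> g y')"
        by (rule sum.swap)
      also have "\<dots> = (\<Sum>\<psi>\<in>{1..p}. \<Sum>j\<in>B. c_coeff ns \<psi> * partial_deriv (\<sigma> j) \<psi> (last_blocks \<alpha> \<sigma> g) x)"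
        by (intro sum.cong refl) (simp add: p2)
      finally show ?thesis unfolding T2_def by (simp add: B_def first_blocks_def y_def)
    qed
    \<comment> \<open>The constant 2 pi i for each of the \<alpha> \<beta> pairs is shared by the
      two functions \<open>zeta\<close>, each of which subtracts pi i.\<close>
    have 3: "T3 \<eta> ns \<alpha> \<beta> f g \<sigma> x = (\<Sum>i\<in>A. \<Sum>j\<in>B. (kk 0 i j y + zp i j y) * \<Phi> y)"
    proof -
      have "(\<Sum>i\<in>A. \<Sum>j\<in>B. deriv th (y j 1 - y i 1) / th (y j 1 - y i 1) + deriv th (y j p - y i p) / th (y j p - y i p))
          - 2 * of_real pi * \<i> * of_nat \<alpha> * of_nat \<beta> =
        (\<Sum>i\<in>A. \<Sum>j\<in>B. deriv th (y j 1 - y i 1) / th (y j 1 - y i 1) + deriv th (y j p - y i p) / th (y j p - y i p) - 2 * of_real pi * \<i>)"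
        by (simp add: sum_subtractf cA)
      also have "\<dots> = (\<Sum>i\<in>A. \<Sum>j\<in>B. kk 0 i j y + zp i j y)"
        by (intro sum.cong refl) (simp add: kk_def zp_def zeta_def)
      finally show ?thesis unfolding T3_def Let_def
        by (simp add: A_def B_def \<Phi>_def tensor_def first_blocks_def last_blocks_def y_def sum_distrib_right mult.assoc)
    qed
    have 4: "T4 \<eta> ns \<alpha> \<beta> f g \<sigma> x = (\<Sum>i\<in>A. \<Sum>j\<in>B. \<Sum>\<psi>\<in>{1..p - 1}. kk \<psi> i j y * \<Phi> (sw \<psi> i j y))"
      unfolding T4_def sum_distrib_left Let_def A_def[symmetric] B_def[symmetric]
    proof (intro sum.cong refl)
      fix i j \<psi> assume i: "i \<in> A" and j: "j \<in> B" and \<psi>: "\<psi> \<in> {1..p - 1}"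
      obtain j' where j': "j' \<in> {1..\<beta>}" "j = \<alpha> + j'" using j by (auto simp: B)
      \<comment> \<open>The two points differ only outside the variables of \<open>f\<close>, namely
        in position 0 and in block \<open>j\<close>.\<close>
      have "first_blocks \<sigma> f (x(\<sigma> i := splice \<psi> (x (\<sigma> j)) (x (\<sigma> i)))) = f (sw \<psi> i j y)"
        unfolding first_blocks_def
        by (rule holomorphic_varsD(1)[OF f])
          (use i j' in \<open>auto simp: sw_apply y_def \<sigma>eq splice_def A_def Transposition.transpose_def\<close>)
      moreover have "last_blocks \<alpha> \<sigma> g (x(\<sigma> j := splice \<psi> (x (\<sigma> i)) (x (\<sigma> j)))) = g (\<lambda>k. sw \<psi> i j y (\<alpha> + k))"
        unfolding last_blocks_def
        by (rule holomorphic_varsD(1)[OF g])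
          (use i j' in \<open>auto simp: sw_apply y_def \<sigma>eq splice_def A_def Transposition.transpose_def\<close>)
      moreover have "x (\<sigma> i) \<psi> + x (\<sigma> j) (\<psi> + 1) - x (\<sigma> j) \<psi> - x (\<sigma> i) (\<psi> + 1) =
          y i \<psi> - y j \<psi> + (y j (\<psi> + 1) - y i (\<psi> + 1))" by (simp add: y_def)
      ultimately show "theta' \<eta> 0 * (th (x (\<sigma> i) \<psi> + x (\<sigma> j) (\<psi> + 1) - x (\<sigma> j) \<psi> - x (\<sigma> i) (\<psi> + 1)) /
          (th (x (\<sigma> i) \<psi> - x (\<sigma> j) \<psi>) * th (x (\<sigma> j) (\<psi> + 1) - x (\<sigma> i) (\<psi> + 1))) *
          first_blocks \<sigma> f (x(\<sigma> i := splice \<psi> (x (\<sigma> j)) (x (\<sigma> i)))) *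
          last_blocks \<alpha> \<sigma> g (x(\<sigma> j := splice \<psi> (x (\<sigma> i)) (x (\<sigma> j))))) = kk \<psi> i j y * \<Phi> (sw \<psi> i j y)"
        using \<psi> by (simp add: kk_def kron_def \<Phi>_def tensor_def) (simp add: y_def)
    qed
    have V: "VV i j \<Phi> y = (kk 0 i j y + zp i j y) * \<Phi> y + (\<Sum>\<psi>\<in>{1..p - 1}. kk \<psi> i j y * \<Phi> (sw \<psi> i j y))" for i j
    proof -
      have s: "{..<p} = insert 0 {1..p - 1}" using ns_nonempty by auto
      show ?thesis unfolding VV_def s by (subst sum.insert) (auto simp: algebra_simps)
    qed
    show ?thesis unfolding 1 2 3 4 RRs_def RR_def \<Phi>_def[symmetric] y_def[symmetric] A_def[symmetric] B_def[symmetric] V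
      by (simp add: sum.distrib sum_subtractf)
  qed
  show ?thesis unfolding bracket_expr_def Sym_def
    by (intro arg_cong2[where f = "(*)"] refl sum.cong term_eq) simp
qed

subsection \<open>Existence of the bracket\<close>

lemma holomorphic_vars_tensor:
  assumes f: "holomorphic_vars p \<alpha> f" and g: "holomorphic_vars p \<beta> g"
  shows "holomorphic_vars p (\<alpha> + \<beta>) (tensor \<alpha> f g)"
proof -
  have "holomorphic_vars p (\<alpha> + \<beta>) (\<lambda>x. f (reblock (\<lambda>\<nu> \<mu>. \<nu>) x))"
    by (rule holomorphic_vars_reblock[OF f]) auto
  moreover have "holomorphic_vars p (\<alpha> + \<beta>) (\<lambda>x. g (reblock (\<lambda>\<nu> \<mu>. \<alpha> + \<nu>) x))"
    by (rule holomorphic_vars_reblock[OF g]) auto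
  ultimately have "holomorphic_vars p (\<alpha> + \<beta>) (\<lambda>x. f (reblock (\<lambda>\<nu> \<mu>. \<nu>) x) * g (reblock (\<lambda>\<nu> \<mu>. \<alpha> + \<nu>) x))"
    by (rule holomorphic_vars_mult)
  then show ?thesis by (simp add: reblock_def tensor_def[abs_def])
qed

lemma TH_tensor:
  assumes f: "f \<in> TH \<alpha>" and g: "g \<in> TH \<beta>"
  shows "tensor \<alpha> f g \<in> TH (\<alpha> + \<beta>)"
proof -
  note hf = TH_D(1)[OF f] and hg = TH_D(1)[OF g]
  have "quasi UNIV (\<alpha> + \<beta>) (tensor \<alpha> f g)"
  proof (rule quasiI)
    fix \<omega> e x \<nu> \<mu> assume per: "(\<omega>, e) \<in> periods" and \<nu>: "\<nu> \<in> {1..\<alpha> + \<beta>}" "\<mu> \<in> {1..p}"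
    show "tensor \<alpha> f g (shift \<omega> \<nu> \<mu> x) = mul e \<mu> (x \<nu>) * tensor \<alpha> f g x"
    proof (cases "\<nu> \<le> \<alpha>")
      case True
      have "g (\<lambda>j. shift \<omega> \<nu> \<mu> x (\<alpha> + j)) = g (\<lambda>j. x (\<alpha> + j))"
        by (rule holomorphic_varsD(1)[OF hg]) (use True in \<open>auto simp: shift_apply\<close>)
      moreover have "f (shift \<omega> \<nu> \<mu> x) = mul e \<mu> (x \<nu>) * f x"
        by (rule quasiD[OF TH_D(2)[OF f] per]) (use True \<nu> in auto)
      ultimately show ?thesis by (simp add: tensor_def)
    next
      case False
      have "f (shift \<omega> \<nu> \<mu> x) = f x"
        by (rule holomorphic_varsD(1)[OF hf]) (use False in \<open>auto simp: shift_apply\<close>)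
      moreover have "(\<lambda>j. shift \<omega> \<nu> \<mu> x (\<alpha> + j)) = shift \<omega> (\<nu> - \<alpha>) \<mu> (\<lambda>j. x (\<alpha> + j))"
        using False by (intro ext) (auto simp: shift_apply)
      moreover have "g (shift \<omega> (\<nu> - \<alpha>) \<mu> (\<lambda>j. x (\<alpha> + j))) = mul e \<mu> (x (\<alpha> + (\<nu> - \<alpha>))) * g (\<lambda>j. x (\<alpha> + j))"
        by (rule quasiD[OF TH_D(2)[OF g] per]) (use False \<nu> in auto)
      ultimately show ?thesis using False by (simp add: tensor_def)
    qed
  qed
  then show ?thesis using holomorphic_vars_tensor[OF hf hg] by (simp add: TH_def)
qed

lemma TH_perm:
  assumes f: "f \<in> TH N" and \<sigma>: "\<sigma> permutes {1..N}"
  shows "(\<lambda>x. f (\<lambda>\<nu>. x (\<sigma> \<nu>))) \<in> TH N"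
proof -
  have "quasi UNIV N (\<lambda>x. f (\<lambda>\<nu>. x (\<sigma> \<nu>)))"
  proof (rule quasiI)
    fix \<omega> e x \<nu> \<mu> assume per: "(\<omega>, e) \<in> periods" and \<nu>: "\<nu> \<in> {1..N}" "\<mu> \<in> {1..p}"
    obtain \<nu>' where \<nu>': "\<nu>' \<in> {1..N}" "\<sigma> \<nu>' = \<nu>"
      using block_permD(4)[OF block_perm_perm[OF \<sigma>] \<nu>(1)] by blast
    have "\<sigma> a = \<nu> \<longleftrightarrow> a = \<nu>'" for a
      using block_permD(2)[OF block_perm_perm[OF \<sigma>], of a \<nu>'] \<nu>'(2) by simp
    then have "(\<lambda>a. shift \<omega> \<nu> \<mu> x (\<sigma> a)) = shift \<omega> \<nu>' \<mu> (\<lambda>a. x (\<sigma> a))"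
      by (intro ext) (simp add: shift_apply \<nu>'(2))
    then show "f (\<lambda>a. shift \<omega> \<nu> \<mu> x (\<sigma> a)) = mul e \<mu> (x \<nu>) * f (\<lambda>\<nu>. x (\<sigma> \<nu>))"
      using quasiD[OF TH_D(2)[OF f] per UNIV_I \<nu>'(1) \<nu>(2), of "\<lambda>a. x (\<sigma> a)"] \<nu>'(2) by simp
  qed
  then show ?thesis using perm_holomorphic_vars[OF TH_D(1)[OF f] \<sigma>] by (simp add: TH_def)
qed

lemma TH_0: "(\<lambda>_. 0) \<in> TH N"
  by (auto simp: TH_def quasi_def intro: holomorphic_vars_intros)

lemma TH_add: "f \<in> TH N \<Longrightarrow> g \<in> TH N \<Longrightarrow> (\<lambda>x. f x + g x) \<in> TH N"
proof -
  assume a: "f \<in> TH N" "g \<in> TH N"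
  have "quasi UNIV N (\<lambda>x. f x + g x)"
    by (rule quasiI) (simp add: quasiD[OF TH_D(2)[OF a(1)]] quasiD[OF TH_D(2)[OF a(2)]] distrib_left)
  then show ?thesis using a by (auto simp: TH_def intro: holomorphic_vars_intros)
qed

lemma TH_mult_const: "f \<in> TH N \<Longrightarrow> (\<lambda>x. c * f x) \<in> TH N"
proof -
  assume a: "f \<in> TH N"
  have "quasi UNIV N (\<lambda>x. c * f x)"
    by (rule quasiI) (simp add: quasiD[OF TH_D(2)[OF a]])
  then show ?thesis using a by (auto simp: TH_def intro: holomorphic_vars_intros)
qed

lemma TH_sum: "(\<And>i. i \<in> I \<Longrightarrow> f i \<in> TH N) \<Longrightarrow> (\<lambda>x. \<Sum>i\<in>I. f i x) \<in> TH N"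
  by (induction I rule: infinite_finite_induct) (auto intro: TH_0 TH_add)

lemma TH_Sym: "f \<in> TH N \<Longrightarrow> Sym N f \<in> TH N"
  unfolding Sym_def[abs_def] by (rule TH_sum, rule TH_perm) simp_all

text \<open>
  Symmetrizing first over the transposition of \<open>i\<close> and \<open>j\<close> replaces \<open>f\<close> by its antisymmetric part.
\<close>

lemma Sym_RR_extend:
  assumes f: "f \<in> TH N" and ij: "i \<in> {1..N}" "j \<in> {1..N}" "i \<noteq> j"
  shows "\<exists>h\<in>TH N. \<forall>x\<in>U N. h x = Sym N (RR i j f) x"
proof -
  define \<tau> where "\<tau> = Transposition.transpose i j"
  have \<tau>: "\<tau> permutes {1..N}" unfolding \<tau>_def using ij by (intro permutes_swap_id)
  have \<tau>ij: "\<tau> i = j" "\<tau> j = i" "\<And>\<nu>. \<tau> (\<tau> \<nu>) = \<nu>" by (simp_all add: \<tau>_def)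
  define W where "W = RR i j f"
  define \<Psi> where "\<Psi> = (\<lambda>x. f x + (- 1) * f (\<lambda>\<nu>. x (\<tau> \<nu>)))"
  have \<Psi>: "\<Psi> \<in> TH N" unfolding \<Psi>_def by (rule TH_add[OF f TH_mult_const[OF TH_perm[OF f \<tau>]]])
  have "\<Psi> (x \<circ> Transposition.transpose i j) = - \<Psi> x" for x
    using \<tau>ij(3) by (simp add: \<Psi>_def o_def flip: \<tau>_def)
  then obtain h where h: "h \<in> TH N" "\<And>x. x \<in> U N \<Longrightarrow> h x = RR i j \<Psi> x"
    using RR_extend[OF \<Psi> ij] by blast
  \<comment> \<open>The transposition turns \<open>RR i j\<close> into \<open>RR j i\<close>, which
    is its negative; with the sign in \<open>\<Psi>\<close> this leaves a sum of two functions with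
    equal symmetrizations.\<close>
  have R: "RR i j \<Psi> y = W y + W (\<lambda>\<nu>. y (\<tau> \<nu>))" if y: "y \<in> U N" for y
  proof -
    have d: "f \<in> dif N" "(\<lambda>x. f (\<lambda>\<nu>. x (\<tau> \<nu>))) \<in> dif N"
      using TH_D(1)[OF f] TH_D(1)[OF TH_perm[OF f \<tau>]] by (auto intro: holomorphic_vars_dif)
    have "RR i j \<Psi> y = RR i j f y + (- 1) * RR i j (\<lambda>x. f (\<lambda>\<nu>. x (\<tau> \<nu>))) y"
      unfolding \<Psi>_def RR_add[OF d(1) dif_mult[OF dif_const d(2)] y ij(1,2)] RR_mult_const[OF d(2) y ij(1,2)] ..
    also have "RR i j (\<lambda>x. f (\<lambda>\<nu>. x (\<tau> \<nu>))) y = RR j i f (\<lambda>\<nu>. y (\<tau> \<nu>))"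
      using RR_act[OF \<tau>, of j i f y] \<tau>ij by simp
    also have "\<dots> = - W (\<lambda>\<nu>. y (\<tau> \<nu>))"
      unfolding W_def by (rule RR_antisym[OF perm_U[OF \<tau> y] ij])
    finally show ?thesis by (simp add: W_def)
  qed
  have "1 / 2 * Sym N h x = Sym N W x" if x: "x \<in> U N" for x
  proof -
    have "Sym N h x = Sym N (\<lambda>y. W y + W (\<lambda>\<nu>. y (\<tau> \<nu>))) x"
      by (rule Sym_cong[OF _ x]) (use h R in simp)
    also have "\<dots> = Sym N W x + Sym N W x"
      unfolding Sym_add by (simp add: Sym_act[OF \<tau>])
    finally show ?thesis by simp
  qed
  then show ?thesis unfolding W_def
    by (intro bexI[OF _ TH_mult_const[OF TH_Sym[OF h(1)], of "1 / 2"]] ballI)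
qed

lemma Sym_RRs_extend:
  assumes f: "f \<in> TH N" and AB: "A \<subseteq> {1..N}" "B \<subseteq> {1..N}" "A \<inter> B = {}"
  shows "\<exists>h\<in>TH N. \<forall>x\<in>U N. h x = Sym N (RRs A B f) x"
proof -
  have "\<exists>h\<in>TH N. \<forall>x\<in>U N. h x = Sym N (RR i j f) x" if "i \<in> A" "j \<in> B" for i j
    using that AB by (intro Sym_RR_extend[OF f]) auto
  then obtain H where H: "\<And>i j. i \<in> A \<Longrightarrow> j \<in> B \<Longrightarrow> H i j \<in> TH N"
    "\<And>i j x. i \<in> A \<Longrightarrow> j \<in> B \<Longrightarrow> x \<in> U N \<Longrightarrow> H i j x = Sym N (RR i j f) x"
    by metis
  have "(\<lambda>x. \<Sum>i\<in>A. \<Sum>j\<in>B. H i j x) \<in> TH N" by (intro TH_sum H)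
  moreover have "(\<Sum>i\<in>A. \<Sum>j\<in>B. H i j x) = Sym N (RRs A B f) x" if "x \<in> U N" for x
    unfolding RRs_def[abs_def] Sym_sum using H(2) that by simp
  ultimately show ?thesis by (intro bexI[of _ "\<lambda>x. \<Sum>i\<in>A. \<Sum>j\<in>B. H i j x"]) auto
qed

abbreviation br :: "nat \<Rightarrow> nat \<Rightarrow> pfun \<Rightarrow> pfun \<Rightarrow> pfun" where "br \<equiv> bracket \<eta> ns"
abbreviation S :: "nat \<Rightarrow> pfun set" where "S \<equiv> sym_theta \<eta> ns"

lemma holomorphic_vars_eq_on_U:
  assumes "holomorphic_vars p N f" "holomorphic_vars p N g" "\<And>x. x \<in> U N \<Longrightarrow> f x = g x"
  shows "f = g"
  by (rule ext, rule eq_on_U[of f g N])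
    (rule holomorphic_varsD(2)[OF assms(1)] holomorphic_varsD(2)[OF assms(2)] assms(3); assumption?)+

text \<open>Existence comes from \<open>Sym_RRs_extend\<close> and uniqueness from the density of
  \<open>U\<close>, so the definite description in \<open>bracket\<close> denotes the
  extension.\<close>

lemma bracket_exists:
  assumes f: "f \<in> TH \<alpha>" and g: "g \<in> TH \<beta>"
  shows "br \<alpha> \<beta> f g \<in> TH (\<alpha> + \<beta>)" "x \<in> U (\<alpha> + \<beta>) \<Longrightarrow> br \<alpha> \<beta> f g x = bracket_expr \<eta> ns \<alpha> \<beta> f g x"
proof -
  have "{1..\<alpha>} \<inter> {\<alpha> + 1..\<alpha> + \<beta>} = {}" by auto
  then obtain h where h: "h \<in> TH (\<alpha> + \<beta>)"
    "\<And>x. x \<in> U (\<alpha> + \<beta>) \<Longrightarrow> h x = Sym (\<alpha> + \<beta>) (RRs {1..\<alpha>} {\<alpha> + 1..\<alpha> + \<beta>} (tensor \<alpha> f g)) x"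
    using Sym_RRs_extend[OF TH_tensor[OF f g], of "{1..\<alpha>}" "{\<alpha> + 1..\<alpha> + \<beta>}"] by auto
  define k where "k = (\<lambda>x. 1 / (fact \<alpha> * fact \<beta>) * h x)"
  have k: "k \<in> TH (\<alpha> + \<beta>)" unfolding k_def by (rule TH_mult_const[OF h(1)])
  have kU: "k x = bracket_expr \<eta> ns \<alpha> \<beta> f g x" if "x \<in> U (\<alpha> + \<beta>)" for x
    unfolding k_def bracket_expr_eq[OF TH_D(1)[OF f] TH_D(1)[OF g]] by (simp only: h(2)[OF that])
  have "br \<alpha> \<beta> f g = k"
    unfolding bracket_def
  proof (rule the_equality)
    show "holomorphic_vars p (\<alpha> + \<beta>) k \<and> (\<forall>x\<in>U (\<alpha> + \<beta>). k x = bracket_expr \<eta> ns \<alpha> \<beta> f g x)"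
      using TH_D(1)[OF k] kU by blast
    fix h assume "holomorphic_vars p (\<alpha> + \<beta>) h \<and> (\<forall>x\<in>U (\<alpha> + \<beta>). h x = bracket_expr \<eta> ns \<alpha> \<beta> f g x)"
    then show "h = k" by (intro holomorphic_vars_eq_on_U[OF _ TH_D(1)[OF k]]) (use kU in auto)
  qed
  then show "br \<alpha> \<beta> f g \<in> TH (\<alpha> + \<beta>)" "x \<in> U (\<alpha> + \<beta>) \<Longrightarrow> br \<alpha> \<beta> f g x = bracket_expr \<eta> ns \<alpha> \<beta> f g x"
    using k kU by auto
qed

lemma bracket_U:
  assumes "f \<in> TH \<alpha>" "g \<in> TH \<beta>" "x \<in> U (\<alpha> + \<beta>)"
  shows "br \<alpha> \<beta> f g x = 1 / (fact \<alpha> * fact \<beta>) * Sym (\<alpha> + \<beta>) (RRs {1..\<alpha>} {\<alpha> + 1..\<alpha> + \<beta>} (tensor \<alpha> f g)) x"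
  unfolding bracket_exists(2)[OF assms] by (rule bracket_expr_eq[OF TH_D(1)[OF assms(1)] TH_D(1)[OF assms(2)]])

lemma bracket_closed:
  assumes f: "f \<in> TH \<alpha>" and g: "g \<in> TH \<beta>"
  shows "br \<alpha> \<beta> f g \<in> S (\<alpha> + \<beta>)"
proof -
  note b = bracket_exists(1)[OF f g]
  have "br \<alpha> \<beta> f g (\<lambda>\<nu>. x (\<sigma> \<nu>)) = br \<alpha> \<beta> f g x" if \<sigma>: "\<sigma> permutes {1..\<alpha> + \<beta>}" for \<sigma> x
  proof -
    have "(\<lambda>x. br \<alpha> \<beta> f g (\<lambda>\<nu>. x (\<sigma> \<nu>))) = br \<alpha> \<beta> f g"
      by (rule holomorphic_vars_eq_on_U[OF TH_D(1)[OF TH_perm[OF b \<sigma>]] TH_D(1)[OF b]])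
        (simp add: bracket_U[OF f g] perm_U[OF \<sigma>] Sym_perm[OF \<sigma>] del: One_nat_def)
    from fun_cong[OF this, of x] show ?thesis .
  qed
  with b show ?thesis by (simp add: sym_theta_iff)
qed

lemma S_D:
  assumes "f \<in> S N"
  shows "f \<in> TH N" "\<And>\<sigma> x. \<sigma> permutes {1..N} \<Longrightarrow> f (\<lambda>\<nu>. x (\<sigma> \<nu>)) = f x"
proof -
  note * = assms[unfolded sym_theta_iff]
  show "f \<in> TH N" by (rule conjunct1[OF *])
  show "f (\<lambda>\<nu>. x (\<sigma> \<nu>)) = f x" if "\<sigma> permutes {1..N}" for \<sigma> x
    by (rule conjunct2[OF *, rule_format, OF that])
qed

subsection \<open>Nested symmetrizations\<close>

text \<open>\<open>shp\<close> lets an inner permutation act on the whole point, so that an outer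
  symmetrization can absorb it.\<close>

lemma tensor_Sym_right:
  assumes f: "holomorphic_vars p \<alpha> f"
  shows "tensor \<alpha> f (Sym M X) x = (\<Sum>\<tau> | \<tau> permutes {1..M}. tensor \<alpha> f X (\<lambda>\<nu>. x (shp \<alpha> \<tau> \<nu>)))"
  unfolding tensor_def Sym_def sum_distrib_left
proof (intro sum.cong refl)
  fix \<tau> assume "\<tau> \<in> {\<tau>. \<tau> permutes {1..M}}"
  then have \<tau>: "\<tau> permutes {1..M}" by simp
  have "f (\<lambda>\<nu>. x (shp \<alpha> \<tau> \<nu>)) = f x"
    by (rule holomorphic_varsD(1)[OF f]) (simp add: shp_def)
  moreover have "(\<lambda>j. x (shp \<alpha> \<tau> (\<alpha> + j))) = (\<lambda>j. x (\<alpha> + \<tau> j))"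
    using permutes_0[OF \<tau>] by (intro ext) (simp add: shp_def)
  ultimately show "f x * X (\<lambda>\<nu>. x (\<alpha> + \<tau> \<nu>)) = f (\<lambda>\<nu>. x (shp \<alpha> \<tau> \<nu>)) * X (\<lambda>j. x (shp \<alpha> \<tau> (\<alpha> + j)))" by simp
qed

lemma tensor_Sym_left:
  assumes h: "holomorphic_vars p \<gamma> h"
  shows "tensor \<alpha> (Sym \<alpha> X) h x = (\<Sum>\<tau> | \<tau> permutes {1..\<alpha>}. tensor \<alpha> X h (\<lambda>\<nu>. x (\<tau> \<nu>)))"
  unfolding tensor_def Sym_def sum_distrib_right
proof (intro sum.cong refl)
  fix \<tau> assume "\<tau> \<in> {\<tau>. \<tau> permutes {1..\<alpha>}}"
  then have \<tau>: "\<tau> permutes {1..\<alpha>}" by simp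
  have "h (\<lambda>j. x (\<tau> (\<alpha> + j))) = h (\<lambda>j. x (\<alpha> + j))"
  proof (rule holomorphic_varsD(1)[OF h])
    fix \<nu> \<mu> assume "\<nu> \<in> {1..\<gamma>}"
    then have "\<tau> (\<alpha> + \<nu>) = \<alpha> + \<nu>" by (intro permutes_not_in[OF \<tau>]) auto
    then show "x (\<tau> (\<alpha> + \<nu>)) \<mu> = x (\<alpha> + \<nu>) \<mu>" by simp
  qed
  then show "X (\<lambda>\<nu>. x (\<tau> \<nu>)) * h (\<lambda>j. x (\<alpha> + j)) = X (\<lambda>\<nu>. x (\<tau> \<nu>)) * h (\<lambda>j. x (\<tau> (\<alpha> + j)))" by simp
qed

text \<open>Each of the \<open>fact M\<close> inner permutations is absorbed by the outer
  sum.\<close>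

lemma Sym_tensor_Sym_right:
  assumes f: "holomorphic_vars p \<alpha> f"
  shows "Sym (\<alpha> + M) (tensor \<alpha> f (Sym M X)) x = fact M * Sym (\<alpha> + M) (tensor \<alpha> f X) x"
proof -
  have "Sym (\<alpha> + M) (tensor \<alpha> f (Sym M X)) x =
      (\<Sum>\<tau> | \<tau> permutes {1..M}. Sym (\<alpha> + M) (\<lambda>x. tensor \<alpha> f X (\<lambda>\<nu>. x (shp \<alpha> \<tau> \<nu>))) x)"
    unfolding Sym_sum[symmetric] by (rule arg_cong[where f = "\<lambda>f. Sym _ f x"]) (rule ext, rule tensor_Sym_right[OF f])
  also have "\<dots> = (\<Sum>\<tau> | \<tau> permutes {1..M}. Sym (\<alpha> + M) (tensor \<alpha> f X) x)"
    by (intro sum.cong refl Sym_act shp_permutes) simp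
  also have "\<dots> = fact M * Sym (\<alpha> + M) (tensor \<alpha> f X) x"
    unfolding sum_constant card_perms by simp
  finally show ?thesis .
qed

lemma Sym_tensor_Sym_left:
  assumes h: "holomorphic_vars p \<gamma> h"
  shows "Sym (\<alpha> + \<gamma>) (tensor \<alpha> (Sym \<alpha> X) h) x = fact \<alpha> * Sym (\<alpha> + \<gamma>) (tensor \<alpha> X h) x"
proof -
  have "Sym (\<alpha> + \<gamma>) (tensor \<alpha> (Sym \<alpha> X) h) x =
      (\<Sum>\<tau> | \<tau> permutes {1..\<alpha>}. Sym (\<alpha> + \<gamma>) (\<lambda>x. tensor \<alpha> X h (\<lambda>\<nu>. x (\<tau> \<nu>))) x)"
    unfolding Sym_sum[symmetric] by (rule arg_cong[where f = "\<lambda>f. Sym _ f x"]) (rule ext, rule tensor_Sym_left[OF h])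
  also have "\<dots> = (\<Sum>\<tau> | \<tau> permutes {1..\<alpha>}. Sym (\<alpha> + \<gamma>) (tensor \<alpha> X h) x)"
  proof (intro sum.cong refl Sym_act)
    fix \<tau> assume "\<tau> \<in> {\<tau>. \<tau> permutes {1..\<alpha>}}"
    then show "\<tau> permutes {1..\<alpha> + \<gamma>}" by (auto intro: permutes_subset)
  qed
  also have "\<dots> = fact \<alpha> * Sym (\<alpha> + \<gamma>) (tensor \<alpha> X h) x"
    unfolding sum_constant card_perms by simp
  finally show ?thesis .
qed

text \<open>An inner permutation maps each of the two index sets onto itself, so by equivariance it
  passes through the operator and is then absorbed by the outer sum. This makes nested brackets
  computable, and also brackets with products.\<close>

lemma Sym_RRs_tensor_Sym:
  assumes f: "holomorphic_vars p \<alpha> f" and X: "tensor \<alpha> f X \<in> dif (\<alpha> + M)" and x: "x \<in> U (\<alpha> + M)"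
  shows "Sym (\<alpha> + M) (RRs {1..\<alpha>} {\<alpha> + 1..\<alpha> + M} (tensor \<alpha> f (Sym M X))) x =
    fact M * Sym (\<alpha> + M) (RRs {1..\<alpha>} {\<alpha> + 1..\<alpha> + M} (tensor \<alpha> f X)) x"
proof -
  define A where "A = {1..\<alpha>}"
  define B where "B = {\<alpha> + 1..\<alpha> + M}"
  have AB: "A \<subseteq> {1..\<alpha> + M}" "B \<subseteq> {1..\<alpha> + M}" by (auto simp: A_def B_def)
  have img: "shp \<alpha> \<tau> ` A = A" "shp \<alpha> \<tau> ` B = B" if "\<tau> permutes {1..M}" for \<tau>
  proof -
    show A: "shp \<alpha> \<tau> ` A = A" by (simp add: A_def shp_def)
    have "B = {1..\<alpha> + M} - A" by (auto simp: A_def B_def)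
    moreover have "shp \<alpha> \<tau> ` ({1..\<alpha> + M} - A) = shp \<alpha> \<tau> ` {1..\<alpha> + M} - shp \<alpha> \<tau> ` A"
      by (rule image_set_diff[OF permutes_inj[OF shp_permutes[OF that]]])
    ultimately show "shp \<alpha> \<tau> ` B = B" using A permutes_image[OF shp_permutes[OF that, of \<alpha>]] by simp
  qed
  have "RRs A B (tensor \<alpha> f (Sym M X)) y = (\<Sum>\<tau> | \<tau> permutes {1..M}. RRs A B (tensor \<alpha> f X) (\<lambda>\<nu>. y (shp \<alpha> \<tau> \<nu>)))"
    if y: "y \<in> U (\<alpha> + M)" for y
  proof -
    have "RRs A B (tensor \<alpha> f (Sym M X)) y = RRs A B (\<lambda>x. \<Sum>\<tau> | \<tau> permutes {1..M}. tensor \<alpha> f X (\<lambda>\<nu>. x (shp \<alpha> \<tau> \<nu>))) y"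
      by (rule RRs_cong[OF tensor_Sym_right[OF f] y AB])
    also have "\<dots> = (\<Sum>\<tau> | \<tau> permutes {1..M}. RRs A B (\<lambda>x. tensor \<alpha> f X (\<lambda>\<nu>. x (shp \<alpha> \<tau> \<nu>))) y)"
      by (rule RRs_sum[OF _ y AB], rule perm_dif[OF X shp_permutes]) simp
    also have "\<dots> = (\<Sum>\<tau> | \<tau> permutes {1..M}. RRs A B (tensor \<alpha> f X) (\<lambda>\<nu>. y (shp \<alpha> \<tau> \<nu>)))"
    proof (intro sum.cong refl)
      fix \<tau> assume "\<tau> \<in> {\<tau>. \<tau> permutes {1..M}}"
      then have \<tau>: "\<tau> permutes {1..M}" by simp
      show "RRs A B (\<lambda>x. tensor \<alpha> f X (\<lambda>\<nu>. x (shp \<alpha> \<tau> \<nu>))) y = RRs A B (tensor \<alpha> f X) (\<lambda>\<nu>. y (shp \<alpha> \<tau> \<nu>))"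
        using RRs_act[OF shp_permutes[OF \<tau>], of \<alpha> A B "tensor \<alpha> f X" y] unfolding img[OF \<tau>] .
    qed
    finally show ?thesis .
  qed
  then have "Sym (\<alpha> + M) (RRs A B (tensor \<alpha> f (Sym M X))) x =
      Sym (\<alpha> + M) (\<lambda>y. \<Sum>\<tau> | \<tau> permutes {1..M}. RRs A B (tensor \<alpha> f X) (\<lambda>\<nu>. y (shp \<alpha> \<tau> \<nu>))) x"
    by (rule Sym_cong[OF _ x])
  also have "\<dots> = (\<Sum>\<tau> | \<tau> permutes {1..M}. Sym (\<alpha> + M) (RRs A B (tensor \<alpha> f X)) x)"
    unfolding Sym_sum by (intro sum.cong refl Sym_act shp_permutes) simp
  also have "\<dots> = fact M * Sym (\<alpha> + M) (RRs A B (tensor \<alpha> f X)) x"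
    unfolding sum_constant card_perms by simp
  finally show ?thesis by (simp add: A_def B_def)
qed

subsection \<open>Rotation of the factors\<close>

lemma tensor_rot:
  assumes f: "holomorphic_vars p \<alpha> f" and g: "holomorphic_vars p \<beta> g"
  shows "tensor \<beta> g f = (\<lambda>x. tensor \<alpha> f g (\<lambda>\<nu>. x (rot \<alpha> \<beta> \<nu>)))"
proof
  fix x
  have "f (\<lambda>\<nu>. x (rot \<alpha> \<beta> \<nu>)) = f (\<lambda>j. x (\<beta> + j))"
    by (rule holomorphic_varsD(1)[OF f]) (simp add: rot_def)
  moreover have "g (\<lambda>j. x (rot \<alpha> \<beta> (\<alpha> + j))) = g x"
    by (rule holomorphic_varsD(1)[OF g]) (simp add: rot_def)
  ultimately show "tensor \<beta> g f x = tensor \<alpha> f g (\<lambda>\<nu>. x (rot \<alpha> \<beta> \<nu>))" by (simp add: tensor_def)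
qed

lemma rot_image_left: "1 \<le> a \<Longrightarrow> b \<le> \<alpha> \<Longrightarrow> rot \<alpha> \<beta> ` {a..b} = {\<beta> + a..\<beta> + b}"
proof -
  assume ab: "1 \<le> a" "b \<le> \<alpha>"
  have "rot \<alpha> \<beta> ` {a..b} = (+) \<beta> ` {a..b}"
    by (intro image_cong) (use ab in \<open>auto simp: rot_def\<close>)
  then show ?thesis by simp
qed

lemma rot_image_right: "1 \<le> a \<Longrightarrow> b \<le> \<beta> \<Longrightarrow> rot \<alpha> \<beta> ` {\<alpha> + a..\<alpha> + b} = {a..b}"
proof -
  assume ab: "1 \<le> a" "b \<le> \<beta>"
  have "rot \<alpha> \<beta> ` {\<alpha> + a..\<alpha> + b} = rot \<alpha> \<beta> ` ((+) \<alpha> ` {a..b})" by (simp add: add.commute)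
  also have "\<dots> = (\<lambda>k. k) ` {a..b}" unfolding image_image
    by (intro image_cong) (use ab in \<open>auto simp: rot_def\<close>)
  finally show ?thesis by simp
qed

text \<open>Serves to bring terms that come with permuted tensor products to a common one under the
  symmetrization.\<close>

lemma RRs_RRs_act:
  assumes \<sigma>: "\<sigma> permutes {1..N}"
  shows "Sym N (RRs (\<sigma> ` A) (\<sigma> ` B) (RRs (\<sigma> ` C) (\<sigma> ` D) (\<lambda>x. f (\<lambda>\<nu>. x (\<sigma> \<nu>))))) x = Sym N (RRs A B (RRs C D f)) x"
    "Sym N (RRs (\<sigma> ` A) (\<sigma> ` B) (\<lambda>x. f (\<lambda>\<nu>. x (\<sigma> \<nu>)))) x = Sym N (RRs A B f) x"
proof -
  have *: "RRs (\<sigma> ` A) (\<sigma> ` B) (\<lambda>x. f (\<lambda>\<nu>. x (\<sigma> \<nu>))) = (\<lambda>x. RRs A B f (\<lambda>\<nu>. x (\<sigma> \<nu>)))" for A B f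
    by (rule ext) (rule RRs_act[OF \<sigma>])
  show "Sym N (RRs (\<sigma> ` A) (\<sigma> ` B) (RRs (\<sigma> ` C) (\<sigma> ` D) (\<lambda>x. f (\<lambda>\<nu>. x (\<sigma> \<nu>))))) x = Sym N (RRs A B (RRs C D f)) x"
    unfolding * by (rule Sym_act[OF \<sigma>])
  show "Sym N (RRs (\<sigma> ` A) (\<sigma> ` B) (\<lambda>x. f (\<lambda>\<nu>. x (\<sigma> \<nu>)))) x = Sym N (RRs A B f) x"
    unfolding * by (rule Sym_act[OF \<sigma>])
qed

section \<open>The axioms of a Poisson bracket\<close>

text \<open>Rotating the factors turns one bracket into the other with the two index sets exchanged;
  \<open>RRs_antisym\<close> gives the sign.\<close>

lemma bracket_antisym:
  assumes f: "f \<in> TH \<alpha>" and g: "g \<in> TH \<beta>"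
  shows "br \<beta> \<alpha> g f x = - br \<alpha> \<beta> f g x"
proof -
  define \<rho> where "\<rho> = rot \<alpha> \<beta>"
  have \<rho>: "\<rho> permutes {1..\<alpha> + \<beta>}" unfolding \<rho>_def by (rule rot_permutes)
  have img: "\<rho> ` {\<alpha> + 1..\<alpha> + \<beta>} = {1..\<beta>}" "\<rho> ` {1..\<alpha>} = {\<beta> + 1..\<beta> + \<alpha>}"
    unfolding \<rho>_def by (rule rot_image_right rot_image_left; simp)+
  have "br \<beta> \<alpha> g f = (\<lambda>x. - br \<alpha> \<beta> f g x)"
  proof (rule holomorphic_vars_eq_on_U)
    show "holomorphic_vars p (\<alpha> + \<beta>) (br \<beta> \<alpha> g f)"
      using TH_D(1)[OF bracket_exists(1)[OF g f]] by (simp add: add.commute)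
    show "holomorphic_vars p (\<alpha> + \<beta>) (\<lambda>x. - br \<alpha> \<beta> f g x)"
      by (intro holomorphic_vars_minus TH_D(1)[OF bracket_exists(1)[OF f g]])
    fix x assume x: "x \<in> U (\<alpha> + \<beta>)"
    have "br \<beta> \<alpha> g f x = 1 / (fact \<beta> * fact \<alpha>) * Sym (\<beta> + \<alpha>) (RRs {1..\<beta>} {\<beta> + 1..\<beta> + \<alpha>} (tensor \<beta> g f)) x"
      by (rule bracket_U[OF g f]) (use x in \<open>simp add: add.commute\<close>)
    also have "Sym (\<beta> + \<alpha>) (RRs {1..\<beta>} {\<beta> + 1..\<beta> + \<alpha>} (tensor \<beta> g f)) x =
        Sym (\<alpha> + \<beta>) (RRs {\<alpha> + 1..\<alpha> + \<beta>} {1..\<alpha>} (tensor \<alpha> f g)) x"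
      unfolding img[symmetric] unfolding tensor_rot[OF TH_D(1)[OF f] TH_D(1)[OF g]] \<rho>_def[symmetric]
      unfolding add.commute[of \<beta> \<alpha>]
      by (rule RRs_RRs_act(2)[OF \<rho>])
    also have "\<dots> = Sym (\<alpha> + \<beta>) (\<lambda>y. - 1 * RRs {1..\<alpha>} {\<alpha> + 1..\<alpha> + \<beta>} (tensor \<alpha> f g) y) x"
    proof (rule Sym_cong[OF _ x])
      fix y assume "y \<in> U (\<alpha> + \<beta>)"
      then have "RRs {\<alpha> + 1..\<alpha> + \<beta>} {1..\<alpha>} (tensor \<alpha> f g) y = - RRs {1..\<alpha>} {\<alpha> + 1..\<alpha> + \<beta>} (tensor \<alpha> f g) y"
        by (rule RRs_antisym) auto
      then show "RRs {\<alpha> + 1..\<alpha> + \<beta>} {1..\<alpha>} (tensor \<alpha> f g) y = - 1 * RRs {1..\<alpha>} {\<alpha> + 1..\<alpha> + \<beta>} (tensor \<alpha> f g) y" by simp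
    qed
    also have "\<dots> = - Sym (\<alpha> + \<beta>) (RRs {1..\<alpha>} {\<alpha> + 1..\<alpha> + \<beta>} (tensor \<alpha> f g)) x"
      unfolding Sym_mult_const by simp
    finally show "br \<beta> \<alpha> g f x = - br \<alpha> \<beta> f g x"
      unfolding bracket_U[OF f g x] by (simp add: mult.commute)
  qed
  from fun_cong[OF this, of x] show ?thesis .
qed

lemma bracket_linear_left:
  assumes f: "f \<in> TH \<alpha>" "f' \<in> TH \<alpha>" and g: "g \<in> TH \<beta>"
  shows "br \<alpha> \<beta> (\<lambda>x. c * f x + f' x) g x = c * br \<alpha> \<beta> f g x + br \<alpha> \<beta> f' g x"
proof -
  have ff: "(\<lambda>x. c * f x + f' x) \<in> TH \<alpha>" by (rule TH_add[OF TH_mult_const[OF f(1)] f(2)])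
  have "br \<alpha> \<beta> (\<lambda>x. c * f x + f' x) g = (\<lambda>x. c * br \<alpha> \<beta> f g x + br \<alpha> \<beta> f' g x)"
  proof (rule holomorphic_vars_eq_on_U)
    show "holomorphic_vars p (\<alpha> + \<beta>) (br \<alpha> \<beta> (\<lambda>x. c * f x + f' x) g)"
      by (rule TH_D(1)[OF bracket_exists(1)[OF ff g]])
    show "holomorphic_vars p (\<alpha> + \<beta>) (\<lambda>x. c * br \<alpha> \<beta> f g x + br \<alpha> \<beta> f' g x)"
      by (rule TH_D(1)[OF TH_add[OF TH_mult_const[OF bracket_exists(1)[OF f(1) g]] bracket_exists(1)[OF f(2) g]]])
    fix x assume x: "x \<in> U (\<alpha> + \<beta>)"
    define A where "A = {1..\<alpha>}"
    define B where "B = {\<alpha> + 1..\<alpha> + \<beta>}"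
    have AB: "A \<subseteq> {1..\<alpha> + \<beta>}" "B \<subseteq> {1..\<alpha> + \<beta>}" by (auto simp: A_def B_def)
    have d: "tensor \<alpha> f g \<in> dif (\<alpha> + \<beta>)" "tensor \<alpha> f' g \<in> dif (\<alpha> + \<beta>)"
      by (intro holomorphic_vars_dif TH_D(1) TH_tensor f g)+
    have t: "tensor \<alpha> (\<lambda>x. c * f x + f' x) g = (\<lambda>x. c * tensor \<alpha> f g x + tensor \<alpha> f' g x)"
      by (rule ext) (simp add: tensor_def algebra_simps)
    have "RRs A B (tensor \<alpha> (\<lambda>x. c * f x + f' x) g) y = c * RRs A B (tensor \<alpha> f g) y + RRs A B (tensor \<alpha> f' g) y"
      if "y \<in> U (\<alpha> + \<beta>)" for y
      unfolding t RRs_add[OF dif_mult[OF dif_const d(1)] d(2) that AB] RRs_mult_const[OF d(1) that AB] ..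
    then have "Sym (\<alpha> + \<beta>) (RRs A B (tensor \<alpha> (\<lambda>x. c * f x + f' x) g)) x =
        Sym (\<alpha> + \<beta>) (\<lambda>y. c * RRs A B (tensor \<alpha> f g) y + RRs A B (tensor \<alpha> f' g) y) x"
      by (rule Sym_cong[OF _ x])
    also have "\<dots> = c * Sym (\<alpha> + \<beta>) (RRs A B (tensor \<alpha> f g)) x + Sym (\<alpha> + \<beta>) (RRs A B (tensor \<alpha> f' g)) x"
      unfolding Sym_add Sym_mult_const ..
    finally show "br \<alpha> \<beta> (\<lambda>x. c * f x + f' x) g x = c * br \<alpha> \<beta> f g x + br \<alpha> \<beta> f' g x"
      unfolding bracket_U[OF ff g x] bracket_U[OF f(1) g x] bracket_U[OF f(2) g x] A_def B_def
      by (simp add: field_simps)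
  qed
  from fun_cong[OF this, of x] show ?thesis .
qed

lemma RR_RRs:
  assumes f: "holomorphic_vars p N f" and x: "x \<in> U N" and ij: "i \<in> {1..N}" "j \<in> {1..N}"
    and AB: "A \<subseteq> {1..N}" "B \<subseteq> {1..N}" "A \<inter> B = {}"
  shows "RR i j (RRs A B f) x = (\<Sum>a\<in>A. \<Sum>b\<in>B. RR i j (RR a b f) x)"
proof -
  have d: "RR a b f \<in> dif N" if "a \<in> A" "b \<in> B" for a b
  proof (rule RR_dif[OF f])
    show "a \<in> {1..N}" "b \<in> {1..N}" "a \<noteq> b" using that AB by blast+
  qed
  have "RR i j (RRs A B f) x = (\<Sum>a\<in>A. RR i j (\<lambda>x. \<Sum>b\<in>B. RR a b f x) x)"
    unfolding RRs_def[abs_def] by (rule RR_sum[OF _ x ij]) (intro dif_sum d)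
  also have "\<dots> = (\<Sum>a\<in>A. \<Sum>b\<in>B. RR i j (RR a b f) x)"
    by (intro sum.cong refl RR_sum[OF _ x ij] d)
  finally show ?thesis .
qed

lemma RRs_RRs:
  assumes f: "holomorphic_vars p N f" and x: "x \<in> U N" and CD: "C \<subseteq> {1..N}" "D \<subseteq> {1..N}"
    and AB: "A \<subseteq> {1..N}" "B \<subseteq> {1..N}" "A \<inter> B = {}"
  shows "RRs C D (RRs A B f) x = (\<Sum>c\<in>C. \<Sum>d\<in>D. \<Sum>a\<in>A. \<Sum>b\<in>B. RR c d (RR a b f) x)"
  unfolding RRs_def[of C D] using CD by (intro sum.cong refl RR_RRs[OF f x _ _ AB]) auto

text \<open>Only the pairs with a common block contribute to a commutator.\<close>

lemma RRs_jacobi: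
  assumes f: "holomorphic_vars p N f" and x: "x \<in> U N"
    and ABC: "A \<subseteq> {1..N}" "B \<subseteq> {1..N}" "C \<subseteq> {1..N}" "A \<inter> B = {}" "A \<inter> C = {}" "B \<inter> C = {}"
  shows "RRs A (B \<union> C) (RRs B C f) x + RRs B (C \<union> A) (RRs C A f) x + RRs C (A \<union> B) (RRs A B f) x = 0"
proof -
  have fin: "finite A" "finite B" "finite C" by (rule finite_subset[OF ABC(1)] finite_subset[OF ABC(2)] finite_subset[OF ABC(3)], simp)+
  have dis: "B \<inter> A = {}" "C \<inter> A = {}" "C \<inter> B = {}" using ABC by auto
  define K where "K i j k l = RR i j (RR k l f) x - RR k l (RR i j f) x" for i j k l
  have com: "K a b c d = 0" if "a \<in> {1..N}" "b \<in> {1..N}" "c \<in> {1..N}" "d \<in> {1..N}" "a \<noteq> b" "c \<noteq> d" "a \<noteq> c" "a \<noteq> d" "b \<noteq> c" "b \<noteq> d" for a b c d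
    unfolding K_def using RR_commute[OF f x that] by simp
  note R = RRs_RRs[OF f x]
  have d: "RRs A C f \<in> dif N" by (rule RRs_dif[OF f ABC(1,3,5)])
  have neg: "RRs X Y (RRs C A f) x = - RRs X Y (RRs A C f) x" if "X \<subseteq> {1..N}" "Y \<subseteq> {1..N}" for X Y
  proof -
    have "RRs X Y (RRs C A f) x = RRs X Y (\<lambda>y. - 1 * RRs A C f y) x"
      by (rule RRs_cong[OF _ x that]) (use RRs_antisym[OF _ ABC(1,3,5)] in simp)
    then show ?thesis unfolding RRs_mult_const[OF d x that] by simp
  qed
  have AB_BC: "RRs A B (RRs B C f) x - RRs B C (RRs A B f) x = (\<Sum>a\<in>A. \<Sum>b\<in>B. \<Sum>c\<in>C. K a b b c)"
  proof -
    have "RRs B C (RRs A B f) x = (\<Sum>b'\<in>B. \<Sum>a\<in>A. \<Sum>c\<in>C. \<Sum>b\<in>B. RR b' c (RR a b f) x)"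
      unfolding R[OF ABC(2,3) ABC(1,2,4)] by (rule sum.cong[OF refl], rule sum.swap)
    also have "\<dots> = (\<Sum>a\<in>A. \<Sum>b'\<in>B. \<Sum>c\<in>C. \<Sum>b\<in>B. RR b' c (RR a b f) x)" by (rule sum.swap)
    also have "\<dots> = (\<Sum>a\<in>A. \<Sum>b'\<in>B. \<Sum>b\<in>B. \<Sum>c\<in>C. RR b' c (RR a b f) x)"
      by (intro sum.cong refl sum.swap)
    also have "\<dots> = (\<Sum>a\<in>A. \<Sum>b\<in>B. \<Sum>b'\<in>B. \<Sum>c\<in>C. RR b' c (RR a b f) x)"
      by (rule sum.cong[OF refl], rule sum.swap)
    finally have "RRs A B (RRs B C f) x - RRs B C (RRs A B f) x = (\<Sum>a\<in>A. \<Sum>b\<in>B. \<Sum>b'\<in>B. \<Sum>c\<in>C. K a b b' c)"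
      unfolding R[OF ABC(1,2) ABC(2,3,6)] K_def sum_subtractf by simp
    also have "\<dots> = (\<Sum>a\<in>A. \<Sum>b\<in>B. \<Sum>b'\<in>B. if b' = b then \<Sum>c\<in>C. K a b b c else 0)"
    proof (intro sum.cong refl)
      fix a b b' assume *: "a \<in> A" "b \<in> B" "b' \<in> B"
      show "(\<Sum>c\<in>C. K a b b' c) = (if b' = b then \<Sum>c\<in>C. K a b b c else 0)"
      proof (cases "b' = b")
        case False
        have "K a b b' c = 0" if "c \<in> C" for c using * that False ABC by (intro com) auto
        with False show ?thesis by simp
      qed simp
    qed
    finally show ?thesis using fin by simp
  qed
  have AC_BC: "RRs A C (RRs B C f) x - RRs B C (RRs A C f) x = (\<Sum>a\<in>A. \<Sum>b\<in>B. \<Sum>c\<in>C. K a c b c)"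
  proof -
    have 1: "RRs A C (RRs B C f) x = (\<Sum>a\<in>A. \<Sum>b\<in>B. \<Sum>c\<in>C. \<Sum>c'\<in>C. RR a c (RR b c' f) x)"
      unfolding R[OF ABC(1,3) ABC(2,3,6)] by (rule sum.cong[OF refl], rule sum.swap)
    have "RRs B C (RRs A C f) x = (\<Sum>b\<in>B. \<Sum>a\<in>A. \<Sum>c'\<in>C. \<Sum>c\<in>C. RR b c' (RR a c f) x)"
      unfolding R[OF ABC(2,3) ABC(1,3,5)] by (rule sum.cong[OF refl], rule sum.swap)
    also have "\<dots> = (\<Sum>a\<in>A. \<Sum>b\<in>B. \<Sum>c'\<in>C. \<Sum>c\<in>C. RR b c' (RR a c f) x)" by (rule sum.swap)
    also have "\<dots> = (\<Sum>a\<in>A. \<Sum>b\<in>B. \<Sum>c\<in>C. \<Sum>c'\<in>C. RR b c' (RR a c f) x)"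
      by (intro sum.cong refl sum.swap)
    finally have "RRs A C (RRs B C f) x - RRs B C (RRs A C f) x = (\<Sum>a\<in>A. \<Sum>b\<in>B. \<Sum>c\<in>C. \<Sum>c'\<in>C. K a c b c')"
      unfolding 1 K_def sum_subtractf by simp
    also have "\<dots> = (\<Sum>a\<in>A. \<Sum>b\<in>B. \<Sum>c\<in>C. \<Sum>c'\<in>C. if c' = c then K a c b c else 0)"
    proof (intro sum.cong refl)
      fix a b c c' assume *: "a \<in> A" "b \<in> B" "c \<in> C" "c' \<in> C"
      show "K a c b c' = (if c' = c then K a c b c else 0)"
        using * ABC by (cases "c' = c") (auto intro!: com)
    qed
    finally show ?thesis using fin by simp
  qed
  have AB_AC: "RRs A B (RRs A C f) x - RRs A C (RRs A B f) x = (\<Sum>a\<in>A. \<Sum>b\<in>B. \<Sum>c\<in>C. K a b a c)"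
  proof -
    have 1: "RRs A B (RRs A C f) x = (\<Sum>a\<in>A. \<Sum>a'\<in>A. \<Sum>b\<in>B. \<Sum>c\<in>C. RR a b (RR a' c f) x)"
      unfolding R[OF ABC(1,2) ABC(1,3,5)] by (rule sum.cong[OF refl], rule sum.swap)
    have "RRs A C (RRs A B f) x = (\<Sum>a'\<in>A. \<Sum>a\<in>A. \<Sum>c\<in>C. \<Sum>b\<in>B. RR a' c (RR a b f) x)"
      unfolding R[OF ABC(1,3) ABC(1,2,4)] by (rule sum.cong[OF refl], rule sum.swap)
    also have "\<dots> = (\<Sum>a\<in>A. \<Sum>a'\<in>A. \<Sum>c\<in>C. \<Sum>b\<in>B. RR a' c (RR a b f) x)" by (rule sum.swap)
    also have "\<dots> = (\<Sum>a\<in>A. \<Sum>a'\<in>A. \<Sum>b\<in>B. \<Sum>c\<in>C. RR a' c (RR a b f) x)"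
      by (intro sum.cong refl sum.swap)
    finally have "RRs A B (RRs A C f) x - RRs A C (RRs A B f) x = (\<Sum>a\<in>A. \<Sum>a'\<in>A. \<Sum>b\<in>B. \<Sum>c\<in>C. K a b a' c)"
      unfolding 1 K_def sum_subtractf by simp
    also have "\<dots> = (\<Sum>a\<in>A. \<Sum>a'\<in>A. if a' = a then \<Sum>b\<in>B. \<Sum>c\<in>C. K a b a c else 0)"
    proof (intro sum.cong refl)
      fix a a' assume *: "a \<in> A" "a' \<in> A"
      show "(\<Sum>b\<in>B. \<Sum>c\<in>C. K a b a' c) = (if a' = a then \<Sum>b\<in>B. \<Sum>c\<in>C. K a b a c else 0)"
      proof (cases "a' = a")
        case False
        have "K a b a' c = 0" if "b \<in> B" "c \<in> C" for b c using * that False ABC by (intro com) auto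
        with False show ?thesis by simp
      qed simp
    qed
    finally show ?thesis using fin by simp
  qed
  have yb: "K a b a c + K a b b c + K a c b c = 0" if "a \<in> A" "b \<in> B" "c \<in> C" for a b c
    unfolding K_def by (rule RR_yang_baxter[OF f x]) (use that ABC in auto)
  \<comment> \<open>Antisymmetry of \<open>RRs\<close> turns the cyclic sum into the three
    commutators of the Yang-Baxter equation.\<close>
  have "RRs A (B \<union> C) (RRs B C f) x + RRs B (C \<union> A) (RRs C A f) x + RRs C (A \<union> B) (RRs A B f) x =
    (RRs A B (RRs A C f) x - RRs A C (RRs A B f) x) + (RRs A B (RRs B C f) x - RRs B C (RRs A B f) x)
    + (RRs A C (RRs B C f) x - RRs B C (RRs A C f) x)"
    unfolding RRs_Un[OF fin(2,3) ABC(6)] RRs_Un[OF fin(3,1) dis(2)] RRs_Un[OF fin(1,2) ABC(4)]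
      neg[OF ABC(2,3)] neg[OF ABC(1,2)]
      RRs_antisym[OF x ABC(1,2,4)] RRs_antisym[OF x ABC(1,3,5)] RRs_antisym[OF x ABC(2,3,6)]
    by simp
  also have "\<dots> = (\<Sum>a\<in>A. \<Sum>b\<in>B. \<Sum>c\<in>C. K a b a c + K a b b c + K a c b c)"
    unfolding AB_BC AC_BC AB_AC by (simp add: sum.distrib)
  also have "\<dots> = 0" using yb by simp
  finally show ?thesis .
qed

text \<open>The factor \<open>fact (\<beta> + \<gamma>)\<close> from absorbing the inner
  symmetrization cancels against the normalization of the outer bracket, which leaves a constant
  symmetric in the three degrees.\<close>

lemma bracket_bracket:
  assumes f: "f \<in> TH \<alpha>" and g: "g \<in> TH \<beta>" and h: "h \<in> TH \<gamma>" and x: "x \<in> U (\<alpha> + (\<beta> + \<gamma>))"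
  shows "br \<alpha> (\<beta> + \<gamma>) f (br \<beta> \<gamma> g h) x = 1 / (fact \<alpha> * fact \<beta> * fact \<gamma>) *
    Sym (\<alpha> + (\<beta> + \<gamma>)) (RRs {1..\<alpha>} {\<alpha> + 1..\<alpha> + (\<beta> + \<gamma>)}
      (RRs {\<alpha> + 1..\<alpha> + \<beta>} {\<alpha> + (\<beta> + 1)..\<alpha> + (\<beta> + \<gamma>)} (tensor \<alpha> f (tensor \<beta> g h)))) x"
proof -
  define M where "M = \<beta> + \<gamma>"
  define N where "N = \<alpha> + M"
  define A where "A = {1..\<alpha>}"
  define B where "B = {\<alpha> + 1..\<alpha> + M}"
  define C where "C = {\<alpha> + 1..\<alpha> + \<beta>}"
  define D where "D = {\<alpha> + (\<beta> + 1)..\<alpha> + (\<beta> + \<gamma>)}"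
  define c where "c = 1 / (fact \<beta> * fact \<gamma> :: complex)"
  define \<Phi> where "\<Phi> = tensor \<alpha> f (tensor \<beta> g h)"
  define Y where "Y = RRs {1..\<beta>} {\<beta> + 1..\<beta> + \<gamma>} (tensor \<beta> g h)"
  \<comment> \<open>The inner bracket before symmetrization. It may have poles, so its tensor
    product with \<open>f\<close> is only shown to lie in \<open>dif\<close>.\<close>
  define X where "X = (\<lambda>z. c * Y z)"
  have b: "br \<beta> \<gamma> g h \<in> TH M" unfolding M_def by (rule bracket_exists(1)[OF g h])
  have gh: "tensor \<beta> g h \<in> TH M" unfolding M_def by (rule TH_tensor[OF g h])
  have \<Phi>: "\<Phi> \<in> TH N" unfolding \<Phi>_def N_def by (rule TH_tensor[OF f gh])
  have xN: "x \<in> U N" using x by (simp add: N_def M_def)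
  have sets: "A \<subseteq> {1..N}" "B \<subseteq> {1..N}" "C \<subseteq> {1..N}" "D \<subseteq> {1..N}" "C \<inter> D = {}"
    by (auto simp: A_def B_def C_def D_def N_def M_def)
  have W: "RRs C D \<Phi> \<in> dif N" by (rule RRs_dif[OF TH_D(1)[OF \<Phi>] sets(3-5)])
  have tX: "tensor \<alpha> f X y = c * RRs C D \<Phi> y" if y: "y \<in> U N" for y
  proof -
    have "tensor \<alpha> f Y y = RRs ((+) \<alpha> ` {1..\<beta>}) ((+) \<alpha> ` {\<beta> + 1..\<beta> + \<gamma>}) \<Phi> y"
      unfolding Y_def \<Phi>_def
      by (rule RRs_tensor_right[OF TH_D(1)[OF f] holomorphic_vars_dif[OF TH_D(1)[OF gh]]])
        (use y in \<open>auto simp: N_def M_def\<close>)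
    moreover have "(+) \<alpha> ` {1..\<beta>} = C" "(+) \<alpha> ` {\<beta> + 1..\<beta> + \<gamma>} = D"
      by (simp_all add: C_def D_def ac_simps)
    ultimately show ?thesis by (simp add: X_def tensor_def[of \<alpha>])
  qed
  have dX: "tensor \<alpha> f X \<in> dif N"
    by (rule dif_cong[OF tX[symmetric] dif_mult[OF dif_const W]])
  have bX: "br \<beta> \<gamma> g h z = Sym M X z" if "z \<in> U M" for z
    unfolding X_def Sym_mult_const Y_def c_def M_def by (rule bracket_U[OF g h]) (use that in \<open>simp add: M_def\<close>)
  have "br \<alpha> (\<beta> + \<gamma>) f (br \<beta> \<gamma> g h) x = 1 / (fact \<alpha> * fact M) * Sym N (RRs A B (tensor \<alpha> f (br \<beta> \<gamma> g h))) x"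
    unfolding N_def A_def B_def M_def by (rule bracket_U[OF f b[unfolded M_def] x])
  also have "Sym N (RRs A B (tensor \<alpha> f (br \<beta> \<gamma> g h))) x = Sym N (RRs A B (tensor \<alpha> f (Sym M X))) x"
  proof (rule Sym_cong[OF RRs_cong[OF _ _ sets(1,2)] xN])
    fix y assume "y \<in> U N"
    then have "(\<lambda>j. y (\<alpha> + j)) \<in> U M" unfolding N_def by (rule shift_U_right)
    then show "tensor \<alpha> f (br \<beta> \<gamma> g h) y = tensor \<alpha> f (Sym M X) y" by (simp add: tensor_def bX)
  qed
  also have "\<dots> = fact M * Sym N (RRs A B (tensor \<alpha> f X)) x"
    unfolding N_def A_def B_def
    by (rule Sym_RRs_tensor_Sym[OF TH_D(1)[OF f]]) (use dX xN in \<open>simp_all add: N_def\<close>)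
  also have "Sym N (RRs A B (tensor \<alpha> f X)) x = Sym N (\<lambda>y. c * RRs A B (RRs C D \<Phi>) y) x"
  proof (rule Sym_cong[OF _ xN])
    fix y assume y: "y \<in> U N"
    have "RRs A B (tensor \<alpha> f X) y = RRs A B (\<lambda>y. c * RRs C D \<Phi> y) y"
      by (rule RRs_cong[OF tX y sets(1,2)])
    then show "RRs A B (tensor \<alpha> f X) y = c * RRs A B (RRs C D \<Phi>) y"
      unfolding RRs_mult_const[OF W y sets(1,2)] .
  qed
  also have "\<dots> = c * Sym N (RRs A B (RRs C D \<Phi>)) x" by (rule Sym_mult_const)
  finally show ?thesis by (simp add: c_def A_def B_def C_def D_def \<Phi>_def N_def M_def)
qed

text \<open>Rotations bring the second and the third term to the tensor product
  \<open>\<Phi>\<close> of the first; under one common symmetrization the sum is then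
  \<open>RRs_jacobi\<close>.\<close>

theorem bracket_jacobi:
  assumes f: "f \<in> TH \<alpha>" and g: "g \<in> TH \<beta>" and h: "h \<in> TH \<gamma>"
  shows "br \<alpha> (\<beta> + \<gamma>) f (br \<beta> \<gamma> g h) x + br \<beta> (\<gamma> + \<alpha>) g (br \<gamma> \<alpha> h f) x + br \<gamma> (\<alpha> + \<beta>) h (br \<alpha> \<beta> f g) x = 0"
proof -
  define N where "N = \<alpha> + (\<beta> + \<gamma>)"
  have N: "\<beta> + (\<gamma> + \<alpha>) = N" "\<gamma> + (\<alpha> + \<beta>) = N" "\<alpha> + (\<beta> + \<gamma>) = N" by (simp_all add: N_def)
  note hf = TH_D(1)[OF f] and hg = TH_D(1)[OF g] and hh = TH_D(1)[OF h]
  define A where "A = {1..\<alpha>}"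
  define B where "B = {\<alpha> + 1..\<alpha> + \<beta>}"
  define C where "C = {\<alpha> + (\<beta> + 1)..\<alpha> + (\<beta> + \<gamma>)}"
  define \<Phi> where "\<Phi> = tensor \<alpha> f (tensor \<beta> g h)"
  define c where "c = 1 / (fact \<alpha> * fact \<beta> * fact \<gamma> :: complex)"
  have \<Phi>: "holomorphic_vars p N \<Phi>"
    unfolding \<Phi>_def N_def by (intro holomorphic_vars_tensor hf hg hh)
  have sets: "A \<subseteq> {1..N}" "B \<subseteq> {1..N}" "C \<subseteq> {1..N}" "A \<inter> B = {}" "A \<inter> C = {}" "B \<inter> C = {}"
    by (auto simp: A_def B_def C_def N_def)
  define J where "J = (\<lambda>x. br \<alpha> (\<beta> + \<gamma>) f (br \<beta> \<gamma> g h) x + br \<beta> (\<gamma> + \<alpha>) g (br \<gamma> \<alpha> h f) x + br \<gamma> (\<alpha> + \<beta>) h (br \<alpha> \<beta> f g) x)"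
  have b: "br \<alpha> (\<beta> + \<gamma>) f (br \<beta> \<gamma> g h) \<in> TH N" "br \<beta> (\<gamma> + \<alpha>) g (br \<gamma> \<alpha> h f) \<in> TH N" "br \<gamma> (\<alpha> + \<beta>) h (br \<alpha> \<beta> f g) \<in> TH N"
    using bracket_exists(1)[OF f bracket_exists(1)[OF g h]] bracket_exists(1)[OF g bracket_exists(1)[OF h f]]
      bracket_exists(1)[OF h bracket_exists(1)[OF f g]] unfolding N by blast+
  have "J = (\<lambda>_. 0)"
  proof (rule holomorphic_vars_eq_on_U)
    show "holomorphic_vars p N J" unfolding J_def by (rule TH_D(1)[OF TH_add[OF TH_add[OF b(1,2)] b(3)]])
    fix x assume x: "x \<in> U N"
    have 1: "br \<alpha> (\<beta> + \<gamma>) f (br \<beta> \<gamma> g h) x = c * Sym N (RRs A (B \<union> C) (RRs B C \<Phi>)) x"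
    proof -
      have BC: "B \<union> C = {\<alpha> + 1..\<alpha> + (\<beta> + \<gamma>)}" by (auto simp: B_def C_def)
      show ?thesis unfolding BC unfolding c_def A_def B_def C_def \<Phi>_def N_def
        by (rule bracket_bracket[OF f g h]) (use x in \<open>simp add: N_def\<close>)
    qed
    have 2: "br \<beta> (\<gamma> + \<alpha>) g (br \<gamma> \<alpha> h f) x = c * Sym N (RRs B (C \<union> A) (RRs C A \<Phi>)) x"
    proof -
      define \<rho> where "\<rho> = rot \<alpha> (\<beta> + \<gamma>)"
      have \<rho>: "\<rho> permutes {1..N}" unfolding \<rho>_def N_def by (rule rot_permutes)
      have iB: "\<rho> ` B = {1..\<beta>}" unfolding \<rho>_def B_def by (rule rot_image_right) auto
      have iC: "\<rho> ` C = {\<beta> + 1..\<beta> + \<gamma>}" unfolding \<rho>_def C_def by (rule rot_image_right) auto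
      have iA: "\<rho> ` A = {\<beta> + (\<gamma> + 1)..\<beta> + (\<gamma> + \<alpha>)}"
        unfolding \<rho>_def A_def by (subst rot_image_left) (auto simp: add.assoc)
      have iCA: "\<rho> ` (C \<union> A) = {\<beta> + 1..\<beta> + (\<gamma> + \<alpha>)}" unfolding image_Un iC iA by auto
      have t: "tensor \<beta> g (tensor \<gamma> h f) = (\<lambda>x. \<Phi> (\<lambda>\<nu>. x (\<rho> \<nu>)))"
        unfolding tensor_assoc[of \<beta> g \<gamma> h f] \<Phi>_def \<rho>_def by (rule tensor_rot[OF hf holomorphic_vars_tensor[OF hg hh]])
      have "br \<beta> (\<gamma> + \<alpha>) g (br \<gamma> \<alpha> h f) x = 1 / (fact \<beta> * fact \<gamma> * fact \<alpha>) *
          Sym N (RRs (\<rho> ` B) (\<rho> ` (C \<union> A)) (RRs (\<rho> ` C) (\<rho> ` A) (\<lambda>x. \<Phi> (\<lambda>\<nu>. x (\<rho> \<nu>))))) x"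
        unfolding iB iC iA iCA t[symmetric] using bracket_bracket[OF g h f, of x] x unfolding N by simp
      then show ?thesis unfolding RRs_RRs_act(1)[OF \<rho>] by (simp add: c_def mult_ac)
    qed
    have 3: "br \<gamma> (\<alpha> + \<beta>) h (br \<alpha> \<beta> f g) x = c * Sym N (RRs C (A \<union> B) (RRs A B \<Phi>)) x"
    proof -
      define \<rho> where "\<rho> = rot (\<alpha> + \<beta>) \<gamma>"
      have \<rho>: "\<rho> permutes {1..N}" unfolding \<rho>_def N_def add.assoc[symmetric] by (rule rot_permutes)
      have iC: "\<rho> ` C = {1..\<gamma>}" unfolding \<rho>_def C_def add.assoc[symmetric] using rot_image_right[of 1 \<gamma> \<gamma> "\<alpha> + \<beta>"] by simp
      have iA: "\<rho> ` A = {\<gamma> + 1..\<gamma> + \<alpha>}" unfolding \<rho>_def A_def by (rule rot_image_left) auto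
      have iB: "\<rho> ` B = {\<gamma> + (\<alpha> + 1)..\<gamma> + (\<alpha> + \<beta>)}" unfolding \<rho>_def B_def by (rule rot_image_left) auto
      have iAB: "\<rho> ` (A \<union> B) = {\<gamma> + 1..\<gamma> + (\<alpha> + \<beta>)}" unfolding image_Un iA iB by auto
      have t: "tensor \<gamma> h (tensor \<alpha> f g) = (\<lambda>x. \<Phi> (\<lambda>\<nu>. x (\<rho> \<nu>)))"
        unfolding \<Phi>_def tensor_assoc[of \<alpha> f \<beta> g h] \<rho>_def by (rule tensor_rot[OF holomorphic_vars_tensor[OF hf hg] hh])
      have "br \<gamma> (\<alpha> + \<beta>) h (br \<alpha> \<beta> f g) x = 1 / (fact \<gamma> * fact \<alpha> * fact \<beta>) *
          Sym N (RRs (\<rho> ` C) (\<rho> ` (A \<union> B)) (RRs (\<rho> ` A) (\<rho> ` B) (\<lambda>x. \<Phi> (\<lambda>\<nu>. x (\<rho> \<nu>))))) x"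
        unfolding iB iC iA iAB t[symmetric] using bracket_bracket[OF h f g, of x] x unfolding N by simp
      then show ?thesis unfolding RRs_RRs_act(1)[OF \<rho>] by (simp add: c_def mult_ac)
    qed
    have "J x = c * Sym N (\<lambda>y. RRs A (B \<union> C) (RRs B C \<Phi>) y + RRs B (C \<union> A) (RRs C A \<Phi>) y + RRs C (A \<union> B) (RRs A B \<Phi>) y) x"
      unfolding J_def 1 2 3 Sym_add by (simp add: distrib_left)
    also have "Sym N (\<lambda>y. RRs A (B \<union> C) (RRs B C \<Phi>) y + RRs B (C \<union> A) (RRs C A \<Phi>) y + RRs C (A \<union> B) (RRs A B \<Phi>) y) x = Sym N (\<lambda>_. 0) x"
      by (rule Sym_cong[OF RRs_jacobi[OF \<Phi> _ sets] x])
    finally show "J x = 0" by (simp add: Sym_def)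
  qed (rule holomorphic_vars_const)
  from fun_cong[OF this, of x] show ?thesis by (simp add: J_def)
qed

subsection \<open>The product\<close>

lemma sym_prod_eq: "sym_prod \<alpha> \<beta> f g x = 1 / (fact \<alpha> * fact \<beta>) * Sym (\<alpha> + \<beta>) (tensor \<alpha> f g) x"
  by (simp add: sym_prod_def Sym_def tensor_def first_blocks_def last_blocks_def)

lemma sym_prod_closed:
  assumes "f \<in> TH \<alpha>" "g \<in> TH \<beta>"
  shows "sym_prod \<alpha> \<beta> f g \<in> S (\<alpha> + \<beta>)"
  unfolding sym_theta_iff
proof (intro conjI allI impI)
  have "(\<lambda>x. 1 / (fact \<alpha> * fact \<beta>) * Sym (\<alpha> + \<beta>) (tensor \<alpha> f g) x) \<in> TH (\<alpha> + \<beta>)"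
    by (rule TH_mult_const[OF TH_Sym[OF TH_tensor[OF assms]]])
  then show "sym_prod \<alpha> \<beta> f g \<in> TH (\<alpha> + \<beta>)" unfolding sym_prod_eq[abs_def] .
  fix \<sigma> x assume "\<sigma> permutes {1..\<alpha> + \<beta>}"
  then show "sym_prod \<alpha> \<beta> f g (\<lambda>\<nu>. x (\<sigma> \<nu>)) = sym_prod \<alpha> \<beta> f g x"
    unfolding sym_prod_eq by (simp only: Sym_perm)
qed

lemma sym_prod_commute:
  assumes f: "f \<in> TH \<alpha>" and g: "g \<in> TH \<beta>"
  shows "sym_prod \<beta> \<alpha> g f x = sym_prod \<alpha> \<beta> f g x"
  unfolding sym_prod_eq tensor_rot[OF TH_D(1)[OF f] TH_D(1)[OF g]] add.commute[of \<beta> \<alpha>] Sym_act[OF rot_permutes]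
  by (simp add: mult.commute)

text \<open>Together with \<open>sym_prod_left\<close> this gives associativity: both ways of
  bracketing lead to the same symmetrized triple tensor product.\<close>

lemma sym_prod_right:
  assumes "f \<in> TH \<alpha>"
  shows "sym_prod \<alpha> (\<beta> + \<gamma>) f (sym_prod \<beta> \<gamma> g h) x =
    1 / (fact \<alpha> * fact \<beta> * fact \<gamma>) * Sym (\<alpha> + (\<beta> + \<gamma>)) (tensor \<alpha> f (tensor \<beta> g h)) x"
proof -
  define c where "c = 1 / (fact \<beta> * fact \<gamma> :: complex)"
  have "tensor \<alpha> f (sym_prod \<beta> \<gamma> g h) = (\<lambda>x. c * tensor \<alpha> f (Sym (\<beta> + \<gamma>) (tensor \<beta> g h)) x)"
    by (rule ext) (simp add: tensor_def[of \<alpha>] sym_prod_eq c_def)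
  then show ?thesis
    unfolding sym_prod_eq[of \<alpha>]
    by (simp only: Sym_mult_const Sym_tensor_Sym_right[OF TH_D(1)[OF assms]]) (simp add: c_def)
qed

lemma sym_prod_left:
  assumes "h \<in> TH \<gamma>"
  shows "sym_prod (\<alpha> + \<beta>) \<gamma> (sym_prod \<alpha> \<beta> f g) h x =
    1 / (fact \<alpha> * fact \<beta> * fact \<gamma>) * Sym (\<alpha> + (\<beta> + \<gamma>)) (tensor \<alpha> f (tensor \<beta> g h)) x"
proof -
  define c where "c = 1 / (fact \<alpha> * fact \<beta> :: complex)"
  have t: "tensor (\<alpha> + \<beta>) (sym_prod \<alpha> \<beta> f g) h = (\<lambda>x. c * tensor (\<alpha> + \<beta>) (Sym (\<alpha> + \<beta>) (tensor \<alpha> f g)) h x)"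
    by (rule ext) (simp add: tensor_def[of "\<alpha> + \<beta>"] sym_prod_eq c_def)
  show ?thesis
    unfolding sym_prod_eq[of "\<alpha> + \<beta>"] tensor_assoc add.assoc[symmetric] t Sym_mult_const
      Sym_tensor_Sym_left[OF TH_D(1)[OF assms]]
    by (simp add: c_def)
qed

lemma sym_prod_assoc:
  assumes "f \<in> TH \<alpha>" "h \<in> TH \<gamma>"
  shows "sym_prod (\<alpha> + \<beta>) \<gamma> (sym_prod \<alpha> \<beta> f g) h x = sym_prod \<alpha> (\<beta> + \<gamma>) f (sym_prod \<beta> \<gamma> g h) x"
  unfolding sym_prod_left[OF assms(2)] sym_prod_right[OF assms(1)] ..

text \<open>Once the inner symmetrizations are absorbed, the left side sums over pairs of a block of
  \<open>f\<close> with a block of \<open>g\<close> or of \<open>h\<close>, and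
  \<open>RRs_Un\<close> separates the two kinds. In the bracket terms the operator acts on two of
  the three factors and leaves the third alone.\<close>

theorem bracket_leibniz:
  assumes f: "f \<in> TH \<alpha>" and g: "g \<in> TH \<beta>" and h: "h \<in> TH \<gamma>"
  shows "br \<alpha> (\<beta> + \<gamma>) f (sym_prod \<beta> \<gamma> g h) x =
    sym_prod (\<alpha> + \<beta>) \<gamma> (br \<alpha> \<beta> f g) h x + sym_prod \<beta> (\<alpha> + \<gamma>) g (br \<alpha> \<gamma> f h) x"
proof -
  define N where "N = \<alpha> + (\<beta> + \<gamma>)"
  have N: "\<alpha> + \<beta> + \<gamma> = N" "\<beta> + (\<alpha> + \<gamma>) = N" "\<alpha> + (\<beta> + \<gamma>) = N" by (simp_all add: N_def)
  note hf = TH_D(1)[OF f] and hg = TH_D(1)[OF g] and hh = TH_D(1)[OF h]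
  define A where "A = {1..\<alpha>}"
  define B where "B = {\<alpha> + 1..\<alpha> + \<beta>}"
  define C where "C = {\<alpha> + (\<beta> + 1)..\<alpha> + (\<beta> + \<gamma>)}"
  define \<Phi> where "\<Phi> = tensor \<alpha> f (tensor \<beta> g h)"
  define c where "c = 1 / (fact \<alpha> * fact \<beta> * fact \<gamma> :: complex)"
  have \<Phi>: "holomorphic_vars p N \<Phi>"
    unfolding \<Phi>_def N_def by (intro holomorphic_vars_tensor hf hg hh)
  have \<Phi>': "\<Phi> = tensor (\<alpha> + \<beta>) (tensor \<alpha> f g) h" by (simp add: \<Phi>_def tensor_assoc)
  have sets: "A \<subseteq> {1..N}" "B \<subseteq> {1..N}" "C \<subseteq> {1..N}" "A \<inter> B = {}" "A \<inter> C = {}" "B \<inter> C = {}"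
    by (auto simp: A_def B_def C_def N_def)
  have gh: "sym_prod \<beta> \<gamma> g h \<in> TH (\<beta> + \<gamma>)" using S_D(1)[OF sym_prod_closed[OF g h]] .
  have fg: "br \<alpha> \<beta> f g \<in> TH (\<alpha> + \<beta>)" and fh: "br \<alpha> \<gamma> f h \<in> TH (\<alpha> + \<gamma>)"
    by (rule bracket_exists(1)[OF f g] bracket_exists(1)[OF f h])+
  have "br \<alpha> (\<beta> + \<gamma>) f (sym_prod \<beta> \<gamma> g h) =
      (\<lambda>x. sym_prod (\<alpha> + \<beta>) \<gamma> (br \<alpha> \<beta> f g) h x + sym_prod \<beta> (\<alpha> + \<gamma>) g (br \<alpha> \<gamma> f h) x)"
  proof (rule holomorphic_vars_eq_on_U)
    show "holomorphic_vars p N (br \<alpha> (\<beta> + \<gamma>) f (sym_prod \<beta> \<gamma> g h))"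
      unfolding N_def by (rule TH_D(1)[OF bracket_exists(1)[OF f gh]])
    show "holomorphic_vars p N (\<lambda>x. sym_prod (\<alpha> + \<beta>) \<gamma> (br \<alpha> \<beta> f g) h x + sym_prod \<beta> (\<alpha> + \<gamma>) g (br \<alpha> \<gamma> f h) x)"
      using TH_D(1)[OF S_D(1)[OF sym_prod_closed[OF fg h]]] TH_D(1)[OF S_D(1)[OF sym_prod_closed[OF g fh]]]
      unfolding N by (rule holomorphic_vars_add)
    fix x assume x: "x \<in> U N"
    have 1: "br \<alpha> (\<beta> + \<gamma>) f (sym_prod \<beta> \<gamma> g h) x = c * Sym N (RRs A (B \<union> C) \<Phi>) x"
    proof -
      define M where "M = \<beta> + \<gamma>"
      have NM: "N = \<alpha> + M" by (simp add: N_def M_def)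
      define k where "k = 1 / (fact \<beta> * fact \<gamma> :: complex)"
      define X where "X = (\<lambda>z. k * tensor \<beta> g h z)"
      have BC: "B \<union> C = {\<alpha> + 1..\<alpha> + M}" by (auto simp: B_def C_def M_def)
      have d: "\<Phi> \<in> dif N" by (rule holomorphic_vars_dif[OF \<Phi>])
      have tX: "tensor \<alpha> f X = (\<lambda>y. k * \<Phi> y)" by (rule ext) (simp add: X_def \<Phi>_def tensor_def[of \<alpha>])
      have s: "sym_prod \<beta> \<gamma> g h = Sym M X" by (rule ext) (simp only: sym_prod_eq X_def Sym_mult_const k_def M_def)
      have "br \<alpha> (\<beta> + \<gamma>) f (sym_prod \<beta> \<gamma> g h) x = 1 / (fact \<alpha> * fact M) * Sym N (RRs A (B \<union> C) (tensor \<alpha> f (Sym M X))) x"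
        unfolding BC A_def NM s[symmetric] unfolding M_def by (rule bracket_U[OF f gh]) (use x in \<open>simp add: N_def\<close>)
      also have "Sym N (RRs A (B \<union> C) (tensor \<alpha> f (Sym M X))) x = fact M * Sym N (RRs A (B \<union> C) (tensor \<alpha> f X)) x"
        unfolding BC A_def NM
        by (rule Sym_RRs_tensor_Sym[OF hf]) (use x d in \<open>auto simp: tX NM intro!: dif_mult dif_const\<close>)
      also have "Sym N (RRs A (B \<union> C) (tensor \<alpha> f X)) x = Sym N (\<lambda>y. k * RRs A (B \<union> C) \<Phi> y) x"
        unfolding tX by (rule Sym_cong[OF RRs_mult_const[OF d] x]) (use sets in auto)
      finally show ?thesis unfolding Sym_mult_const by (simp add: c_def k_def)
    qed
    have 2: "sym_prod (\<alpha> + \<beta>) \<gamma> (br \<alpha> \<beta> f g) h x = c * Sym N (RRs A B \<Phi>) x"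
    proof -
      define k where "k = 1 / (fact \<alpha> * fact \<beta> :: complex)"
      define Y where "Y = RRs A B (tensor \<alpha> f g)"
      have "Sym N (tensor (\<alpha> + \<beta>) (br \<alpha> \<beta> f g) h) x = Sym N (\<lambda>y. k * tensor (\<alpha> + \<beta>) (Sym (\<alpha> + \<beta>) Y) h y) x"
      proof (rule Sym_cong[OF _ x])
        fix y assume "y \<in> U N"
        then have "y \<in> U (\<alpha> + \<beta>)" unfolding N(1)[symmetric] by (rule U_left)
        from bracket_U[OF f g this]
        show "tensor (\<alpha> + \<beta>) (br \<alpha> \<beta> f g) h y = k * tensor (\<alpha> + \<beta>) (Sym (\<alpha> + \<beta>) Y) h y"
          by (simp add: tensor_def[of "\<alpha> + \<beta>"] k_def Y_def A_def B_def)
      qed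
      also have "\<dots> = k * (fact (\<alpha> + \<beta>) * Sym N (tensor (\<alpha> + \<beta>) Y h) x)"
        unfolding Sym_mult_const N(1)[symmetric] Sym_tensor_Sym_left[OF hh] ..
      also have "Sym N (tensor (\<alpha> + \<beta>) Y h) x = Sym N (RRs A B \<Phi>) x"
        unfolding Y_def \<Phi>' N(1)[symmetric]
        by (rule Sym_cong[OF RRs_tensor_left[OF hh holomorphic_vars_dif[OF holomorphic_vars_tensor[OF hf hg]]]])
          (use x in \<open>auto simp: A_def B_def N\<close>)
      finally show ?thesis unfolding sym_prod_eq N by (simp add: c_def k_def)
    qed
    have 3: "sym_prod \<beta> (\<alpha> + \<gamma>) g (br \<alpha> \<gamma> f h) x = c * Sym N (RRs A C \<Phi>) x"
    proof -
      \<comment> \<open>In this term \<open>g\<close> stands before \<open>f\<close>;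
        \<open>\<rho>\<close> exchanges their blocks and fixes those of \<open>h\<close>.\<close>
      define \<rho> where "\<rho> = rot \<alpha> \<beta>"
      have "\<rho> permutes {1..\<alpha> + \<beta>}" unfolding \<rho>_def by (rule rot_permutes)
      then have \<rho>: "\<rho> permutes {1..N}" by (rule permutes_subset) (auto simp: N_def)
      define k where "k = 1 / (fact \<alpha> * fact \<gamma> :: complex)"
      define Y where "Y = RRs {1..\<alpha>} {\<alpha> + 1..\<alpha> + \<gamma>} (tensor \<alpha> f h)"
      have iA: "\<rho> ` A = {\<beta> + 1..\<beta> + \<alpha>}" unfolding \<rho>_def A_def by (rule rot_image_left) auto
      have "\<rho> ` C = (\<lambda>k. k) ` C" by (rule image_cong) (auto simp: \<rho>_def C_def rot_def)
      then have iC: "\<rho> ` C = C" by simp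
      have t: "tensor \<beta> g (tensor \<alpha> f h) = (\<lambda>x. \<Phi> (\<lambda>\<nu>. x (\<rho> \<nu>)))"
      proof
        fix x
        have "h (\<lambda>j. x (\<beta> + \<alpha> + j)) = h (\<lambda>j. x (\<rho> (\<alpha> + \<beta> + j)))"
          by (rule holomorphic_varsD(1)[OF hh]) (simp add: \<rho>_def rot_def add.commute[of \<alpha> \<beta>])
        then show "tensor \<beta> g (tensor \<alpha> f h) x = \<Phi> (\<lambda>\<nu>. x (\<rho> \<nu>))"
          unfolding tensor_assoc \<Phi>' tensor_rot[OF hf hg] \<rho>_def[symmetric] by (simp add: tensor_def[of "\<alpha> + \<beta>"] tensor_def[of "\<beta> + \<alpha>"])
      qed
      have "Sym N (tensor \<beta> g (br \<alpha> \<gamma> f h)) x = Sym N (\<lambda>y. k * tensor \<beta> g (Sym (\<alpha> + \<gamma>) Y) y) x"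
      proof (rule Sym_cong[OF _ x])
        fix y assume "y \<in> U N"
        then have "(\<lambda>j. y (\<beta> + j)) \<in> U (\<alpha> + \<gamma>)" unfolding N(2)[symmetric] by (rule shift_U_right)
        from bracket_U[OF f h this]
        show "tensor \<beta> g (br \<alpha> \<gamma> f h) y = k * tensor \<beta> g (Sym (\<alpha> + \<gamma>) Y) y"
          by (simp add: tensor_def[of \<beta>] k_def Y_def)
      qed
      also have "\<dots> = k * (fact (\<alpha> + \<gamma>) * Sym N (tensor \<beta> g Y) x)"
        unfolding Sym_mult_const N(2)[symmetric] Sym_tensor_Sym_right[OF hg] ..
      also have "Sym N (tensor \<beta> g Y) x = Sym N (RRs (\<rho> ` A) (\<rho> ` C) (\<lambda>x. \<Phi> (\<lambda>\<nu>. x (\<rho> \<nu>)))) x"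
      proof (rule Sym_cong[OF _ x])
        fix y assume y: "y \<in> U N"
        have "tensor \<beta> g Y y = RRs ((+) \<beta> ` {1..\<alpha>}) ((+) \<beta> ` {\<alpha> + 1..\<alpha> + \<gamma>}) (tensor \<beta> g (tensor \<alpha> f h)) y"
          unfolding Y_def
          by (rule RRs_tensor_right[OF hg holomorphic_vars_dif[OF holomorphic_vars_tensor[OF hf hh]]])
            (use y in \<open>auto simp: N\<close>)
        moreover have "(+) \<beta> ` {1..\<alpha>} = \<rho> ` A" "(+) \<beta> ` {\<alpha> + 1..\<alpha> + \<gamma>} = \<rho> ` C"
          unfolding iA iC unfolding C_def by (simp_all add: ac_simps)
        ultimately show "tensor \<beta> g Y y = RRs (\<rho> ` A) (\<rho> ` C) (\<lambda>x. \<Phi> (\<lambda>\<nu>. x (\<rho> \<nu>))) y" by (simp add: t)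
      qed
      also have "\<dots> = Sym N (RRs A C \<Phi>) x" by (rule RRs_RRs_act(2)[OF \<rho>])
      finally show ?thesis unfolding sym_prod_eq N by (simp add: c_def k_def)
    qed
    have "RRs A (B \<union> C) \<Phi> = (\<lambda>y. RRs A B \<Phi> y + RRs A C \<Phi> y)"
      by (rule ext) (rule RRs_Un[OF finite_subset[OF sets(2)] finite_subset[OF sets(3)] sets(6)]; simp)
    then show "br \<alpha> (\<beta> + \<gamma>) f (sym_prod \<beta> \<gamma> g h) x =
        sym_prod (\<alpha> + \<beta>) \<gamma> (br \<alpha> \<beta> f g) h x + sym_prod \<beta> (\<alpha> + \<gamma>) g (br \<alpha> \<gamma> f h) x"
      unfolding 1 2 3 by (simp add: Sym_add distrib_left)
  qed
  from fun_cong[OF this, of x] show ?thesis .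
qed

section \<open>The Poisson algebra\<close>

lemma S_0: "(\<lambda>x. 0) \<in> S N"
  unfolding sym_theta_iff by (intro conjI TH_0 allI impI refl)

lemma S_linear:
  assumes "f \<in> S N" "g \<in> S N"
  shows "(\<lambda>x. c * f x + g x) \<in> S N"
  unfolding sym_theta_iff
proof (intro conjI allI impI)
  show "(\<lambda>x. c * f x + g x) \<in> TH N"
    by (rule TH_add[OF TH_mult_const[OF S_D(1)[OF assms(1)]] S_D(1)[OF assms(2)]])
  fix \<sigma> x assume "\<sigma> permutes {1..N}"
  then show "c * f (\<lambda>\<nu>. x (\<sigma> \<nu>)) + g (\<lambda>\<nu>. x (\<sigma> \<nu>)) = c * f x + g x"
    using S_D(2)[OF assms(1), of \<sigma> x] S_D(2)[OF assms(2), of \<sigma> x] by simp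
qed

lemma S_add: "f \<in> S N \<Longrightarrow> g \<in> S N \<Longrightarrow> (\<lambda>x. f x + g x) \<in> S N"
  using S_linear[of f N g 1] by simp

lemma S_sum: "(\<And>i. i \<in> I \<Longrightarrow> f i \<in> S N) \<Longrightarrow> (\<lambda>x. \<Sum>i\<in>I. f i x) \<in> S N"
proof (induction I rule: infinite_finite_induct)
  case (insert i I)
  then show ?case using S_add[of "f i" N "\<lambda>x. \<Sum>i\<in>I. f i x"] by simp
qed (simp_all add: S_0)

lemma S_const: "(\<lambda>x. 1) \<in> S 0"
proof -
  have "quasi UNIV 0 (\<lambda>x. 1)" by (rule quasiI) simp
  then show ?thesis by (simp add: sym_theta_iff TH_def holomorphic_vars_const)
qed

text \<open>The common properties of product and bracket, so that their extension from homogeneous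
  elements to families is treated only once.\<close>

definition graded_bilinear :: "(nat \<Rightarrow> nat \<Rightarrow> pfun \<Rightarrow> pfun \<Rightarrow> pfun) \<Rightarrow> bool" where
  "graded_bilinear P \<longleftrightarrow> (\<forall>\<alpha> \<beta>. \<forall>f\<in>S \<alpha>. \<forall>g\<in>S \<beta>. P \<alpha> \<beta> f g \<in> S (\<alpha> + \<beta>) \<and>
     (\<forall>f'\<in>S \<alpha>. \<forall>c x. P \<alpha> \<beta> (\<lambda>x. c * f x + f' x) g x = c * P \<alpha> \<beta> f g x + P \<alpha> \<beta> f' g x) \<and>
     (\<forall>g'\<in>S \<beta>. \<forall>c x. P \<alpha> \<beta> f (\<lambda>x. c * g x + g' x) x = c * P \<alpha> \<beta> f g x + P \<alpha> \<beta> f g' x))"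

lemma graded_bilinearD:
  assumes "graded_bilinear P" "f \<in> S \<alpha>" "g \<in> S \<beta>"
  shows "P \<alpha> \<beta> f g \<in> S (\<alpha> + \<beta>)"
    "f' \<in> S \<alpha> \<Longrightarrow> P \<alpha> \<beta> (\<lambda>x. c * f x + f' x) g x = c * P \<alpha> \<beta> f g x + P \<alpha> \<beta> f' g x"
    "g' \<in> S \<beta> \<Longrightarrow> P \<alpha> \<beta> f (\<lambda>x. c * g x + g' x) x = c * P \<alpha> \<beta> f g x + P \<alpha> \<beta> f g' x"
proof -
  note * = assms(1)[unfolded graded_bilinear_def, THEN spec[of _ \<alpha>], THEN spec[of _ \<beta>],
      THEN bspec[OF _ assms(2)], THEN bspec[OF _ assms(3)]]
  show "P \<alpha> \<beta> f g \<in> S (\<alpha> + \<beta>)" by (rule conjunct1[OF *])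
  show "P \<alpha> \<beta> (\<lambda>x. c * f x + f' x) g x = c * P \<alpha> \<beta> f g x + P \<alpha> \<beta> f' g x" if "f' \<in> S \<alpha>"
    by (rule bspec[OF conjunct1[OF conjunct2[OF *]] that, THEN spec, THEN spec])
  show "P \<alpha> \<beta> f (\<lambda>x. c * g x + g' x) x = c * P \<alpha> \<beta> f g x + P \<alpha> \<beta> f g' x" if "g' \<in> S \<beta>"
    by (rule bspec[OF conjunct2[OF conjunct2[OF *]] that, THEN spec, THEN spec])
qed

text \<open>Linearity on the right follows from that on the left by exchanging the arguments; the
  sign \<open>s\<close> is 1 for the product and -1 for the bracket.\<close>

lemma graded_bilinearI:
  assumes c: "\<And>\<alpha> \<beta> f g. f \<in> S \<alpha> \<Longrightarrow> g \<in> S \<beta> \<Longrightarrow> P \<alpha> \<beta> f g \<in> S (\<alpha> + \<beta>)"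
    and l: "\<And>\<alpha> \<beta> f f' g c x. f \<in> S \<alpha> \<Longrightarrow> f' \<in> S \<alpha> \<Longrightarrow> g \<in> S \<beta> \<Longrightarrow>
      P \<alpha> \<beta> (\<lambda>x. c * f x + f' x) g x = c * P \<alpha> \<beta> f g x + P \<alpha> \<beta> f' g x"
    and s: "\<And>\<alpha> \<beta> f g x. f \<in> S \<alpha> \<Longrightarrow> g \<in> S \<beta> \<Longrightarrow> P \<beta> \<alpha> g f x = s * P \<alpha> \<beta> f g x"
  shows "graded_bilinear P"
  unfolding graded_bilinear_def
proof (intro allI ballI conjI)
  fix \<alpha> \<beta> f g assume f: "f \<in> S \<alpha>" and g: "g \<in> S \<beta>"
  show "P \<alpha> \<beta> f g \<in> S (\<alpha> + \<beta>)" by (rule c[OF f g])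
  show "P \<alpha> \<beta> (\<lambda>x. c * f x + f' x) g x = c * P \<alpha> \<beta> f g x + P \<alpha> \<beta> f' g x" if "f' \<in> S \<alpha>" for f' c x
    by (rule l[OF f that g])
next
  fix \<alpha> \<beta> f g g' c x assume f: "f \<in> S \<alpha>" and g: "g \<in> S \<beta>" "g' \<in> S \<beta>"
  show "P \<alpha> \<beta> f (\<lambda>x. c * g x + g' x) x = c * P \<alpha> \<beta> f g x + P \<alpha> \<beta> f g' x"
    unfolding s[OF g(1) f] s[OF g(2) f] s[OF S_linear[OF g] f] l[OF g f] by (simp add: algebra_simps)
qed

lemma graded_bilinear_0:
  assumes "graded_bilinear P"
  shows "g \<in> S \<beta> \<Longrightarrow> P \<alpha> \<beta> (\<lambda>x. 0) g x = 0" "f \<in> S \<alpha> \<Longrightarrow> P \<alpha> \<beta> f (\<lambda>x. 0) x = 0"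
proof -
  show "P \<alpha> \<beta> (\<lambda>x. 0) g x = 0" if g: "g \<in> S \<beta>"
  proof -
    have "P \<alpha> \<beta> (\<lambda>x. 1 * 0 + 0) g x = 1 * P \<alpha> \<beta> (\<lambda>x. 0) g x + P \<alpha> \<beta> (\<lambda>x. 0) g x"
      by (rule graded_bilinearD(2)[OF assms S_0 g S_0])
    then show ?thesis by simp
  qed
  show "P \<alpha> \<beta> f (\<lambda>x. 0) x = 0" if f: "f \<in> S \<alpha>"
  proof -
    have "P \<alpha> \<beta> f (\<lambda>x. 1 * 0 + 0) x = 1 * P \<alpha> \<beta> f (\<lambda>x. 0) x + P \<alpha> \<beta> f (\<lambda>x. 0) x"
      by (rule graded_bilinearD(3)[OF assms f S_0 S_0])
    then show ?thesis by simp
  qed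
qed

lemma graded_bilinear_sum_left:
  assumes P: "graded_bilinear P" and g: "g \<in> S \<beta>" and f: "\<And>i. i \<in> I \<Longrightarrow> f i \<in> S \<alpha>"
  shows "P \<alpha> \<beta> (\<lambda>x. \<Sum>i\<in>I. f i x) g x = (\<Sum>i\<in>I. P \<alpha> \<beta> (f i) g x)"
  using f
proof (induction I rule: infinite_finite_induct)
  case (insert i I)
  have "P \<alpha> \<beta> (\<lambda>x. \<Sum>i\<in>insert i I. f i x) g x = P \<alpha> \<beta> (\<lambda>x. 1 * f i x + (\<Sum>i\<in>I. f i x)) g x"
    using insert.hyps by simp
  also have "\<dots> = 1 * P \<alpha> \<beta> (f i) g x + P \<alpha> \<beta> (\<lambda>x. \<Sum>i\<in>I. f i x) g x"
    by (rule graded_bilinearD(2)[OF P insert.prems[OF insertI1] g S_sum[OF insert.prems[OF insertI2]]])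
  also have "P \<alpha> \<beta> (\<lambda>x. \<Sum>i\<in>I. f i x) g x = (\<Sum>i\<in>I. P \<alpha> \<beta> (f i) g x)"
    by (rule insert.IH[OF insert.prems[OF insertI2]])
  finally show ?case using insert.hyps by (simp only: sum.insert mult_1 not_False_eq_True)
next
  case (infinite I)
  then show ?case by (simp only: sum.infinite graded_bilinear_0(1)[OF P g] not_False_eq_True)
next
  case empty
  show ?case by (simp only: sum.empty graded_bilinear_0(1)[OF P g])
qed

lemma graded_bilinear_sum_right:
  assumes P: "graded_bilinear P" and f: "f \<in> S \<alpha>" and g: "\<And>i. i \<in> I \<Longrightarrow> g i \<in> S \<beta>"
  shows "P \<alpha> \<beta> f (\<lambda>x. \<Sum>i\<in>I. g i x) x = (\<Sum>i\<in>I. P \<alpha> \<beta> f (g i) x)"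
  using g
proof (induction I rule: infinite_finite_induct)
  case (insert i I)
  have "P \<alpha> \<beta> f (\<lambda>x. \<Sum>i\<in>insert i I. g i x) x = P \<alpha> \<beta> f (\<lambda>x. 1 * g i x + (\<Sum>i\<in>I. g i x)) x"
    using insert.hyps by simp
  also have "\<dots> = 1 * P \<alpha> \<beta> f (g i) x + P \<alpha> \<beta> f (\<lambda>x. \<Sum>i\<in>I. g i x) x"
    by (rule graded_bilinearD(3)[OF P f insert.prems[OF insertI1] S_sum[OF insert.prems[OF insertI2]]])
  also have "P \<alpha> \<beta> f (\<lambda>x. \<Sum>i\<in>I. g i x) x = (\<Sum>i\<in>I. P \<alpha> \<beta> f (g i) x)"
    by (rule insert.IH[OF insert.prems[OF insertI2]])
  finally show ?case using insert.hyps by (simp only: sum.insert mult_1 not_False_eq_True)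
next
  case (infinite I)
  then show ?case by (simp only: sum.infinite graded_bilinear_0(2)[OF P f] not_False_eq_True)
next
  case empty
  show ?case by (simp only: sum.empty graded_bilinear_0(2)[OF P f])
qed

section \<open>Families of homogeneous components and their convolutions\<close>

definition Q :: "(nat \<Rightarrow> pfun) set" where
  "Q = {F. (\<forall>\<alpha>. F \<alpha> \<in> S \<alpha>) \<and> finite {\<alpha>. F \<alpha> \<noteq> (\<lambda>x. 0)}}"

definition conv :: "(nat \<Rightarrow> nat \<Rightarrow> pfun \<Rightarrow> pfun \<Rightarrow> pfun) \<Rightarrow> (nat \<Rightarrow> pfun) \<Rightarrow> (nat \<Rightarrow> pfun) \<Rightarrow> nat \<Rightarrow> pfun" where
  "conv P F G = (\<lambda>m x. \<Sum>\<alpha>\<le>m. P \<alpha> (m - \<alpha>) (F \<alpha>) (G (m - \<alpha>)) x)"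

lemma Q_D: "F \<in> Q \<Longrightarrow> F \<alpha> \<in> S \<alpha>"
  by (simp add: Q_def)

lemma Q_linear:
  assumes "F \<in> Q" "G \<in> Q"
  shows "(\<lambda>\<alpha> x. c * F \<alpha> x + G \<alpha> x) \<in> Q"
proof -
  have "finite ({\<alpha>. F \<alpha> \<noteq> (\<lambda>x. 0)} \<union> {\<alpha>. G \<alpha> \<noteq> (\<lambda>x. 0)})" using assms by (simp add: Q_def)
  then have "finite {\<alpha>. (\<lambda>x. c * F \<alpha> x + G \<alpha> x) \<noteq> (\<lambda>x. 0)}"
    by (rule rev_finite_subset) auto
  then show ?thesis using S_linear[OF Q_D[OF assms(1)] Q_D[OF assms(2)]] by (simp add: Q_def)
qed

lemma Q_0: "(\<lambda>\<alpha> x. 0) \<in> Q"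
  by (simp add: Q_def S_0)

lemma Q_one: "(\<lambda>\<alpha> x. if \<alpha> = 0 then 1 else 0) \<in> Q"
proof -
  have "(\<lambda>x. if \<alpha> = 0 then 1 else 0) \<in> S \<alpha>" for \<alpha>
    by (cases "\<alpha> = 0") (simp_all add: S_0 S_const)
  moreover have "{\<alpha> :: nat. (\<lambda>x :: point. if \<alpha> = 0 then 1 else 0 :: complex) \<noteq> (\<lambda>x. 0)} \<subseteq> {0}" by auto
  ultimately show ?thesis using finite_subset by (auto simp: Q_def)
qed

text \<open>The support of the result lies in the set of sums of degrees from the two supports,
  which is finite.\<close>

lemma conv_closed:
  assumes P: "graded_bilinear P" and F: "F \<in> Q" and G: "G \<in> Q"
  shows "conv P F G \<in> Q"
proof -
  have "P \<alpha> (m - \<alpha>) (F \<alpha>) (G (m - \<alpha>)) \<in> S m" if "\<alpha> \<le> m" for \<alpha> m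
    using graded_bilinearD(1)[OF P Q_D[OF F, of \<alpha>] Q_D[OF G, of "m - \<alpha>"]] that by simp
  then have "conv P F G m \<in> S m" for m
    unfolding conv_def by (intro S_sum) simp
  moreover have "finite {m. conv P F G m \<noteq> (\<lambda>x. 0)}"
  proof (rule finite_subset)
    let ?A = "{\<alpha>. F \<alpha> \<noteq> (\<lambda>x. 0)}" and ?B = "{\<alpha>. G \<alpha> \<noteq> (\<lambda>x. 0)}"
    show "finite ((\<lambda>(a, b). a + b) ` (?A \<times> ?B))" using F G by (simp add: Q_def)
    show "{m. conv P F G m \<noteq> (\<lambda>x. 0)} \<subseteq> (\<lambda>(a, b). a + b) ` (?A \<times> ?B)"
    proof (rule subsetI, rule ccontr)
      fix m assume m: "m \<in> {m. conv P F G m \<noteq> (\<lambda>x. 0)}" "m \<notin> (\<lambda>(a, b). a + b) ` (?A \<times> ?B)"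
      have "P \<alpha> (m - \<alpha>) (F \<alpha>) (G (m - \<alpha>)) x = 0" if "\<alpha> \<le> m" for \<alpha> x
      proof -
        have "F \<alpha> = (\<lambda>x. 0) \<or> G (m - \<alpha>) = (\<lambda>x. 0)"
        proof (rule ccontr)
          assume "\<not> ?thesis"
          then have "(\<alpha>, m - \<alpha>) \<in> ?A \<times> ?B" by simp
          from imageI[OF this, of "\<lambda>(a, b). a + b"] m(2) that show False by simp
        qed
        then show ?thesis
          using graded_bilinear_0(1)[OF P Q_D[OF G]] graded_bilinear_0(2)[OF P Q_D[OF F]] by auto
      qed
      then have "conv P F G m = (\<lambda>x. 0)" by (simp add: conv_def)
      with m(1) show False by simp
    qed
  qed
  ultimately show ?thesis by (simp add: Q_def)
qed

lemma conv_linear_left: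
  assumes "graded_bilinear P" "F \<in> Q" "F' \<in> Q" "G \<in> Q"
  shows "conv P (\<lambda>\<alpha> x. c * F \<alpha> x + F' \<alpha> x) G = (\<lambda>m x. c * conv P F G m x + conv P F' G m x)"
proof (intro ext)
  fix m x
  have "conv P (\<lambda>\<alpha> x. c * F \<alpha> x + F' \<alpha> x) G m x =
      (\<Sum>\<alpha>\<le>m. c * P \<alpha> (m - \<alpha>) (F \<alpha>) (G (m - \<alpha>)) x + P \<alpha> (m - \<alpha>) (F' \<alpha>) (G (m - \<alpha>)) x)"
    unfolding conv_def
    by (rule sum.cong[OF refl]) (rule graded_bilinearD(2)[OF assms(1) Q_D[OF assms(2)] Q_D[OF assms(4)] Q_D[OF assms(3)]])
  then show "conv P (\<lambda>\<alpha> x. c * F \<alpha> x + F' \<alpha> x) G m x = c * conv P F G m x + conv P F' G m x"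
    by (simp only: conv_def sum.distrib sum_distrib_left)
qed

lemma conv_linear_right:
  assumes "graded_bilinear P" "F \<in> Q" "G \<in> Q" "G' \<in> Q"
  shows "conv P F (\<lambda>\<alpha> x. c * G \<alpha> x + G' \<alpha> x) = (\<lambda>m x. c * conv P F G m x + conv P F G' m x)"
proof (intro ext)
  fix m x
  have "conv P F (\<lambda>\<alpha> x. c * G \<alpha> x + G' \<alpha> x) m x =
      (\<Sum>\<alpha>\<le>m. c * P \<alpha> (m - \<alpha>) (F \<alpha>) (G (m - \<alpha>)) x + P \<alpha> (m - \<alpha>) (F \<alpha>) (G' (m - \<alpha>)) x)"
    unfolding conv_def
    by (rule sum.cong[OF refl]) (rule graded_bilinearD(3)[OF assms(1) Q_D[OF assms(2)] Q_D[OF assms(3)] Q_D[OF assms(4)]])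
  then show "conv P F (\<lambda>\<alpha> x. c * G \<alpha> x + G' \<alpha> x) m x = c * conv P F G m x + conv P F G' m x"
    by (simp only: conv_def sum.distrib sum_distrib_left)
qed

lemma conv_swap:
  assumes F: "F \<in> Q" and G: "G \<in> Q"
    and s: "\<And>\<alpha> \<beta> f g x. f \<in> S \<alpha> \<Longrightarrow> g \<in> S \<beta> \<Longrightarrow> P \<beta> \<alpha> g f x = s * P \<alpha> \<beta> f g x"
  shows "conv P G F m x = s * conv P F G m x"
proof -
  have "conv P G F m x = (\<Sum>\<alpha>\<le>m. P (m - \<alpha>) \<alpha> (G (m - \<alpha>)) (F \<alpha>) x)"
    unfolding conv_def by (rule sum.reindex_bij_witness[of _ "\<lambda>a. m - a" "\<lambda>a. m - a"]) auto
  also have "\<dots> = (\<Sum>\<alpha>\<le>m. s * P \<alpha> (m - \<alpha>) (F \<alpha>) (G (m - \<alpha>)) x)"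
    by (intro sum.cong refl s Q_D F G)
  finally show ?thesis by (simp add: conv_def sum_distrib_left)
qed

text \<open>Iterated convolutions, whichever way they are nested, become sums over this set, on
  which the three degrees can be permuted freely.\<close>

definition triples :: "nat \<Rightarrow> (nat \<times> nat \<times> nat) set" where
  "triples m = {(a, b, c). a + b + c = m}"

lemma triples_rotate: "(\<Sum>(a, b, c)\<in>triples m. u a b c) = (\<Sum>(a, b, c)\<in>triples m. u b c a)"
proof -
  have "(\<Sum>t\<in>triples m. case t of (a, b, c) \<Rightarrow> u a b c) = (\<Sum>t\<in>triples m. case t of (a, b, c) \<Rightarrow> u b c a)"
    by (rule sum.reindex_bij_witness[of _ "\<lambda>t. (fst (snd t), snd (snd t), fst t)" "\<lambda>t. (snd (snd t), fst t, fst (snd t))"])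
      (auto simp: triples_def split_def)
  then show ?thesis .
qed

lemma triples_swap: "(\<Sum>(a, b, c)\<in>triples m. u a b c) = (\<Sum>(a, b, c)\<in>triples m. u b a c)"
  by (rule sum.reindex_bij_witness[of _ "\<lambda>t. (fst (snd t), fst t, snd (snd t))" "\<lambda>t. (fst (snd t), fst t, snd (snd t))"])
    (auto simp: triples_def split_def)

lemma conv_conv_right:
  assumes P: "graded_bilinear P" and R: "graded_bilinear R" and Q: "F \<in> Q" "G \<in> Q" "H \<in> Q"
  shows "conv P F (conv R G H) m x = (\<Sum>(a, b, c)\<in>triples m. P a (b + c) (F a) (R b c (G b) (H c)) x)"
proof -
  have "P a (m - a) (F a) (conv R G H (m - a)) x =
      (\<Sum>b\<le>m - a. P a (m - a) (F a) (R b (m - a - b) (G b) (H (m - a - b))) x)" for a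
    unfolding conv_def
  proof (rule graded_bilinear_sum_right[OF P Q_D[OF Q(1)]])
    fix b assume "b \<in> {..m - a}"
    then have "b + (m - a - b) = m - a" by simp
    then show "R b (m - a - b) (G b) (H (m - a - b)) \<in> S (m - a)"
      using graded_bilinearD(1)[OF R Q_D[OF Q(2), of b] Q_D[OF Q(3), of "m - a - b"]] by (simp only:)
  qed
  then have "conv P F (conv R G H) m x =
      (\<Sum>a\<le>m. \<Sum>b\<le>m - a. P a (m - a) (F a) (R b (m - a - b) (G b) (H (m - a - b))) x)"
    unfolding conv_def[of P] by simp
  also have "\<dots> = (\<Sum>(a, b)\<in>Sigma {..m} (\<lambda>a. {..m - a}). P a (m - a) (F a) (R b (m - a - b) (G b) (H (m - a - b))) x)"
    by (rule sum.Sigma) auto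
  also have "\<dots> = (\<Sum>(a, b, c)\<in>triples m. P a (b + c) (F a) (R b c (G b) (H c)) x)"
    by (rule sum.reindex_bij_witness[of _ "\<lambda>(a, b, c). (a, b)" "\<lambda>(a, b). (a, b, m - a - b)"])
      (auto simp: triples_def)
  finally show ?thesis .
qed

lemma conv_conv_left:
  assumes P: "graded_bilinear P" and R: "graded_bilinear R" and Q: "F \<in> Q" "G \<in> Q" "H \<in> Q"
  shows "conv P (conv R F G) H m x = (\<Sum>(a, b, c)\<in>triples m. P (a + b) c (R a b (F a) (G b)) (H c) x)"
proof -
  have "P k (m - k) (conv R F G k) (H (m - k)) x =
      (\<Sum>a\<le>k. P k (m - k) (R a (k - a) (F a) (G (k - a))) (H (m - k)) x)" for k
    unfolding conv_def
  proof (rule graded_bilinear_sum_left[OF P Q_D[OF Q(3)]])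
    fix a assume "a \<in> {..k}"
    then show "R a (k - a) (F a) (G (k - a)) \<in> S k"
      using graded_bilinearD(1)[OF R Q_D[OF Q(1), of a] Q_D[OF Q(2), of "k - a"]] by simp
  qed
  then have "conv P (conv R F G) H m x =
      (\<Sum>k\<le>m. \<Sum>a\<le>k. P k (m - k) (R a (k - a) (F a) (G (k - a))) (H (m - k)) x)"
    unfolding conv_def[of P] by simp
  also have "\<dots> = (\<Sum>(k, a)\<in>Sigma {..m} (\<lambda>k. {..k}). P k (m - k) (R a (k - a) (F a) (G (k - a))) (H (m - k)) x)"
    by (rule sum.Sigma) auto
  also have "\<dots> = (\<Sum>(a, b, c)\<in>triples m. P (a + b) c (R a b (F a) (G b)) (H c) x)"
    by (rule sum.reindex_bij_witness[of _ "\<lambda>(a, b, c). (a + b, a)" "\<lambda>(k, a). (a, k - a, m - k)"])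
      (auto simp: triples_def)
  finally show ?thesis .
qed

lemma sym_prod_linear_left:
  "sym_prod \<alpha> \<beta> (\<lambda>x. c * f x + f' x) g x = c * sym_prod \<alpha> \<beta> f g x + sym_prod \<alpha> \<beta> f' g x"
proof -
  have "tensor \<alpha> (\<lambda>x. c * f x + f' x) g = (\<lambda>x. c * tensor \<alpha> f g x + tensor \<alpha> f' g x)"
    by (rule ext) (simp add: tensor_def algebra_simps)
  then show ?thesis unfolding sym_prod_eq by (simp only: Sym_add Sym_mult_const) (simp add: field_simps)
qed

lemma graded_bilinear_sym_prod: "graded_bilinear sym_prod"
proof (rule graded_bilinearI)
  show "sym_prod \<beta> \<alpha> g f x = 1 * sym_prod \<alpha> \<beta> f g x" if "f \<in> S \<alpha>" "g \<in> S \<beta>" for \<alpha> \<beta> f g x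
    using sym_prod_commute[OF S_D(1)[OF that(1)] S_D(1)[OF that(2)]] unfolding mult_1 .
qed (rule sym_prod_linear_left sym_prod_closed S_D(1); assumption?)+

lemma graded_bilinear_bracket: "graded_bilinear br"
proof (rule graded_bilinearI)
  show "br \<beta> \<alpha> g f x = - 1 * br \<alpha> \<beta> f g x" if "f \<in> S \<alpha>" "g \<in> S \<beta>" for \<alpha> \<beta> f g x
    using bracket_antisym[OF S_D(1)[OF that(1)] S_D(1)[OF that(2)]] unfolding mult_minus1 .
qed (rule bracket_linear_left bracket_closed S_D(1); assumption?)+

text \<open>Only degree 0 of the unit contributes, and symmetrizing a symmetric function of degree m
  multiplies it by m!, which the normalization of the product cancels.\<close>

lemma conv_one:
  assumes F: "F \<in> Q"
  shows "conv sym_prod (\<lambda>\<alpha> x. if \<alpha> = 0 then 1 else 0) F = F"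
proof (intro ext)
  fix m x
  have "conv sym_prod (\<lambda>\<alpha> x. if \<alpha> = 0 then 1 else 0) F m x = (\<Sum>\<alpha>\<in>{0}. sym_prod \<alpha> (m - \<alpha>) (\<lambda>x. 1) (F (m - \<alpha>)) x)"
    unfolding conv_def
    by (rule sum.mono_neutral_cong_right) (use graded_bilinear_0(1)[OF graded_bilinear_sym_prod Q_D[OF F]] in auto)
  also have "\<dots> = F m x"
  proof -
    have "tensor 0 (\<lambda>x. 1) (F m) = F m" by (simp add: tensor_def fun_eq_iff)
    moreover have "Sym m (F m) x = fact m * F m x" by (rule Sym_symmetric[OF S_D(2)[OF Q_D[OF F]]])
    ultimately show ?thesis by (simp add: sym_prod_eq)
  qed
  finally show "conv sym_prod (\<lambda>\<alpha> x. if \<alpha> = 0 then 1 else 0) F m x = F m x" .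
qed

section \<open>The axioms of a Poisson algebra for convolutions\<close>

lemma q_algebra_simps:
  "carrier (q_algebra \<eta> ns) = Q" "mult (q_algebra \<eta> ns) = conv sym_prod"
  "one (q_algebra \<eta> ns) = (\<lambda>\<alpha> x. if \<alpha> = 0 then 1 else 0)" "zero (q_algebra \<eta> ns) = (\<lambda>\<alpha> x. 0)"
  "add (q_algebra \<eta> ns) = (\<lambda>F G \<alpha> x. F \<alpha> x + G \<alpha> x)" "smult (q_algebra \<eta> ns) = (\<lambda>c F \<alpha> x. c * F \<alpha> x)"
  "q_bracket \<eta> ns = conv br"
  by (simp_all add: q_algebra_def Q_def conv_def[abs_def] q_bracket_def[abs_def])

lemma Q_add: "F \<in> Q \<Longrightarrow> G \<in> Q \<Longrightarrow> (\<lambda>\<alpha> x. F \<alpha> x + G \<alpha> x) \<in> Q"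
  using Q_linear[of F G 1] by simp

lemma Q_smult: "F \<in> Q \<Longrightarrow> (\<lambda>\<alpha> x. c * F \<alpha> x) \<in> Q"
  using Q_linear[OF _ Q_0, of F c] by simp

lemma conv_add_left:
  assumes "graded_bilinear P" "F \<in> Q" "F' \<in> Q" "G \<in> Q"
  shows "conv P (\<lambda>\<alpha> x. F \<alpha> x + F' \<alpha> x) G = (\<lambda>m x. conv P F G m x + conv P F' G m x)"
  using conv_linear_left[OF assms, of 1] by simp

lemma conv_smult_left:
  assumes P: "graded_bilinear P" and "F \<in> Q" and G: "G \<in> Q"
  shows "conv P (\<lambda>\<alpha> x. c * F \<alpha> x) G = (\<lambda>m x. c * conv P F G m x)"
proof -
  have "conv P (\<lambda>\<alpha> x. 0) G m x = 0" for m x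
    by (simp add: conv_def graded_bilinear_0(1)[OF P Q_D[OF G]])
  then show ?thesis using conv_linear_left[OF P assms(2) Q_0 G, of c] by simp
qed

lemma conv_add_right:
  assumes "graded_bilinear P" "F \<in> Q" "G \<in> Q" "G' \<in> Q"
  shows "conv P F (\<lambda>\<alpha> x. G \<alpha> x + G' \<alpha> x) = (\<lambda>m x. conv P F G m x + conv P F G' m x)"
  using conv_linear_right[OF assms, of 1] by simp

lemma conv_smult_right:
  assumes P: "graded_bilinear P" and F: "F \<in> Q" and "G \<in> Q"
  shows "conv P F (\<lambda>\<alpha> x. c * G \<alpha> x) = (\<lambda>m x. c * conv P F G m x)"
proof -
  have "conv P F (\<lambda>\<alpha> x. 0) m x = 0" for m x
    by (simp add: conv_def graded_bilinear_0(2)[OF P Q_D[OF F]])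
  then show ?thesis using conv_linear_right[OF P F assms(3) Q_0, of c] by simp
qed

lemma conv_sym_prod_commute:
  assumes "F \<in> Q" "G \<in> Q"
  shows "conv sym_prod G F = conv sym_prod F G"
proof (intro ext)
  fix m x
  have "conv sym_prod G F m x = 1 * conv sym_prod F G m x"
  proof (rule conv_swap[OF assms])
    fix \<alpha> \<beta> f g x assume "f \<in> S \<alpha>" "g \<in> S \<beta>"
    from sym_prod_commute[OF S_D(1)[OF this(1)] S_D(1)[OF this(2)]]
    show "sym_prod \<beta> \<alpha> g f x = 1 * sym_prod \<alpha> \<beta> f g x" unfolding mult_1 .
  qed
  then show "conv sym_prod G F m x = conv sym_prod F G m x" by simp
qed

lemma conv_sym_prod_assoc:
  assumes "F \<in> Q" "G \<in> Q" "H \<in> Q"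
  shows "conv sym_prod (conv sym_prod F G) H = conv sym_prod F (conv sym_prod G H)"
  unfolding fun_eq_iff conv_conv_left[OF graded_bilinear_sym_prod graded_bilinear_sym_prod assms]
    conv_conv_right[OF graded_bilinear_sym_prod graded_bilinear_sym_prod assms]
  by (simp only: sym_prod_assoc[OF S_D(1)[OF Q_D[OF assms(1)]] S_D(1)[OF Q_D[OF assms(3)]]]) simp

text \<open>\<open>conv_swap\<close> with sign -1 and equal arguments shows that the value is its
  own negative.\<close>

lemma conv_bracket_alternating:
  assumes "F \<in> Q"
  shows "conv br F F m x = 0"
proof -
  have "conv br F F m x = - 1 * conv br F F m x"
  proof (rule conv_swap[OF assms assms])
    fix \<alpha> \<beta> f g x assume "f \<in> S \<alpha>" "g \<in> S \<beta>"
    from bracket_antisym[OF S_D(1)[OF this(1)] S_D(1)[OF this(2)]]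
    show "br \<beta> \<alpha> g f x = - 1 * br \<alpha> \<beta> f g x" unfolding mult_minus1 .
  qed
  then show ?thesis by simp
qed

lemma conv_bracket_jacobi:
  assumes Q: "F \<in> Q" "G \<in> Q" "H \<in> Q"
  shows "conv br F (conv br G H) m x + conv br G (conv br H F) m x + conv br H (conv br F G) m x = 0"
proof -
  note b = graded_bilinear_bracket
  have 1: "conv br F (conv br G H) m x = (\<Sum>(a, b, c)\<in>triples m. br a (b + c) (F a) (br b c (G b) (H c)) x)"
    by (rule conv_conv_right[OF b b Q])
  have 2: "conv br G (conv br H F) m x = (\<Sum>(a, b, c)\<in>triples m. br b (c + a) (G b) (br c a (H c) (F a)) x)"
    unfolding conv_conv_right[OF b b Q(2,3,1)] by (rule triples_rotate)
  have 3: "conv br H (conv br F G) m x = (\<Sum>(a, b, c)\<in>triples m. br c (a + b) (H c) (br a b (F a) (G b)) x)"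
    unfolding conv_conv_right[OF b b Q(3,1,2)] by (rule triples_rotate[symmetric])
  have "conv br F (conv br G H) m x + conv br G (conv br H F) m x + conv br H (conv br F G) m x =
    (\<Sum>(a, b, c)\<in>triples m. br a (b + c) (F a) (br b c (G b) (H c)) x +
       br b (c + a) (G b) (br c a (H c) (F a)) x + br c (a + b) (H c) (br a b (F a) (G b)) x)"
    unfolding 1 2 3 sum.distrib[symmetric] by (simp only: split_def)
  also have "\<dots> = 0"
    using bracket_jacobi[OF S_D(1)[OF Q_D[OF Q(1)]] S_D(1)[OF Q_D[OF Q(2)]] S_D(1)[OF Q_D[OF Q(3)]]]
    by (simp add: split_def)
  finally show ?thesis .
qed

lemma conv_bracket_leibniz:
  assumes Q: "F \<in> Q" "G \<in> Q" "H \<in> Q"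
  shows "conv br F (conv sym_prod G H) m x =
    conv sym_prod (conv br F G) H m x + conv sym_prod G (conv br F H) m x"
proof -
  note b = graded_bilinear_bracket and s = graded_bilinear_sym_prod
  note leib = bracket_leibniz[OF S_D(1)[OF Q_D[OF Q(1)]] S_D(1)[OF Q_D[OF Q(2)]] S_D(1)[OF Q_D[OF Q(3)]]]
  have "conv sym_prod G (conv br F H) m x =
      (\<Sum>(a, b, c)\<in>triples m. sym_prod b (a + c) (G b) (br a c (F a) (H c)) x)"
    unfolding conv_conv_right[OF s b Q(2,1,3)]
    by (rule triples_swap[of "\<lambda>a b c. sym_prod a (b + c) (G a) (br b c (F b) (H c)) x"])
  then show ?thesis
    unfolding conv_conv_right[OF b s Q] conv_conv_left[OF s b Q]
    by (simp only: split_def leib sum.distrib)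
qed

lemma cring_complex_field: "cring complex_field"
proof (rule cringI)
  show "abelian_group complex_field"
  proof (rule abelian_groupI)
    show "\<exists>y\<in>carrier complex_field. y \<oplus>\<^bsub>complex_field\<^esub> x = \<zero>\<^bsub>complex_field\<^esub>" for x
      by (rule bexI[of _ "- x"]) (simp_all add: complex_field_def)
  qed (simp_all add: complex_field_def)
  show "comm_monoid complex_field"
    by (rule comm_monoidI) (simp_all add: complex_field_def)
qed (simp add: complex_field_def algebra_simps)

lemma cring_q_algebra: "cring (q_algebra \<eta> ns)"
proof (rule cringI)
  show "abelian_group (q_algebra \<eta> ns)"
  proof (rule abelian_groupI; unfold q_algebra_simps)
    show "\<exists>G\<in>Q. (\<lambda>\<alpha> x. G \<alpha> x + F \<alpha> x) = (\<lambda>\<alpha> x. 0)" if "F \<in> Q" for F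
      by (rule bexI[OF _ Q_smult[OF that, of "- 1"]]) simp
  qed (simp_all add: Q_0 Q_add add_ac)
  show "comm_monoid (q_algebra \<eta> ns)"
    by (rule comm_monoidI; unfold q_algebra_simps)
      (rule Q_one conv_closed[OF graded_bilinear_sym_prod] conv_one conv_sym_prod_assoc conv_sym_prod_commute; assumption)+
qed (unfold q_algebra_simps, rule conv_add_left[OF graded_bilinear_sym_prod])

theorem poisson_algebra_q_algebra: "poisson_algebra complex_field (q_algebra \<eta> ns) (q_bracket \<eta> ns)"
proof (rule poisson_algebra.intro)
  note b = graded_bilinear_bracket
  have C: "carrier complex_field = UNIV" "add complex_field = (+)" "mult complex_field = (*)" "one complex_field = 1"
    by (simp_all add: complex_field_def)
  show "Module.algebra complex_field (q_algebra \<eta> ns)"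
  proof (rule Module.algebraI[OF cring_complex_field cring_q_algebra]; unfold q_algebra_simps C)
    show "conv sym_prod (\<lambda>\<alpha> x. c * F \<alpha> x) G = (\<lambda>\<alpha> x. c * conv sym_prod F G \<alpha> x)"
      if "F \<in> Q" "G \<in> Q" for c F G
      by (rule conv_smult_left[OF graded_bilinear_sym_prod that])
  qed (simp_all add: Q_smult algebra_simps)
  show "poisson_algebra_axioms complex_field (q_algebra \<eta> ns) (q_bracket \<eta> ns)"
  proof (rule poisson_algebra_axioms.intro; unfold q_algebra_simps C)
    fix F G H assume Q: "F \<in> Q" "G \<in> Q" "H \<in> Q"
    show "conv br F G \<in> Q" by (rule conv_closed[OF b Q(1,2)])
    show "conv br (\<lambda>\<alpha> x. F \<alpha> x + G \<alpha> x) H = (\<lambda>\<alpha> x. conv br F H \<alpha> x + conv br G H \<alpha> x)"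
      by (rule conv_add_left[OF b Q])
    show "conv br F (\<lambda>\<alpha> x. G \<alpha> x + H \<alpha> x) = (\<lambda>\<alpha> x. conv br F G \<alpha> x + conv br F H \<alpha> x)"
      by (rule conv_add_right[OF b Q])
    show "conv br (\<lambda>\<alpha> x. c * F \<alpha> x) G = (\<lambda>\<alpha> x. c * conv br F G \<alpha> x)" for c
      by (rule conv_smult_left[OF b Q(1,2)])
    show "conv br F (\<lambda>\<alpha> x. c * G \<alpha> x) = (\<lambda>\<alpha> x. c * conv br F G \<alpha> x)" for c
      by (rule conv_smult_right[OF b Q(1,2)])
    show "conv br F F = (\<lambda>\<alpha> x. 0)"
      by (intro ext conv_bracket_alternating Q(1))
    show "(\<lambda>\<alpha> x. conv br F (conv br G H) \<alpha> x + conv br G (conv br H F) \<alpha> x + conv br H (conv br F G) \<alpha> x) = (\<lambda>\<alpha> x. 0)"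
      by (intro ext conv_bracket_jacobi Q)
    show "conv br F (conv sym_prod G H) =
        (\<lambda>\<alpha> x. conv sym_prod (conv br F G) H \<alpha> x + conv sym_prod G (conv br F H) \<alpha> x)"
      by (intro ext conv_bracket_leibniz Q)
  qed
qed

end

theorem proposition1:
  fixes n k :: nat and ns :: "nat list" and \<eta> :: complex
  assumes "1 \<le> k" and "k < n" and "coprime n k"
    and "ns \<noteq> []" and "\<forall>m\<in>set ns. 2 \<le> m"
    and "real n / real k = neg_cont_frac ns"
    and "Im \<eta> > 0"
  shows "(\<forall>\<alpha> \<beta> f g. f \<in> sym_theta \<eta> ns \<alpha> \<longrightarrow> g \<in> sym_theta \<eta> ns \<beta> \<longrightarrow>
            bracket \<eta> ns \<alpha> \<beta> f g \<in> sym_theta \<eta> ns (\<alpha> + \<beta>) \<and>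
            (\<forall>x\<in>off_poles \<eta> (length ns) (\<alpha> + \<beta>).
               bracket \<eta> ns \<alpha> \<beta> f g x = bracket_expr \<eta> ns \<alpha> \<beta> f g x)) \<and>
         poisson_algebra complex_field (q_algebra \<eta> ns) (q_bracket \<eta> ns)"
proof -
  interpret theta_data \<eta> ns
    by standard (use assms in auto)
  show ?thesis
    using bracket_closed[OF S_D(1) S_D(1)] bracket_exists(2)[OF S_D(1) S_D(1)] poisson_algebra_q_algebra
    by blast
qed

end
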